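(* Let $G$ be a finite group with $\mathsf D(G)=6$. If $G^*$ is a finite group with $\mathcal L(G^* )=\mathcal L(G)$, then $G^*\cong G$.
   Context: Let $G$ be a finite group with identity $1_G$. $\mathcal F(G)$ is the free abelian monoid with basis $G$; its elements are called sequences over $G$ (finite, unordered, repetition allowed), and $|S|$ is the length (number of terms with multiplicity) of $S$. The monoid of product-one sequences $\mathcal B(G)\subset\mathcal F(G)$ consists of all sequences whose terms can be ordered so that their product in $G$ equals $1_G$ (including the empty sequence). $\mathcal A(G)$ denotes the set of atoms (irreducible elements) of $\mathcal B(G)$, and $\mathsf D(G)=\max\{|S|\mid S\in\mathcal A(G)\}$ is the (large) Davenport constant of $G$. For $S\in\mathcal B(G)$ non-empty, $\mathsf L(S)$ is the set of all $k\in\mathbb N$ such that $S$ is a product (in $\mathcal B(G)$) of $k$ atoms; for the empty sequence $\mathsf L=\{0\}$. $\mathcal L(G)=\{\mathsf L(S)\mid S\in\mathcal B(G)\}$ is the system of sets of lengths. *)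

theory Defs
  imports "HOL-Algebra.Divisibility" "HOL-Library.Multiset"
begin

text \<open>
  Sequences over a group \<open>G\<close> (elements of the free abelian monoid with basis \<open>G\<close>) are the
  multisets \<open>S\<close> with \<^term>\<open>set_mset S \<subseteq> carrier G\<close>; concatenation is multiset addition and
  the length of \<open>S\<close> is \<^term>\<open>size S\<close>.
\<close>

definition product_one_monoid :: "('a, 'm) monoid_scheme \<Rightarrow> 'a multiset monoid" where
  "product_one_monoid G =
     \<lparr>carrier = {S. set_mset S \<subseteq> carrier G \<and>
                    (\<exists>xs. mset xs = S \<and> foldr (\<otimes>\<^bsub>G\<^esub>) xs \<one>\<^bsub>G\<^esub> = \<one>\<^bsub>G\<^esub>)},
      monoid.mult = (+), one = {#}\<rparr>"

definition product_one_atoms :: "('a, 'm) monoid_scheme \<Rightarrow> 'a multiset set" where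
  "product_one_atoms G =
     {S \<in> carrier (product_one_monoid G). irreducible (product_one_monoid G) S}"

text \<open>
  For finite \<open>G\<close> the maximum below is taken over a finite nonempty set, see
  \<open>finite_product_one_atoms\<close> and \<open>product_one_atoms_nonempty\<close>.
\<close>

definition large_Davenport :: "('a, 'm) monoid_scheme \<Rightarrow> nat" where
  "large_Davenport G = Max (size ` product_one_atoms G)"

text \<open>
  The condition \<open>set As \<subseteq> carrier M\<close> is needed since \<^const>\<open>factors\<close> only asks the listed elements
  to be irreducible, not to lie in the carrier. The empty list witnesses the length \<open>0\<close> of the
  identity element.
\<close>

definition lengths_set :: "('b, 'm) monoid_scheme \<Rightarrow> 'b \<Rightarrow> nat set" where
  "lengths_set M a = {length As | As. set As \<subseteq> carrier M \<and> factors M As a}"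

definition system_of_lengths :: "('a, 'm) monoid_scheme \<Rightarrow> nat set set" where
  "system_of_lengths G =
     lengths_set (product_one_monoid G) ` carrier (product_one_monoid G)"

lemma (in monoid) foldr_mult_append:
  assumes "set xs \<subseteq> carrier G" "set ys \<subseteq> carrier G"
  shows "foldr (\<otimes>) (xs @ ys) \<one> = foldr (\<otimes>) xs \<one> \<otimes> foldr (\<otimes>) ys \<one>"
  using assms by (induction xs) (auto simp: m_assoc)

lemma product_one_monoid_simps [simp]:
  "mult (product_one_monoid G) = (+)" "one (product_one_monoid G) = {#}"
  by (simp_all add: product_one_monoid_def)

lemma carrier_product_one_monoid_iff:
  "S \<in> carrier (product_one_monoid G) \<longleftrightarrow> set_mset S \<subseteq> carrier G \<and>
     (\<exists>xs. mset xs = S \<and> foldr (\<otimes>\<^bsub>G\<^esub>) xs \<one>\<^bsub>G\<^esub> = \<one>\<^bsub>G\<^esub>)"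
  by (simp add: product_one_monoid_def)

lemma empty_in_product_one_monoid [simp]: "{#} \<in> carrier (product_one_monoid G)"
  by (simp add: carrier_product_one_monoid_iff)

lemma comm_monoid_cancel_product_one_monoid:
  fixes G (structure)
  assumes "monoid G"
  shows "comm_monoid_cancel (product_one_monoid G)"
proof -
  interpret monoid G by fact
  have closed: "S + T \<in> carrier (product_one_monoid G)"
    if S: "S \<in> carrier (product_one_monoid G)" and T: "T \<in> carrier (product_one_monoid G)" for S T
  proof -
    obtain xs ys where *: "mset xs = S" "foldr (\<otimes>) xs \<one> = \<one>" "mset ys = T" "foldr (\<otimes>) ys \<one> = \<one>"
      using S T by (auto simp: carrier_product_one_monoid_iff)
    have sub: "set xs \<subseteq> carrier G" "set ys \<subseteq> carrier G"
      using S T * by (auto simp: carrier_product_one_monoid_iff)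
    have "foldr (\<otimes>) (xs @ ys) \<one> = \<one>"
      using foldr_mult_append[OF sub] * by simp
    moreover have "mset (xs @ ys) = S + T" using * by simp
    ultimately show ?thesis
      using S T unfolding carrier_product_one_monoid_iff set_mset_union by blast
  qed
  show ?thesis
    by (intro comm_monoid_cancelI comm_monoidI) (auto simp: closed ac_simps)
qed

lemma product_one_atoms_iff:
  "S \<in> product_one_atoms G \<longleftrightarrow> S \<in> carrier (product_one_monoid G) \<and> S \<noteq> {#} \<and>
     (\<forall>T \<in> carrier (product_one_monoid G). \<forall>U \<in> carrier (product_one_monoid G).
        S = T + U \<longrightarrow> T = {#} \<or> U = {#})"
proof -
  have units: "Units (product_one_monoid G) = {{#}}"
    by (auto simp: Units_def)
  have pf: "properfactor (product_one_monoid G) T S \<longleftrightarrow>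
      (\<exists>U \<in> carrier (product_one_monoid G). S = T + U \<and> U \<noteq> {#})" for T
  proof
    assume "properfactor (product_one_monoid G) T S"
    then obtain U where U: "U \<in> carrier (product_one_monoid G)" "S = T + U"
      and nd: "\<not> factor (product_one_monoid G) S T"
      by (auto simp: properfactor_def factor_def)
    have "U \<noteq> {#}" using nd U by (auto simp: factor_def)
    then show "\<exists>U \<in> carrier (product_one_monoid G). S = T + U \<and> U \<noteq> {#}" using U by blast
  next
    assume "\<exists>U \<in> carrier (product_one_monoid G). S = T + U \<and> U \<noteq> {#}"
    then show "properfactor (product_one_monoid G) T S"
      by (auto simp: properfactor_def factor_def add.assoc)
  qed
  show ?thesis
    unfolding product_one_atoms_def irreducible_def units
    by (simp add: pf) blast
qed

lemma size_product_one_atom_le: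
  fixes G (structure)
  assumes "group G" "finite (carrier G)" "S \<in> product_one_atoms G"
  shows "size S \<le> card (carrier G)"
proof (rule ccontr)
  interpret group G by fact
  let ?P = "\<lambda>xs. foldr (\<otimes>) xs \<one>"
  assume gt: "\<not> size S \<le> card (carrier G)"
  have S: "S \<in> carrier (product_one_monoid G)" using assms(3) by (simp add: product_one_atoms_iff)
  then obtain xs where xs: "mset xs = S" "?P xs = \<one>" by (auto simp: carrier_product_one_monoid_iff)
  have sub: "set xs \<subseteq> carrier G" using S xs by (auto simp: carrier_product_one_monoid_iff)
  have subs: "set (take n xs) \<subseteq> carrier G" "set (drop n xs) \<subseteq> carrier G" for n
    using sub set_take_subset[of n xs] set_drop_subset[of n xs] by blast+
  have "(\<lambda>i. ?P (take i xs)) ` {..<length xs} \<subseteq> carrier G"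
    using subs by auto
  then have "card ((\<lambda>i. ?P (take i xs)) ` {..<length xs}) \<le> card (carrier G)"
    using assms(2) card_mono by blast
  moreover have "length xs = size S" using xs by auto
  ultimately have "\<not> inj_on (\<lambda>i. ?P (take i xs)) {..<length xs}"
    using gt by (metis card_image card_lessThan)
  then obtain i j where ij: "i < j" "j < length xs" "?P (take i xs) = ?P (take j xs)"
    unfolding inj_on_def by (metis lessThan_iff linorder_neqE_nat)
  define zs where "zs = drop i (take j xs)"
  have tj: "take j xs = take i xs @ zs"
    using ij unfolding zs_def by (metis append_take_drop_id less_imp_le min.absorb1 take_take)
  have zsub: "set zs \<subseteq> carrier G" using subs(1)[of j] tj by auto
  have "?P (take i xs) \<otimes> ?P zs = ?P (take i xs)"
    using foldr_mult_append[OF subs(1) zsub, of i] ij(3) tj by simp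
  then have zs1: "?P zs = \<one>"
    using multlist_closed[OF subs(1)] multlist_closed[OF zsub]
      l_cancel[of "?P (take i xs)" "?P zs" \<one>] by simp
  have "?P xs = ?P (take j xs) \<otimes> ?P (drop j xs)"
    using foldr_mult_append[OF subs, of j j] by (simp only: append_take_drop_id)
  then have ys1: "?P (take i xs @ drop j xs) = \<one>"
    using foldr_mult_append[OF subs, of i j] ij(3) xs(2) by simp
  have "S = mset (take j xs @ drop j xs)" using xs by simp
  also have "\<dots> = mset zs + mset (take i xs @ drop j xs)" unfolding tj by simp
  finally have eq: "S = mset zs + mset (take i xs @ drop j xs)" .
  have "mset zs \<in> carrier (product_one_monoid G)"
    using zsub zs1 by (auto simp: carrier_product_one_monoid_iff)
  moreover have "mset (take i xs @ drop j xs) \<in> carrier (product_one_monoid G)"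
    unfolding carrier_product_one_monoid_iff using subs ys1
    by (metis (no_types, lifting) Un_least set_append set_mset_mset)
  moreover have "mset zs \<noteq> {#}" "mset (take i xs @ drop j xs) \<noteq> {#}"
    using ij by (auto simp: zs_def)
  ultimately show False using assms(3) eq unfolding product_one_atoms_iff by blast
qed

lemma finite_product_one_atoms:
  assumes "group G" "finite (carrier G)"
  shows "finite (product_one_atoms G)"
proof -
  have "product_one_atoms G \<subseteq> mset ` {xs. set xs \<subseteq> carrier G \<and> length xs \<le> card (carrier G)}"
  proof
    fix S assume S: "S \<in> product_one_atoms G"
    obtain xs where xs: "mset xs = S" using ex_mset by blast
    have "set xs \<subseteq> carrier G"
      using S xs by (auto simp: product_one_atoms_iff carrier_product_one_monoid_iff)
    moreover have "length xs \<le> card (carrier G)"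
      using size_product_one_atom_le[OF assms S] xs by auto
    ultimately show "S \<in> mset ` {xs. set xs \<subseteq> carrier G \<and> length xs \<le> card (carrier G)}"
      using xs by auto
  qed
  then show ?thesis
    using finite_lists_length_le[OF assms(2)] finite_surj by blast
qed

lemma product_one_atoms_nonempty:
  fixes G (structure)
  assumes "group G"
  shows "{#\<one>\<^bsub>G\<^esub>#} \<in> product_one_atoms G"
proof -
  interpret group G by fact
  have "{#\<one>#} \<in> carrier (product_one_monoid G)"
    unfolding carrier_product_one_monoid_iff
    by (auto intro!: exI[of _ "[\<one>]"])
  then show ?thesis
    by (auto simp: product_one_atoms_iff union_is_single single_is_union)
qed

lemma lengths_set_empty: "lengths_set (product_one_monoid G) {#} = {0}"
proof -
  have "As = []" if "set As \<subseteq> carrier (product_one_monoid G)"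
    "factors (product_one_monoid G) As {#}" for As
    using that by (cases As) (auto simp: factors_def irreducible_def Units_def)
  then show ?thesis
    by (auto simp: lengths_set_def factors_def intro!: exI[of _ "[]"])
qed

end

theory Submission
  imports Defs "HOL-Algebra.Multiplicative_Group" "HOL-Algebra.Elementary_Groups"
begin

text \<open>
  The Davenport constant, if at least two, is the largest \<open>k\<close> such that some set of lengths contains
  \<open>2\<close> and \<open>k\<close>, so it is determined by the system \<open>\<L>\<close> of sets of lengths. If it is six, then a proper
  subgroup \<open>H\<close> containing a product-one free sequence \<open>T\<close> must be small: an element outside \<open>H\<close> extends \<open>T\<close>
  to an atom of length \<open>|T| + 2\<close>. A few such constructions leave only the groups
  \<open>C\<^sub>6\<close>, \<open>C\<^sub>2\<^sup>5\<close>, \<open>C\<^sub>4 \<times> C\<^sub>2\<^sup>2\<close>, \<open>S\<^sub>3\<close>, \<open>D\<^sub>8\<close> and \<open>Q\<^sub>8\<close>.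

  Among these, \<open>{2, 4, 6} \<in> \<L>\<close> singles out \<open>C\<^sub>4 \<times> C\<^sub>2\<^sup>2\<close>. Among the others, some \<open>L \<in> \<L>\<close> contains
  \<open>{2, 3, 6}\<close> exactly for the nonabelian groups, of which \<open>S\<^sub>3\<close> is characterized by \<open>{2, 6} \<in> \<L>\<close> and then
  \<open>D\<^sub>8\<close> by \<open>{2, 5} \<in> \<L>\<close>, while \<open>C\<^sub>2\<^sup>5\<close> differs from \<open>C\<^sub>6\<close> by some \<open>L\<close> containing \<open>{3, 9}\<close>. The sets containing
  both \<open>k\<close> and \<open>3 k\<close> are rigid: they come from \<open>k\<close> atoms of length six whose product is also a product of
  inverse pairs.
\<close>

subsection \<open>Factorizations of product-one sequences\<close>

text \<open>Lengths see a group through inverse pairs. An atom together with its inverses splits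
  into two atoms and also into as many pairs as it has terms; conversely, every factor other than
  the identity has at least two terms, so two atoms with at most D terms each never yield more than
  D factors. For D = 6 a sequence with lengths k and 3 k is extremal in both counts. The obstacle is
  that the cofactor of a product-one subsequence need not be product-one when the group is not
  commutative, so an atom has to be tested against pairs of factors. The constructions therefore
  keep most terms in a cyclic or abelian subgroup: a single term outside it cannot belong to a
  product-one factor, which keeps the outer terms together and leaves only powers to be split off.
  Most structural exclusions are atoms with seven or eight terms, or product-one free sequences with
  at least six, found in this way. Lengths are computed in explicit models, where a factorization
  becomes a solution of linear equations for the multiplicities of the few atoms that divide the
  sequence.\<close>

abbreviation prod_one :: "('a, 'm) monoid_scheme \<Rightarrow> 'a multiset \<Rightarrow> bool" where
  "prod_one G S \<equiv> S \<in> carrier (product_one_monoid G)"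

text \<open>Lists of atoms are added as multisets, so that factorizations can be compared by
  counting terms; \<open>lengths_set_product_one\<close> links this with
  \<open>lengths_set\<close>.\<close>

definition fact_len :: "('a, 'm) monoid_scheme \<Rightarrow> nat \<Rightarrow> 'a multiset \<Rightarrow> bool" where
  "fact_len G k S \<longleftrightarrow> (\<exists>As. length As = k \<and> set As \<subseteq> product_one_atoms G \<and> sum_list As = S)"

lemma foldr_plus_mset: "foldr (+) As {#} = sum_list (As :: 'a multiset list)"
  by (simp add: sum_list.eq_foldr)

lemma lengths_set_product_one:
  "lengths_set (product_one_monoid G) S = {k. fact_len G k S}"
  by (auto simp: lengths_set_def fact_len_def factors_def foldr_plus_mset product_one_atoms_def subset_iff)

lemma mem_system_of_lengths:
  "L \<in> system_of_lengths G \<longleftrightarrow> (\<exists>S. prod_one G S \<and> L = {k. fact_len G k S})"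
  by (auto simp: system_of_lengths_def lengths_set_product_one)

lemma fact_len_0 [simp]: "fact_len G 0 S \<longleftrightarrow> S = {#}"
  by (auto simp: fact_len_def)

lemma fact_len_Suc:
  "fact_len G (Suc k) S \<longleftrightarrow> (\<exists>A T. A \<in> product_one_atoms G \<and> fact_len G k T \<and> S = A + T)"
proof
  assume "fact_len G (Suc k) S"
  then show "\<exists>A T. A \<in> product_one_atoms G \<and> fact_len G k T \<and> S = A + T"
    by (fastforce simp: fact_len_def length_Suc_conv)
next
  assume "\<exists>A T. A \<in> product_one_atoms G \<and> fact_len G k T \<and> S = A + T"
  then obtain A As where "A \<in> product_one_atoms G" "length As = k" "set As \<subseteq> product_one_atoms G"
    "S = A + sum_list As" by (auto simp: fact_len_def)
  then show "fact_len G (Suc k) S"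
    unfolding fact_len_def by (intro exI[of _ "A # As"]) auto
qed

lemma fact_len_1: "fact_len G 1 S \<longleftrightarrow> S \<in> product_one_atoms G"
  by (auto simp: fact_len_Suc simp flip: One_nat_def) (auto simp: fact_len_Suc One_nat_def)

lemma fact_len_2:
  "fact_len G 2 S \<longleftrightarrow> (\<exists>U V. U \<in> product_one_atoms G \<and> V \<in> product_one_atoms G \<and> S = U + V)"
  by (auto simp: numeral_2_eq_2 fact_len_Suc)

lemma fact_len_add:
  assumes "fact_len G k S" "fact_len G l T"
  shows "fact_len G (k + l) (S + T)"
proof -
  obtain As Bs where "length As = k" "set As \<subseteq> product_one_atoms G" "sum_list As = S"
    "length Bs = l" "set Bs \<subseteq> product_one_atoms G" "sum_list Bs = T"
    using assms by (auto simp: fact_len_def)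
  then show ?thesis
    unfolding fact_len_def by (intro exI[of _ "As @ Bs"]) auto
qed

lemma atom_prod_one: "U \<in> product_one_atoms G \<Longrightarrow> prod_one G U"
  by (simp add: product_one_atoms_iff)

lemma atom_nonempty: "U \<in> product_one_atoms G \<Longrightarrow> U \<noteq> {#}"
  by (simp add: product_one_atoms_iff)

lemma atom_split:
  assumes "T + U \<in> product_one_atoms G" "prod_one G T" "prod_one G U"
  shows "T = {#} \<or> U = {#}"
  using assms by (auto simp: product_one_atoms_iff)

lemma prod_one_carrier: "prod_one G S \<Longrightarrow> set_mset S \<subseteq> carrier G"
  by (simp add: carrier_product_one_monoid_iff)

lemma atom_carrier: "U \<in> product_one_atoms G \<Longrightarrow> set_mset U \<subseteq> carrier G"
  by (simp add: product_one_atoms_iff carrier_product_one_monoid_iff)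

text \<open>In a factorization one factor contains the marked term \<open>c\<close>, and the other
  is a subsequence X of \<open>T\<close>. So only factors avoiding one chosen occurrence have to be
  excluded, and both X and its cofactor may be assumed product-one.\<close>

lemma product_one_atomI:
  assumes po: "prod_one G (add_mset c T)"
    and nosplit: "\<And>X. X \<subseteq># T \<Longrightarrow> prod_one G X \<Longrightarrow> prod_one G (add_mset c (T - X)) \<Longrightarrow> X = {#}"
  shows "add_mset c T \<in> product_one_atoms G"
proof -
  have *: "Y = {#}" if eq: "add_mset c T = Z + Y" and c: "c \<in># Z" and "prod_one G Z" "prod_one G Y" for Z Y
  proof -
    have T: "T = (Z - {#c#}) + Y"
      using eq c by (metis add_mset_remove_trivial insert_DiffM union_mset_add_mset_left)
    then have "add_mset c (T - Y) = Z" "Y \<subseteq># T" using c by (simp_all only: add_diff_cancel_right' insert_DiffM mset_subset_eq_add_right)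
    then show ?thesis using nosplit[of Y] that by simp
  qed
  have "Z = {#} \<or> Y = {#}" if "prod_one G Z" "prod_one G Y" "add_mset c T = Z + Y" for Z Y
  proof -
    have "c \<in># Z \<or> c \<in># Y" using that(3) by (metis union_iff union_single_eq_member)
    then show ?thesis using *[of Z Y] *[of Y Z] that by (auto simp: add.commute)
  qed
  then show ?thesis using po by (auto simp: product_one_atoms_iff)
qed

subsection \<open>Long atoms from subgroups and cosets\<close>

definition prod_one_free :: "('a, 'm) monoid_scheme \<Rightarrow> 'a multiset \<Rightarrow> bool" where
  "prod_one_free G T \<longleftrightarrow> set_mset T \<subseteq> carrier G \<and> (\<forall>X. X \<subseteq># T \<longrightarrow> prod_one G X \<longrightarrow> X = {#})"

context group
begin

abbreviation lprod :: "'a list \<Rightarrow> 'a" where "lprod xs \<equiv> foldr (\<otimes>) xs \<one>"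

lemma prod_oneI: "set xs \<subseteq> carrier G \<Longrightarrow> lprod xs = \<one> \<Longrightarrow> S = mset xs \<Longrightarrow> prod_one G S"
  by (auto simp: carrier_product_one_monoid_iff)

lemma prod_one_add: "prod_one G S \<Longrightarrow> prod_one G T \<Longrightarrow> prod_one G (S + T)"
  using monoid.m_closed[of "product_one_monoid G" S T]
    comm_monoid_cancel_product_one_monoid[OF is_monoid]
  by (simp add: comm_monoid_cancel_def monoid_cancel_def)

text \<open>A trivial product stays trivial under cyclic rotation, so any chosen term can be moved
  to the front.\<close>

lemma prod_one_rotate:
  assumes "prod_one G (add_mset x S)"
  obtains ys where "mset ys = S" "set ys \<subseteq> carrier G" "x \<otimes> lprod ys = \<one>"
proof -
  obtain xs where xs: "mset xs = add_mset x S" "lprod xs = \<one>" "set xs \<subseteq> carrier G"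
    using assms by (auto simp: carrier_product_one_monoid_iff) (metis set_mset_add_mset_insert set_mset_mset insert_subset)
  obtain us vs where uv: "xs = us @ x # vs"
    using xs(1) by (metis split_list set_mset_mset union_single_eq_member add_mset_add_single)
  have c: "set us \<subseteq> carrier G" "set vs \<subseteq> carrier G" "x \<in> carrier G" using xs(3) uv by auto
  have "lprod us \<otimes> (x \<otimes> lprod vs) = \<one>"
    using xs(2) uv foldr_mult_append[of us "x # vs"] c by simp
  then have "(x \<otimes> lprod vs) \<otimes> lprod us = \<one>" using c inv_comm by auto
  then have "x \<otimes> lprod (vs @ us) = \<one>" using c foldr_mult_append[of vs us] by (simp add: m_assoc)
  moreover have "mset (vs @ us) = S" using xs(1) uv by (simp add: add.commute)
  ultimately show ?thesis using that[of "vs @ us"] c by auto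
qed

text \<open>With \<open>x\<close> in front, the position of \<open>y\<close> cuts the other terms
  into two words. This reduces questions about all orderings to the choice of \<open>us\<close> and
  \<open>vs\<close>.\<close>

lemma prod_one_rotate2:
  assumes "prod_one G (add_mset x (add_mset y S))"
  obtains us vs where "mset us + mset vs = S" "set us \<subseteq> carrier G" "set vs \<subseteq> carrier G"
    "x \<otimes> lprod us \<otimes> (y \<otimes> lprod vs) = \<one>" "x \<in> carrier G" "y \<in> carrier G"
proof -
  have xy: "x \<in> carrier G" "y \<in> carrier G" using prod_one_carrier[OF assms] by auto
  obtain ys where ys: "mset ys = add_mset y S" "set ys \<subseteq> carrier G" "x \<otimes> lprod ys = \<one>"
    using prod_one_rotate[OF assms] by blast
  obtain us vs where uv: "ys = us @ y # vs"
    using ys(1) by (metis split_list set_mset_mset union_single_eq_member)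
  have c: "set us \<subseteq> carrier G" "set vs \<subseteq> carrier G" using ys(2) uv by auto
  show ?thesis
    using that[of us vs] ys uv c xy foldr_mult_append[of us "y # vs"] by (simp add: m_assoc)
qed

lemma prod_one_single: "prod_one G {#x#} \<longleftrightarrow> x = \<one>"
proof
  assume "prod_one G {#x#}"
  then show "x = \<one>" by (auto simp: carrier_product_one_monoid_iff)
next
  assume "x = \<one>" then show "prod_one G {#x#}" by (intro prod_oneI[of "[x]"]) auto
qed

lemma prod_one_pair: "prod_one G {#x, y#} \<longleftrightarrow> x \<in> carrier G \<and> y \<in> carrier G \<and> x \<otimes> y = \<one>"
proof
  assume a: "prod_one G {#x, y#}"
  then have "x \<in> carrier G" "y \<in> carrier G" using prod_one_carrier by fastforce+
  moreover obtain ys where "mset ys = {#y#}" "x \<otimes> lprod ys = \<one>"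
    using prod_one_rotate[OF a] by blast
  ultimately show "x \<in> carrier G \<and> y \<in> carrier G \<and> x \<otimes> y = \<one>" by auto
next
  assume "x \<in> carrier G \<and> y \<in> carrier G \<and> x \<otimes> y = \<one>"
  then show "prod_one G {#x, y#}" by (intro prod_oneI[of "[x, y]"]) auto
qed

lemma lprod_subgroup: "subgroup H G \<Longrightarrow> set xs \<subseteq> H \<Longrightarrow> lprod xs \<in> H"
  by (induction xs) (auto intro: subgroup.m_closed subgroup.one_closed)

lemma lprod_const: "a \<in> carrier G \<Longrightarrow> set xs \<subseteq> {a} \<Longrightarrow> lprod xs = a [^] length xs"
proof (induction xs)
  case (Cons x xs)
  then have "x = a" "lprod xs = a [^] length xs" by auto
  then show ?case using nat_pow_Suc2[OF Cons.prems(1), of "length xs"] by simp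
qed simp

text \<open>After rotation \<open>x\<close> is the inverse of a product in \<open>H\<close>. The
  main use is negative: a single term outside \<open>H\<close> is never completed to a trivial
  product by terms of \<open>H\<close>.\<close>

lemma prod_one_subgroup_single:
  assumes "subgroup H G" "set_mset T \<subseteq> H" "prod_one G (add_mset x T)"
  shows "x \<in> H"
proof -
  obtain ys where ys: "mset ys = T" "set ys \<subseteq> carrier G" "x \<otimes> lprod ys = \<one>"
    using prod_one_rotate[OF assms(3)] by blast
  have H: "lprod ys \<in> H" using lprod_subgroup[OF assms(1)] assms(2) ys(1) by (metis set_mset_mset)
  have x: "x \<in> carrier G" using prod_one_carrier[OF assms(3)] by auto
  have "x = inv (lprod ys)" using ys H x subgroup.subset[OF assms(1)] inv_equality[of x "lprod ys"] by auto
  then show ?thesis using H assms(1) by (simp add: subgroup.m_inv_closed)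
qed

lemma prod_one_replicate:
  assumes "a \<in> carrier G"
  shows "prod_one G (replicate_mset n a) \<longleftrightarrow> a [^] n = \<one>"
proof
  assume "prod_one G (replicate_mset n a)"
  then obtain xs where xs: "mset xs = replicate_mset n a" "lprod xs = \<one>"
    by (auto simp: carrier_product_one_monoid_iff)
  have "set xs \<subseteq> {a}" "length xs = n"
    using arg_cong[OF xs(1), of set_mset] arg_cong[OF xs(1), of size] by (auto split: if_splits)
  then show "a [^] n = \<one>" using lprod_const[OF assms, of xs] xs by simp
next
  assume "a [^] n = \<one>"
  moreover have "lprod (replicate n a) = a [^] n"
    using lprod_const[OF assms, of "replicate n a"] by (simp add: set_replicate_conv_if)
  ultimately show "prod_one G (replicate_mset n a)"
    using assms by (intro prod_oneI[of "replicate n a"]) auto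
qed

lemma pow_neq_one: "a \<in> carrier G \<Longrightarrow> 0 < m \<Longrightarrow> m < ord a \<Longrightarrow> a [^] m \<noteq> \<one>"
  using pow_eq_id[of a m] by (auto dest: dvd_imp_le)

lemma prod_one_free_replicate:
  assumes "a \<in> carrier G" "m < ord a"
  shows "prod_one_free G (replicate_mset m a)"
  unfolding prod_one_free_def
proof (intro conjI allI impI)
  fix X assume X: "X \<subseteq># replicate_mset m a" "prod_one G X"
  obtain k where k: "k \<le> m" "X = replicate_mset k a"
    using X(1) by (metis msubseteq_replicate_msetE)
  have "a [^] k = \<one>" using X(2) k prod_one_replicate[OF assms(1)] by simp
  then show "X = {#}" using pow_neq_one[OF assms(1), of k] k assms(2) by (cases k) auto
qed (use assms in auto)

text \<open>The inverse of a product of all terms completes \<open>T\<close>; a factor avoiding this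
  new term is a product-one subsequence of \<open>T\<close>, hence empty.\<close>

lemma prod_one_free_imp_atom:
  assumes "prod_one_free G T"
  obtains U where "U \<in> product_one_atoms G" "size U = Suc (size T)"
proof -
  obtain xs where xs: "mset xs = T" using ex_mset by blast
  have T: "set xs \<subseteq> carrier G" using assms xs by (auto simp: prod_one_free_def)
  have "add_mset (inv (lprod xs)) T \<in> product_one_atoms G"
  proof (rule product_one_atomI)
    show "prod_one G (add_mset (inv (lprod xs)) T)"
      using T xs by (intro prod_oneI[of "inv (lprod xs) # xs"]) auto
  qed (use assms in \<open>auto simp: prod_one_free_def\<close>)
  then show ?thesis using that by simp
qed

text \<open>By \<open>nb\<close> the elements of \<open>N\<close> can be moved to the right past
  \<open>b\<close>, so all copies of \<open>b\<close> gather in front, and modulo \<open>N\<close>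
  only their number matters.\<close>

lemma lprod_normalized:
  assumes N: "subgroup N G" and b: "b \<in> carrier G"
    and nb: "\<And>n. n \<in> N \<Longrightarrow> \<exists>n'\<in>N. n \<otimes> b = b \<otimes> n'"
    and xs: "set xs \<subseteq> insert b N" "b \<notin> N"
  shows "\<exists>n\<in>N. lprod xs = b [^] count (mset xs) b \<otimes> n"
  using xs(1)
proof (induction xs)
  case Nil
  then show ?case using subgroup.one_closed[OF N] by (auto intro!: bexI[of _ \<one>])
next
  case (Cons x xs)
  then obtain n where n: "n \<in> N" "lprod xs = b [^] count (mset xs) b \<otimes> n" by auto
  have nc: "n \<in> carrier G" using n subgroup.mem_carrier[OF N] by blast
  show ?case
  proof (cases "x = b")
    case True
    then show ?thesis using n nc b nat_pow_Suc2[OF b, of "count (mset xs) b"]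
      by (auto intro!: bexI[of _ n] simp: m_assoc[symmetric])
  next
    case False
    then have x: "x \<in> N" using Cons.prems by auto
    have pow: "\<exists>n'\<in>N. x \<otimes> b [^] (k::nat) = b [^] k \<otimes> n'" for k
    proof (induction k)
      case 0
      then show ?case using x subgroup.mem_carrier[OF N] by (auto intro!: bexI[of _ x])
    next
      case (Suc k)
      then obtain n' where n': "n' \<in> N" "x \<otimes> b [^] k = b [^] k \<otimes> n'" by auto
      obtain n'' where n'': "n'' \<in> N" "n' \<otimes> b = b \<otimes> n''" using nb n' by auto
      have c: "x \<in> carrier G" "n' \<in> carrier G" "n'' \<in> carrier G"
        using x n' n'' subgroup.mem_carrier[OF N] by auto
      have "x \<otimes> b [^] Suc k = b [^] k \<otimes> n' \<otimes> b" using n' b c by (simp add: m_assoc[symmetric])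
      also have "\<dots> = b [^] Suc k \<otimes> n''" using n'' b c by (simp add: m_assoc)
      finally show ?case using n'' by auto
    qed
    then obtain n' where n': "n' \<in> N" "x \<otimes> b [^] count (mset xs) b = b [^] count (mset xs) b \<otimes> n'" by auto
    have c: "x \<in> carrier G" "n' \<in> carrier G"
      using x n' subgroup.mem_carrier[OF N] by auto
    have "lprod (x # xs) = b [^] count (mset xs) b \<otimes> (n' \<otimes> n)"
      using n n' c nc b by (simp add: m_assoc[symmetric])
    then show ?thesis using False n n' subgroup.m_closed[OF N] by auto
  qed
qed

text \<open>In a product-one subsequence the number k of copies of \<open>b\<close> satisfies
  \<open>b [^] k \<in> N\<close>, so k = 0 and the subsequence lies in \<open>T\<close>. Iteration
  over independent elements gives the long free sequences used against large groups.\<close>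

lemma prod_one_free_extend:
  assumes N: "subgroup N G" and b: "b \<in> carrier G"
    and nb: "\<And>n. n \<in> N \<Longrightarrow> \<exists>n'\<in>N. n \<otimes> b = b \<otimes> n'"
    and pow: "\<And>k. 0 < k \<Longrightarrow> k \<le> m \<Longrightarrow> b [^] k \<notin> N" and m: "0 < m"
    and T: "set_mset T \<subseteq> N" "prod_one_free G T"
  shows "prod_one_free G (T + replicate_mset m b)"
  unfolding prod_one_free_def
proof (intro conjI allI impI)
  show "set_mset (T + replicate_mset m b) \<subseteq> carrier G"
    using T b by (auto simp: prod_one_free_def)
  fix X assume X: "X \<subseteq># T + replicate_mset m b" "prod_one G X"
  have bN: "b \<notin> N" using pow[of 1] m b by auto
  obtain xs where xs: "mset xs = X" "lprod xs = \<one>"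
    using X(2) by (auto simp: carrier_product_one_monoid_iff)
  have "set_mset X \<subseteq> set_mset (T + replicate_mset m b)" using X(1) by (rule set_mset_mono)
  then have sx: "set xs \<subseteq> insert b N" using T(1) xs(1) by (auto split: if_splits)
  obtain n where n: "n \<in> N" "lprod xs = b [^] count X b \<otimes> n"
    using lprod_normalized[OF N b nb sx bN] xs by auto
  have "count T b = 0" using bN T(1) by (meson count_inI subsetD)
  then have cX: "count X b \<le> m" using X(1) by (metis add_0 count_replicate_mset count_union mset_subset_eq_count)
  have "b [^] count X b = inv n"
    using n xs(2) b subgroup.mem_carrier[OF N n(1)] inv_equality[of "b [^] count X b" n] by auto
  then have "b [^] count X b \<in> N" using n(1) N by (simp add: subgroup.m_inv_closed)
  then have "count X b = 0" using pow[of "count X b"] cX by (meson gr0I)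
  then have "X \<subseteq># T" using X(1)
    by (metis (no_types, lifting) add.right_neutral count_replicate_mset count_union mset_subset_eqI
        mset_subset_eq_count zero_le)
  then show "X = {#}" using T(2) X(2) by (auto simp: prod_one_free_def)
qed

abbreviation powers :: "'a \<Rightarrow> 'a set" where "powers a \<equiv> range (\<lambda>k::nat. a [^] k)"

lemma subgroup_powers:
  assumes "a \<in> carrier G" "0 < ord a"
  shows "subgroup (powers a) G"
proof (rule subgroupI)
  fix x assume "x \<in> powers a"
  then obtain k :: nat where k: "x = a [^] k" by auto
  have "a [^] (ord a * k - k) \<otimes> a [^] k = a [^] (ord a * k)"
    using assms by (simp add: nat_pow_mult)
  also have "\<dots> = \<one>" using assms by (simp add: nat_pow_pow[symmetric])
  finally have "inv x = a [^] (ord a * k - k)" using k assms inv_equality by auto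
  then show "inv x \<in> powers a" by auto
qed (use assms in \<open>auto simp: nat_pow_mult intro: range_eqI\<close>)

lemma powers_self: "a \<in> carrier G \<Longrightarrow> a \<in> powers a"
  by (metis nat_pow_eone rangeI)

lemma powers_commute:
  assumes "a \<in> carrier G" "x \<in> powers a" shows "x \<otimes> a = a \<otimes> x"
  using assms by (metis imageE nat_pow_Suc nat_pow_Suc2)

lemma prod_one_triple:
  "prod_one G {#x, y, w#} \<longleftrightarrow>
    {x, y, w} \<subseteq> carrier G \<and> (x \<otimes> (y \<otimes> w) = \<one> \<or> x \<otimes> (w \<otimes> y) = \<one>)"
proof
  assume a: "prod_one G {#x, y, w#}"
  then have c: "{x, y, w} \<subseteq> carrier G" using prod_one_carrier by fastforce
  obtain us vs where uv: "mset us + mset vs = {#w#}" "x \<otimes> lprod us \<otimes> (y \<otimes> lprod vs) = \<one>"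
    using prod_one_rotate2[OF a] by metis
  then have "us = [w] \<and> vs = [] \<or> us = [] \<and> vs = [w]" by (auto simp: union_is_single)
  then show "{x, y, w} \<subseteq> carrier G \<and> (x \<otimes> (y \<otimes> w) = \<one> \<or> x \<otimes> (w \<otimes> y) = \<one>)"
    using uv(2) c by (auto simp: m_assoc)
next
  assume "{x, y, w} \<subseteq> carrier G \<and> (x \<otimes> (y \<otimes> w) = \<one> \<or> x \<otimes> (w \<otimes> y) = \<one>)"
  then show "prod_one G {#x, y, w#}"
    using prod_oneI[of "[x, y, w]" "{#x, y, w#}"] prod_oneI[of "[x, w, y]" "{#x, y, w#}"]
    by (auto simp: add_mset_commute)
qed

lemma subset_add_mset_notin: "X \<subseteq># add_mset b T \<Longrightarrow> b \<notin># X \<Longrightarrow> X \<subseteq># T"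
  unfolding subseteq_mset_def by (metis count_add_mset count_inI le0)

text \<open>The two new terms are \<open>b\<close> and the inverse of the total product. A factor
  avoiding the latter contains \<open>b\<close> at most once, hence not at all because
  \<open>b\<close> is outside \<open>H\<close>; so it is a subsequence of \<open>T\<close> and
  empty.\<close>

lemma atom_from_coset:
  assumes H: "subgroup H G" and T: "set_mset T \<subseteq> H" "prod_one_free G T"
    and b: "b \<in> carrier G" "b \<notin> H"
  obtains U where "U \<in> product_one_atoms G" "size U = size T + 2"
proof -
  obtain xs where xs: "mset xs = T" using ex_mset by blast
  have sx: "set xs \<subseteq> carrier G" using T xs by (auto simp: prod_one_free_def)
  define c where "c = inv (lprod (xs @ [b]))"
  have cc: "set (xs @ [b]) \<subseteq> carrier G" using sx b by auto
  have "add_mset c (add_mset b T) \<in> product_one_atoms G"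
  proof (rule product_one_atomI)
    show "prod_one G (add_mset c (add_mset b T))"
    proof (rule prod_oneI)
      show "lprod (c # xs @ [b]) = \<one>"
        using multlist_closed[OF cc] by (simp add: c_def del: foldr_append)
      show "set (c # xs @ [b]) \<subseteq> carrier G"
        using multlist_closed[OF cc] cc unfolding c_def by simp
      show "add_mset c (add_mset b T) = mset (c # xs @ [b])" using xs by simp
    qed
    fix X assume X: "X \<subseteq># add_mset b T" "prod_one G X"
    have "b \<notin># X"
    proof
      assume "b \<in># X"
      then obtain X' where X': "X = add_mset b X'" using multi_member_split[of b X] by blast
      then have "X' \<subseteq># T" using X(1) by simp
      then have "set_mset X' \<subseteq> H" using T(1) set_mset_mono by blast
      then show False using prod_one_subgroup_single[OF H, of X' b] X(2) X' b(2) by simp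
    qed
    with X(1) have "X \<subseteq># T" by (rule subset_add_mset_notin)
    then show "X = {#}" using X(2) T(2) unfolding prod_one_free_def by blast
  qed
  then show ?thesis using that[of "add_mset c (add_mset b T)"] by simp
qed

lemma mset_replicate_parts:
  assumes "mset us + mset vs = replicate_mset m a"
  obtains i j where "us = replicate i a" "vs = replicate j a" "i + j = m"
proof -
  have "set us \<union> set vs \<subseteq> {a}" using arg_cong[OF assms, of set_mset] by (auto split: if_splits)
  then have "us = replicate (length us) a" "vs = replicate (length vs) a"
    by (simp_all add: replicate_eqI subset_iff)
  moreover have "length us + length vs = m" using arg_cong[OF assms, of size] by simp
  ultimately show ?thesis using that by blast
qed

lemma lprod_replicate: "a \<in> carrier G \<Longrightarrow> lprod (replicate i a) = a [^] i"
  using lprod_const[of a "replicate i a"] by (simp add: set_replicate_conv_if)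

text \<open>The atom is a^(2n-2) b d^-1 with n the order of a and d = a^(n-1) b a^(n-1). Only a^n
  could be split off, and then the cofactor a^(n-2) b d^-1 would yield a nontrivial power of a
  commuting with b.\<close>

lemma atom_from_double_coset:
  assumes a: "a \<in> carrier G" "2 \<le> ord a" and b: "b \<in> carrier G"
    and nc: "\<And>m. 0 < m \<Longrightarrow> m < ord a \<Longrightarrow> b \<otimes> a [^] m \<noteq> a [^] m \<otimes> b"
  obtains U where "U \<in> product_one_atoms G" "size U = 2 * ord a"
proof -
  define n where "n = ord a"
  have n: "2 \<le> n" "a [^] n = \<one>" using a by (auto simp: n_def)
  define d where "d = a [^] (n - 1) \<otimes> b \<otimes> a [^] (n - 1)"
  have d: "d \<in> carrier G" using a b by (simp add: d_def)
  define T where "T = replicate_mset (2 * n - 2) a"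
  have H: "subgroup (powers a) G" using subgroup_powers a by simp
  have bH: "b \<notin> powers a" using powers_commute[OF a(1), of b] nc[of 1] a by auto
  have "add_mset (inv d) (add_mset b T) \<in> product_one_atoms G"
  proof (rule product_one_atomI)
    have "lprod (replicate (n - 1) a @ b # replicate (n - 1) a) = d"
      using a b foldr_mult_append[of "replicate (n - 1) a" "b # replicate (n - 1) a"]
      by (simp add: lprod_replicate d_def m_assoc set_replicate_conv_if del: foldr_append foldr_replicate)
    then have "lprod (inv d # replicate (n - 1) a @ b # replicate (n - 1) a) = inv d \<otimes> d"
      by simp
    moreover have "mset (inv d # replicate (n - 1) a @ b # replicate (n - 1) a)
        = add_mset (inv d) (add_mset b T)"
      using n by (intro multiset_eqI) (auto simp: T_def)
    ultimately show "prod_one G (add_mset (inv d) (add_mset b T))"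
      using a b d
      by (intro prod_oneI[of "inv d # replicate (n - 1) a @ b # replicate (n - 1) a"]) auto
    fix X assume X: "X \<subseteq># add_mset b T" "prod_one G X"
      "prod_one G (add_mset (inv d) (add_mset b T - X))"
    have "b \<notin># X"
    proof
      assume "b \<in># X"
      then obtain X' where X': "X = add_mset b X'" using multi_member_split[of b X] by blast
      then have "X' \<subseteq># T" using X(1) by simp
      then have "set_mset X' \<subseteq> set_mset T" by (rule set_mset_mono)
      then have "set_mset X' \<subseteq> powers a" using powers_self[OF a(1)] by (auto simp: T_def split: if_splits)
      then show False using prod_one_subgroup_single[OF H, of X' b] X(2) X' bH by simp
    qed
    with X(1) have XT: "X \<subseteq># T" by (rule subset_add_mset_notin)
    then obtain k where k: "k \<le> 2 * n - 2" "X = replicate_mset k a"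
      unfolding T_def by (metis msubseteq_replicate_msetE)
    have "a [^] k = \<one>" using X(2) k prod_one_replicate a by simp
    then have "n dvd k" using pow_eq_id[OF a(1)] by (simp add: n_def)
    then obtain q where q: "k = n * q" by auto
    have "q < 2"
    proof (rule ccontr)
      assume "\<not> q < 2"
      then have "n * 2 \<le> n * q" by (intro mult_le_mono2) simp
      then show False using k q n by linarith
    qed
    show "X = {#}"
    proof (cases q)
      case 0
      then show ?thesis using k q by simp
    next
      case (Suc q')
      then have "k = n" using \<open>q < 2\<close> q by auto
      then have "add_mset b T - X = add_mset b (replicate_mset (n - 2) a)"
        using k n by (intro multiset_eqI) (auto simp: T_def)
      then have "prod_one G (add_mset b (add_mset (inv d) (replicate_mset (n - 2) a)))"
        using X(3) by (simp add: add_mset_commute)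
      then obtain us vs where uv: "mset us + mset vs = replicate_mset (n - 2) a"
          "b \<otimes> lprod us \<otimes> (inv d \<otimes> lprod vs) = \<one>"
        using prod_one_rotate2 by metis
      then obtain i j where ij: "us = replicate i a" "vs = replicate j a" "i + j = n - 2"
        using mset_replicate_parts by metis
      have 1: "b \<otimes> a [^] i \<otimes> (inv d \<otimes> a [^] j) = \<one>" using uv(2) ij a by (simp add: lprod_replicate del: foldr_replicate)
      \<comment> \<open>Since i + j = n - 2, this exponent lies strictly between 0 and n. Cancelling
        the outer powers in the two expressions for \<open>d\<close> shows that a^m commutes with
        b.\<close>
      define m where "m = n - 1 - j"
      have m: "0 < m" "m < n" "n - 1 = (j + 1) + i" "n - 1 = j + m" "n = j + 1 + m" using ij(3) n by (auto simp: m_def)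
      have "inv (inv d \<otimes> a [^] j) = b \<otimes> a [^] i" using 1 a b d by (simp add: inv_equality)
      then have "inv (a [^] j) \<otimes> d = b \<otimes> a [^] i" using a d by (simp add: inv_mult_group)
      then have "d = a [^] j \<otimes> (b \<otimes> a [^] i)" using a b d by (metis inv_solve_left m_closed nat_pow_closed)
      moreover have "d = a [^] j \<otimes> (a [^] m \<otimes> b \<otimes> a [^] (j + 1) \<otimes> a [^] i)"
      proof -
        have "a [^] (n - 1) = a [^] j \<otimes> a [^] m" "a [^] (n - 1) = a [^] (j + 1) \<otimes> a [^] i"
          using a(1) m(3,4) by (metis nat_pow_mult)+
        then have "d = (a [^] j \<otimes> a [^] m) \<otimes> b \<otimes> (a [^] (j + 1) \<otimes> a [^] i)"
          unfolding d_def by metis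
        then show ?thesis using a b by (simp only: m_assoc m_closed nat_pow_closed)
      qed
      ultimately have "b = a [^] m \<otimes> b \<otimes> a [^] (j + 1)"
        using a b by (metis l_cancel r_cancel m_closed nat_pow_closed)
      then have "b \<otimes> a [^] m = a [^] m \<otimes> b \<otimes> (a [^] (j + 1) \<otimes> a [^] m)"
        using a b by (metis m_assoc m_closed nat_pow_closed)
      also have "a [^] (j + 1) \<otimes> a [^] m = \<one>" using nat_pow_mult[OF a(1), of "j + 1" m] n(2) m(5) by simp
      also have "a [^] m \<otimes> b \<otimes> \<one> = a [^] m \<otimes> b" using a b by simp
      finally show ?thesis using nc[of m] m by (simp add: n_def)
    qed
  qed
  moreover have "size (add_mset (inv d) (add_mset b T)) = 2 * n" using n by (simp add: T_def)
  ultimately show ?thesis using that n_def by metis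
qed

section \<open>Atoms of length seven and eight from special configurations\<close>

lemma lprod_two:
  assumes "a \<in> carrier G" "b \<in> carrier G" "a \<otimes> b = b \<otimes> a" "a \<noteq> b" "set xs \<subseteq> {a, b}"
  shows "lprod xs = a [^] count (mset xs) a \<otimes> b [^] count (mset xs) b"
  using assms(5)
proof (induction xs)
  case (Cons x xs)
  let ?i = "count (mset xs) a" and ?j = "count (mset xs) b"
  have comm: "b \<otimes> a [^] (k::nat) = a [^] k \<otimes> b" for k
    using assms(1-3) by (simp add: group_commutes_pow)
  show ?case
  proof (cases "x = a")
    case True
    then show ?thesis using Cons assms nat_pow_Suc2[OF assms(1), of ?i] by (simp add: m_assoc)
  next
    case False
    then have "lprod (x # xs) = b \<otimes> a [^] ?i \<otimes> b [^] ?j" using Cons assms by (simp add: m_assoc)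
    also have "\<dots> = a [^] ?i \<otimes> (b [^] ?j \<otimes> b)"
      using comm[of ?i] assms nat_pow_Suc2[OF assms(2), of ?j] by (simp add: m_assoc)
    finally show ?thesis using False Cons by auto
  qed
qed simp

lemma pow_mult_dvd: "a \<in> carrier G \<Longrightarrow> a [^] (k::nat) = \<one> \<Longrightarrow> ord a dvd k"
  using pow_eq_id by blast

lemma square_one_imp_inv: "s \<in> carrier G \<Longrightarrow> s \<otimes> s = \<one> \<Longrightarrow> inv s = s"
  by (simp add: inv_equality)

lemma inverted_mult:
  assumes "s \<in> carrier G" "v \<in> carrier G" "w \<in> carrier G" "s \<otimes> s = \<one>" "s \<otimes> v = inv v \<otimes> s"
  shows "s \<otimes> v \<otimes> (s \<otimes> w) = inv v \<otimes> w"
proof -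
  have "s \<otimes> v \<otimes> (s \<otimes> w) = inv v \<otimes> s \<otimes> (s \<otimes> w)" using assms(5) by (rule arg_cong)
  also have "\<dots> = inv v \<otimes> (s \<otimes> s) \<otimes> w" using assms(1-3) by (simp add: m_assoc)
  finally show ?thesis using assms by simp
qed

lemma prod_one_pow_pair:
  assumes a: "a \<in> carrier G" "b \<in> carrier G" "a \<otimes> b = b \<otimes> a" "a \<noteq> b"
    and X: "X \<subseteq># replicate_mset m a + replicate_mset n b" "prod_one G X"
  obtains i j where "i \<le> m" "j \<le> n" "X = replicate_mset i a + replicate_mset j b"
    "a [^] i \<otimes> b [^] j = \<one>"
proof -
  have s: "set_mset X \<subseteq> {a, b}" using set_mset_mono[OF X(1)] by (auto split: if_splits)
  obtain xs where xs: "mset xs = X" "lprod xs = \<one>"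
    using X(2) by (auto simp: carrier_product_one_monoid_iff)
  have "a [^] count X a \<otimes> b [^] count X b = \<one>"
    using lprod_two[OF a, of xs] xs s by auto
  moreover have "count X a \<le> m" "count X b \<le> n"
    using mset_subset_eq_count[OF X(1), of a] mset_subset_eq_count[OF X(1), of b] a(4) by auto
  moreover have "X = replicate_mset (count X a) a + replicate_mset (count X b) b"
    using s a(4) by (intro multiset_eqI) (auto simp: count_eq_zero_iff)
  ultimately show ?thesis using that by blast
qed

lemma lprod_pair_parts:
  assumes "a \<in> carrier G" "b \<in> carrier G" "a \<otimes> b = b \<otimes> a" "a \<noteq> b"
    and "mset us + mset vs = replicate_mset m a + replicate_mset n b"
  obtains i j i' j' :: nat where "lprod us = a [^] i \<otimes> b [^] j" "lprod vs = a [^] i' \<otimes> b [^] j'"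
    "i + i' = m" "j + j' = n"
proof -
  have s: "set us \<union> set vs \<subseteq> {a, b}" using arg_cong[OF assms(5), of set_mset] by (auto split: if_splits)
  have "count (mset us) a + count (mset vs) a = m" "count (mset us) b + count (mset vs) b = n"
    using arg_cong[OF assms(5), of "\<lambda>M. count M a"] arg_cong[OF assms(5), of "\<lambda>M. count M b"] assms(4) by auto
  then show ?thesis using that lprod_two[OF assms(1-4), of us] lprod_two[OF assms(1-4), of vs] s by blast
qed

text \<open>The atom exists in every quotient of the alternating group on four letters in which the
  involution and the element of order three survive.\<close>

lemma atom_tetrahedral:
  assumes s: "s \<in> carrier G" "s \<noteq> \<one>" "s \<otimes> s = \<one>" and a: "a \<in> carrier G" "ord a = 3"
    and sa: "(s \<otimes> a) [^] (3::nat) = \<one>"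
  obtains U where "U \<in> product_one_atoms G" "size U = 7"
proof -
  define a' where "a' = inv a"
  have a': "a' \<in> carrier G" "a \<otimes> a' = \<one>" "a' \<otimes> a = \<one>" using a by (auto simp: a'_def)
  have a3: "a [^] (3::nat) = \<one>" using a pow_ord_eq_1[of a] by simp
  then have aaa: "a \<otimes> (a \<otimes> a) = \<one>" using a(1) by (simp add: numeral_3_eq_3 m_assoc)
  then have aa: "a \<otimes> a = a'" using a inv_equality[of "a \<otimes> a" a] by (simp add: a'_def m_assoc)
  have ne: "a \<noteq> a'"
  proof
    assume "a = a'"
    then have "a [^] (2::nat) = \<one>" using a' by (simp add: numeral_2_eq_2 a)
    then show False using pow_neq_one[of a 2] a by simp
  qed
  have H: "subgroup (powers a) G" using subgroup_powers a by simp
  have a'H: "a' \<in> powers a" using aa a by (intro range_eqI[of _ _ 2]) (simp add: numeral_2_eq_2)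
  have sH: "s \<notin> powers a"
  proof
    assume "s \<in> powers a"
    then obtain k :: nat where k: "s = a [^] k" by auto
    then have "a [^] (k + k) = \<one>" using s(3) a by (simp add: nat_pow_mult)
    then have "3 dvd k + k" using pow_mult_dvd a by metis
    then have "3 dvd k" by presburger
    then have "s = \<one>" using k pow_eq_id[OF a(1)] a(2) by simp
    then show False using s by simp
  qed
  let ?T = "replicate_mset 2 s + (replicate_mset 2 a + replicate_mset 2 a')"
  have sna: "s \<noteq> a" "s \<noteq> a'" using sH powers_self[OF a(1)] a'H by auto
  have one: "\<not> prod_one G (add_mset s Y)" if "set_mset Y \<subseteq> {a, a'}" for Y
    using prod_one_subgroup_single[OF H, of Y s] that sH powers_self[OF a(1)] a'H by auto
  have "add_mset s ?T \<in> product_one_atoms G"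
  proof (rule product_one_atomI)
    show "prod_one G (add_mset s ?T)"
    proof (rule prod_oneI)
      \<comment> \<open>The word s a s a' a' s a equals (s a)^3, because a' a' = a.\<close>
      have "(s \<otimes> a) [^] (3::nat) = s \<otimes> (a \<otimes> (s \<otimes> (a \<otimes> (s \<otimes> a))))"
        using s a by (simp add: numeral_3_eq_3 m_assoc)
      then show "lprod [s, a, s, a', a', s, a] = \<one>"
      proof -
        assume eq: "(s \<otimes> a) [^] (3::nat) = s \<otimes> (a \<otimes> (s \<otimes> (a \<otimes> (s \<otimes> a))))"
        have "a' \<otimes> a' = a" using aa a by (metis a'_def inv_inv inv_mult_group)
        then have "a' \<otimes> (a' \<otimes> (s \<otimes> a)) = a \<otimes> (s \<otimes> a)" using a' s a by (simp add: m_assoc[symmetric])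
        moreover have "s \<otimes> (a \<otimes> (s \<otimes> (a \<otimes> (s \<otimes> a)))) = \<one>" using trans[OF sym[OF eq] sa] .
        ultimately show ?thesis by (simp add: a(1))
      qed
      show "add_mset s ?T = mset [s, a, s, a', a', s, a]"
        by (simp add: numeral_2_eq_2 add_mset_commute)
    qed (use s a a' in auto)
    fix X assume X: "X \<subseteq># ?T" "prod_one G X" "prod_one G (add_mset s (?T - X))"
    \<comment> \<open>The three counts determine X. A single copy of \<open>s\<close> in X is
      impossible because s is outside <a>, and two copies leave a single one in the cofactor. So X
      involves only a and a', and its two exponents agree.\<close>
    have cX: "count X s \<le> 2" "count X a \<le> 2" "count X a' \<le> 2" "\<And>y. y \<notin> {s, a, a'} \<Longrightarrow> count X y = 0"
    proof -
      have c: "count X y \<le> count ?T y" for y using X(1) by (rule mset_subset_eq_count)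
      show "count X s \<le> 2" "count X a \<le> 2" "count X a' \<le> 2" using c[of s] c[of a] c[of a'] sna ne by auto
      fix y assume "y \<notin> {s, a, a'}"
      then show "count X y = 0" using c[of y] by simp
    qed
    have Xeq: "X = replicate_mset (count X s) s + (replicate_mset (count X a) a + replicate_mset (count X a') a')"
      using cX(4) sna ne by (intro multiset_eqI) auto
    have Ceq: "?T - X = replicate_mset (2 - count X s) s
        + (replicate_mset (2 - count X a) a + replicate_mset (2 - count X a') a')"
      using cX(4) sna ne by (intro multiset_eqI) auto
    have "count X s \<noteq> 1"
    proof
      assume 1: "count X s = 1"
      show False
        using one[of "replicate_mset (count X a) a + replicate_mset (count X a') a'"] X(2) 1
        by (subst (asm) Xeq) (auto split: if_splits)
    qed
    moreover have "count X s \<noteq> 2"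
    proof
      assume 2: "count X s = 2"
      show False
        using one[of "replicate_mset (2 - count X a) a + replicate_mset (2 - count X a') a'"] X(3) 2
        unfolding Ceq by (auto split: if_splits)
    qed
    ultimately have s0: "count X s = 0" using cX(1) by linarith
    have X0: "X \<subseteq># replicate_mset 2 a + replicate_mset 2 a'"
      using cX(2-4) s0 ne by (intro mset_subset_eqI) (metis count_replicate_mset count_union add_0 add_0_right le0 insert_iff emptyE)
    obtain i j where ij: "i \<le> 2" "j \<le> 2" "X = replicate_mset i a + replicate_mset j a'" "a [^] i \<otimes> a' [^] j = \<one>"
      using prod_one_pow_pair[OF a(1) a'(1) _ ne X0 X(2)] a' by auto
    have "a' = a [^] (2::nat)" using aa a by (simp add: numeral_2_eq_2)
    then have "a' [^] j = a [^] (2 * j)" using a nat_pow_pow[of a 2 j] by simp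
    then have "a [^] (i + 2 * j) = \<one>" using ij(4) a by (simp add: nat_pow_mult)
    then have "3 dvd i + 2 * j" using pow_mult_dvd a by metis
    then have "i = j" using ij(1,2) by presburger
    consider "i = 0" | "i = 1" | "i = 2" using ij(1) by linarith
    then show "X = {#}"
    proof cases
      case 1 then show ?thesis using ij \<open>i = j\<close> by simp
    next
      case 2
      have "add_mset s (?T - X) = add_mset a (add_mset a' (replicate_mset 3 s))"
        using ij \<open>i = j\<close> 2 ne sna by (simp add: numeral_2_eq_2 numeral_3_eq_3 add_mset_commute)
      then obtain us vs where uv: "mset us + mset vs = replicate_mset 3 s"
          "a \<otimes> lprod us \<otimes> (a' \<otimes> lprod vs) = \<one>"
        using prod_one_rotate2 X(3) by metis
      then obtain p q where pq: "us = replicate p s" "vs = replicate q s" "p + q = 3"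
        using mset_replicate_parts by metis
      \<comment> \<open>However the three copies of \<open>s\<close> are distributed, the word
        reduces to s or to a conjugate of s.\<close>
      have eq: "a \<otimes> s [^] p \<otimes> (a' \<otimes> s [^] q) = \<one>" using uv(2) pq s by (simp add: lprod_replicate del: foldr_replicate)
      have s2: "s [^] (2::nat) = \<one>" "s [^] (3::nat) = s" using s by (simp_all add: numeral_2_eq_2 numeral_3_eq_3)
      consider "p = 0" "q = 3" | "p = 1" "q = 2" | "p = 2" "q = 1" | "p = 3" "q = 0" using pq(3) by linarith
      then have "s = \<one>"
      proof cases
        case 1 then show ?thesis using eq s2 s a a' by (simp add: m_assoc[symmetric])
      next
        case 2 then have "a \<otimes> s \<otimes> a' = \<one>" using eq s2 s a a' by simp
        then show ?thesis using s a a' by (metis a'_def inv_equality inv_inv l_cancel_one m_closed)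
      next
        case 3 then show ?thesis using eq s2 s a a' by (simp add: m_assoc[symmetric])
      next
        case 4 then have "a \<otimes> s \<otimes> a' = \<one>" using eq s2 s a a' by simp
        then show ?thesis using s a a' by (metis a'_def inv_equality inv_inv l_cancel_one m_closed)
      qed
      then show ?thesis using s by simp
    next
      case 3
      have "add_mset s (?T - X) = replicate_mset 3 s"
        using ij \<open>i = j\<close> 3 by (simp add: numeral_3_eq_3 numeral_2_eq_2)
      then have "s [^] (3::nat) = \<one>" using X(3) prod_one_replicate[OF s(1)] by simp
      then show ?thesis using s by (simp add: numeral_3_eq_3)
    qed
  qed
  then show ?thesis using that by force
qed

text \<open>The atom is s^2 a^4 c^2, ordered as s w s w with w = a a c. A nonempty factor without
  \<open>s\<close> can only be a^3; the cofactor s^2 a c^2 would then split a c^2 into two parts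
  with equal products, against the independence of a and c.\<close>

lemma atom_generalized_dihedral:
  assumes s: "s \<in> carrier G" "s \<otimes> s = \<one>" and a: "a \<in> carrier G" "ord a = 3"
    and c: "c \<in> carrier G" "ord c = 3" "a \<otimes> c = c \<otimes> a" "c \<notin> powers a"
    and sac: "s \<otimes> a = inv a \<otimes> s" "s \<otimes> c = inv c \<otimes> s"
  obtains U where "U \<in> product_one_atoms G" "size U = 8"
proof -
  have ne: "a \<noteq> c" using c powers_self[OF a(1)] by auto
  have a2: "a \<otimes> a \<noteq> \<one>"
    using pow_neq_one[of a 2] a by (simp add: numeral_2_eq_2)
  have c3: "c [^] (3::nat) = \<one>" using c pow_ord_eq_1[of c] by simp
  have sinv: "inv s = s" using square_one_imp_inv s by simp
  have sna: "s \<noteq> a" using s a2 by auto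
  \<comment> \<open>Inversion by \<open>s\<close> extends from the two generators to the whole
    abelian subgroup that they generate.\<close>
  have flip: "s \<otimes> (a [^] i \<otimes> c [^] j) = inv (a [^] i \<otimes> c [^] j) \<otimes> s" for i j :: nat
  proof -
    have sa: "s \<otimes> a [^] i = inv (a [^] i) \<otimes> s" for i :: nat
    proof (induction i)
      case (Suc i)
      have "s \<otimes> a [^] Suc i = inv (a [^] i) \<otimes> (s \<otimes> a)" using Suc s a by (simp add: m_assoc[symmetric])
      also have "\<dots> = inv (a [^] i) \<otimes> inv a \<otimes> s" using sac s a by (simp add: m_assoc)
      also have "\<dots> = inv (a [^] Suc i) \<otimes> s" using a by (simp add: inv_mult_group[symmetric] nat_pow_Suc2[symmetric])
      finally show ?case .
    qed (use s in simp)
    have sc: "s \<otimes> c [^] i = inv (c [^] i) \<otimes> s" for i :: nat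
    proof (induction i)
      case (Suc i)
      have "s \<otimes> c [^] Suc i = inv (c [^] i) \<otimes> (s \<otimes> c)" using Suc s c by (simp add: m_assoc[symmetric])
      also have "\<dots> = inv (c [^] i) \<otimes> inv c \<otimes> s" using sac s c by (simp add: m_assoc)
      also have "\<dots> = inv (c [^] Suc i) \<otimes> s" using c by (simp add: inv_mult_group[symmetric] nat_pow_Suc2[symmetric])
      finally show ?case .
    qed (use s in simp)
    have comm: "a [^] i \<otimes> c [^] j = c [^] j \<otimes> a [^] i"
      using a c by (metis group_commutes_pow nat_pow_closed)
    have "s \<otimes> (a [^] i \<otimes> c [^] j) = inv (a [^] i) \<otimes> (s \<otimes> c [^] j)"
      using s a c sa[of i] by (simp add: m_assoc[symmetric])
    also have "\<dots> = inv (a [^] i) \<otimes> inv (c [^] j) \<otimes> s" using s a c sc[of j] by (simp add: m_assoc)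
    also have "\<dots> = inv (a [^] i \<otimes> c [^] j) \<otimes> s" using comm a c by (simp add: inv_mult_group)
    finally show ?thesis .
  qed
  let ?T = "add_mset s (replicate_mset 4 a + replicate_mset 2 c)"
  \<comment> \<open>Otherwise \<open>s\<close> would be a product of powers of a and c and commute
    with a, whereas it inverts a.\<close>
  have single: "\<not> prod_one G (add_mset s Y)" if "set_mset Y \<subseteq> {a, c}" for Y
  proof
    assume "prod_one G (add_mset s Y)"
    then obtain ys where ys: "mset ys = Y" "s \<otimes> lprod ys = \<one>" using prod_one_rotate by metis
    have "set ys \<subseteq> {a, c}" using that ys(1) by auto
    then obtain i j :: nat where "lprod ys = a [^] i \<otimes> c [^] j" using lprod_two[OF a(1) c(1) c(3) ne] by blast
    then have n: "s \<otimes> (a [^] i \<otimes> c [^] j) = \<one>" using ys by simp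
    then have "s = a [^] i \<otimes> c [^] j" using s a c sinv by (metis inv_equality inv_inv m_closed nat_pow_closed)
    moreover have "a [^] i \<otimes> c [^] j \<otimes> a = a \<otimes> (a [^] i \<otimes> c [^] j)"
    proof -
      have "a [^] i \<otimes> a = a \<otimes> a [^] i" using a by (metis nat_pow_Suc nat_pow_Suc2)
      moreover have "c [^] j \<otimes> a = a \<otimes> c [^] j" using a c by (metis group_commutes_pow)
      ultimately show ?thesis using a c by (metis m_assoc nat_pow_closed)
    qed
    ultimately have "inv a \<otimes> s = a \<otimes> s" using sac by simp
    then have "inv a = a" using s a by simp
    then show False using a2 a by (metis l_inv)
  qed
  have "add_mset s ?T \<in> product_one_atoms G"
  proof (rule product_one_atomI)
    show "prod_one G (add_mset s ?T)"
    proof (rule prod_oneI)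
      let ?w = "a [^] (2::nat) \<otimes> c [^] (1::nat)"
      have w: "?w = a \<otimes> (a \<otimes> c)" using a c by (simp add: numeral_2_eq_2 m_assoc)
      have "s \<otimes> ?w \<otimes> (s \<otimes> ?w) = inv ?w \<otimes> ?w"
        using flip[of 2 1] s a c by (intro inverted_mult) auto
      also have "\<dots> = \<one>" using s a c by simp
      finally have "s \<otimes> (a \<otimes> (a \<otimes> c)) \<otimes> (s \<otimes> (a \<otimes> (a \<otimes> c))) = \<one>" unfolding w .
      then show "lprod [s, a, a, c, s, a, a, c] = \<one>" using s(1) a(1) c(1) by (simp add: m_assoc)
      show "add_mset s ?T = mset [s, a, a, c, s, a, a, c]"
        by (simp add: numeral_eq_Suc add_mset_commute)
    qed (use s a c in auto)
    fix X assume X: "X \<subseteq># ?T" "prod_one G X" "prod_one G (add_mset s (?T - X))"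
    have "s \<notin># X"
    proof
      assume "s \<in># X"
      then obtain Y where Y: "X = add_mset s Y" using multi_member_split[of s X] by blast
      then have "Y \<subseteq># replicate_mset 4 a + replicate_mset 2 c" using X(1) by simp
      then have "set_mset Y \<subseteq> {a, c}" using set_mset_mono by fastforce
      then show False using single X(2) Y by blast
    qed
    with X(1) have X': "X \<subseteq># replicate_mset 4 a + replicate_mset 2 c" by (rule subset_add_mset_notin)
    obtain i j where ij: "i \<le> 4" "j \<le> 2" "X = replicate_mset i a + replicate_mset j c" "a [^] i \<otimes> c [^] j = \<one>"
      using prod_one_pow_pair[OF a(1) c(1) c(3) ne X' X(2)] by auto
    have H: "subgroup (powers a) G" using subgroup_powers a by simp
    have cpow: "c [^] k \<notin> powers a" if "0 < k" "k < 3" for k :: nat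
    proof
      assume k: "c [^] k \<in> powers a"
      have "k = 1 \<or> k = 2" using that(1,2) by linarith
      then consider "k = 1" | "k = 2" by blast
      then show False
      proof cases
        case 1 then show ?thesis using k c by simp
      next
        case 2
        have "inv (c [^] k) = c" using c3 c 2 by (intro inv_equality) (auto simp: numeral_3_eq_3 numeral_2_eq_2 m_assoc)
        then show ?thesis using k H c subgroup.m_inv_closed by metis
      qed
    qed
    have "c [^] j = inv (a [^] i)" using ij(4) a c by (metis inv_equality inv_inv nat_pow_closed)
    then have "c [^] j \<in> powers a" using H subgroup.m_inv_closed by (metis rangeI)
    then have j0: "j = 0" using cpow[of j] ij(2) by (cases "j = 0") auto
    then have "a [^] i = \<one>" using ij(4) a by simp
    then have "3 dvd i" using pow_mult_dvd a by metis
    show "X = {#}"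
    proof (cases "i = 0")
      case True then show ?thesis using ij j0 by simp
    next
      case False
      then have "i = 3" using \<open>3 dvd i\<close> ij(1) by presburger
      then have "add_mset s (?T - X) = add_mset s (add_mset s (replicate_mset 1 a + replicate_mset 2 c))"
        using ij j0 sna by (simp add: numeral_eq_Suc)
      then obtain us vs where uv: "mset us + mset vs = replicate_mset 1 a + replicate_mset 2 c"
          "s \<otimes> lprod us \<otimes> (s \<otimes> lprod vs) = \<one>"
        using prod_one_rotate2 X(3) by metis
      then obtain i1 j1 i2 j2 :: nat where p: "lprod us = a [^] i1 \<otimes> c [^] j1" "lprod vs = a [^] i2 \<otimes> c [^] j2"
          "i1 + i2 = 1" "j1 + j2 = 2"
        using lprod_pair_parts[OF a(1) c(1) c(3) ne uv(1)] by blast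
      let ?v = "a [^] i1 \<otimes> c [^] j1" and ?w = "a [^] i2 \<otimes> c [^] j2"
      have "s \<otimes> ?v \<otimes> (s \<otimes> ?w) = inv ?v \<otimes> ?w"
        using flip[of i1 j1] s a c by (intro inverted_mult) auto
      then have "inv ?v \<otimes> ?w = \<one>" using uv(2) p s a c by simp
      then have vw: "?v = ?w" using a c by (metis inv_equality inv_inv m_closed nat_pow_closed inv_closed)
      have comm: "a \<otimes> c [^] k = c [^] k \<otimes> a" for k :: nat using a c by (metis group_commutes_pow)
      have "a \<noteq> \<one>" using a by auto
      then have f1: "a \<otimes> c \<noteq> c" using a(1) c(1) by simp
      have c2: "a \<noteq> c [^] (2::nat)" "inv a \<noteq> c [^] (2::nat)"
        using cpow[of 2] powers_self[OF a(1)] subgroup.m_inv_closed[OF H powers_self[OF a(1)]] by auto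
      have f2: "a \<otimes> c [^] (2::nat) \<noteq> \<one>"
        using c2(2) a(1) c(1) comm[of 2] by (metis inv_equality nat_pow_closed)
      have jj: "j1 = 1 \<and> j2 = 1 \<or> j1 = 0 \<and> j2 = 2 \<or> j1 = 2 \<and> j2 = 0" using p(4) by linarith
      have "i1 = 0 \<and> i2 = 1 \<or> i1 = 1 \<and> i2 = 0" using p(3) by linarith
      then have "a \<otimes> c [^] j1 = c [^] j2 \<or> a \<otimes> c [^] j2 = c [^] j1" using vw a(1) c(1) by fastforce
      then have False using jj f1 f2 c2(1) a(1) c(1) by fastforce
      then show ?thesis ..
    qed
  qed
  then show ?thesis using that by force
qed

text \<open>Here z is the commutator of b and a. The atom is c x b a^4 with c = z (x b)^-1, where
  the word c x a b a^3 uses the noncommuting a and b to cancel z. Splitting off a^4 would leave c x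
  b, whose product is z and not the identity, and each of x, b, c alone is outside <a>.\<close>

lemma atom_central_extension:
  assumes a: "a \<in> carrier G" "ord a = 4" and b: "b \<in> carrier G" and x: "x \<in> carrier G" and z: "z \<in> carrier G"
    and ba: "b \<otimes> a = z \<otimes> (a \<otimes> b)" "z \<noteq> \<one>"
    and zc: "z \<otimes> a = a \<otimes> z" "z \<otimes> b = b \<otimes> z" "z \<otimes> x = x \<otimes> z"
    and xc: "x \<otimes> a = a \<otimes> x" "x \<otimes> b = b \<otimes> x" "x \<notin> powers a"
  obtains U where "U \<in> product_one_atoms G" "size U = 7"
proof -
  define c where "c = z \<otimes> inv (x \<otimes> b)"
  have c: "c \<in> carrier G" using z x b by (simp add: c_def)
  have cxb: "c \<otimes> (x \<otimes> b) = z" "x \<otimes> b \<otimes> c = z"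
  proof -
    have z1: "z \<otimes> (x \<otimes> b) = x \<otimes> b \<otimes> z" using z x b zc by (metis m_assoc)
    show "c \<otimes> (x \<otimes> b) = z" using z x b by (simp add: c_def m_assoc)
    have "z \<otimes> inv (x \<otimes> b) = inv (x \<otimes> b) \<otimes> z"
      using z1 z x b by (metis inv_closed inv_solve_left inv_solve_right m_assoc m_closed)
    then show "x \<otimes> b \<otimes> c = z" using z x b by (simp add: c_def m_assoc[symmetric])
  qed
  have H: "subgroup (powers a) G" using subgroup_powers a by simp
  have bnc: "b \<otimes> a \<noteq> a \<otimes> b"
  proof
    assume "b \<otimes> a = a \<otimes> b"
    then have "z \<otimes> (a \<otimes> b) = \<one> \<otimes> (a \<otimes> b)" using ba a b by simp
    then show False using ba a b z by (metis m_closed one_closed r_cancel)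
  qed
  have bH: "b \<notin> powers a" using powers_commute[OF a(1), of b] bnc by auto
  have cH: "c \<notin> powers a"
  proof
    assume "c \<in> powers a"
    then have ca: "c \<otimes> a = a \<otimes> c" using powers_commute a by blast
    have "c \<otimes> (x \<otimes> (a \<otimes> b)) = a \<otimes> z"
      using cxb(1) ca xc a b x c by (metis m_assoc m_closed)
    also have "\<dots> = c \<otimes> (x \<otimes> b) \<otimes> a" using cxb(1) zc by simp
    also have "\<dots> = c \<otimes> (x \<otimes> (b \<otimes> a))" using c x b a by (simp add: m_assoc)
    finally show False using bnc a b c x by simp
  qed
  have xb: "x \<noteq> b" using xc bnc by auto
  have xa: "x \<noteq> a" "b \<noteq> a" using xc bH powers_self[OF a(1)] by auto
  have a4: "a [^] (4::nat) = \<one>" using a pow_ord_eq_1[of a] by simp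
  let ?T = "add_mset x (add_mset b (replicate_mset 4 a))"
  have single: "y \<in> powers a" if "prod_one G (add_mset y Y)" "set_mset Y \<subseteq> {a}" for y Y
    using prod_one_subgroup_single[OF H, of Y y] that powers_self[OF a(1)] by auto
  have "add_mset c ?T \<in> product_one_atoms G"
  proof (rule product_one_atomI)
    show "prod_one G (add_mset c ?T)"
    proof (rule prod_oneI)
      \<comment> \<open>The factor z turns a b into b a, after which the powers of a combine to a^4
        = 1.\<close>
      have ba3: "z \<otimes> (a \<otimes> (b \<otimes> (a \<otimes> (a \<otimes> a)))) = b"
      proof -
        have "z \<otimes> (a \<otimes> (b \<otimes> (a \<otimes> (a \<otimes> a)))) = z \<otimes> (a \<otimes> b) \<otimes> (a \<otimes> (a \<otimes> a))"
          using a b z by (simp add: m_assoc)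
        also have "\<dots> = b \<otimes> a \<otimes> (a \<otimes> (a \<otimes> a))" using ba by simp
        also have "\<dots> = b \<otimes> a [^] (4::nat)" using a b by (simp add: numeral_eq_Suc m_assoc)
        finally show ?thesis using a4 b by simp
      qed
      let ?w = "a \<otimes> (b \<otimes> (a \<otimes> (a \<otimes> a)))"
      have w: "?w = inv z \<otimes> b" using ba3 z a b by (metis inv_solve_left m_closed)
      have "c \<otimes> (x \<otimes> ?w) = c \<otimes> (x \<otimes> b) \<otimes> inv z"
      proof -
        have "inv z \<otimes> b = b \<otimes> inv z" using zc z b by (metis inv_closed inv_solve_left inv_solve_right m_assoc m_closed)
        then show ?thesis using w c x b z by (simp add: m_assoc)
      qed
      then show "lprod [c, x, a, b, a, a, a] = \<one>" using cxb z a b c x by simp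
      show "add_mset c ?T = mset [c, x, a, b, a, a, a]" by (simp add: numeral_eq_Suc add_mset_commute)
    qed (use a b c x in auto)
    fix X assume X: "X \<subseteq># ?T" "prod_one G X" "prod_one G (add_mset c (?T - X))"
    have cX: "count X x \<le> 1" "count X b \<le> 1" "count X a \<le> 4" "\<And>y. y \<notin> {x, b, a} \<Longrightarrow> count X y = 0"
    proof -
      have c: "count X y \<le> count ?T y" for y using X(1) by (rule mset_subset_eq_count)
      show "count X x \<le> 1" "count X b \<le> 1" "count X a \<le> 4" using c[of x] c[of b] c[of a] xa xb by auto
      show "\<And>y. y \<notin> {x, b, a} \<Longrightarrow> count X y = 0" using c by (metis count_add_mset count_replicate_mset insertCI le_zero_eq)
    qed
    define p q r where pqr: "p = count X x" "q = count X b" "r = count X a"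
    have Xeq: "X = replicate_mset p x + (replicate_mset q b + replicate_mset r a)"
      using cX(4) xa xb by (intro multiset_eqI) (auto simp: pqr)
    have Ceq: "?T - X = replicate_mset (1 - p) x + (replicate_mset (1 - q) b + replicate_mset (4 - r) a)"
      using cX(4) xa xb by (intro multiset_eqI) (auto simp: pqr)
    have s: "set_mset (replicate_mset k a) \<subseteq> {a}" for k by simp
    consider "p = 0" "q = 0" | "p = 1" "q = 0" | "p = 0" "q = 1" | "p = 1" "q = 1"
      using cX(1,2) unfolding pqr by linarith
    then show "X = {#}"
    proof cases
      case 1
      then have Xa: "X = replicate_mset r a" using Xeq by simp
      then have "a [^] r = \<one>" using X(2) prod_one_replicate[OF a(1)] by metis
      then have "4 dvd r" using pow_mult_dvd a by metis
      then consider "r = 0" | "r = 4" using cX(3) unfolding pqr(3)[symmetric] by (cases "r = 0") (auto dest: dvd_imp_le)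
      then show ?thesis
      proof cases
        case 1 then show ?thesis using Xa by simp
      next
        case 2
        then have "prod_one G {#c, x, b#}" using X(3) \<open>p = 0\<close> \<open>q = 0\<close> unfolding Ceq
          by (simp add: add_mset_commute)
        then have "c \<otimes> (x \<otimes> b) = \<one> \<or> c \<otimes> (b \<otimes> x) = \<one>" using prod_one_triple by blast
        then show ?thesis using cxb xc ba by auto
      qed
    next
      case 2
      then have "X = add_mset x (replicate_mset r a)" using Xeq by simp
      then show ?thesis using single[OF _ s, of x r] X(2) xc by simp
    next
      case 3
      then have "X = add_mset b (replicate_mset r a)" using Xeq by simp
      then show ?thesis using single[OF _ s, of b r] X(2) bH by simp
    next
      case 4
      then have "?T - X = replicate_mset (4 - r) a" using Ceq by simp
      then show ?thesis using single[OF _ s, of c "4 - r"] X(3) cH by simp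
    qed
  qed
  then show ?thesis using that by force
qed

end

subsection \<open>Element orders\<close>

text \<open>Two facts about atoms stand for the maximum: the bound excludes groups with longer
  atoms, and the atom of length six excludes groups that are too small.\<close>

locale davenport_6 = group +
  assumes finite_carrier: "finite (carrier G)"
    and atom_size_le: "U \<in> product_one_atoms G \<Longrightarrow> size U \<le> 6"
    and ex_atom_6: "\<exists>U \<in> product_one_atoms G. size U = 6"
begin

lemma ord_pos: "x \<in> carrier G \<Longrightarrow> 0 < ord x"
  using ord_ge_1[OF finite_carrier] by fastforce

lemma free_size_le: assumes "prod_one_free G T" shows "size T \<le> 5"
proof -
  obtain U where "U \<in> product_one_atoms G" "size U = Suc (size T)"
    using prod_one_free_imp_atom[OF assms] by blast
  then show ?thesis using atom_size_le[of U] by simp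
qed

lemma ord_le_6: "x \<in> carrier G \<Longrightarrow> ord x \<le> 6"
  using free_size_le[OF prod_one_free_replicate[of x "ord x - 1"]] ord_pos[of x] by fastforce

lemma subgroup_pow: "x \<in> carrier G \<Longrightarrow> subgroup (powers x) G"
  using subgroup_powers ord_pos by blast

lemma card_carrier_ge: "6 \<le> card (carrier G)"
  using ex_atom_6 size_product_one_atom_le[OF is_group finite_carrier] by fastforce

lemma card_powers_le: assumes "x \<in> carrier G" shows "card (powers x) \<le> ord x"
proof -
  have "powers x \<subseteq> (\<lambda>k. x [^] k) ` {..<ord x}"
  proof
    fix y assume "y \<in> powers x"
    then obtain k :: nat where k: "y = x [^] k" by auto
    have "x [^] k = x [^] (ord x * (k div ord x)) \<otimes> x [^] (k mod ord x)"
      using assms by (simp add: nat_pow_mult)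
    also have "x [^] (ord x * (k div ord x)) = \<one>"
      using assms by (simp add: nat_pow_pow[symmetric])
    finally have "y = x [^] (k mod ord x)" using assms k by simp
    then show "y \<in> (\<lambda>k. x [^] k) ` {..<ord x}" using ord_pos[OF assms] by auto
  qed
  then show ?thesis using surj_card_le[of "{..<ord x}"] by fastforce
qed

text \<open>An element outside <x> would extend the free sequence x^5 to an atom of length
  seven.\<close>

lemma order_6_cyclic:
  assumes "x \<in> carrier G" "ord x = 6"
  shows "carrier G = powers x"
proof (rule ccontr)
  assume "carrier G \<noteq> powers x"
  moreover have "powers x \<subseteq> carrier G" using assms by auto
  ultimately obtain b where b: "b \<in> carrier G" "b \<notin> powers x" by blast
  have "set_mset (replicate_mset 5 x) \<subseteq> powers x" using powers_self[OF assms(1)] by simp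
  moreover have "prod_one_free G (replicate_mset 5 x)" using assms by (intro prod_one_free_replicate) auto
  ultimately obtain U where "U \<in> product_one_atoms G" "size U = size (replicate_mset 5 x) + 2"
    using atom_from_coset[OF subgroup_pow[OF assms(1)] _ _ b] by blast
  then show False using atom_size_le[of U] by simp
qed

lemma ord_dvdI: "x \<in> carrier G \<Longrightarrow> x [^] (k::nat) = \<one> \<Longrightarrow> ord x dvd k"
  using pow_mult_dvd by blast

lemma comm_power:
  assumes "x \<in> carrier G" "y \<in> carrier G" "x \<otimes> y = y \<otimes> x"
  shows "x \<otimes> y [^] (k::nat) = y [^] k \<otimes> x" "x [^] k \<otimes> y = y \<otimes> x [^] k"
  using assms group_commutes_pow by metis+

lemma comm_mult_pow:
  assumes "x \<in> carrier G" "y \<in> carrier G" "x \<otimes> y = y \<otimes> x"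
  shows "(x \<otimes> y) [^] (n::nat) = x [^] n \<otimes> y [^] n"
  using pow_mult_distrib[OF assms(3,1,2)] .

text \<open>Otherwise the double coset construction yields an atom with at least eight
  terms.\<close>

lemma commutes_with_power:
  assumes a: "a \<in> carrier G" "4 \<le> ord a" and b: "b \<in> carrier G"
  obtains m :: nat where "0 < m" "m < ord a" "b \<otimes> a [^] m = a [^] m \<otimes> b"
proof (rule ccontr)
  assume "\<not> thesis"
  then have "b \<otimes> a [^] m \<noteq> a [^] m \<otimes> b" if "0 < m" "m < ord a" for m :: nat
    using that(1,2) \<open>\<not> thesis\<close> \<open>\<And>m. \<lbrakk>0 < m; m < ord a; b \<otimes> a [^] m = a [^] m \<otimes> b\<rbrakk> \<Longrightarrow> thesis\<close> by blast
  moreover have "2 \<le> ord a" using a by simp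
  ultimately obtain U where "U \<in> product_one_atoms G" "size U = 2 * ord a"
    using atom_from_double_coset[OF a(1) _ b] by metis
  then show False using atom_size_le[of U] a by simp
qed

text \<open>An element b outside <a> commutes with a nontrivial power of a, hence with a. The bounds
  on element orders and divisibility of the group order force b to have order five as well, and then
  a^4 b^4 is a product-one free sequence of length eight.\<close>

lemma no_order_5:
  assumes a: "a \<in> carrier G" "ord a = 5"
  shows False
proof -
  have a5: "a [^] (5::nat) = \<one>" using a pow_ord_eq_1[of a] by simp
  have "carrier G \<noteq> powers a" using card_powers_le[OF a(1)] card_carrier_ge a by auto
  then obtain b where b: "b \<in> carrier G" "b \<notin> powers a" using a by blast
  have aab: "a \<otimes> b = b \<otimes> a"
  proof -
    obtain m :: nat where m: "0 < m" "m < 5" "b \<otimes> a [^] m = a [^] m \<otimes> b"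
      using commutes_with_power[OF a(1) _ b(1)] a(2) by auto
    have "m = 1 \<or> m = 2 \<or> m = 3 \<or> m = 4" using m by linarith
    \<comment> \<open>The exponent k inverts m modulo five, so (a^m)^k = a.\<close>
    then obtain k l :: nat where "m * k = 5 * l + 1"
    proof (elim disjE)
      assume "m = 2" then show ?thesis using that[of 3 1] by simp
    next assume "m = 3" then show ?thesis using that[of 2 1] by simp
    next assume "m = 4" then show ?thesis using that[of 4 3] by simp
    qed (use that[of 1 0] in simp)
    then have "(a [^] m) [^] k = (a [^] (5::nat)) [^] l \<otimes> a" using a by (simp add: nat_pow_pow)
    then have "(a [^] m) [^] k = a" using a5 a by simp
    then show ?thesis using comm_power(2)[of "a [^] m" b k] m(3) a b by simp
  qed
  have ordb: "ord b = 5"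
  proof -
    have "ord b \<noteq> 1" using b ord_eq_1[of b] subgroup.one_closed[OF subgroup_pow[OF a(1)]] by auto
    moreover have "ord b \<noteq> 6"
      using order_6_cyclic[OF b(1)] aab b(1) a comm_power
      using ord_dvd_group_order[of a] ord_dvd_group_order[of b] card_powers_le[OF b(1)]
        card_carrier_ge finite_carrier by (auto simp: Coset.order_def dest: dvd_imp_le)
    moreover have False if "ord b \<in> {2, 3, 4}"
    proof -
      define n where "n = ord (a \<otimes> b)"
      have n: "n \<le> 6" "0 < n" using a b ord_le_6 ord_pos by (auto simp: n_def)
      have ab: "a [^] n \<otimes> b [^] n = \<one>" using comm_mult_pow[OF a(1) b(1) aab, of n] a b by (simp add: n_def)
      have "(a \<otimes> b) [^] (n * ord b) = \<one>" using a b by (simp add: n_def nat_pow_pow[symmetric])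
      moreover have "b [^] (n * ord b) = \<one>" using b by (metis mult.commute nat_pow_one nat_pow_pow pow_ord_eq_1)
      ultimately have "a [^] (n * ord b) = \<one>"
        using comm_mult_pow[OF a(1) b(1) aab, of "n * ord b"] a by simp
      \<comment> \<open>As ord b is prime to five, n is a multiple of five and at most six, so n = 5
        and b^5 = 1, against the assumed order of b.\<close>
      then have "5 dvd n * ord b" using ord_dvdI a by metis
      then have "5 dvd n" using that by auto presburger+
      then have "n = 5" using n by (auto simp: dvd_def)
      then have "b [^] (5::nat) = \<one>" using ab a5 b by simp
      then have "ord b dvd 5" using ord_dvdI b by blast
      then show False using that by auto
    qed
    moreover have "ord b \<in> {1, 2, 3, 4, 5, 6}" using ord_le_6[OF b(1)] ord_pos[OF b(1)] by auto
    ultimately show ?thesis by auto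
  qed
  have "b [^] k \<notin> powers a" if k: "0 < k" "k \<le> 4" for k :: nat
  proof
    assume bk: "b [^] k \<in> powers a"
    have "k = 1 \<or> k = 2 \<or> k = 3 \<or> k = 4" using k by linarith
    then obtain r l :: nat where "k * r = 5 * l + 1"
    proof (elim disjE)
      assume "k = 2" then show ?thesis using that[of 3 1] by simp
    next assume "k = 3" then show ?thesis using that[of 2 1] by simp
    next assume "k = 4" then show ?thesis using that[of 4 3] by simp
    qed (use that[of 1 0] in simp)
    then have "(b [^] k) [^] r = (b [^] (5::nat)) [^] l \<otimes> b" using b by (simp add: nat_pow_pow)
    then have "(b [^] k) [^] r = b" using ordb b pow_ord_eq_1[of b] by simp
    moreover have "(b [^] k) [^] r \<in> powers a" using bk a by (auto simp: nat_pow_pow)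
    ultimately show False using b by simp
  qed
  then have "prod_one_free G (replicate_mset 4 a + replicate_mset 4 b)"
    using subgroup_pow[OF a(1)] a b powers_self[OF a(1)] comm_power(2)[OF a(1) b(1) aab]
    by (intro prod_one_free_extend[of "powers a"] prod_one_free_replicate) auto
  then show False using free_size_le by fastforce
qed

text \<open>The power of a commuting with b is a, a^2 or a^3, and each of these has a^2 among its
  powers.\<close>

lemma order_4_square_central:
  assumes a: "a \<in> carrier G" "ord a = 4" and b: "b \<in> carrier G"
  shows "a [^] (2::nat) \<otimes> b = b \<otimes> a [^] (2::nat)"
proof -
  obtain m :: nat where m: "0 < m" "m < 4" "b \<otimes> a [^] m = a [^] m \<otimes> b"
    using commutes_with_power[OF a(1) _ b] a(2) by auto
  have "m = 1 \<or> m = 2 \<or> m = 3" using m by linarith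
  then obtain k l :: nat where "m * k = 4 * l + 2"
  proof (elim disjE)
    assume "m = 2" then show ?thesis using that[of 1 0] by simp
  next assume "m = 3" then show ?thesis using that[of 2 1] by simp
  qed (use that[of 2 0] in simp)
  then have "(a [^] m) [^] k = (a [^] (4::nat)) [^] l \<otimes> a [^] (2::nat)"
    using a by (simp only: nat_pow_pow nat_pow_mult)
  then have "(a [^] m) [^] k = a [^] (2::nat)" using a pow_ord_eq_1[of a] by simp
  then show ?thesis using comm_power(2)[of "a [^] m" b k] m(3) a b by simp
qed

lemma commuting_2_3_cyclic:
  assumes x: "x \<in> carrier G" "ord x = 2" and a: "a \<in> carrier G" "ord a = 3" and xa: "x \<otimes> a = a \<otimes> x"
  shows "ord (x \<otimes> a) = 6"
proof -
  define n where "n = ord (x \<otimes> a)"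
  have n: "n \<le> 6" "0 < n" using a x ord_le_6 ord_pos by (auto simp: n_def)
  have e: "x [^] (n * k) \<otimes> a [^] (n * k) = \<one>" for k
    using comm_mult_pow[OF x(1) a(1) xa, of "n * k"] x a by (simp add: n_def nat_pow_pow[symmetric])
  have x2: "x [^] (2::nat) = \<one>" and a3: "a [^] (3::nat) = \<one>"
    using pow_ord_eq_1[of x] pow_ord_eq_1[of a] x a by simp_all
  have "x [^] (n * 2) = \<one>" "a [^] (n * 3) = \<one>"
    using x2 a3 x(1) a(1) by (metis mult.commute nat_pow_one nat_pow_pow)+
  then have "a [^] (n * 2) = \<one>" "x [^] (n * 3) = \<one>" using e[of 2] e[of 3] x a by simp_all
  then have "3 dvd n * 2" "2 dvd n * 3" using ord_dvdI x a by metis+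
  then show ?thesis using n unfolding n_def[symmetric] by presburger
qed

end

subsection \<open>Groups with Davenport constant six\<close>

text \<open>The symmetric group on three letters, with \<open>(i, e)\<close> standing for \<open>a\<^sup>i s\<^sup>e\<close>.\<close>

definition S3_group :: "(int \<times> bool) monoid" where
  "S3_group = \<lparr>carrier = {0, 1, 2} \<times> UNIV,
     monoid.mult = (\<lambda>(i, e) (j, f). ((if e then i - j else i + j) mod 3, e \<noteq> f)), one = (0, False)\<rparr>"

text \<open>The two nonabelian groups of order eight, with \<open>(u, v, w)\<close> standing for \<open>a\<^sup>u b\<^sup>v z\<^sup>w\<close> where
  \<open>z = a\<^sup>2\<close> is the commutator of \<open>a\<close> and \<open>b\<close>: dihedral if \<open>b\<^sup>2 = 1\<close>, quaternion if \<open>b\<^sup>2 = z\<close>.\<close>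

definition order_8_group :: "bool \<Rightarrow> (bool \<times> bool \<times> bool) monoid" where
  "order_8_group s = \<lparr>carrier = UNIV,
     monoid.mult = (\<lambda>(u, v, w) (u', v', w'). (u \<noteq> u', v \<noteq> v',
       (((w \<noteq> w') \<noteq> (v \<and> u')) \<noteq> (u \<and> u')) \<noteq> (s \<and> v \<and> v'))), one = (False, False, False)\<rparr>"

definition C2_group :: "bool monoid" where
  "C2_group = \<lparr>carrier = UNIV, monoid.mult = (\<noteq>), one = False\<rparr>"

lemma S3_group_simps [simp]:
  "carrier S3_group = {0, 1, 2} \<times> UNIV" "\<one>\<^bsub>S3_group\<^esub> = (0, False)"
  "(i, e) \<otimes>\<^bsub>S3_group\<^esub> (j, f) = ((if e then i - j else i + j) mod 3, e \<noteq> f)"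
  by (simp_all add: S3_group_def)

lemma order_8_group_simps [simp]:
  "carrier (order_8_group s) = UNIV" "\<one>\<^bsub>order_8_group s\<^esub> = (False, False, False)"
  "(u, v, w) \<otimes>\<^bsub>order_8_group s\<^esub> (u', v', w') = (u \<noteq> u', v \<noteq> v',
     (((w \<noteq> w') \<noteq> (v \<and> u')) \<noteq> (u \<and> u')) \<noteq> (s \<and> v \<and> v'))"
  by (simp_all add: order_8_group_def)

lemma C2_group_simps [simp]:
  "carrier C2_group = UNIV" "\<one>\<^bsub>C2_group\<^esub> = False" "x \<otimes>\<^bsub>C2_group\<^esub> y = (x \<noteq> y)"
  by (simp_all add: C2_group_def)

lemma group_S3: "group S3_group"
proof (rule groupI)
  fix x assume "x \<in> carrier S3_group"
  then show "\<exists>y\<in>carrier S3_group. y \<otimes>\<^bsub>S3_group\<^esub> x = \<one>\<^bsub>S3_group\<^esub>"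
    by (cases x) (auto intro!: bexI[of _ "if snd x then x else ((- fst x) mod 3, False)"])
next
  fix x y z assume "x \<in> carrier S3_group" "y \<in> carrier S3_group" "z \<in> carrier S3_group"
  then show "x \<otimes>\<^bsub>S3_group\<^esub> y \<otimes>\<^bsub>S3_group\<^esub> z = x \<otimes>\<^bsub>S3_group\<^esub> (y \<otimes>\<^bsub>S3_group\<^esub> z)"
    by (cases x; cases y; cases z; cases "snd x"; cases "snd y"; cases "snd z")
      (simp_all add: mod_simps algebra_simps)
next
  fix x y assume "x \<in> carrier S3_group" "y \<in> carrier S3_group"
  moreover have "k mod 3 = 0 \<or> k mod 3 = 1 \<or> k mod 3 = 2" for k :: int by presburger
  ultimately show "x \<otimes>\<^bsub>S3_group\<^esub> y \<in> carrier S3_group"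
    by (cases x; cases y) simp
next
  fix x assume "x \<in> carrier S3_group"
  then show "\<one>\<^bsub>S3_group\<^esub> \<otimes>\<^bsub>S3_group\<^esub> x = x"
    by (cases x) auto
qed simp

lemma group_order_8: "group (order_8_group s)"
proof (rule groupI)
  fix x assume "x \<in> carrier (order_8_group s)"
  obtain u v w where x: "x = (u, v, w)" by (cases x)
  show "\<exists>y\<in>carrier (order_8_group s). y \<otimes>\<^bsub>order_8_group s\<^esub> x = \<one>\<^bsub>order_8_group s\<^esub>"
    unfolding x by (rule bexI[of _ "(u, v, ((w \<noteq> (v \<and> u)) \<noteq> u) \<noteq> (s \<and> v))"]) (simp_all, argo)
next
  fix x y z :: "bool \<times> bool \<times> bool"
  obtain u v w u' v' w' u'' v'' w'' where x: "x = (u, v, w)" "y = (u', v', w')" "z = (u'', v'', w'')"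
    by (cases x, cases y, cases z)
  show "x \<otimes>\<^bsub>order_8_group s\<^esub> y \<otimes>\<^bsub>order_8_group s\<^esub> z
      = x \<otimes>\<^bsub>order_8_group s\<^esub> (y \<otimes>\<^bsub>order_8_group s\<^esub> z)"
    unfolding x by (cases u; cases v; cases u'; cases v'; cases u''; cases v''; cases s; simp; argo?)
next
  fix x :: "bool \<times> bool \<times> bool"
  show "\<one>\<^bsub>order_8_group s\<^esub> \<otimes>\<^bsub>order_8_group s\<^esub> x = x"
    by (cases x) simp
qed simp_all

lemma group_C2: "group C2_group"
  by (rule groupI) auto

section \<open>Groups with elements of orders two and three: the symmetric group\<close>

context davenport_6
begin

lemma ord_eq_2:
  assumes "x \<in> carrier G" "x \<noteq> \<one>" "x [^] (2::nat) = \<one>"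
  shows "ord x = 2"
proof -
  have "ord x \<le> 2" using ord_dvdI[OF assms(1,3)] by (simp add: dvd_imp_le)
  then show ?thesis using ord_eq_1[OF assms(1)] ord_pos[OF assms(1)] assms(2) by linarith
qed

text \<open>The values \<open>h_eqs\<close> determine \<open>h\<close> on the model. The relations
  and their right-nested forms \<open>assoc\<close> rewrite each of the 36 products to the normal
  form a^i s^e.\<close>

lemma S3_relations_hom:
  assumes h_eqs: "h (0, False) = \<one>" "h (1, False) = a" "h (2, False) = a \<otimes> a"
      "h (0, True) = s" "h (1, True) = a \<otimes> s" "h (2, True) = a \<otimes> (a \<otimes> s)"
    and a3: "a \<otimes> (a \<otimes> a) = \<one>" and sa: "s \<otimes> a = a \<otimes> (a \<otimes> s)" and ss: "s \<otimes> s = \<one>"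
    and c: "s \<in> carrier G" "a \<in> carrier G"
    and assoc: "\<And>y. y \<in> carrier G \<Longrightarrow> a \<otimes> (a \<otimes> (a \<otimes> y)) = y"
      "\<And>y. y \<in> carrier G \<Longrightarrow> s \<otimes> (s \<otimes> y) = y"
      "\<And>y. y \<in> carrier G \<Longrightarrow> s \<otimes> (a \<otimes> y) = a \<otimes> (a \<otimes> (s \<otimes> y))"
    and ij: "i = 0 \<or> i = 1 \<or> i = 2" "j = 0 \<or> j = 1 \<or> j = 2"
  shows "h ((i, e) \<otimes>\<^bsub>S3_group\<^esub> (j, f)) = h (i, e) \<otimes> h (j, f)"
  using ij
  apply (cases e; cases f; elim disjE; simp add: h_eqs)
  apply (simp_all only: m_assoc m_closed assoc a3 sa ss c r_one l_one)
  done

text \<open>By \<open>no6\<close> no involution commutes with an element of order three. This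
  excludes order four, whose squares are central involutions. A product of an involution and an
  element of order three then has order two, so the former inverts the latter; a product of two
  involutions falls into <a>. Hence the group is the union of <a> and <a> s.\<close>

lemma iso_S3:
  assumes no6: "\<And>x. x \<in> carrier G \<Longrightarrow> ord x \<noteq> 6"
    and s: "s \<in> carrier G" "ord s = 2" and a: "a \<in> carrier G" "ord a = 3"
  shows "\<exists>h. h \<in> iso S3_group G"
proof -
  have ord_cases: "ord x \<in> {1, 2, 3, 4}" if "x \<in> carrier G" for x
    using ord_pos[OF that] ord_le_6[OF that] no6[OF that] no_order_5[OF that] by fastforce
  have no_comm: False if "x \<in> carrier G" "ord x = 2" "c \<in> carrier G" "ord c = 3" "x \<otimes> c = c \<otimes> x" for x c
    using commuting_2_3_cyclic[OF that] no6 that by blast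
  have sq: "x \<otimes> x = \<one>" "x \<noteq> \<one>" if "x \<in> carrier G" "ord x = 2" for x
    using pow_ord_eq_1[OF that(1)] that by (auto simp: numeral_2_eq_2)
  have no4: "ord x \<noteq> 4" if x: "x \<in> carrier G" for x
  proof
    assume x4: "ord x = 4"
    have "x [^] (2::nat) \<noteq> \<one>" using pow_neq_one[OF x, of 2] x4 by simp
    moreover have "(x [^] (2::nat)) [^] (2::nat) = \<one>" using pow_ord_eq_1[OF x] x4 x by (simp add: nat_pow_pow)
    ultimately have "ord (x [^] (2::nat)) = 2" using ord_eq_2[of "x [^] (2::nat)"] x by simp
    then show False using no_comm[of "x [^] (2::nat)" a] order_4_square_central[OF x x4 a(1)] x a by simp
  qed
  have inverts: "t \<otimes> c = inv c \<otimes> t" if t: "t \<in> carrier G" "ord t = 2" and c: "c \<in> carrier G" "ord c = 3" for t c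
  proof -
    have tc: "t \<otimes> c \<in> carrier G" using t c by simp
    have "ord (t \<otimes> c) \<noteq> 1"
    proof
      assume "ord (t \<otimes> c) = 1"
      then have "t \<otimes> c = \<one>" using ord_eq_1 tc by simp
      then have "t = inv c" using inv_equality[of t c] t c by simp
      then show False using ord_inv[OF c(1)] t c by simp
    qed
    \<comment> \<open>Order three would give the relations of the alternating group on four
      letters.\<close>
    moreover have "ord (t \<otimes> c) \<noteq> 3"
    proof
      assume "ord (t \<otimes> c) = 3"
      then have "(t \<otimes> c) [^] (3::nat) = \<one>" using pow_ord_eq_1[OF tc] by simp
      then obtain U where "U \<in> product_one_atoms G" "size U = 7"
        using atom_tetrahedral[OF t(1) sq(2)[OF t] sq(1)[OF t] c] by blast
      then show False using atom_size_le[of U] by simp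
    qed
    ultimately have "ord (t \<otimes> c) = 2" using ord_cases[OF tc] no4[OF tc] by auto
    then have "t \<otimes> c \<otimes> (t \<otimes> c) = \<one>" using sq tc by blast
    then have "c \<otimes> (t \<otimes> c) = inv t" using t c inv_equality[of "c \<otimes> (t \<otimes> c)" t]
      by (metis m_assoc m_closed inv_comm)
    then have "c \<otimes> (t \<otimes> c) = t" using square_one_imp_inv[OF t(1) sq(1)[OF t]] by simp
    then show ?thesis using t c by (metis inv_solve_left m_closed)
  qed
  \<comment> \<open>Both involutions invert a, so their product centralizes a. Outside <a> it would
    have order three and produce the generalized dihedral configuration.\<close>
  have prod: "t \<otimes> t' \<in> powers a" if t: "t \<in> carrier G" "ord t = 2" and t': "t' \<in> carrier G" "ord t' = 2" for t t'
  proof (rule ccontr)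
    assume np: "t \<otimes> t' \<notin> powers a"
    let ?p = "t \<otimes> t'"
    have p: "?p \<in> carrier G" using t t' by simp
    have pa: "?p \<otimes> a = a \<otimes> ?p"
    proof -
      have "?p \<otimes> a = t \<otimes> (inv a \<otimes> t')" using inverts[OF t' a] t t' a by (simp add: m_assoc)
      also have "\<dots> = t \<otimes> inv a \<otimes> t'" using t t' a by (simp add: m_assoc)
      also have "t \<otimes> inv a = a \<otimes> t" using inverts[of t "inv a"] t a by simp
      finally show ?thesis using t t' a by (simp add: m_assoc)
    qed
    have "?p \<noteq> \<one>" using np subgroup.one_closed[OF subgroup_pow[OF a(1)]] by auto
    moreover have "ord ?p \<noteq> 2" using no_comm[OF p _ a pa] by auto
    ultimately have p3: "ord ?p = 3" using ord_cases[OF p] no4[OF p] ord_eq_1[OF p] by auto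
    obtain U where "U \<in> product_one_atoms G" "size U = 8"
      using atom_generalized_dihedral[OF t(1) sq(1)[OF t] a p p3 pa[symmetric] np inverts[OF t a] inverts[OF t p p3]] .
    then show False using atom_size_le[of U] by simp
  qed
  have "ord (s \<otimes> c) = 2" if c: "c \<in> carrier G" "ord c = 3" for c
  proof -
    have "s \<otimes> c \<otimes> (s \<otimes> c) = inv c \<otimes> c"
      using inverts[OF s c] s c sq(1)[OF s] by (intro inverted_mult) auto
    then have 1: "(s \<otimes> c) [^] (2::nat) = \<one>" using s c by (simp add: numeral_2_eq_2)
    have "s \<otimes> c \<noteq> \<one>"
    proof
      assume "s \<otimes> c = \<one>"
      then have "s = inv c" using inv_equality[of s c] s c by simp
      then show False using ord_inv[OF c(1)] s c by simp
    qed
    then show ?thesis using ord_eq_2[of "s \<otimes> c"] 1 s c by simp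
  qed note sc = this
  \<comment> \<open>The elements s a and s c are involutions, and their product is a^-1 c.\<close>
  have three: "c \<in> powers a" if c: "c \<in> carrier G" "ord c = 3" for c
  proof -
    have "s \<otimes> a \<otimes> (s \<otimes> c) = inv a \<otimes> c"
      using inverts[OF s a] s a c sq(1)[OF s] by (intro inverted_mult) auto
    then have "inv a \<otimes> c \<in> powers a" using prod[OF _ sc[OF a] _ sc[OF c]] s a c by simp
    then have "a \<otimes> (inv a \<otimes> c) \<in> powers a"
      using subgroup.m_closed[OF subgroup_pow[OF a(1)] powers_self[OF a(1)]] by blast
    then show ?thesis using a c by (simp add: m_assoc[symmetric])
  qed
  define h where "h = (\<lambda>(i :: int, e). a [^] nat i \<otimes> (if e then s else \<one>))"
  have a3: "a \<otimes> (a \<otimes> a) = \<one>" using pow_ord_eq_1[OF a(1)] a by (simp add: numeral_3_eq_3 m_assoc)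
  have ia: "inv a = a \<otimes> a" using a3 a by (intro inv_equality) (auto simp: m_assoc)
  have sa: "s \<otimes> a = a \<otimes> (a \<otimes> s)" using inverts[OF s a] ia s a by (simp add: m_assoc)
  have ss: "s \<otimes> s = \<one>" using sq[OF s] by blast
  have sn: "s \<notin> powers a"
  proof
    assume "s \<in> powers a"
    then have "s \<otimes> a = a \<otimes> s" using powers_commute a by blast
    then show False using no_comm s a by blast
  qed
  have assoc: "a \<otimes> (a \<otimes> (a \<otimes> y)) = y" "s \<otimes> (s \<otimes> y) = y" "s \<otimes> (a \<otimes> y) = a \<otimes> (a \<otimes> (s \<otimes> y))"
    if "y \<in> carrier G" for y
  proof -
    have "a \<otimes> (a \<otimes> (a \<otimes> y)) = a \<otimes> (a \<otimes> a) \<otimes> y" using a that by (simp add: m_assoc)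
    then show "a \<otimes> (a \<otimes> (a \<otimes> y)) = y" using a3 that by simp
    have "s \<otimes> (s \<otimes> y) = s \<otimes> s \<otimes> y" using s that by (simp add: m_assoc)
    then show "s \<otimes> (s \<otimes> y) = y" using ss that by simp
    have "s \<otimes> (a \<otimes> y) = s \<otimes> a \<otimes> y" using s a that by (simp add: m_assoc)
    then show "s \<otimes> (a \<otimes> y) = a \<otimes> (a \<otimes> (s \<otimes> y))" using sa s a that by (simp add: m_assoc)
  qed
  have p: "a [^] (2::nat) = a \<otimes> a" using a by (simp add: numeral_2_eq_2)
  have h_eqs: "h (0, False) = \<one>" "h (1, False) = a" "h (2, False) = a \<otimes> a"
    "h (0, True) = s" "h (1, True) = a \<otimes> s" "h (2, True) = a \<otimes> (a \<otimes> s)"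
    using s(1) a(1) p by (simp_all add: h_def m_assoc)
  have "h \<in> hom S3_group G"
  proof (rule homI)
    fix x y assume xy: "x \<in> carrier S3_group" "y \<in> carrier S3_group"
    obtain i e j f where [simp]: "x = (i, e)" "y = (j, f)" by (cases x, cases y)
    have "i = 0 \<or> i = 1 \<or> i = 2" "j = 0 \<or> j = 1 \<or> j = 2" using xy by auto
    then show "h (x \<otimes>\<^bsub>S3_group\<^esub> y) = h x \<otimes> h y"
      using S3_relations_hom[OF h_eqs a3 sa ss s(1) a(1) assoc] by simp
  qed (use s a in \<open>auto simp: h_def\<close>)
  moreover have "inj_on h (carrier S3_group)"
  proof (rule inj_onI)
    fix x y assume xy: "x \<in> carrier S3_group" "y \<in> carrier S3_group" "h x = h y"
    obtain i e j f where e: "x = (i, e)" "y = (j, f)" by (cases x, cases y)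
    have ij: "0 \<le> i" "i < 3" "0 \<le> j" "j < 3" using xy e by auto
    have key: False if "a [^] (k::nat) = a [^] (l::nat) \<otimes> s" for k l
    proof -
      have "s = inv (a [^] l) \<otimes> a [^] k" using that s a inv_solve_left[of s "a [^] l" "a [^] k"] by simp
      then show False using sn subgroup_pow[OF a(1)] by (metis rangeI subgroup.m_closed subgroup.m_inv_closed)
    qed
    have ef: "e = f" using xy(3) key[of "nat i" "nat j"] key[of "nat j" "nat i"] a e
      by (cases e; cases f) (auto simp: h_def)
    then have "a [^] nat i = a [^] nat j" using xy(3) e s a by (auto simp: h_def split: if_splits)
    then have "nat i = nat j" using ord_inj[OF a(1)] ij a(2) by (auto simp: inj_on_def)
    then show "x = y" using e ef ij by simp
  qed
  moreover have "h ` carrier S3_group = carrier G"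
  proof
    show "h ` carrier S3_group \<subseteq> carrier G" using s a by (auto simp: h_def)
    have pw: "\<exists>i\<in>{0,1,2::int}. y = a [^] nat i" if y: "y \<in> powers a" for y
    proof -
      obtain k :: nat where k: "y = a [^] k" using y by auto
      have "a [^] k = a [^] (3 * (k div 3)) \<otimes> a [^] (k mod 3)" using a by (simp add: nat_pow_mult)
      also have "a [^] (3 * (k div 3)) = \<one>" using a pow_ord_eq_1[OF a(1)] by (simp add: nat_pow_pow[symmetric])
      finally have "y = a [^] nat (int (k mod 3))" using a k by simp
      moreover have "int (k mod 3) \<in> {0,1,2}" by auto
      ultimately show ?thesis by blast
    qed
    show "carrier G \<subseteq> h ` carrier S3_group"
    proof
      fix y assume y: "y \<in> carrier G"
      have "ord y = 1 \<or> ord y = 3 \<or> ord y = 2" using ord_cases[OF y] no4[OF y] by auto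
      then consider "y \<in> powers a" | "ord y = 2"
        using ord_eq_1[OF y] three[OF y] subgroup.one_closed[OF subgroup_pow[OF a(1)]] by auto
      then show "y \<in> h ` carrier S3_group"
      proof cases
        case 1
        then obtain i where "i \<in> {0,1,2::int}" "y = a [^] nat i" using pw by blast
        then have "y = h (i, False)" "(i, False) \<in> carrier S3_group" using a by (auto simp: h_def)
        then show ?thesis by blast
      next
        case 2
        obtain i where i: "i \<in> {0,1,2::int}" "y \<otimes> s = a [^] nat i" using pw[OF prod[OF y 2 s]] by blast
        have "y = y \<otimes> s \<otimes> s" using y s ss by (simp add: m_assoc)
        then have "y = h (i, True)" "(i, True) \<in> carrier S3_group" using i by (auto simp: h_def)
        then show ?thesis by blast
      qed
    qed
  qed
  ultimately show ?thesis unfolding iso_def bij_betw_def by blast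
qed

text \<open>For commuting elements of finite order this is the subgroup that they generate: inverses
  are natural powers.\<close>

definition span2 :: "'a \<Rightarrow> 'a \<Rightarrow> 'a set" where
  "span2 a c = {a [^] i \<otimes> c [^] j | (i :: nat) (j :: nat). True}"

lemma span2I: "a [^] (i::nat) \<otimes> c [^] (j::nat) \<in> span2 a c"
  by (auto simp: span2_def)

lemma span2_gens:
  assumes "a \<in> carrier G" "c \<in> carrier G"
  shows "a \<in> span2 a c" "c \<in> span2 a c"
  using span2I[of a 1 c 0] span2I[of a 0 c 1] assms by auto

lemma subgroup_span2:
  assumes a: "a \<in> carrier G" "0 < ord a" and c: "c \<in> carrier G" "0 < ord c" and comm: "a \<otimes> c = c \<otimes> a"
  shows "subgroup (span2 a c) G"
proof -
  have ac: "a [^] i \<otimes> c [^] j = c [^] j \<otimes> a [^] i" for i j :: nat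
    using a c comm by (metis group_commutes_pow nat_pow_closed)
  have closed: "x \<otimes> y \<in> span2 a c" if in_span: "x \<in> span2 a c" "y \<in> span2 a c" for x y
  proof -
    obtain i j k l :: nat where xy: "x = a [^] i \<otimes> c [^] j" "y = a [^] k \<otimes> c [^] l"
      using in_span unfolding span2_def by blast
    have "x \<otimes> y = a [^] i \<otimes> (c [^] j \<otimes> a [^] k) \<otimes> c [^] l" using a c xy by (simp add: m_assoc)
    also have "\<dots> = a [^] i \<otimes> (a [^] k \<otimes> c [^] j) \<otimes> c [^] l" by (simp add: ac)
    also have "\<dots> = (a [^] i \<otimes> a [^] k) \<otimes> (c [^] j \<otimes> c [^] l)" using a c by (simp add: m_assoc)
    also have "\<dots> = a [^] (i + k) \<otimes> c [^] (j + l)" using a c by (simp add: nat_pow_mult)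
    finally show ?thesis using span2I by simp
  qed
  have inv: "inv x \<in> span2 a c" if in_span: "x \<in> span2 a c" for x
  proof -
    obtain i j :: nat where x: "x = a [^] i \<otimes> c [^] j" using in_span unfolding span2_def by blast
    have "inv (a [^] i) \<in> powers a" "inv (c [^] j) \<in> powers c"
      using subgroup.m_inv_closed[OF subgroup_powers[OF a]] subgroup.m_inv_closed[OF subgroup_powers[OF c]] by auto
    then obtain k l :: nat where kl: "inv (a [^] i) = a [^] k" "inv (c [^] j) = c [^] l" by auto
    have "inv x = inv (c [^] j) \<otimes> inv (a [^] i)" using a c x by (simp add: inv_mult_group)
    then have "inv x = a [^] k \<otimes> c [^] l" using kl ac by simp
    then show ?thesis using span2I by simp
  qed
  show ?thesis
    using a c inv closed span2_gens by (intro subgroupI) (auto simp: span2_def)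
qed

lemma powers_3_free:
  assumes N: "subgroup N G" and b: "b \<in> carrier G" "ord b = 3" "b \<notin> N" and k: "0 < k" "k \<le> (2::nat)"
  shows "b [^] k \<notin> N"
proof
  assume bk: "b [^] k \<in> N"
  have "k = 1 \<or> k = 2" using k by linarith
  then show False
  proof
    assume "k = 1" then show ?thesis using bk b by simp
  next
    assume k2: "k = 2"
    have "b [^] (2::nat) \<otimes> b = \<one>" using pow_ord_eq_1[OF b(1)] b by (simp add: numeral_3_eq_3 numeral_2_eq_2)
    then have "inv (b [^] (2::nat)) = b" using b by (metis inv_equality inv_inv nat_pow_closed)
    then show ?thesis using subgroup.m_inv_closed[OF N bk] k2 b by simp
  qed
qed

end

section \<open>Exclusion of groups of exponent three\<close>

context davenport_6
begin

lemma subgroup_span: "a \<in> carrier G \<Longrightarrow> c \<in> carrier G \<Longrightarrow> a \<otimes> c = c \<otimes> a \<Longrightarrow> subgroup (span2 a c) G"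
  using subgroup_span2 ord_pos by blast

text \<open>Two extensions make a^2 c^2 b^2 a product-one free sequence of length six, one more than
  the bound allows.\<close>

lemma free_rank_3:
  assumes a: "a \<in> carrier G" "ord a = 3" and c: "c \<in> carrier G" "ord c = 3" "c \<notin> powers a" "a \<otimes> c = c \<otimes> a"
    and b: "b \<in> carrier G" "ord b = 3" "b \<notin> span2 a c"
    and nb: "\<And>n. n \<in> span2 a c \<Longrightarrow> \<exists>n'\<in>span2 a c. n \<otimes> b = b \<otimes> n'"
  shows False
proof -
  have "prod_one_free G (replicate_mset 2 a + replicate_mset 2 c)"
    using subgroup_pow[OF a(1)] a c powers_self[OF a(1)] comm_power(2)[OF a(1) c(1) c(4)]
      powers_3_free[OF subgroup_pow[OF a(1)] c(1-3)]
    by (intro prod_one_free_extend[of "powers a"] prod_one_free_replicate) auto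
  then have "prod_one_free G (replicate_mset 2 a + replicate_mset 2 c + replicate_mset 2 b)"
    using subgroup_span[OF a(1) c(1) c(4)] b nb span2_gens[OF a(1) c(1)]
      powers_3_free[OF subgroup_span[OF a(1) c(1) c(4)] b]
    by (intro prod_one_free_extend[of "span2 a c" b 2 "replicate_mset 2 a + replicate_mset 2 c"])
      (auto split: if_splits)
  then show False using free_size_le by fastforce
qed

lemma ex_not_power:
  assumes "x \<in> carrier G" "ord x < 6"
  obtains b where "b \<in> carrier G" "b \<notin> powers x"
proof -
  have "carrier G \<noteq> powers x" using card_powers_le[OF assms(1)] card_carrier_ge assms(2) by auto
  moreover have "powers x \<subseteq> carrier G" using assms by auto
  ultimately show ?thesis using that by blast
qed

text \<open>In a commutative group the cofactor of a product-one subsequence is product-one, so an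
  atom has no proper nonempty product-one subsequence.\<close>

lemma commutative_atom_sub:
  assumes comm: "\<And>x y. x \<in> carrier G \<Longrightarrow> y \<in> carrier G \<Longrightarrow> x \<otimes> y = y \<otimes> x"
    and U: "U \<in> product_one_atoms G" and xs: "mset xs \<subseteq># U" "lprod xs = \<one>"
  shows "xs = [] \<or> mset xs = U"
proof -
  obtain zs where zs: "mset zs = U" "lprod zs = \<one>"
    using atom_prod_one[OF U] by (auto simp: carrier_product_one_monoid_iff)
  have Uc: "set_mset U \<subseteq> carrier G" using U by (rule atom_carrier)
  obtain ys where ys: "mset ys = U - mset xs" using ex_mset by blast
  have c: "set xs \<subseteq> carrier G" "set ys \<subseteq> carrier G" "set zs \<subseteq> carrier G"
    using Uc xs(1) ys zs by (auto dest: mset_subset_eqD in_diffD simp flip: set_mset_mset)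
  interpret comm_group G using comm by (intro group_comm_groupI) auto
  have "mset zs = mset (xs @ ys)" using zs ys xs by simp
  then have "lprod (xs @ ys) = \<one>" using multlist_perm_cong[of "xs @ ys" zs] c zs by simp
  then have "lprod ys = \<one>" using foldr_mult_append[of xs ys] c xs by simp
  then have "prod_one G (mset xs)" "prod_one G (mset ys)" using c xs by (auto intro: prod_oneI)
  moreover have "mset xs + mset ys \<in> product_one_atoms G" using U ys xs by simp
  ultimately have "mset xs = {#} \<or> mset ys = {#}" by (intro atom_split[of "mset xs"])
  then show ?thesis using ys xs(1) by (auto simp: Diff_eq_empty_iff_mset intro: subset_mset.antisym)
qed

text \<open>For noncommuting x and y, the conjugates of x generate a rank-two subgroup normalized by
  y, and \<open>free_rank_3\<close> applies. So the group is commutative and, again by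
  \<open>free_rank_3\<close>, generated by two elements. It has at most nine elements, which is too
  few for an atom of length six: its terms contain two doubled elements, and their products already
  reach the inverse of any further term.\<close>

lemma exponent_3_impossible:
  assumes e3: "\<And>x. x \<in> carrier G \<Longrightarrow> x \<otimes> (x \<otimes> x) = \<one>"
  shows False
proof -
  have o3: "ord x = 3" if x: "x \<in> carrier G" "x \<noteq> \<one>" for x
  proof -
    have "x [^] (3::nat) = \<one>" using e3[OF x(1)] x by (simp add: numeral_3_eq_3 m_assoc)
    then have "ord x dvd 3" using ord_dvdI x by blast
    moreover have "ord x \<noteq> 1" using ord_eq_1 x by blast
    moreover have "ord x \<le> 3" using calculation(1) by (simp add: dvd_imp_le)
    moreover have "ord x \<noteq> 2" using calculation(1) by auto
    ultimately show ?thesis using ord_pos[OF x(1)] by linarith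
  qed
  have iv: "inv x = x \<otimes> x" if "x \<in> carrier G" for x
    using e3[OF that] that by (intro inv_equality) (auto simp: m_assoc)
  have one_p: "\<one> \<in> powers x" if "x \<in> carrier G" for x using subgroup.one_closed[OF subgroup_pow[OF that]] .
  have comm: "x \<otimes> y = y \<otimes> x" if x: "x \<in> carrier G" and y: "y \<in> carrier G" for x y
  proof (rule ccontr)
    assume nc: "x \<otimes> y \<noteq> y \<otimes> x"
    \<comment> \<open>These are the two other conjugates of x under <y>. Expanding (x y)^3 = 1 and
      (x y^-1)^3 = 1 gives x c d = 1 = x d c, so x, c and d commute with each other.\<close>
    define c where "c = y \<otimes> x \<otimes> inv y"
    define d where "d = inv y \<otimes> x \<otimes> y"
    have cd: "c \<in> carrier G" "d \<in> carrier G" using x y by (auto simp: c_def d_def)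
    have yy: "inv y \<otimes> inv y = y" "y \<otimes> y = inv y" using iv[OF y] iv[of "inv y"] y by (metis inv_closed inv_inv)+
    have d': "d = y \<otimes> c \<otimes> inv y"
    proof -
      have "y \<otimes> c \<otimes> inv y = (y \<otimes> y) \<otimes> x \<otimes> (inv y \<otimes> inv y)" using x y by (simp add: c_def m_assoc)
      then show ?thesis using yy by (simp add: d_def)
    qed
    have 1: "x \<otimes> (c \<otimes> d) = \<one>"
    proof -
      have "x \<otimes> (c \<otimes> d) = x \<otimes> (y \<otimes> x \<otimes> inv y \<otimes> (inv y \<otimes> x \<otimes> y))" by (simp add: c_def d_def)
      also have "\<dots> = x \<otimes> (y \<otimes> (x \<otimes> ((inv y \<otimes> inv y) \<otimes> (x \<otimes> y))))" using x y by (simp add: m_assoc)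
      also have "\<dots> = (x \<otimes> y) \<otimes> ((x \<otimes> y) \<otimes> (x \<otimes> y))" using x y yy by (simp add: m_assoc)
      finally show ?thesis using e3 x y by simp
    qed
    have 2: "x \<otimes> (d \<otimes> c) = \<one>"
    proof -
      have "x \<otimes> (d \<otimes> c) = x \<otimes> (inv y \<otimes> x \<otimes> y \<otimes> (y \<otimes> x \<otimes> inv y))" by (simp add: c_def d_def)
      also have "\<dots> = x \<otimes> (inv y \<otimes> (x \<otimes> ((y \<otimes> y) \<otimes> (x \<otimes> inv y))))" using x y by (simp add: m_assoc)
      also have "\<dots> = (x \<otimes> inv y) \<otimes> ((x \<otimes> inv y) \<otimes> (x \<otimes> inv y))" using x y yy by (simp add: m_assoc)
      finally show ?thesis using e3 x y by simp
    qed
    have dc: "d \<otimes> c = c \<otimes> d" using 1 2 x cd by (metis l_cancel m_closed)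
    have ix: "inv x = c \<otimes> d" using 1 x cd by (metis inv_equality inv_comm m_closed)
    then have xe: "x = (c \<otimes> d) \<otimes> (c \<otimes> d)" using iv[of "inv x"] x by (metis inv_closed inv_inv)
    have cdc: "(c \<otimes> d) \<otimes> c = c \<otimes> (c \<otimes> d)" using dc cd by (simp add: m_assoc)
    have xc: "x \<otimes> c = c \<otimes> x"
    proof -
      have "(c \<otimes> d) \<otimes> (c \<otimes> d) \<otimes> c = c \<otimes> ((c \<otimes> d) \<otimes> (c \<otimes> d))"
        using cdc cd by (metis m_assoc m_closed)
      then show ?thesis using xe by simp
    qed
    have x1: "x \<noteq> \<one>" "y \<noteq> \<one>" using nc x y by auto
    have c1: "c \<noteq> \<one>"
    proof
      assume "c = \<one>"
      then have "y \<otimes> x = y" using x y unfolding c_def by (metis inv_inv inv_closed inv_equality m_closed inv_solve_right' l_one)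
      then show False using x1 x y by simp
    qed
    have cx: "c \<noteq> x" using nc x y unfolding c_def by (metis inv_solve_right m_closed)
    \<comment> \<open>If c were a power of x, it would be the inverse of x. Conjugating once more
      gives d = c^-1, hence c d = 1 and x = 1.\<close>
    have cnp: "c \<notin> powers x"
    proof
      assume "c \<in> powers x"
      then obtain k :: nat where k: "c = x [^] k" by auto
      have "x [^] k = x [^] (3 * (k div 3)) \<otimes> x [^] (k mod 3)" using x by (simp add: nat_pow_mult)
      also have "x [^] (3 * (k div 3)) = \<one>" using x pow_ord_eq_1[OF x] o3[OF x x1(1)] by (simp add: nat_pow_pow[symmetric])
      finally have ck: "c = x [^] (k mod 3)" using k x by simp
      have "k mod 3 = 0 \<or> k mod 3 = 1 \<or> k mod 3 = 2" by presburger
      then have ci: "c = inv x" using ck c1 cx x iv[OF x] by (auto simp: numeral_2_eq_2)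
      have "inv c = y \<otimes> (inv x \<otimes> inv y)" using x y by (simp add: c_def inv_mult_group m_assoc)
      moreover have "d = y \<otimes> (inv x \<otimes> inv y)" using d' ci x y by (simp add: m_assoc)
      ultimately have "d = inv c" by simp
      then have "x = \<one>" using xe cd by simp
      then show False using x1 by simp
    qed
    have ynN: "y \<notin> span2 x c"
    proof
      assume "y \<in> span2 x c"
      then obtain i j :: nat where y': "y = x [^] i \<otimes> c [^] j" by (auto simp: span2_def)
      have "x \<otimes> y = y \<otimes> x"
        using y' x cd comm_power(1)[OF x x] comm_power(1)[OF x cd(1) xc] by (metis m_assoc nat_pow_closed)
      then show False using nc by simp
    qed
    have N: "subgroup (span2 x c) G" using subgroup_span x cd xc by blast
    have dN: "d \<in> span2 x c"
    proof -
      have "d = inv c \<otimes> inv x" using ix cd by (metis inv_mult_group inv_solve_left x inv_closed m_closed inv_inv dc)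
      then show ?thesis using N span2_gens[OF x cd(1)] by (simp add: subgroup.m_closed subgroup.m_inv_closed)
    qed
    have conj_pow: "u [^] k \<otimes> y = y \<otimes> (inv y \<otimes> u \<otimes> y) [^] k" if u: "u \<in> carrier G" for u and k :: nat
    proof (induction k)
      case (Suc k)
      have "u [^] Suc k \<otimes> y = u [^] k \<otimes> (u \<otimes> y)" using u y by (simp add: m_assoc)
      also have "u \<otimes> y = y \<otimes> (inv y \<otimes> u \<otimes> y)" using u y by (simp add: m_assoc[symmetric])
      also have "u [^] k \<otimes> (y \<otimes> (inv y \<otimes> u \<otimes> y)) = (u [^] k \<otimes> y) \<otimes> (inv y \<otimes> u \<otimes> y)" using u y by (simp add: m_assoc)
      also have "\<dots> = y \<otimes> (inv y \<otimes> u \<otimes> y) [^] Suc k" unfolding Suc using u y by (simp add: m_assoc)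
      finally show ?case .
    qed (use y in simp)
    have cy: "inv y \<otimes> c \<otimes> y = x"
    proof -
      have "inv y \<otimes> c \<otimes> y = (inv y \<otimes> y) \<otimes> x \<otimes> (inv y \<otimes> y)" using x y unfolding c_def by (simp only: m_assoc m_closed inv_closed)
      then show ?thesis using x y by simp
    qed
    \<comment> \<open>Conjugation by y^-1 sends x to d and c to x, so it preserves the
      subgroup.\<close>
    have "\<exists>n'\<in>span2 x c. n \<otimes> y = y \<otimes> n'" if "n \<in> span2 x c" for n
    proof -
      obtain i j :: nat where n: "n = x [^] i \<otimes> c [^] j" using \<open>n \<in> span2 x c\<close> by (auto simp: span2_def)
      have "n \<otimes> y = x [^] i \<otimes> (c [^] j \<otimes> y)" using n x y cd by (simp add: m_assoc)
      also have "\<dots> = (x [^] i \<otimes> y) \<otimes> x [^] j" using conj_pow[OF cd(1), of j] cy x y by (simp add: m_assoc)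
      also have "\<dots> = y \<otimes> (d [^] i \<otimes> x [^] j)" using conj_pow[OF x, of i] x y cd by (simp add: d_def m_assoc)
      finally have ny: "n \<otimes> y = y \<otimes> (d [^] i \<otimes> x [^] j)" .
      have "d [^] i \<in> span2 x c" for i :: nat
        by (induction i) (use N dN in \<open>auto simp: subgroup.one_closed subgroup.m_closed\<close>)
      moreover have "x [^] j \<in> span2 x c" using span2I[of x j c 0] x by simp
      ultimately have "d [^] i \<otimes> x [^] j \<in> span2 x c" using subgroup.m_closed[OF N] by simp
      then show ?thesis using ny by blast
    qed
    then show False
      using free_rank_3[OF x o3[OF x x1(1)] cd(1) o3[OF cd(1) c1] cnp xc y o3[OF y x1(2)] ynN] by blast
  qed
  obtain U where U: "U \<in> product_one_atoms G" "size U = 6" using ex_atom_6 by blast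
  have Uc: "set_mset U \<subseteq> carrier G" using U(1) by (rule atom_carrier)
  have sub: False if "mset xs \<subseteq># U" "lprod xs = \<one>" "xs \<noteq> []" "length xs < 6" for xs
    using commutative_atom_sub[OF comm U(1) that(1,2)] that(3,4) U(2) by (metis size_mset nat_neq_iff)
  have U1: "\<one> \<notin># U" using sub[of "[\<one>]"] by auto
  have cnt: "count U x \<le> 2" for x
  proof (rule ccontr)
    assume "\<not> count U x \<le> 2"
    then have "mset [x, x, x] \<subseteq># U" by (intro mset_subset_eqI) auto
    moreover have "x \<in> carrier G" using \<open>\<not> count U x \<le> 2\<close> Uc by (metis count_inI le0 subsetD)
    ultimately show False using sub[of "[x, x, x]"] e3[of x] by simp
  qed
  have red: "w [^] k = w [^] (k mod 3)" if w: "w \<in> carrier G" for w and k :: nat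
  proof -
    have w3: "w [^] (3::nat) = \<one>" using w e3[OF w] by (simp add: numeral_3_eq_3 m_assoc)
    have "w [^] k = w [^] (3 * (k div 3)) \<otimes> w [^] (k mod 3)" using w by (simp add: nat_pow_mult)
    also have "w [^] (3 * (k div 3)) = \<one>" using nat_pow_pow[OF w, of 3 "k div 3"] w3 by simp
    finally show ?thesis using w by simp
  qed
  \<comment> \<open>An element outside the span would be a third independent one; with commutativity
    established, the normality condition of \<open>free_rank_3\<close> holds.\<close>
  have gen: "carrier G = span2 x y" if c: "x \<in> carrier G" "y \<in> carrier G" "x \<noteq> \<one>" "y \<noteq> \<one>" "y \<notin> powers x" for x y
  proof (rule ccontr)
    assume "carrier G \<noteq> span2 x y"
    moreover have sc: "span2 x y \<subseteq> carrier G" using c by (auto simp: span2_def)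
    ultimately obtain b where b: "b \<in> carrier G" "b \<notin> span2 x y" by blast
    have "b \<noteq> \<one>" using b subgroup.one_closed[OF subgroup_span[OF c(1,2) comm[OF c(1,2)]]] by auto
    moreover have "\<exists>n'\<in>span2 x y. n \<otimes> b = b \<otimes> n'" if n: "n \<in> span2 x y" for n
      using comm[of n b] b n sc by blast
    ultimately show False
      using free_rank_3[OF c(1) o3[OF c(1) c(3)] c(2) o3[OF c(2) c(4)] c(5) comm[OF c(1,2)] b(1) o3[OF b(1)] b(2)] by blast
  qed
  \<comment> \<open>For independent x and y the products x^i y^j with exponents at most two exhaust
    the group. One of them is the inverse of a further term u, which gives a product-one subsequence
    with at most five terms.\<close>
  have indep: "y \<in> powers x" if xy: "x \<in># U" "y \<in># U" "2 \<le> count U x" "2 \<le> count U y" "x \<noteq> y" for x y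
  proof (rule ccontr)
    assume yx: "y \<notin> powers x"
    have c: "x \<in> carrier G" "y \<in> carrier G" "x \<noteq> \<one>" "y \<noteq> \<one>" using xy Uc U1 by auto
    note gen = gen[OF c yx]
    have "mset [x, x, y, y] \<subseteq># U" using xy by (intro mset_subset_eqI) auto
    then have Ueq: "U = mset [x, x, y, y] + (U - mset [x, x, y, y])"
      by (rule subset_mset.add_diff_inverse[symmetric])
    have "size (U - mset [x, x, y, y]) = size U - size (mset [x, x, y, y])"
      using \<open>mset [x, x, y, y] \<subseteq># U\<close> by (rule size_Diff_submset)
    then have "size (U - mset [x, x, y, y]) = 2" using U(2) by simp
    then obtain u where u: "u \<in># U - mset [x, x, y, y]" by (metis size_eq_Suc_imp_elem numeral_2_eq_2)
    have uc: "u \<in> carrier G" using u Uc by (meson in_diffD subsetD)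
    have "inv u \<in> span2 x y" using gen uc by auto
    then obtain i j :: nat where ij: "inv u = x [^] i \<otimes> y [^] j" by (auto simp: span2_def)

    define xs where "xs = u # replicate (i mod 3) x @ replicate (j mod 3) y"
    have "lprod xs = u \<otimes> inv u"
      using c uc ij red[OF c(1), of i] red[OF c(2), of j] foldr_mult_append[of "replicate (i mod 3) x" "replicate (j mod 3) y"]
      unfolding xs_def by (simp add: lprod_replicate set_replicate_conv_if del: foldr_replicate foldr_append)
    then have "lprod xs = \<one>" using uc by simp
    moreover have "mset xs \<subseteq># U"
    proof -
      have "i mod 3 \<le> 2" "j mod 3 \<le> 2" by presburger+
      then have "replicate_mset (i mod 3) x + replicate_mset (j mod 3) y \<subseteq># mset [x, x, y, y]"
        using xy(5) by (intro mset_subset_eqI) auto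
      then have "add_mset u (replicate_mset (i mod 3) x + replicate_mset (j mod 3) y) \<subseteq># mset [x, x, y, y] + (U - mset [x, x, y, y])"
        using u by (metis add_mset_add_single mset_subset_eq_mono_add mset_subset_eq_single)
      then show ?thesis using Ueq by (simp add: xs_def)
    qed
    moreover have "length xs < 6"
    proof -
      have "i mod 3 \<le> 2" "j mod 3 \<le> 2" by presburger+
      then show ?thesis by (simp add: xs_def)
    qed
    ultimately show False using sub[of xs] by (auto simp: xs_def)
  qed
  have "card (carrier G) \<le> 9"
  proof -
    obtain x where x: "x \<in> carrier G" "x \<noteq> \<one>"
      using card_carrier_ge card_mono[of "{\<one>}" "carrier G"] by fastforce
    obtain y where y: "y \<in> carrier G" "y \<notin> powers x" using ex_not_power[OF x(1)] o3[OF x] by auto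
    have "y \<noteq> \<one>" using y one_p[OF x(1)] by auto
    then have g: "carrier G = span2 x y" using gen x y by blast
    have "span2 x y \<subseteq> (\<lambda>(i, j). x [^] i \<otimes> y [^] j) ` ({..<3::nat} \<times> {..<3::nat})"
    proof
      fix w assume "w \<in> span2 x y"
      then obtain i j :: nat where "w = x [^] i \<otimes> y [^] j" unfolding span2_def by blast
      then have "w = (\<lambda>(i, j). x [^] i \<otimes> y [^] j) (i mod 3, j mod 3)"
        using red[OF x(1), of i] red[OF y(1), of j] by simp
      moreover have "(i mod 3, j mod 3) \<in> {..<3::nat} \<times> {..<3::nat}" by simp
      ultimately show "w \<in> (\<lambda>(i, j). x [^] i \<otimes> y [^] j) ` ({..<3::nat} \<times> {..<3::nat})" by blast
    qed
    then have "card (span2 x y) \<le> card ({..<3::nat} \<times> {..<3::nat})"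
      by (intro surj_card_le) auto
    then show ?thesis using g by simp
  qed
  define D where "D = set_mset U"
  have fD: "finite D" "D \<subseteq> carrier G" using Uc by (auto simp: D_def)
  \<comment> \<open>An atom of length six contains no inverse pair, so its distinct terms and their
    inverses are disjoint among at most eight nonidentity elements. Hence there are at most four
    distinct terms.\<close>
  have "D \<inter> (\<lambda>x. inv x) ` D = {}"
  proof (rule ccontr)
    assume "D \<inter> (\<lambda>x. inv x) ` D \<noteq> {}"
    then obtain x where x: "x \<in> D" "inv x \<in> D" by auto
    then have xc: "x \<in> carrier G" using fD by blast
    have "x \<noteq> inv x"
    proof
      assume "x = inv x"
      then have "x \<otimes> x = \<one>" using xc by (metis r_inv)
      then have "x = \<one>" using e3[OF xc] xc by simp
      then show False using x U1 by (simp add: D_def)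
    qed
    then have "mset [x, inv x] \<subseteq># U" using x by (intro mset_subset_eqI) (auto simp: D_def Suc_le_eq)
    then show False using sub[of "[x, inv x]"] xc by simp
  qed
  moreover have "card ((\<lambda>x. inv x) ` D) = card D"
  proof (intro card_image inj_onI)
    fix x y assume "x \<in> D" "y \<in> D" "inv x = inv y"
    moreover have "x \<in> carrier G" "y \<in> carrier G" using calculation fD(2) by blast+
    ultimately show "x = y" using inv_inv by metis
  qed
  ultimately have "card (D \<union> (\<lambda>x. inv x) ` D) = 2 * card D" using fD by (simp add: card_Un_disjoint)
  moreover have "card (D \<union> (\<lambda>x. inv x) ` D) \<le> card (carrier G - {\<one>})"
    using fD U1 finite_carrier by (intro card_mono) (auto simp: D_def inv_eq_1_iff subset_iff)
  moreover have "card (carrier G - {\<one>}) \<le> 8" using \<open>card (carrier G) \<le> 9\<close> finite_carrier by simp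
  ultimately have D4: "card D \<le> 4" by linarith
  define E where "E = {x \<in> D. count U x = 2}"
  have fE: "finite E" using fD by (simp add: E_def)
  \<comment> \<open>Multiplicities are at most two, so six terms with at most four distinct values
    contain at least two doubled values.\<close>
  have "6 = (\<Sum>x\<in>D. count U x)" using U(2) by (simp add: size_multiset_overloaded_eq D_def)
  also have "\<dots> \<le> (\<Sum>x\<in>D. 1 + (if count U x = 2 then 1 else 0))"
  proof (rule sum_mono)
    fix x show "count U x \<le> 1 + (if count U x = 2 then 1 else 0)" using cnt[of x] by auto
  qed
  also have "\<dots> = card D + card (D \<inter> {x. count U x = 2})" using fD by (simp only: sum.distrib sum.If_cases) simp
  also have "D \<inter> {x. count U x = 2} = E" by (auto simp: E_def)
  finally have "2 \<le> card E" using D4 by linarith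
  then obtain x y where xy: "x \<in> E" "y \<in> E" "x \<noteq> y"
    using fE by (metis card_le_Suc0_iff_eq not_less_eq_eq numeral_2_eq_2)
  have xyU: "x \<in># U" "y \<in># U" "2 \<le> count U x" "2 \<le> count U y" using xy by (auto simp: E_def D_def)
  have xc: "x \<in> carrier G" "y \<in> carrier G" using xyU Uc by auto
  obtain k :: nat where "y = x [^] k" using indep[OF xyU xy(3)] by auto
  then have "y = x [^] (k mod 3)" using red[OF xc(1)] by simp
  moreover have "k mod 3 = 0 \<or> k mod 3 = 1 \<or> k mod 3 = 2" by presburger
  moreover have "y \<noteq> \<one>" using xyU U1 by auto
  ultimately have "y = x \<otimes> x" using xy(3) xc by (auto simp: numeral_2_eq_2)
  moreover have "mset [x, y] \<subseteq># U" using xy(3) xyU by (intro mset_subset_eqI) auto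
  ultimately show False using sub[of "[x, y]"] e3[OF xc(1)] xc by simp
qed

end

section \<open>Nonabelian groups of exponent four\<close>

lemma (in group) commute_mult:
  assumes "p \<in> carrier G" "q \<in> carrier G" "r \<in> carrier G" "p \<otimes> r = r \<otimes> p" "q \<otimes> r = r \<otimes> q"
  shows "p \<otimes> q \<otimes> r = r \<otimes> (p \<otimes> q)"
proof -
  have "p \<otimes> q \<otimes> r = p \<otimes> (q \<otimes> r)" using assms(1-3) by (simp add: m_assoc)
  also have "\<dots> = p \<otimes> r \<otimes> q" unfolding assms(5) using assms(1-3) by (simp add: m_assoc)
  also have "\<dots> = r \<otimes> (p \<otimes> q)" unfolding assms(4) using assms(1-3) by (simp add: m_assoc)
  finally show ?thesis .
qed

lemma (in group) commuting_square:
  assumes "p \<in> carrier G" "q \<in> carrier G" "q \<otimes> p = p \<otimes> q"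
  shows "p \<otimes> q \<otimes> (p \<otimes> q) = p \<otimes> p \<otimes> (q \<otimes> q)"
proof -
  have "p \<otimes> q \<otimes> (p \<otimes> q) = p \<otimes> (q \<otimes> p) \<otimes> q" using assms(1,2) by (simp add: m_assoc)
  also have "\<dots> = p \<otimes> p \<otimes> (q \<otimes> q)" using assms by (simp add: m_assoc)
  finally show ?thesis .
qed

text \<open>The primed facts are the relations in right-nested form; together with the relations
  they rewrite every product to a^u b^v z^w, for both values of \<open>s\<close>. Injectivity is a
  separate matter.\<close>

lemma (in group) order_8_group_hom:
  assumes a: "a \<in> carrier G" and b: "b \<in> carrier G" and z: "z \<in> carrier G"
    and aa: "a \<otimes> a = z" and ba: "b \<otimes> a = a \<otimes> (b \<otimes> z)" and bb: "b \<otimes> b = (if s then z else \<one>)"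
    and zz: "z \<otimes> z = \<one>" and za: "z \<otimes> a = a \<otimes> z" and zb: "z \<otimes> b = b \<otimes> z"
    and h: "h = (\<lambda>(u, v, w). (if u then a else \<one>) \<otimes> ((if v then b else \<one>) \<otimes> (if w then z else \<one>)))"
  shows "h (x \<otimes>\<^bsub>order_8_group s\<^esub> y) = h x \<otimes> h y"
proof -
  have aa': "a \<otimes> (a \<otimes> y) = z \<otimes> y" if "y \<in> carrier G" for y
    using aa a that by (simp add: m_assoc[symmetric])
  have ba': "b \<otimes> (a \<otimes> y) = a \<otimes> (b \<otimes> (z \<otimes> y))" if "y \<in> carrier G" for y
    using ba a b z that by (metis m_assoc m_closed)
  have bb': "b \<otimes> (b \<otimes> y) = (if s then z else \<one>) \<otimes> y" if "y \<in> carrier G" for y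
    using bb b that by (simp only: m_assoc[symmetric])
  have zz': "z \<otimes> (z \<otimes> y) = y" if "y \<in> carrier G" for y
    using zz z that by (simp add: m_assoc[symmetric])
  have za': "z \<otimes> (a \<otimes> y) = a \<otimes> (z \<otimes> y)" if "y \<in> carrier G" for y
    using za a z that by (metis m_assoc)
  have zb': "z \<otimes> (b \<otimes> y) = b \<otimes> (z \<otimes> y)" if "y \<in> carrier G" for y
    using zb b z that by (metis m_assoc)
  obtain u v w u' v' w' where [simp]: "x = (u, v, w)" "y = (u', v', w')" by (cases x, cases y)
  show ?thesis
    apply (cases u; cases v; cases w; cases u'; cases v'; cases w'; cases s; simp add: h)
    apply (simp_all only: m_assoc m_closed a b z aa ba bb zz za zb aa' ba' bb' zz' za' zb' r_one l_one if_True if_False one_closed)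
    done
qed

context davenport_6
begin

text \<open>Squares are central, and commutators are products of squares, so commutators are central
  with trivial square. By \<open>atom_central_extension\<close> an element centralizing a and b lies
  in <a>, where a^2 is the only involution. Hence every commutator is 1 or z = a^2, and b^2 = 1 or
  b^2 = z selects the model.\<close>

lemma iso_order_8_group:
  assumes e4: "\<And>x. x \<in> carrier G \<Longrightarrow> x [^] (4::nat) = \<one>"
    and xy: "x \<in> carrier G" "y \<in> carrier G" "x \<otimes> y \<noteq> y \<otimes> x"
  shows "\<exists>h s. h \<in> iso (order_8_group s) G"
proof -
  have sq4: "x \<otimes> x \<otimes> (x \<otimes> x) = \<one>" if "x \<in> carrier G" for x
    using e4[OF that] that by (simp add: numeral_eq_Suc m_assoc)
  have ord4: "ord x = 4" if x: "x \<in> carrier G" "x \<otimes> x \<noteq> \<one>" for x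
  proof -
    have "ord x dvd 4" using ord_dvdI[OF x(1)] e4[OF x(1)] by blast
    then have "ord x = 1 \<or> ord x = 2 \<or> ord x = 3 \<or> ord x = 4"
      using ord_pos[OF x(1)] dvd_imp_le[of "ord x" 4] by linarith
    then have "ord x \<in> {1, 2, 4}" using \<open>ord x dvd 4\<close> by (elim disjE) simp_all
    moreover have "\<not> ord x dvd 2" using pow_eq_id[OF x(1), of 2] x by (simp add: numeral_2_eq_2)
    ultimately show ?thesis by auto
  qed
  have sq_central: "x \<otimes> x \<otimes> y = y \<otimes> (x \<otimes> x)" if "x \<in> carrier G" "y \<in> carrier G" for x y
  proof (cases "x \<otimes> x = \<one>")
    case False
    then show ?thesis using order_4_square_central[OF that(1) ord4 that(2)] that by (simp add: numeral_2_eq_2)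
  qed (use that in simp)
  have comm_ex: "\<exists>z\<in>carrier G. u \<otimes> v = z \<otimes> (v \<otimes> u) \<and> z \<otimes> z = \<one> \<and> (\<forall>t\<in>carrier G. z \<otimes> t = t \<otimes> z)"
    if uv: "u \<in> carrier G" "v \<in> carrier G" for u v
  proof -
    \<comment> \<open>The product u^2 (u^-1 v)^2 v^-2 collapses to the commutator u v u^-1
      v^-1.\<close>
    let ?u = "u \<otimes> u" and ?v = "inv v \<otimes> inv v" and ?w = "(inv u \<otimes> v) \<otimes> (inv u \<otimes> v)"
    define z where "z = ?u \<otimes> (?w \<otimes> ?v)"
    have c: "?u \<in> carrier G" "?v \<in> carrier G" "?w \<in> carrier G" using uv by auto
    have cen: "?u \<otimes> t = t \<otimes> ?u" "?v \<otimes> t = t \<otimes> ?v" "?w \<otimes> t = t \<otimes> ?w" if "t \<in> carrier G" for t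
      using sq_central that uv by auto
    have s1: "?u \<otimes> ?u = \<one>" "?v \<otimes> ?v = \<one>" "?w \<otimes> ?w = \<one>" using sq4 uv by auto
    have zt: "z \<otimes> t = t \<otimes> z" if t: "t \<in> carrier G" for t
      unfolding z_def
      by (rule commute_mult[OF c(1) m_closed[OF c(3,2)] t cen(1)[OF t] commute_mult[OF c(3,2) t cen(3,2)[OF t]]])
    have "z \<otimes> z = (?u \<otimes> ?u) \<otimes> ((?w \<otimes> ?v) \<otimes> (?w \<otimes> ?v))"
      unfolding z_def using commuting_square[OF c(1) m_closed[OF c(3,2)]] cen(1)[OF m_closed[OF c(3,2)]] by simp
    also have "(?w \<otimes> ?v) \<otimes> (?w \<otimes> ?v) = (?w \<otimes> ?w) \<otimes> (?v \<otimes> ?v)"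
      by (rule commuting_square[OF c(3,2) cen(2)[OF c(3)]])
    finally have "z \<otimes> z = \<one>" unfolding s1 by simp
    moreover have "u \<otimes> v = z \<otimes> (v \<otimes> u)"
    proof -
      have "z \<otimes> (v \<otimes> u) = ?u \<otimes> ((inv u \<otimes> v) \<otimes> (inv u \<otimes> (v \<otimes> (?v \<otimes> (v \<otimes> u)))))"
        unfolding z_def using uv by (simp only: m_assoc m_closed inv_closed)
      also have "v \<otimes> (?v \<otimes> (v \<otimes> u)) = (v \<otimes> inv v) \<otimes> ((inv v \<otimes> v) \<otimes> u)"
        using uv by (simp only: m_assoc m_closed inv_closed)
      also have "\<dots> = u" using uv by simp
      also have "?u \<otimes> ((inv u \<otimes> v) \<otimes> (inv u \<otimes> u)) = u \<otimes> ((u \<otimes> inv u) \<otimes> (v \<otimes> (inv u \<otimes> u)))"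
        using uv by (simp only: m_assoc m_closed inv_closed)
      also have "\<dots> = u \<otimes> v" using uv by simp
      finally show ?thesis by simp
    qed
    moreover have "z \<in> carrier G" using c by (simp add: z_def)
    ultimately show ?thesis using zt by blast
  qed
  have centre: "t \<in> powers a" if a: "a \<in> carrier G" "a \<otimes> a \<noteq> \<one>" and b: "b \<in> carrier G" "a \<otimes> b \<noteq> b \<otimes> a"
    and t: "t \<in> carrier G" "t \<otimes> a = a \<otimes> t" "t \<otimes> b = b \<otimes> t" for a b t
  proof (rule ccontr)
    assume nt: "t \<notin> powers a"
    obtain z where z: "z \<in> carrier G" "b \<otimes> a = z \<otimes> (a \<otimes> b)" "\<forall>t\<in>carrier G. z \<otimes> t = t \<otimes> z"
      using comm_ex[OF b(1) a(1)] by blast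
    have "z \<noteq> \<one>" using z a b by auto
    then obtain U where "U \<in> product_one_atoms G" "size U = 7"
      using atom_central_extension[OF a(1) ord4[OF a] b(1) t(1) z(1,2) _ _ _ _ t(2,3) nt] z(3) a b t by blast
    then show False using atom_size_le[of U] by simp
  qed
  have pow4: "t = \<one> \<or> t = a \<otimes> a" if a: "a \<in> carrier G" "a \<otimes> a \<noteq> \<one>" and t: "t \<in> powers a" "t \<otimes> t = \<one>" for a t
  proof -
    obtain k :: nat where k: "t = a [^] k" using t by auto
    have "a [^] (k + k) = \<one>" using t(2) k a by (simp add: nat_pow_mult)
    then have "4 dvd k + k" using ord_dvdI[OF a(1)] ord4[OF a] by metis
    then have "2 dvd k" by presburger
    then obtain l where l: "k = 2 * l" by (elim dvdE)
    have "t = (a \<otimes> a) [^] l" using k l a nat_pow_pow[OF a(1), of 2 l] by (simp add: numeral_2_eq_2)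
    moreover have "(a \<otimes> a) [^] l = \<one> \<or> (a \<otimes> a) [^] l = a \<otimes> a" for l :: nat
      by (induction l) (use sq4[OF a(1)] a in auto)
    ultimately show ?thesis by simp
  qed
  \<comment> \<open>If x and y both have trivial square, then x y does not, because x and y do not
    commute.\<close>
  obtain a b where a: "a \<in> carrier G" "a \<otimes> a \<noteq> \<one>" and b: "b \<in> carrier G" and nc: "a \<otimes> b \<noteq> b \<otimes> a"
  proof (cases "x \<otimes> x = \<one>")
    case False
    then show ?thesis using that xy by blast
  next
    case x: True
    show ?thesis
    proof (cases "y \<otimes> y = \<one>")
      case False
      then show ?thesis using that[of y x] xy by auto
    next
      case y: True
      have "x \<otimes> y \<otimes> (x \<otimes> y) \<noteq> \<one>"
      proof
        assume "x \<otimes> y \<otimes> (x \<otimes> y) = \<one>"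
        then have "x \<otimes> y = inv (x \<otimes> y)" using xy by (metis inv_equality m_closed)
        also have "\<dots> = y \<otimes> x" using xy x y square_one_imp_inv by (simp add: inv_mult_group)
        finally show False using xy by simp
      qed
      moreover have "x \<otimes> y \<otimes> x \<noteq> x \<otimes> (x \<otimes> y)" using xy by (simp add: m_assoc)
      ultimately show ?thesis using that[of "x \<otimes> y" x] xy by auto
    qed
  qed
  define z where "z = a \<otimes> a"
  have z: "z \<in> carrier G" "z \<noteq> \<one>" "z \<otimes> z = \<one>" using a sq4[OF a(1)] by (auto simp: z_def)
  have zc: "z \<otimes> t = t \<otimes> z" if "t \<in> carrier G" for t using sq_central[OF a(1) that] by (simp add: z_def)
  have cen: "t = \<one> \<or> t = z" if t: "t \<in> carrier G" "t \<otimes> t = \<one>" "\<forall>u\<in>carrier G. t \<otimes> u = u \<otimes> t" for t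
  proof -
    have "t \<in> powers a" using centre[OF a b nc t(1)] t(3) a(1) b by blast
    then show ?thesis using pow4[OF a _ t(2)] by (simp add: z_def)
  qed
  have comm_z: "u \<otimes> v = v \<otimes> u \<or> u \<otimes> v = z \<otimes> (v \<otimes> u)" if uv: "u \<in> carrier G" "v \<in> carrier G" for u v
  proof -
    obtain t where t: "t \<in> carrier G" "u \<otimes> v = t \<otimes> (v \<otimes> u)" "t \<otimes> t = \<one>" "\<forall>u\<in>carrier G. t \<otimes> u = u \<otimes> t"
      using comm_ex[OF uv] by blast
    then have "t = \<one> \<or> t = z" using cen by blast
    then show ?thesis using t(2) uv by auto
  qed
  have ba: "b \<otimes> a = a \<otimes> (b \<otimes> z)"
  proof -
    have "b \<otimes> a = z \<otimes> (a \<otimes> b)" using comm_z[OF b a(1)] nc by auto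
    then show ?thesis using zc[of "a \<otimes> b"] a b z by (simp add: m_assoc)
  qed
  have bb: "b \<otimes> b = \<one> \<or> b \<otimes> b = z"
    using cen[OF m_closed[OF b b] sq4[OF b]] sq_central[OF b] by blast
  define s where "s \<longleftrightarrow> b \<otimes> b = z"
  have bbs: "b \<otimes> b = (if s then z else \<one>)" using bb by (auto simp: s_def)
  define h where "h = (\<lambda>(u, v, w). (if u then a else \<one>) \<otimes> ((if v then b else \<one>) \<otimes> (if w then z else \<one>)))"
  have hom: "h \<in> hom (order_8_group s) G"
  proof (rule homI)
    fix x y show "h (x \<otimes>\<^bsub>order_8_group s\<^esub> y) = h x \<otimes> h y"
      by (rule order_8_group_hom[OF a(1) b z(1) z_def[symmetric] ba bbs z(3) zc[OF a(1)] zc[OF b] h_def])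
  next
    fix x show "h x \<in> carrier G" using a b z by (cases x) (simp add: h_def)
  qed
  have bz: "b \<noteq> \<one>" "b \<noteq> z" "a \<noteq> \<one>" "a \<noteq> z" "a \<otimes> b \<noteq> \<one>" "a \<otimes> b \<noteq> z"
  proof -
    show "b \<noteq> \<one>" "b \<noteq> z" using nc zc[OF a(1)] a by auto
    show "a \<noteq> \<one>" "a \<noteq> z" using nc zc[OF b] b by auto
    show "a \<otimes> b \<noteq> \<one>" using nc a b inv_comm by auto
    show "a \<otimes> b \<noteq> z"
    proof
      assume e: "a \<otimes> b = z"
      then have "a \<otimes> b = a \<otimes> a" by (simp add: z_def)
      then have "b = a" using a b by simp
      then show False using nc by simp
    qed
  qed
  have ker: "x = (False, False, False)" if "h x = \<one>" for x
  proof -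
    obtain u v w where x: "x = (u, v, w)" by (cases x)
    have *: "y = z" if "y \<in> carrier G" "y \<otimes> z = \<one>" for y
      using that z by (metis inv_equality square_one_imp_inv)
    show ?thesis
      using that x bz z a b *[of a] *[of b] *[of "a \<otimes> b"]
      by (cases u; cases v; cases w) (auto simp: h_def m_assoc)
  qed
  have "group_hom (order_8_group s) G h"
    using hom group_order_8 is_group by (simp add: group_hom_def group_hom_axioms_def)
  then have "inj_on h (carrier (order_8_group s))"
    using ker by (subst group_hom.inj_on_one_iff) auto
  moreover have "carrier G \<subseteq> h ` carrier (order_8_group s)"
  proof
    fix t assume t: "t \<in> carrier G"
    let ?H = "h ` carrier (order_8_group s)"
    have H: "subgroup ?H G"
      using group_hom.img_is_subgroup[OF \<open>group_hom (order_8_group s) G h\<close>] .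
    have aH: "a \<in> ?H" using a by (intro image_eqI[of _ _ "(True, False, False)"]) (auto simp: h_def)
    have bH: "b \<in> ?H" using b by (intro image_eqI[of _ _ "(False, True, False)"]) (auto simp: h_def)
    have pH: "powers a \<subseteq> ?H"
    proof
      fix y assume "y \<in> powers a"
      then obtain k :: nat where "y = a [^] k" by auto
      moreover have "a [^] k \<in> ?H" for k :: nat
        by (induction k) (use H aH in \<open>auto simp only: nat_pow_0 nat_pow_Suc subgroup.one_closed subgroup.m_closed\<close>)
      ultimately show "y \<in> ?H" by simp
    qed
    have move: "p \<otimes> q \<otimes> r = r \<otimes> (p \<otimes> q)" if "p \<in> carrier G" "q \<in> carrier G" "r \<in> carrier G"
      "p \<otimes> r = z \<otimes> (r \<otimes> p)" "q \<otimes> r = z \<otimes> (r \<otimes> q)" for p q r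
    proof -
      have "p \<otimes> q \<otimes> r = p \<otimes> (q \<otimes> r)" using that(1-3) by (simp add: m_assoc)
      also have "\<dots> = (p \<otimes> z) \<otimes> (r \<otimes> q)" unfolding that(5) using that(1-3) z(1) by (simp add: m_assoc)
      also have "\<dots> = z \<otimes> ((p \<otimes> r) \<otimes> q)"
        unfolding zc[OF that(1), symmetric] using that(1-3) z(1) by (simp add: m_assoc)
      also have "\<dots> = (z \<otimes> z) \<otimes> (r \<otimes> (p \<otimes> q))" unfolding that(4) using that(1-3) z(1) by (simp add: m_assoc)
      finally show ?thesis using z(3) that(1-3) by simp
    qed

    \<comment> \<open>Commutators are 1 or z, and z has order two. If t does not commute with a,
      then t b does; a further factor a repairs commutation with b without disturbing the first. The
      corrected element centralizes a and b, so it lies in <a>.\<close>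
    obtain t1 where t1: "t1 \<in> carrier G" "t1 \<otimes> a = a \<otimes> t1" "t1 \<in> ?H \<Longrightarrow> t \<in> ?H"
    proof (cases "t \<otimes> a = a \<otimes> t")
      case True then show ?thesis using that t by blast
    next
      case False
      then have "t \<otimes> a = z \<otimes> (a \<otimes> t)" using comm_z[OF t a(1)] by auto
      moreover have "b \<otimes> a = z \<otimes> (a \<otimes> b)" using comm_z[OF b a(1)] nc by auto
      ultimately have "t \<otimes> b \<otimes> a = a \<otimes> (t \<otimes> b)" using move t a b by blast
      moreover have "t \<in> ?H" if tb: "t \<otimes> b \<in> ?H"
      proof -
        have "t = t \<otimes> b \<otimes> inv b" using t b by (simp add: m_assoc)
        then show ?thesis using subgroup.m_closed[OF H tb subgroup.m_inv_closed[OF H bH]] by simp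
      qed
      ultimately show ?thesis using that[of "t \<otimes> b"] t b by blast
    qed
    obtain t2 where t2: "t2 \<in> carrier G" "t2 \<otimes> a = a \<otimes> t2" "t2 \<otimes> b = b \<otimes> t2" "t2 \<in> ?H \<Longrightarrow> t1 \<in> ?H"
    proof (cases "t1 \<otimes> b = b \<otimes> t1")
      case True then show ?thesis using that t1 by blast
    next
      case False
      then have "t1 \<otimes> b = z \<otimes> (b \<otimes> t1)" using comm_z[OF t1(1) b] by auto
      moreover have "a \<otimes> b = z \<otimes> (b \<otimes> a)" using comm_z[OF a(1) b] nc by auto
      ultimately have 1: "t1 \<otimes> a \<otimes> b = b \<otimes> (t1 \<otimes> a)" using move t1 a b by blast
      have 2: "t1 \<otimes> a \<otimes> a = a \<otimes> (t1 \<otimes> a)" using commute_mult[of t1 a a] t1 a by blast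
      have "t1 \<in> ?H" if tb: "t1 \<otimes> a \<in> ?H"
      proof -
        have "t1 = t1 \<otimes> a \<otimes> inv a" using t1(1) a(1) by (simp add: m_assoc)
        then show ?thesis using subgroup.m_closed[OF H tb subgroup.m_inv_closed[OF H aH]] by simp
      qed
      then show ?thesis using that[of "t1 \<otimes> a"] t1 a 1 2 by blast
    qed
    have "t2 \<in> powers a" using centre[OF a b nc t2(1-3)] .
    then show "t \<in> ?H" using pH t1 t2 by blast
  qed
  moreover have "h ` carrier (order_8_group s) \<subseteq> carrier G" using hom by (auto simp: hom_def)
  ultimately have "h \<in> iso (order_8_group s) G" using hom by (auto simp: iso_def bij_betw_def)
  then show ?thesis by blast
qed

end

section \<open>Abelian groups of exponent dividing four: adjoining involutions\<close>

lemma (in group) mon_extend_involution: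
  assumes M: "group M" and f: "f \<in> mon M G" and x: "x \<in> carrier G" "x \<otimes> x = \<one>" "x \<notin> f ` carrier M"
    and comm: "\<And>y. y \<in> carrier M \<Longrightarrow> x \<otimes> f y = f y \<otimes> x"
  shows "(\<lambda>p. f (fst p) \<otimes> (if snd p then x else \<one>)) \<in> mon (M \<times>\<times> C2_group) G"
proof -
  have fh: "f \<in> hom M G" and inj: "inj_on f (carrier M)" using f by (auto simp: mon_def)
  have fc: "f m \<in> carrier G" if "m \<in> carrier M" for m using fh that by (auto simp: hom_def)
  have fm: "f (m \<otimes>\<^bsub>M\<^esub> n) = f m \<otimes> f n" if "m \<in> carrier M" "n \<in> carrier M" for m n
    using fh that by (auto simp: hom_def)
  let ?h = "\<lambda>p. f (fst p) \<otimes> (if snd p then x else \<one>)"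
  have "?h \<in> hom (M \<times>\<times> C2_group) G"
  proof (rule homI)
    fix p q assume "p \<in> carrier (M \<times>\<times> C2_group)" "q \<in> carrier (M \<times>\<times> C2_group)"
    then obtain m e n g where pq: "p = (m, e)" "q = (n, g)" "m \<in> carrier M" "n \<in> carrier M" by (cases p, cases q) auto
    have c: "f m \<in> carrier G" "f n \<in> carrier G" using fc pq by auto
    have 1: "f m \<otimes> x \<otimes> (f n \<otimes> y) = f m \<otimes> f n \<otimes> (x \<otimes> y)" if "y \<in> carrier G" for y
    proof -
      have "f m \<otimes> x \<otimes> (f n \<otimes> y) = f m \<otimes> (x \<otimes> f n) \<otimes> y" using c x(1) that by (simp add: m_assoc)
      also have "\<dots> = f m \<otimes> f n \<otimes> (x \<otimes> y)" unfolding comm[OF pq(4)] using c x(1) that by (simp add: m_assoc)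
      finally show ?thesis .
    qed
    show "?h (p \<otimes>\<^bsub>M \<times>\<times> C2_group\<^esub> q) = ?h p \<otimes> ?h q"
      using c x 1[of x] 1[of \<one>] by (cases e; cases g) (simp_all add: pq fm m_assoc)
  qed (use fc x in \<open>auto\<close>)
  moreover have "inj_on ?h (carrier (M \<times>\<times> C2_group))"
  proof (rule inj_onI)
    fix p q assume a: "p \<in> carrier (M \<times>\<times> C2_group)" "q \<in> carrier (M \<times>\<times> C2_group)" "?h p = ?h q"
    then obtain m e n g where pq: "p = (m, e)" "q = (n, g)" "m \<in> carrier M" "n \<in> carrier M" by (cases p, cases q) auto
    have c: "f m \<in> carrier G" "f n \<in> carrier G" using fc pq by auto
    have H: "subgroup (f ` carrier M) G"
      using fh M is_group group_hom.img_is_subgroup[of M G f] by (simp add: group_hom_def group_hom_axioms_def)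
    have key: False if "f u = f v \<otimes> x" "u \<in> carrier M" "v \<in> carrier M" for u v
    proof -
      have "x = inv (f v) \<otimes> f u" using inv_solve_left[of x "f v" "f u"] that fc x by simp
      moreover have "inv (f v) \<otimes> f u \<in> f ` carrier M"
        by (rule subgroup.m_closed[OF H subgroup.m_inv_closed[OF H imageI[OF that(3)]] imageI[OF that(2)]])
      ultimately show False using x(3) by simp
    qed
    have "e = g" using a(3) key[of m n] key[of n m] pq c by (cases e; cases g) auto
    then have "f m = f n" using a(3) pq c x by (auto split: if_splits)
    then show "p = q" using inj pq \<open>e = g\<close> by (auto simp: inj_on_def)
  qed
  ultimately show ?thesis by (simp add: mon_def)
qed

lemma (in comm_group) finprod_list:
  "distinct xs \<Longrightarrow> set xs \<subseteq> carrier G \<Longrightarrow> finprod G (\<lambda>x. x) (set xs) = lprod xs"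
proof (induction xs)
  case (Cons x xs)
  then show ?case using finprod_insert[of "set xs" x "\<lambda>x. x"] by (simp add: Pi_def subset_iff)
qed simp

context davenport_6
begin

text \<open>A partial isomorphism: \<open>M\<close> is embedded, and its image contains a
  product-one free sequence of length \<open>k\<close>. The bound on \<open>k\<close> stops the
  growth by direct factors, and \<open>a\<close> is a fixed element from which involutions outside
  the image are obtained.\<close>

definition chain :: "'a \<Rightarrow> ('x, 'y) monoid_scheme \<Rightarrow> nat \<Rightarrow> bool" where
  "chain a M k \<longleftrightarrow> group M \<and> (\<exists>f T. f \<in> mon M G \<and> a \<in> f ` carrier M \<and>
     prod_one_free G T \<and> size T = k \<and> set_mset T \<subseteq> f ` carrier M)"

lemma chain_le_5: "chain a M k \<Longrightarrow> k \<le> 5"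
  using free_size_le by (auto simp: chain_def)

text \<open>An involution outside the image contributes a direct factor of order two and one more
  term of the free sequence.\<close>

lemma chain_step:
  assumes comm: "\<And>x y. x \<in> carrier G \<Longrightarrow> y \<in> carrier G \<Longrightarrow> x \<otimes> y = y \<otimes> x"
    and inv: "\<And>N y. subgroup N G \<Longrightarrow> a \<in> N \<Longrightarrow> y \<in> carrier G \<Longrightarrow> y \<notin> N \<Longrightarrow>
        \<exists>x. x \<in> carrier G \<and> x \<notin> N \<and> x \<otimes> x = \<one>"
    and ch: "chain a M k"
  shows "(\<exists>h. h \<in> iso M G) \<or> chain a (M \<times>\<times> C2_group) (Suc k)"
proof -
  obtain f T where M: "group M" and f: "f \<in> mon M G" "a \<in> f ` carrier M"
    and T: "prod_one_free G T" "size T = k" "set_mset T \<subseteq> f ` carrier M"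
    using ch by (auto simp: chain_def)
  have fh: "f \<in> hom M G" "inj_on f (carrier M)" using f by (auto simp: mon_def)
  have H: "subgroup (f ` carrier M) G"
    using fh M is_group group_hom.img_is_subgroup[of M G f] by (simp add: group_hom_def group_hom_axioms_def)
  show ?thesis
  proof (cases "f ` carrier M = carrier G")
    case True
    then have "f \<in> iso M G" using fh by (auto simp: iso_def bij_betw_def)
    then show ?thesis by blast
  next
    case False
    then obtain y where "y \<in> carrier G" "y \<notin> f ` carrier M" using subgroup.subset[OF H] by blast
    then obtain x where x: "x \<in> carrier G" "x \<notin> f ` carrier M" "x \<otimes> x = \<one>" using inv[OF H f(2)] by blast
    have fc: "f m \<in> carrier G" if "m \<in> carrier M" for m using subgroup.subset[OF H] that by blast
    let ?h = "\<lambda>p. f (fst p) \<otimes> (if snd p then x else \<one>)"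
    have "?h \<in> mon (M \<times>\<times> C2_group) G"
      using comm fc x by (intro mon_extend_involution[OF M f(1) x(1,3,2)]) auto
    moreover have sub: "f ` carrier M \<subseteq> ?h ` carrier (M \<times>\<times> C2_group)"
    proof
      fix y assume "y \<in> f ` carrier M"
      then obtain m where "m \<in> carrier M" "y = f m" by blast
      then have "y = ?h (m, False)" "(m, False) \<in> carrier (M \<times>\<times> C2_group)" using fc by auto
      then show "y \<in> ?h ` carrier (M \<times>\<times> C2_group)" by blast
    qed
    moreover have "x \<in> ?h ` carrier (M \<times>\<times> C2_group)"
    proof -
      have "f \<one>\<^bsub>M\<^esub> = \<one>" using hom_one[OF fh(1) M is_group] .
      then have "x = ?h (\<one>\<^bsub>M\<^esub>, True)" "(\<one>\<^bsub>M\<^esub>, True) \<in> carrier (M \<times>\<times> C2_group)"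
        using x(1) group.is_monoid[OF M] by auto
      then show ?thesis by blast
    qed
    moreover have "prod_one_free G (T + replicate_mset 1 x)"
    proof (rule prod_one_free_extend[OF H x(1) _ _ _ T(3,1)])
      fix n assume "n \<in> f ` carrier M"
      then show "\<exists>n'\<in>f ` carrier M. n \<otimes> x = x \<otimes> n'" using comm[of n x] x subgroup.subset[OF H] by blast
    next
      fix j :: nat assume "0 < j" "j \<le> 1"
      then have "j = 1" by simp
      then show "x [^] j \<notin> f ` carrier M" using x by simp
    qed simp
    moreover have "group (M \<times>\<times> C2_group)" using DirProd_group[OF M group_C2] .
    ultimately have "chain a (M \<times>\<times> C2_group) (Suc k)"
      unfolding chain_def using f(2) T(2,3)
      by (intro conjI exI[of _ ?h] exI[of _ "T + replicate_mset 1 x"]) auto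
    then show ?thesis by blast
  qed
qed

text \<open>Five terms of an atom of length six have 32 distinct subset products: two subsets with
  equal products have a symmetric difference with trivial product, which is a subsequence of at most
  five terms. The bound keeps the chain of embeddings from stopping early.\<close>

lemma elementary_card_ge:
  assumes e2: "\<And>x. x \<in> carrier G \<Longrightarrow> x \<otimes> x = \<one>"
    and comm: "\<And>x y. x \<in> carrier G \<Longrightarrow> y \<in> carrier G \<Longrightarrow> x \<otimes> y = y \<otimes> x"
  shows "32 \<le> card (carrier G)"
proof -
  interpret comm_group G using comm by (intro group_comm_groupI) auto
  obtain U where U: "U \<in> product_one_atoms G" "size U = 6" using ex_atom_6 by blast
  have Uc: "set_mset U \<subseteq> carrier G" using U(1) by (rule atom_carrier)
  have sub: False if "mset xs \<subseteq># U" "lprod xs = \<one>" "xs \<noteq> []" "length xs < 6" for xs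
    using commutative_atom_sub[OF comm U(1) that(1,2)] that(3,4) U(2) by (metis size_mset nat_neq_iff)
  obtain us where us: "mset us = U" using ex_mset by blast
  have cnt: "count U x \<le> 1" for x
  proof (rule ccontr)
    assume c: "\<not> count U x \<le> 1"
    then have "mset [x, x] \<subseteq># U" by (intro mset_subset_eqI) auto
    moreover have "x \<in> carrier G" using c Uc by (metis count_inI le0 subsetD)
    ultimately show False using sub[of "[x, x]"] e2[of x] by simp
  qed
  then have "distinct us" using us by (metis distinct_count_atmost_1 count_eq_zero_iff le_SucE le_zero_eq One_nat_def set_mset_mset)
  define D where "D = set (tl us)"
  obtain u vs where uv: "us = u # vs" using us U(2) by (cases us) auto
  have D: "D = set vs" "card D = 5" "finite D" "D \<subseteq> carrier G" "distinct vs"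
    using \<open>distinct us\<close> us U(2) uv Uc by (auto simp: D_def distinct_card)
  let ?p = "\<lambda>A. finprod G (\<lambda>x. x) A"
  have pc: "?p A \<in> carrier G" if "A \<subseteq> D" for A
    using that D by (intro finprod_closed) auto
  have "inj_on ?p (Pow D)"
  proof (rule inj_onI)
    fix A B assume AB: "A \<in> Pow D" "B \<in> Pow D" "?p A = ?p B"
    have fin: "finite A" "finite B" using AB finite_subset[OF _ D(3)] by blast+
    have split: "?p X = ?p (X \<inter> Y) \<otimes> ?p (X - Y)" if "X \<subseteq> D" for X Y
    proof -
      have "?p (X \<inter> Y \<union> (X - Y)) = ?p (X \<inter> Y) \<otimes> ?p (X - Y)"
        using that D finite_subset[OF that D(3)] by (intro finprod_Un_disjoint) auto
      then show ?thesis by (simp add: Int_Diff_Un)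
    qed
    let ?C = "(A - B) \<union> (B - A)"
    have "?p (A - B) = ?p (B - A)"
    proof -
      have "A \<subseteq> D" "B \<subseteq> D" using AB by auto
      then have c: "?p (A \<inter> B) \<in> carrier G" "?p (A - B) \<in> carrier G" "?p (B - A) \<in> carrier G"
        using pc by (meson Diff_subset Int_lower1 order_trans)+
      have "?p (A \<inter> B) \<otimes> ?p (A - B) = ?p (A \<inter> B) \<otimes> ?p (B - A)"
        using split[OF \<open>A \<subseteq> D\<close>, of B] split[OF \<open>B \<subseteq> D\<close>, of A] AB(3) by (simp add: Int_commute[of B A])
      then show ?thesis using c by simp
    qed
    moreover have "?p ?C = ?p (A - B) \<otimes> ?p (B - A)"
      using AB D fin by (intro finprod_Un_disjoint) auto
    ultimately have C1: "?p ?C = \<one>" using e2 pc[of "B - A"] AB by auto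
    have CD: "?C \<subseteq> D" using AB by auto
    obtain xs where xs: "set xs = ?C" "distinct xs" using finite_distinct_list[of ?C] fin by auto
    have "set xs \<subseteq> carrier G" using xs(1) CD D(4) by blast
    then have "lprod xs = \<one>" using finprod_list[OF xs(2)] xs(1) C1 by simp
    moreover have "mset xs \<subseteq># U"
    proof (rule mset_subset_eqI)
      fix x
      show "count (mset xs) x \<le> count U x"
        using xs CD D(1) us uv by (cases "x \<in> set xs") (auto simp: distinct_count_atmost_1 Suc_le_eq)
    qed
    moreover have "length xs < 6"
      using card_mono[OF D(3) CD] xs D(2) distinct_card[OF xs(2)] by simp
    ultimately have "xs = []" using sub by blast
    then show "A = B" using xs(1) by auto
  qed
  then have "card (Pow D) \<le> card (carrier G)"
    using pc finite_carrier by (intro card_inj_on_le) auto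
  then show ?thesis using D by (simp add: card_Pow)
qed

text \<open>The chain starts with one involution. The cardinality 32 prevents the four smaller
  powers from being the whole group, and a sixth factor would give a free sequence of length
  six.\<close>

lemma iso_elementary:
  assumes e2: "\<And>x. x \<in> carrier G \<Longrightarrow> x \<otimes> x = \<one>"
  shows "\<exists>h. h \<in> iso ((((C2_group \<times>\<times> C2_group) \<times>\<times> C2_group) \<times>\<times> C2_group) \<times>\<times> C2_group) G"
proof -
  have comm: "x \<otimes> y = y \<otimes> x" if "x \<in> carrier G" "y \<in> carrier G" for x y
  proof -
    have "x \<otimes> y = inv (x \<otimes> y)" using e2 that by (metis inv_equality m_closed)
    also have "\<dots> = inv y \<otimes> inv x" using that by (rule inv_mult_group)
    finally show ?thesis using that square_one_imp_inv e2 by metis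
  qed
  have inv: "\<exists>x. x \<in> carrier G \<and> x \<notin> N \<and> x \<otimes> x = \<one>"
    if "subgroup N G" "\<one> \<in> N" "y \<in> carrier G" "y \<notin> N" for N y using e2 that by blast
  note step = chain_step[of \<one>, OF comm inv]
  have card: "card (carrier M) = card (carrier G)" if "h \<in> iso M G" for h M
    using that by (auto simp: iso_def bij_betw_same_card)
  have no: "\<nexists>h. h \<in> iso M G" if "card (carrier M) < 32" for M :: "'x monoid"
    using card[of _ M] elementary_card_ge[OF e2 comm] that by fastforce
  obtain x where x: "x \<in> carrier G" "x \<noteq> \<one>"
    using card_carrier_ge card_mono[of "{\<one>}" "carrier G"] by fastforce
  have 1: "chain \<one> C2_group 1"
    unfolding chain_def
  proof (intro conjI exI)
    let ?f = "\<lambda>e. if e then x else \<one>"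
    show "?f \<in> mon C2_group G" using x e2[OF x(1)] by (auto simp: mon_def hom_def inj_on_def)
    show "prod_one_free G (replicate_mset 1 x)" using x by (intro prod_one_free_replicate) (use ord_eq_1[of x] ord_pos[of x] in auto)
  qed (auto simp: group_C2 image_iff)
  have 2: "chain \<one> (C2_group \<times>\<times> C2_group) 2"
    using step[OF _ _ _ _ _ _ 1] no[of C2_group] by (simp add: numeral_2_eq_2)
  have 3: "chain \<one> ((C2_group \<times>\<times> C2_group) \<times>\<times> C2_group) 3"
    using step[OF _ _ _ _ _ _ 2] no[of "C2_group \<times>\<times> C2_group"]
    by (simp add: card_cartesian_product eval_nat_numeral del: UNIV_Times_UNIV)
  have 4: "chain \<one> (((C2_group \<times>\<times> C2_group) \<times>\<times> C2_group) \<times>\<times> C2_group) 4"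
    using step[OF _ _ _ _ _ _ 3] no[of "(C2_group \<times>\<times> C2_group) \<times>\<times> C2_group"]
    by (simp add: card_cartesian_product eval_nat_numeral del: UNIV_Times_UNIV)
  have 5: "chain \<one> ((((C2_group \<times>\<times> C2_group) \<times>\<times> C2_group) \<times>\<times> C2_group) \<times>\<times> C2_group) 5"
    using step[OF _ _ _ _ _ _ 4] no[of "((C2_group \<times>\<times> C2_group) \<times>\<times> C2_group) \<times>\<times> C2_group"]
    by (simp add: card_cartesian_product eval_nat_numeral del: UNIV_Times_UNIV)
  show ?thesis using step[OF _ _ _ _ _ _ 5] chain_le_5 by fastforce
qed

text \<open>The Davenport constant of C_4 x C_2 is five. An atom of length six would be described by
  the multiplicities of the eight elements, and the short product-one sequences that it cannot
  contain bound their sum below six.\<close>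

lemma not_iso_C4_C2:
  assumes comm: "\<And>x y. x \<in> carrier G \<Longrightarrow> y \<in> carrier G \<Longrightarrow> x \<otimes> y = y \<otimes> x"
    and h: "h \<in> iso (integer_mod_group 4 \<times>\<times> C2_group) G"
  shows False
proof -
  let ?M = "integer_mod_group 4 \<times>\<times> C2_group"
  obtain U where U: "U \<in> product_one_atoms G" "size U = 6" using ex_atom_6 by blast
  have M: "group ?M" using DirProd_group group_integer_mod_group group_C2 by blast
  have hh: "h \<in> hom ?M G" "inj_on h (carrier ?M)" "h ` carrier ?M = carrier G"
    using h by (auto simp: iso_def bij_betw_def)
  have cM: "carrier ?M = {0, 1, 2, 3} \<times> UNIV"
    by (auto simp: carrier_integer_mod_group)
  have hp: "lprod (map h xs) = h (foldr (\<otimes>\<^bsub>?M\<^esub>) xs \<one>\<^bsub>?M\<^esub>) \<and> foldr (\<otimes>\<^bsub>?M\<^esub>) xs \<one>\<^bsub>?M\<^esub> \<in> carrier ?M"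
    if "set xs \<subseteq> carrier ?M" for xs
    using that
  proof (induction xs)
    case Nil
    then show ?case using hom_one[OF hh(1) M is_group] monoid.one_closed[OF group.is_monoid[OF M]] by simp
  next
    case (Cons x xs)
    then show ?case using hh(1) monoid.m_closed[OF group.is_monoid[OF M]] by (auto simp: hom_def Pi_iff simp del: carrier_DirProd one_DirProd)
  qed
  have sub: "\<exists>p\<in>set xs. count U (h p) < count (mset xs) p"
    if xs: "set xs \<subseteq> {0,1,2,3} \<times> UNIV" "foldr (\<otimes>\<^bsub>?M\<^esub>) xs (0, False) = (0, False)" "xs \<noteq> []" "length xs < 6" for xs
  proof (rule ccontr)
    assume n: "\<not> ?thesis"
    have "mset (map h xs) \<subseteq># U"
    proof (rule mset_subset_eqI)
      fix y
      show "count (mset (map h xs)) y \<le> count U y"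
      proof (cases "y \<in> h ` set xs")
        case True
        then obtain p where p: "p \<in> set xs" "y = h p" by blast
        have "count (mset (map h xs)) y = count (mset xs) p"
        proof -
          have "h -` {h p} \<inter> set xs = {p}"
          proof -
            have "q = p" if "q \<in> set xs" "h q = h p" for q
              using inj_onD[OF hh(2) that(2)] that(1) p(1) xs(1) unfolding cM by blast
            then show ?thesis using p(1) by auto
          qed
          then show ?thesis by (simp add: count_image_mset p(2))
        qed
        then show ?thesis using n p by force
      next
        case False
        then have "count (mset (map h xs)) y = 0" by (simp add: count_eq_zero_iff image_iff)
        then show ?thesis by simp
      qed
    qed
    moreover have "lprod (map h xs) = \<one>"
      using hp[of xs] xs(1,2) cM hom_one[OF hh(1) M is_group] by simp
    ultimately show False
      using commutative_atom_sub[OF comm U(1), of "map h xs"] xs(3,4) U(2) by (metis length_map list.map_disc_iff nat_neq_iff size_mset)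
  qed
  \<comment> \<open>Each of the following facts forbids product-one subsequences with at most four
    terms.\<close>
  define c where "c p = count U (h p)" for p
  have c0: "c (0, False) = 0" using sub[of "[(0, False)]"] by (simp add: c_def)
  have pairs: "c (1, e) = 0 \<or> c (3, e) = 0" for e
    using sub[of "[(1, e), (3, e)]"] by (auto simp: c_def)
  have ones: "c (2, e) \<le> 1" for e
    using sub[of "[(2, e), (2, e)]"] by (auto simp: c_def)
  have one: "c (0, True) \<le> 1"
    using sub[of "[(0, True), (0, True)]"] by (auto simp: c_def)
  have tri: "c (2, False) = 0 \<or> c (0, True) = 0 \<or> c (2, True) = 0"
    using sub[of "[(2, False), (0, True), (2, True)]"] by (auto simp: c_def)
  have odd: "c (i, e) \<le> 3" "c (i, e) \<le> 1 \<or> c (2, False) = 0" "c (i, e) \<le> 1 \<or> c (0, True) = 0 \<or> c (2, True) = 0"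
    if "i = 1 \<or> i = 3" for i e
    using that sub[of "[(i, e), (i, e), (i, e), (i, e)]"] sub[of "[(i, e), (i, e), (2, False)]"]
      sub[of "[(i, e), (i, e), (0, True), (2, True)]"] by (auto simp: c_def)
  have two: "c (i, False) \<le> 1 \<or> c (j, True) \<le> 1" if "i = 1 \<or> i = 3" "j = 1 \<or> j = 3" for i j
    using that sub[of "[(i, False), (i, False), (j, True), (j, True)]"] by (auto simp: c_def)
  have "6 = (\<Sum>y\<in>set_mset U. count U y)" using U(2) by (simp add: size_multiset_overloaded_eq)
  also have "\<dots> = (\<Sum>y\<in>carrier G. count U y)"
    using finite_carrier atom_carrier[OF U(1)] by (intro sum.mono_neutral_left) (auto simp: count_eq_zero_iff)
  also have "\<dots> = (\<Sum>p\<in>carrier ?M. c p)"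
    using hh by (subst hh(3)[symmetric], subst sum.reindex) (auto simp: c_def)
  also have "\<dots> = c (0, False) + c (1, False) + c (2, False) + c (3, False)
      + c (0, True) + c (1, True) + c (2, True) + c (3, True)"
    unfolding cM UNIV_bool sum.cartesian_product[symmetric] by simp
  finally have s: "6 = c (0, False) + c (1, False) + c (2, False) + c (3, False)
      + c (0, True) + c (1, True) + c (2, True) + c (3, True)" .
  \<comment> \<open>Of two inverse elements of order four at most one occurs; i and j name it in the
    two cosets of the cyclic factor.\<close>
  obtain i where i: "i = 1 \<or> i = 3" "c (1, False) + c (3, False) = c (i, False)" using pairs[of False] by fastforce
  obtain j where j: "j = 1 \<or> j = 3" "c (1, True) + c (3, True) = c (j, True)" using pairs[of True] by fastforce
  have "6 = c (i, False) + c (j, True) + c (2, False) + c (0, True) + c (2, True)" using s c0 i(2) j(2) by linarith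
  then show False
    using ones[of False] ones[of True] one tri odd[OF i(1), of False] odd[OF j(1), of True] two[OF i(1) j(1)]
    by (elim disjE) linarith+
qed

text \<open>The chain argument asks for an involution outside every proper subgroup N containing a.
  If y outside N has nontrivial square, then y^2 = a^2, as otherwise a^3 y^3 would be free of length
  six; so y a^-1 is an involution outside N.\<close>

lemma iso_C4_C2_C2:
  assumes comm: "\<And>x y. x \<in> carrier G \<Longrightarrow> y \<in> carrier G \<Longrightarrow> x \<otimes> y = y \<otimes> x"
    and e4: "\<And>x. x \<in> carrier G \<Longrightarrow> x [^] (4::nat) = \<one>"
    and a: "a \<in> carrier G" "a \<otimes> a \<noteq> \<one>"
  shows "\<exists>h. h \<in> iso ((integer_mod_group 4 \<times>\<times> C2_group) \<times>\<times> C2_group) G"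
proof -
  have ord4: "ord x = 4" if x: "x \<in> carrier G" "x \<otimes> x \<noteq> \<one>" for x
  proof -
    have d: "ord x dvd 4" using ord_dvdI[OF x(1)] e4[OF x(1)] by blast
    then have "ord x = 1 \<or> ord x = 2 \<or> ord x = 3 \<or> ord x = 4"
      using ord_pos[OF x(1)] dvd_imp_le[of "ord x" 4] by linarith
    then have "ord x \<in> {1, 2, 4}" using d by (elim disjE) simp_all
    moreover have "\<not> ord x dvd 2" using pow_eq_id[OF x(1), of 2] x by (simp add: numeral_2_eq_2)
    ultimately show ?thesis by auto
  qed
  have sq4: "x \<otimes> x \<otimes> (x \<otimes> x) = \<one>" if "x \<in> carrier G" for x
    using e4[OF that] that by (simp add: numeral_eq_Suc m_assoc)
  have pow4: "t = \<one> \<or> t = a \<otimes> a" if t: "t \<in> powers a" "t \<otimes> t = \<one>" for t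
  proof -
    obtain k :: nat where k: "t = a [^] k" using t by auto
    have "a [^] (k + k) = \<one>" using t(2) k a by (simp add: nat_pow_mult)
    then have "4 dvd k + k" using ord_dvdI[OF a(1)] ord4[OF a] by metis
    then have "2 dvd k" by presburger
    then obtain l where l: "k = 2 * l" by (elim dvdE)
    have "t = (a \<otimes> a) [^] l" using k l a nat_pow_pow[OF a(1), of 2 l] by (simp add: numeral_2_eq_2)
    moreover have "(a \<otimes> a) [^] l = \<one> \<or> (a \<otimes> a) [^] l = a \<otimes> a" for l :: nat
      by (induction l) (use sq4[OF a(1)] a in auto)
    ultimately show ?thesis by simp
  qed
  have inv: "\<exists>x. x \<in> carrier G \<and> x \<notin> N \<and> x \<otimes> x = \<one>"
    if N: "subgroup N G" "a \<in> N" and y: "y \<in> carrier G" "y \<notin> N" for N y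
  proof (cases "y \<otimes> y = \<one>")
    case True then show ?thesis using y by blast
  next
    case False

    have pN: "powers a \<subseteq> N"
    proof
      fix t assume "t \<in> powers a"
      then obtain k :: nat where "t = a [^] k" by auto
      moreover have "a [^] k \<in> N" for k :: nat
        by (induction k) (use N in \<open>auto simp: subgroup.one_closed subgroup.m_closed\<close>)
      ultimately show "t \<in> N" by simp
    qed
    have "y \<otimes> y = a \<otimes> a"
    proof (rule ccontr)
      assume ne: "y \<otimes> y \<noteq> a \<otimes> a"
      have "y [^] k \<notin> powers a" if k: "0 < k" "k \<le> 3" for k :: nat
      proof
        assume yk: "y [^] k \<in> powers a"
        have "k = 1 \<or> k = 2 \<or> k = 3" using k by linarith
        then show False
        proof (elim disjE)
          assume "k = 1" then show False using yk y pN by auto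
        next
          assume "k = 2"
          then have "y \<otimes> y \<in> powers a" using yk y by (simp add: numeral_2_eq_2)
          then show False using pow4[OF _ sq4[OF y(1)]] ne False by blast
        next
          assume k3: "k = 3"
          have "y [^] (3::nat) \<otimes> y = \<one>" using e4[OF y(1)] by (simp add: eval_nat_numeral)
          then have "y = inv (y [^] (3::nat))" using y by (metis inv_comm inv_equality nat_pow_closed)
          then have "y \<in> N" using yk k3 pN N(1) by (metis subgroup.m_inv_closed subsetD)
          then show False using y by simp
        qed
      qed
      then have "prod_one_free G (replicate_mset 3 a + replicate_mset 3 y)"
        using subgroup_pow[OF a(1)] a y powers_self[OF a(1)] comm ord4[OF a]
        by (intro prod_one_free_extend[of "powers a"] prod_one_free_replicate) auto
      then show False using free_size_le by fastforce
    qed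
    moreover have "y \<otimes> inv a \<otimes> (y \<otimes> inv a) = (y \<otimes> y) \<otimes> inv (a \<otimes> a)"
      using commuting_square[of y "inv a"] comm[of "inv a" y] y a by (simp add: inv_mult_group)
    ultimately have "y \<otimes> inv a \<otimes> (y \<otimes> inv a) = \<one>" using a by simp
    moreover have "y \<otimes> inv a \<notin> N"
    proof
      assume "y \<otimes> inv a \<in> N"
      then have "y \<otimes> inv a \<otimes> a \<in> N" by (rule subgroup.m_closed[OF N(1) _ N(2)])
      then show False using y a by (simp add: m_assoc)
    qed
    moreover have "y \<otimes> inv a \<in> carrier G" using y a by simp
    ultimately show ?thesis by blast
  qed
  note step = chain_step[of a, OF comm inv]
  \<comment> \<open>The chain starts with C_4 and the free sequence a^3. It cannot stop there, as
    the group has at least six elements, nor at C_4 x C_2, and it must stop at length five.\<close>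
  have 3: "chain a (integer_mod_group 4) 3"
    unfolding chain_def
  proof (intro conjI exI)
    let ?f = "\<lambda>i::int. a [^] i"
    have o: "(a [^] i = a [^] j) \<longleftrightarrow> i mod 4 = j mod 4" for i j :: int
      using int_pow_eq[OF a(1), of i j] ord4[OF a] by (simp add: mod_eq_dvd_iff) (metis dvd_minus_iff minus_diff_eq)
    have "a [^] ((i + j) mod 4) = a [^] i \<otimes> a [^] j" for i j :: int
      using o[of "(i + j) mod 4" "i + j"] a by (simp add: int_pow_mult)
    then show "?f \<in> mon (integer_mod_group 4) G"
      using a o by (auto simp: mon_def hom_def inj_on_def carrier_integer_mod_group)
    show "a \<in> ?f ` carrier (integer_mod_group 4)"
      using a by (intro image_eqI[of _ _ 1]) (auto simp: int_pow_1)
    then show "set_mset (replicate_mset 3 a) \<subseteq> ?f ` carrier (integer_mod_group 4)" by auto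
    show "prod_one_free G (replicate_mset 3 a)" using a ord4[OF a] by (intro prod_one_free_replicate) auto
  qed auto
  have "\<nexists>h. h \<in> iso (integer_mod_group 4) G"
  proof
    assume "\<exists>h. h \<in> iso (integer_mod_group 4) G"
    then have "card (carrier G) = card (carrier (integer_mod_group 4))" by (auto simp: iso_def bij_betw_same_card)
    then show False using card_carrier_ge by (simp add: carrier_integer_mod_group)
  qed
  then have 4: "chain a (integer_mod_group 4 \<times>\<times> C2_group) 4"
    using step[OF _ _ _ _ _ _ 3] by (simp add: eval_nat_numeral)
  have 5: "chain a ((integer_mod_group 4 \<times>\<times> C2_group) \<times>\<times> C2_group) 5"
  proof -
    have "(\<exists>h. h \<in> iso (integer_mod_group 4 \<times>\<times> C2_group) G)
        \<or> chain a ((integer_mod_group 4 \<times>\<times> C2_group) \<times>\<times> C2_group) (Suc 4)"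
      by (rule step[OF _ _ _ _ _ _ 4])
    then show ?thesis using not_iso_C4_C2[OF comm] by auto
  qed
  show ?thesis using step[OF _ _ _ _ _ _ 5] chain_le_5 by fastforce
qed

end

subsection \<open>Sets of lengths and the Davenport constant\<close>

lemma hom_foldr:
  assumes G: "monoid G" and h: "h \<in> hom G H" "h \<one>\<^bsub>G\<^esub> = \<one>\<^bsub>H\<^esub>" and xs: "set xs \<subseteq> carrier G"
  shows "foldr (\<otimes>\<^bsub>H\<^esub>) (map h xs) \<one>\<^bsub>H\<^esub> = h (foldr (\<otimes>\<^bsub>G\<^esub>) xs \<one>\<^bsub>G\<^esub>)"
  using xs
proof (induction xs)
  case (Cons x xs)
  then have "foldr (\<otimes>\<^bsub>G\<^esub>) xs \<one>\<^bsub>G\<^esub> \<in> carrier G" using monoid.multlist_closed[OF G] by simp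
  then show ?case using Cons h by (simp add: hom_def Pi_iff)
qed (use h in simp)

text \<open>An ordering of the image lifts term by term to an ordering of \<open>S\<close>, and
  injectivity reflects the triviality of its product.\<close>

lemma mon_prod_one_iff:
  assumes G: "group G" and H: "group H" and h: "h \<in> mon G H" and S: "set_mset S \<subseteq> carrier G"
  shows "prod_one H (image_mset h S) \<longleftrightarrow> prod_one G S"
proof -
  have hh: "h \<in> hom G H" "inj_on h (carrier G)" using h by (auto simp: mon_def)
  have h1: "h \<one>\<^bsub>G\<^esub> = \<one>\<^bsub>H\<^esub>" using hom_one[OF hh(1) G H] .
  have fold: "foldr (\<otimes>\<^bsub>H\<^esub>) (map h xs) \<one>\<^bsub>H\<^esub> = h (foldr (\<otimes>\<^bsub>G\<^esub>) xs \<one>\<^bsub>G\<^esub>)" if "set xs \<subseteq> carrier G" for xs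
    using hom_foldr[OF group.is_monoid[OF G] hh(1) h1 that] .
  have hS: "set_mset (image_mset h S) \<subseteq> carrier H" using hh(1) S by (auto simp: hom_def)
  show ?thesis
  proof
    assume "prod_one H (image_mset h S)"
    then obtain ys where ys: "mset ys = image_mset h S" "foldr (\<otimes>\<^bsub>H\<^esub>) ys \<one>\<^bsub>H\<^esub> = \<one>\<^bsub>H\<^esub>"
      by (auto simp: carrier_product_one_monoid_iff)
    obtain xs where xs: "mset xs = S" "ys = map h xs"
    proof -
      obtain zs where zs: "mset zs = S" using ex_mset by blast
      have "mset (map h zs) = mset ys" using ys zs by simp
      then have "\<exists>xs. mset xs = mset zs \<and> ys = map h xs"
      proof (induction ys arbitrary: zs)
        case (Cons y ys)
        have "y \<in> set (map h zs)" using Cons.prems by (metis list.set_intros(1) set_mset_mset)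
        then obtain x where x: "x \<in> set zs" "y = h x" by auto
        then have "mset (map h (remove1 x zs)) = mset ys"
          using Cons.prems by (simp add: image_mset_Diff)
        then obtain xs where "mset xs = mset (remove1 x zs)" "ys = map h xs" using Cons.IH by blast
        then show ?case using x by (intro exI[of _ "x # xs"]) simp
      qed simp
      then show ?thesis using that zs by auto
    qed
    have c: "set xs \<subseteq> carrier G" using xs S by auto
    have "h (foldr (\<otimes>\<^bsub>G\<^esub>) xs \<one>\<^bsub>G\<^esub>) = h \<one>\<^bsub>G\<^esub>" using fold[OF c] xs ys h1 by simp
    then have "foldr (\<otimes>\<^bsub>G\<^esub>) xs \<one>\<^bsub>G\<^esub> = \<one>\<^bsub>G\<^esub>"
      using hh(2) monoid.multlist_closed[OF group.is_monoid[OF G] c] monoid.one_closed[OF group.is_monoid[OF G]]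
      by (simp add: inj_on_eq_iff)
    then show "prod_one G S" using S xs by (auto simp: carrier_product_one_monoid_iff)
  next
    assume "prod_one G S"
    then obtain xs where xs: "mset xs = S" "foldr (\<otimes>\<^bsub>G\<^esub>) xs \<one>\<^bsub>G\<^esub> = \<one>\<^bsub>G\<^esub>"
      by (auto simp: carrier_product_one_monoid_iff)
    have c: "set xs \<subseteq> carrier G" using xs S by auto
    have "foldr (\<otimes>\<^bsub>H\<^esub>) (map h xs) \<one>\<^bsub>H\<^esub> = \<one>\<^bsub>H\<^esub>" using fold[OF c] xs h1 by simp
    moreover have "mset (map h xs) = image_mset h S" using xs by simp
    ultimately show "prod_one H (image_mset h S)"
      using hS unfolding carrier_product_one_monoid_iff by blast
  qed
qed

lemma mon_atom:
  assumes "group G" "group H" "h \<in> mon G H" "U \<in> product_one_atoms G"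
  shows "image_mset h U \<in> product_one_atoms H"
proof -
  have c: "set_mset U \<subseteq> carrier G" using assms(4) by (rule atom_carrier)
  have "A = {#} \<or> B = {#}" if AB: "prod_one H A" "prod_one H B" "image_mset h U = A + B" for A B
  proof -
    obtain A' B' where U: "U = A' + B'" "A = image_mset h A'" "B = image_mset h B'"
      using image_mset_eq_plusD[OF AB(3)] by blast
    then have "prod_one G A'" "prod_one G B'" using AB mon_prod_one_iff[OF assms(1-3)] c by auto
    then show ?thesis using atom_split[of A' B' G] assms(4) U by auto
  qed
  then show ?thesis
    using mon_prod_one_iff[OF assms(1-3) c] assms(4) by (auto simp: product_one_atoms_iff)
qed

lemma mon_fact_len:
  assumes "group G" "group H" "h \<in> mon G H" "fact_len G k S"
  shows "fact_len H k (image_mset h S)"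
  using assms(4)
proof (induction k arbitrary: S)
  case (Suc k)
  then obtain A T where "A \<in> product_one_atoms G" "fact_len G k T" "S = A + T" by (auto simp: fact_len_Suc)
  then show ?case using Suc.IH mon_atom[OF assms(1-3)] by (auto simp: fact_len_Suc)
qed simp

lemma iso_system_subset:
  assumes G: "group G" and H: "group H" and h: "h \<in> iso G H"
  shows "system_of_lengths G \<subseteq> system_of_lengths H"
proof
  fix L assume "L \<in> system_of_lengths G"
  then obtain S where S: "prod_one G S" "L = {k. fact_len G k S}" by (auto simp: mem_system_of_lengths)
  have hm: "h \<in> mon G H" using h by (auto simp: iso_iff_mon_epi)
  define g where "g = inv_into (carrier G) h"
  have g: "g \<in> iso H G" unfolding g_def using group.iso_set_sym[OF G h] .
  then have gm: "g \<in> mon H G" by (auto simp: iso_iff_mon_epi)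
  have Sc: "set_mset S \<subseteq> carrier G" using S(1) by (rule prod_one_carrier)
  have "image_mset g (image_mset h S) = S"
  proof -
    have "g (h x) = x" if "x \<in># S" for x
      unfolding g_def using h that Sc by (intro inv_into_f_f) (auto simp: iso_def bij_betw_def)
    then have "image_mset (\<lambda>x. g (h x)) S = image_mset (\<lambda>x. x) S" by (intro image_mset_cong) auto
    then show ?thesis by (simp add: multiset.map_comp comp_def)
  qed
  then have "fact_len H k (image_mset h S) \<longleftrightarrow> fact_len G k S" for k
    using mon_fact_len[OF G H hm, of k S] mon_fact_len[OF H G gm, of k "image_mset h S"] by auto
  moreover have "prod_one H (image_mset h S)" using mon_prod_one_iff[OF G H hm Sc] S by simp
  ultimately show "L \<in> system_of_lengths H" using S(2) by (auto simp: mem_system_of_lengths)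
qed

lemma iso_system_eq:
  assumes "group G" "group H" "h \<in> iso G H"
  shows "system_of_lengths G = system_of_lengths H"
  using iso_system_subset[OF assms] iso_system_subset[OF assms(2,1) group.iso_set_sym[OF assms(1,3)]] by blast

section \<open>Bounds relating lengths to the number of terms\<close>

lemma (in group) fact_len_exists:
  "prod_one G S \<Longrightarrow> \<exists>k. fact_len G k S"
proof (induction "size S" arbitrary: S rule: less_induct)
  case less
  consider "S = {#}" | "S \<in> product_one_atoms G"
    | T U where "prod_one G T" "prod_one G U" "S = T + U" "T \<noteq> {#}" "U \<noteq> {#}"
    using less.prems by (auto simp: product_one_atoms_iff)
  then show ?case
  proof cases
    case 1
    then show ?thesis by (intro exI[of _ 0]) simp
  next
    case 2
    then show ?thesis using fact_len_1 by blast
  next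
    case 3
    then have "size T < size S" "size U < size S" by (auto simp: nonempty_has_size)
    then obtain k l where "fact_len G k T" "fact_len G l U" using less.hyps 3 by blast
    then show ?thesis using fact_len_add 3 by blast
  qed
qed

lemma fact_len_prod_one:
  assumes "group G" "fact_len G k S"
  shows "prod_one G S"
  using assms(2)
proof (induction k arbitrary: S)
  case (Suc k)
  then show ?case using group.prod_one_add[OF assms(1)] atom_prod_one by (fastforce simp: fact_len_Suc)
qed simp

text \<open>The identity is the only atom with one term, so here every factor has at least
  two.\<close>

lemma fact_len_size_ge:
  assumes G: "group G" and "\<one>\<^bsub>G\<^esub> \<notin># S" "fact_len G k S"
  shows "2 * k \<le> size S"
  using assms(2,3)
proof (induction k arbitrary: S)
  case (Suc k)
  then obtain A T where A: "A \<in> product_one_atoms G" "fact_len G k T" "S = A + T" by (auto simp: fact_len_Suc)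
  have "size A \<noteq> 0" using A(1) atom_nonempty by auto
  moreover have "size A \<noteq> 1"
  proof
    assume "size A = 1"
    then obtain x where "A = {#x#}" using size_1_singleton_mset by blast
    then show False using A Suc.prems group.prod_one_single[OF G, of x] atom_prod_one by fastforce
  qed
  ultimately have "2 \<le> size A" by linarith
  then show ?case using Suc.IH[of T] Suc.prems A by simp
qed simp

lemma (in group) atom_one:
  assumes "U \<in> product_one_atoms G" "\<one> \<in># U"
  shows "U = {#\<one>#}"
proof -
  obtain T where T: "U = {#\<one>#} + T" using assms(2) by (metis insert_DiffM add_mset_add_single add.commute)
  have "set_mset T \<subseteq> carrier G" using atom_carrier[OF assms(1)] T by auto
  obtain ys where ys: "mset ys = T" "set ys \<subseteq> carrier G" "\<one> \<otimes> lprod ys = \<one>"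
    using prod_one_rotate[of \<one> T] atom_prod_one[OF assms(1)] T by auto
  then have "prod_one G T" by (intro prod_oneI[of ys]) auto
  then show ?thesis using atom_split[of "{#\<one>#}" T G] assms(1) T prod_one_single by auto
qed

text \<open>An atom containing the identity consists of it alone, so an identity term accounts for
  exactly one factor.\<close>

lemma (in group) fact_len_cancel_one:
  assumes "fact_len G (Suc k) (add_mset \<one> S)"
  shows "fact_len G k S"
  using assms
proof (induction k arbitrary: S)
  case 0
  then have "add_mset \<one> S \<in> product_one_atoms G" using fact_len_1[of G "add_mset \<one> S"] by simp
  then show ?case using atom_one by fastforce
next
  case (Suc k)
  obtain A T where A: "A \<in> product_one_atoms G" "fact_len G (Suc k) T" "add_mset \<one> S = A + T"
    using Suc.prems fact_len_Suc[of G "Suc k"] by blast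
  show ?case
  proof (cases "\<one> \<in># A")
    case True
    then show ?thesis using atom_one[OF A(1)] A by simp
  next
    case False
    then have "\<one> \<in># T" using A(3) by (metis union_iff union_single_eq_member add_mset_add_single)
    then obtain T' where T': "T = add_mset \<one> T'" by (meson multi_member_split)
    then have "fact_len G k T'" using Suc.IH A(2) by blast
    moreover have "S = A + T'" using A(3) T' by simp
    ultimately show ?thesis using A(1) fact_len_Suc by blast
  qed
qed

text \<open>If one atom contained the identity, it would be the identity alone; cancelling it would
  split the other atom into k - 1 \<ge> 2 atoms.\<close>

lemma (in group) two_atoms_no_one:
  assumes "U \<in> product_one_atoms G" "V \<in> product_one_atoms G" "fact_len G k (U + V)" "3 \<le> k"
  shows "\<one> \<notin># U + V"
proof
  have no: False if UV: "U \<in> product_one_atoms G" "V \<in> product_one_atoms G" "fact_len G k (U + V)" "\<one> \<in># U" for U V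
  proof -
    have "U + V = add_mset \<one> V" using atom_one[OF UV(1,4)] by simp
    moreover obtain l where l: "k = Suc (Suc (Suc l))" using assms(4) by (metis Suc_le_D numeral_3_eq_3 Suc_le_mono)
    ultimately have "fact_len G (Suc (Suc l)) V" using fact_len_cancel_one UV(3) by simp
    then obtain A B T where "A \<in> product_one_atoms G" "B \<in> product_one_atoms G" "fact_len G l T" "V = A + (B + T)"
      by (auto simp: fact_len_Suc)
    moreover then have "prod_one G (B + T)"
      using prod_one_add atom_prod_one fact_len_prod_one[OF is_group] by blast
    ultimately show False
      using atom_split[of A "B + T" G] UV(2) atom_nonempty atom_prod_one by (metis union_eq_empty)
  qed
  assume "\<one> \<in># U + V"
  then show False using no[of U V] no[of V U] assms by (auto simp: add.commute)
qed

lemma large_Davenport_eqD: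
  assumes "group G" "finite (carrier G)"
  shows "U \<in> product_one_atoms G \<Longrightarrow> size U \<le> large_Davenport G"
    and "\<exists>U \<in> product_one_atoms G. size U = large_Davenport G"
proof -
  have fin: "finite (size ` product_one_atoms G)" using finite_product_one_atoms[OF assms] by simp
  have ne: "size ` product_one_atoms G \<noteq> {}" using product_one_atoms_nonempty[OF assms(1)] by blast
  show "U \<in> product_one_atoms G \<Longrightarrow> size U \<le> large_Davenport G"
    unfolding large_Davenport_def using fin by (intro Max_ge) auto
  show "\<exists>U \<in> product_one_atoms G. size U = large_Davenport G"
    using Max_in[OF fin ne] unfolding large_Davenport_def by auto
qed

lemma (in group) inverse_atom:
  assumes "U \<in> product_one_atoms G"
  shows "image_mset (\<lambda>x. inv x) U \<in> product_one_atoms G"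
proof -
  have po: "prod_one G (image_mset (\<lambda>x. inv x) S)" if S: "prod_one G S" for S
  proof -
    obtain xs where xs: "mset xs = S" "lprod xs = \<one>" "set xs \<subseteq> carrier G"
      using S by (auto simp: carrier_product_one_monoid_iff)
    have "lprod (rev (map (\<lambda>x. inv x) xs)) = inv (lprod xs)"
      using xs(3)
    proof (induction xs)
      case (Cons x xs)
      then have "lprod (rev (map (\<lambda>x. inv x) (x # xs))) = lprod (rev (map (\<lambda>x. inv x) xs)) \<otimes> lprod [inv x]"
        using foldr_mult_append[of "rev (map (\<lambda>x. inv x) xs)" "[inv x]"] by auto
      then show ?case using Cons multlist_closed[of xs] by (simp add: inv_mult_group)
    qed simp
    then have "lprod (rev (map (\<lambda>x. inv x) xs)) = \<one>" using xs by simp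
    then show ?thesis using xs by (intro prod_oneI[of "rev (map (\<lambda>x. inv x) xs)"]) auto
  qed
  have inv2: "image_mset (\<lambda>x. inv x) (image_mset (\<lambda>x. inv x) S) = S" if "set_mset S \<subseteq> carrier G" for S
  proof -
    have "image_mset (\<lambda>x. inv (inv x)) S = image_mset (\<lambda>x. x) S"
      using that by (intro image_mset_cong) auto
    then show ?thesis by (simp add: multiset.map_comp comp_def)
  qed
  have c: "set_mset U \<subseteq> carrier G" using assms by (rule atom_carrier)
  have "A = {#} \<or> B = {#}" if AB: "prod_one G A" "prod_one G B" "image_mset (\<lambda>x. inv x) U = A + B" for A B
  proof -
    have "U = image_mset (\<lambda>x. inv x) A + image_mset (\<lambda>x. inv x) B"
      using inv2[OF c] AB(3) by (metis image_mset_union)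
    then show ?thesis using atom_split[of "image_mset (\<lambda>x. inv x) A" "image_mset (\<lambda>x. inv x) B" G] po AB assms by auto
  qed
  then show ?thesis using po[OF atom_prod_one[OF assms]] assms by (auto simp: product_one_atoms_iff)
qed

lemma (in group) pair_atom:
  assumes "x \<in> carrier G" "x \<noteq> \<one>"
  shows "{#x, inv x#} \<in> product_one_atoms G"
proof (rule product_one_atomI)
  show "prod_one G {#x, inv x#}" using assms prod_one_pair by simp
  fix X assume X: "X \<subseteq># {#inv x#}" "prod_one G X"
  have "size X \<le> 1" using size_mset_mono[OF X(1)] by simp
  then have "size X = 0 \<or> size X = 1" by linarith
  then show "X = {#}"
  proof
    assume "size X = 1"
    then obtain y where y: "X = {#y#}" using size_1_singleton_mset by blast
    then have "y = inv x" using mset_subset_eqD[OF X(1), of y] by simp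
    then show ?thesis using X(2) y assms prod_one_single by auto
  qed simp
qed

lemma (in group) atom_times_inverse:
  assumes "U \<in> product_one_atoms G" "2 \<le> size U"
  shows "fact_len G (size U) (U + image_mset (\<lambda>x. inv x) U)"
proof -
  have "\<one> \<notin># U" using atom_one[OF assms(1)] assms(2) by auto
  have "fact_len G (size S) (S + image_mset (\<lambda>x. inv x) S)" if "set_mset S \<subseteq> carrier G - {\<one>}" for S
    using that
  proof (induction S)
    case (add x S)
    then have "{#x, inv x#} \<in> product_one_atoms G" using pair_atom by auto
    moreover have "add_mset x S + image_mset (\<lambda>x. inv x) (add_mset x S) = {#x, inv x#} + (S + image_mset (\<lambda>x. inv x) S)"
      by simp
    ultimately show ?case using add unfolding size_add_mset fact_len_Suc by (metis Diff_iff insert_subset set_mset_add_mset_insert)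
  qed simp
  then show ?thesis using atom_carrier[OF assms(1)] \<open>\<one> \<notin># U\<close> by auto
qed

lemma (in group) system_large_Davenport:
  assumes fin: "finite (carrier G)" and d: "2 \<le> large_Davenport G"
  shows "\<exists>L \<in> system_of_lengths G. 2 \<in> L \<and> large_Davenport G \<in> L"
proof -
  obtain U where U: "U \<in> product_one_atoms G" "size U = large_Davenport G"
    using large_Davenport_eqD(2)[OF is_group fin] by blast
  let ?S = "U + image_mset (\<lambda>x. inv x) U"
  have "fact_len G 2 ?S" unfolding fact_len_2 using U(1) inverse_atom[OF U(1)] by blast
  moreover have "fact_len G (large_Davenport G) ?S" using atom_times_inverse[OF U(1)] U d by simp
  moreover have "prod_one G ?S" by (rule prod_one_add[OF atom_prod_one[OF U(1)] atom_prod_one[OF inverse_atom[OF U(1)]]])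
  then have "{k. fact_len G k ?S} \<in> system_of_lengths G"
    unfolding mem_system_of_lengths by (intro exI[of _ ?S] conjI refl)
  ultimately show ?thesis by (intro bexI[of _ "{k. fact_len G k ?S}"]) simp_all
qed

text \<open>For k \<ge> 3 there is no identity term, so k factors need 2 k terms, while two atoms
  supply at most twice the Davenport constant.\<close>

lemma (in group) two_in_length_le:
  assumes fin: "finite (carrier G)" and L: "L \<in> system_of_lengths G" "2 \<in> L" "k \<in> L" "3 \<le> k"
  shows "k \<le> large_Davenport G"
proof -
  obtain S where S: "L = {k. fact_len G k S}" using L(1) by (auto simp: mem_system_of_lengths)
  then obtain U V where UV: "U \<in> product_one_atoms G" "V \<in> product_one_atoms G" "S = U + V"
    using L(2) fact_len_2[of G S] by auto
  have k: "fact_len G k (U + V)" using L(3) S UV(3) by simp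
  have "2 * k \<le> size (U + V)"
    using fact_len_size_ge[OF is_group two_atoms_no_one[OF UV(1,2) k L(4)] k] .
  then show ?thesis
    using large_Davenport_eqD(1)[OF is_group fin UV(1)] large_Davenport_eqD(1)[OF is_group fin UV(2)] by simp
qed

text \<open>Each group's longest atom provides a set of lengths that bounds the constant of the
  other group from below.\<close>

lemma Davenport_6_transfer:
  assumes G: "group G" "finite (carrier G)" "large_Davenport G = 6"
    and H: "group H" "finite (carrier H)" and eq: "system_of_lengths H = system_of_lengths G"
  shows "large_Davenport H = 6"
proof -
  obtain L where L: "L \<in> system_of_lengths H" "2 \<in> L" "6 \<in> L"
    using group.system_large_Davenport[OF G(1,2)] G(3) eq by auto
  have ge: "6 \<le> large_Davenport H" using group.two_in_length_le[OF H L] by simp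
  obtain K where K: "K \<in> system_of_lengths G" "2 \<in> K" "large_Davenport H \<in> K"
    using group.system_large_Davenport[OF H] ge eq by auto
  then have "large_Davenport H \<le> 6" using group.two_in_length_le[OF G(1,2) K] ge G(3) by simp
  then show ?thesis using ge by simp
qed

lemma davenport_6I:
  assumes "group G" "finite (carrier G)" "large_Davenport G = 6"
  shows "davenport_6 G"
proof -
  interpret group G by fact
  show ?thesis
    using assms large_Davenport_eqD[OF assms(1,2)] by unfold_locales auto
qed

text \<open>Lists of atoms dividing a given sequence, restricted to finitely many candidates, turn the
  determination of a set of lengths into a system of linear equations for the multiplicities.\<close>

lemma sum_list_mset_distinct:
  fixes As :: "'x multiset list"
  assumes "set As \<subseteq> set Cs" "distinct Cs"
  shows "sum_list As = (\<Sum>C\<leftarrow>Cs. repeat_mset (count_list As C) C)"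
    and "length As = (\<Sum>C\<leftarrow>Cs. count_list As C)"
proof -
  show "length As = (\<Sum>C\<leftarrow>Cs. count_list As C)"
    using assms sum_count_set[OF assms(1)] by (simp add: sum_list_distinct_conv_sum_set)
  show "sum_list As = (\<Sum>C\<leftarrow>Cs. repeat_mset (count_list As C) C)"
    using assms(1)
  proof (induction As)
    case Nil
    then show ?case by (induction Cs) auto
  next
    case (Cons A As)
    have "(\<Sum>C\<leftarrow>Cs. repeat_mset (count_list (A # As) C) C)
        = (\<Sum>C\<leftarrow>Cs. (if C = A then C else {#}) + repeat_mset (count_list As C) C)"
      by (intro arg_cong[of _ _ sum_list] map_cong) auto
    also have "\<dots> = (\<Sum>C\<leftarrow>Cs. if C = A then C else {#}) + sum_list As"
      using Cons by (simp add: sum_list_addf)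
    also have "(\<Sum>C\<leftarrow>Cs. if C = A then C else {#}) = A"
      using Cons.prems assms(2) by (simp add: sum_list_distinct_conv_sum_set sum.delta')
    finally show ?case by simp
  qed
qed

lemma fact_len_candidates:
  assumes "fact_len G k S" "\<And>A. A \<in> product_one_atoms G \<Longrightarrow> A \<subseteq># S \<Longrightarrow> A \<in> set Cs" "distinct Cs"
  obtains n where "S = (\<Sum>C\<leftarrow>Cs. repeat_mset (n C) C)" "k = (\<Sum>C\<leftarrow>Cs. n C)"
proof -
  obtain As where As: "length As = k" "set As \<subseteq> product_one_atoms G" "sum_list As = S"
    using assms(1) by (auto simp: fact_len_def)
  have "A \<subseteq># sum_list As" if "A \<in> set As" for A
    using that by (induction As) (auto intro: subset_mset.order_trans)
  then have "set As \<subseteq> set Cs" using As assms(2) by blast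
  then show ?thesis using that sum_list_mset_distinct[OF _ assms(3)] As by metis
qed

text \<open>In length at most five, one of two factors has length at most two.\<close>

lemma (in group) small_atomI:
  assumes S: "prod_one G S" "S \<noteq> {#}" "size S \<le> 5" "\<one> \<notin># S"
    and pairs: "\<And>x y. x \<in># S \<Longrightarrow> y \<in># S \<Longrightarrow> {#x, y#} \<subseteq># S \<Longrightarrow> x \<otimes> y = \<one> \<Longrightarrow> prod_one G (S - {#x, y#}) \<Longrightarrow> S = {#x, y#}"
  shows "S \<in> product_one_atoms G"
proof -
  have small: "T = {#} \<or> U = {#}" if TU: "prod_one G T" "prod_one G U" "S = T + U" "size T \<le> 2" for T U
  proof -
    consider "size T = 0" | "size T = 1" | "size T = 2" using TU(4) by linarith
    then show ?thesis
    proof cases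
      case 2
      then obtain x where "T = {#x#}" using size_1_singleton_mset by blast
      then show ?thesis using TU S(4) prod_one_single by auto
    next
      case 3
      then obtain x T' where T': "T = add_mset x T'" using size_eq_Suc_imp_eq_union[of T 1] by auto
      then have "size T' = 1" using 3 by simp
      then obtain y where "T' = {#y#}" using size_1_singleton_mset by blast
      then have xy: "T = {#x, y#}" using T' by simp
      then have "x \<otimes> y = \<one>" using TU(1) prod_one_pair by blast
      then have "S = {#x, y#}" using pairs[of x y] TU xy by auto
      then show ?thesis using TU(3) xy by simp
    qed auto
  qed
  have "T = {#} \<or> U = {#}" if "prod_one G T" "prod_one G U" "S = T + U" for T U
  proof -
    have "size T \<le> 2 \<or> size U \<le> 2" using S(3) that(3) by auto
    then show ?thesis using small[of T U] small[of U T] that by (auto simp: add.commute)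
  qed
  then show ?thesis using S by (auto simp: product_one_atoms_iff)
qed

text \<open>A repeated element splits off as a pair, because removing it does not change the
  product.\<close>

lemma (in group) elementary_balanced:
  assumes e2: "\<And>x. x \<in> carrier G \<Longrightarrow> x \<otimes> x = \<one>"
    and U: "U \<in> product_one_atoms G" and x: "2 \<le> count U x"
  shows "U = {#x, x#}"
proof -
  have xU: "{#x, x#} \<subseteq># U" using x by (intro mset_subset_eqI) auto
  then obtain W where W: "U = {#x, x#} + W" by (metis subset_mset.add_diff_inverse)
  have Uc: "set_mset U \<subseteq> carrier G" using U by (rule atom_carrier)
  have xc: "x \<in> carrier G" using Uc W by auto
  have px: "prod_one G {#x, x#}" using prod_one_pair xc e2 by blast
  have comm: "a \<otimes> b = b \<otimes> a" if "a \<in> carrier G" "b \<in> carrier G" for a b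
  proof -
    have "a \<otimes> b = inv (a \<otimes> b)" using e2 that by (metis inv_equality m_closed)
    also have "\<dots> = inv b \<otimes> inv a" using that by (rule inv_mult_group)
    finally show ?thesis using that square_one_imp_inv e2 by metis
  qed
  interpret comm_group G using comm by (intro group_comm_groupI) auto
  obtain us where us: "mset us = U" "lprod us = \<one>"
    using atom_prod_one[OF U] by (auto simp: carrier_product_one_monoid_iff)
  obtain ws where ws: "mset ws = W" using ex_mset by blast
  have "set_mset W \<subseteq> carrier G" using Uc W by auto
  then have c: "set us \<subseteq> carrier G" "set ws \<subseteq> carrier G" using Uc us(1) ws by (metis set_mset_mset)+
  have "lprod (x # x # ws) = \<one>"
    using multlist_perm_cong[of "x # x # ws" us] us ws W xc c by simp
  moreover have "lprod (x # x # ws) = (x \<otimes> x) \<otimes> lprod ws" using xc c by (simp add: m_assoc)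
  ultimately have "lprod ws = \<one>" using e2[OF xc] c by simp
  then have "prod_one G W" using c ws by (intro prod_oneI) auto
  then have "W = {#}" using atom_split[of "{#x, x#}" W G] U W px by auto
  then show ?thesis using W by simp
qed

text \<open>Counting identities twice gives every atom weight at least two, including the atom with
  one term.\<close>

lemma fact_len_size_count_one:
  assumes G: "group G" and "fact_len G k S"
  shows "2 * k \<le> size S + count S \<one>\<^bsub>G\<^esub>"
  using assms(2)
proof (induction k arbitrary: S)
  case (Suc k)
  then obtain A T where A: "A \<in> product_one_atoms G" "fact_len G k T" "S = A + T" by (auto simp: fact_len_Suc)
  have "size A \<noteq> 0" using A(1) atom_nonempty by auto
  moreover have "count A \<one>\<^bsub>G\<^esub> = 1" if s1: "size A = 1"
  proof -
    obtain x where x: "A = {#x#}" using s1 size_1_singleton_mset by blast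
    then have "x = \<one>\<^bsub>G\<^esub>" using A(1) group.prod_one_single[OF G, of x] atom_prod_one by fastforce
    then show ?thesis using x by simp
  qed
  ultimately have "2 \<le> size A + count A \<one>\<^bsub>G\<^esub>" by linarith
  then show ?case using Suc.IH[OF A(2)] A(3) by simp
qed simp

section \<open>Balanced sequences and maximal lengths\<close>

lemma pair_subset_mset: "x \<noteq> y \<Longrightarrow> x \<in># S \<Longrightarrow> y \<in># S \<Longrightarrow> {#x, y#} \<subseteq># S"
  by (intro mset_subset_eqI) (auto simp: Suc_le_eq)

text \<open>The terms can be grouped into pairs of an element and its inverse; self-inverse
  elements, among them the identity, therefore occur an even number of times.\<close>

definition (in group) balanced :: "'a multiset \<Rightarrow> bool" where
  "balanced S \<longleftrightarrow> (\<forall>x\<in>carrier G. if inv x = x then even (count S x) else count S x = count S (inv x))"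

lemma (in group) balanced_add:
  assumes "balanced S" "balanced T" shows "balanced (S + T)"
  unfolding balanced_def
proof
  fix x assume "x \<in> carrier G"
  then show "if inv x = x then even (count (S + T) x) else count (S + T) x = count (S + T) (inv x)"
    using bspec[OF assms(1)[unfolded balanced_def], of x] bspec[OF assms(2)[unfolded balanced_def], of x]
    by (cases "inv x = x") simp_all
qed

lemma (in group) balancedD:
  assumes "balanced S" "x \<in> carrier G"
  shows "inv x = x \<Longrightarrow> even (count S x)" "inv x \<noteq> x \<Longrightarrow> count S (inv x) = count S x"
  using bspec[OF assms(1)[unfolded balanced_def] assms(2)] by simp_all

lemma (in group) balanced_cancel:
  assumes "balanced (S + T)" "balanced S" shows "balanced T"
  unfolding balanced_def
proof
  fix x assume "x \<in> carrier G"
  then show "if inv x = x then even (count T x) else count T x = count T (inv x)"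
    using bspec[OF assms(1)[unfolded balanced_def], of x] bspec[OF assms(2)[unfolded balanced_def], of x]
    by (cases "inv x = x") simp_all
qed

lemma (in group) balanced_pair:
  assumes "x \<in> carrier G" shows "balanced {#x, inv x#}"
  unfolding balanced_def
proof
  fix t assume t: "t \<in> carrier G"
  have "inv t = x \<longleftrightarrow> t = inv x" "inv t = inv x \<longleftrightarrow> t = x" using t assms by (metis inv_inv)+
  then show "if inv t = t then even (count {#x, inv x#} t) else count {#x, inv x#} t = count {#x, inv x#} (inv t)"
    using assms t by auto
qed

text \<open>The equation size S = 2 k forces all k factors to have exactly two terms, so each is an
  inverse pair.\<close>

lemma (in group) fact_len_balanced:
  assumes "fact_len G k S" "size S = 2 * k" "\<one> \<notin># S"
  shows "balanced S"
  using assms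
proof (induction k arbitrary: S)
  case 0
  then show ?case by (simp add: balanced_def)
next
  case (Suc k)
  then obtain A T where A: "A \<in> product_one_atoms G" "fact_len G k T" "S = A + T" by (auto simp: fact_len_Suc)
  have o: "\<one> \<notin># A" "\<one> \<notin># T" using A(3) Suc.prems(3) by auto
  have "2 * 1 \<le> size A" using fact_len_size_ge[OF is_group o(1), of 1] A(1) fact_len_1[of G A] by simp
  moreover have "2 * k \<le> size T" using fact_len_size_ge[OF is_group o(2) A(2)] .
  ultimately have sz: "size A = 2" "size T = 2 * k" using A(3) Suc.prems(2) by auto
  then obtain x A' where A': "A = add_mset x A'" using size_eq_Suc_imp_eq_union[of A 1] by auto
  then have "size A' = 1" using sz by simp
  then obtain y where "A' = {#y#}" using size_1_singleton_mset by blast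
  then have xy: "A = {#x, y#}" using A' by simp
  then have c: "x \<in> carrier G" "y \<in> carrier G" "x \<otimes> y = \<one>" using prod_one_pair atom_prod_one[OF A(1)] by auto
  then have y: "y = inv x" using inv_equality[of y x] inv_comm[of x y] by simp
  have "balanced A" using balanced_pair[OF c(1)] xy y by simp
  then show ?case using Suc.IH[OF A(2) sz(2) o(2)] A(3) balanced_add by blast
qed

lemma (in group) balanced_fact_len:
  assumes "balanced S" "set_mset S \<subseteq> carrier G" "\<one> \<notin># S" "size S = 2 * k"
  shows "fact_len G k S"
  using assms
proof (induction k arbitrary: S)
  case (Suc k)
  then obtain x where x: "x \<in># S" by (metis multiset_nonemptyE mult_is_0 nat.distinct(1) size_empty zero_neq_numeral)
  have xc: "x \<in> carrier G" "x \<noteq> \<one>" using x Suc.prems by auto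
  have sub: "{#x, inv x#} \<subseteq># S"
  proof (cases "inv x = x")
    case True
    have "even (count S x)" using balancedD(1)[OF Suc.prems(1) xc(1) True] .
    moreover have "1 \<le> count S x" using x by (simp add: Suc_le_eq)
    ultimately have "2 \<le> count S x" by presburger
    then show ?thesis unfolding True by (intro mset_subset_eqI) auto
  next
    case False
    have "count S (inv x) = count S x" using balancedD(2)[OF Suc.prems(1) xc(1) False] .
    then have "inv x \<in># S" using x by (simp flip: count_greater_zero_iff)
    then show ?thesis using False x by (intro pair_subset_mset) auto
  qed
  define T where "T = S - {#x, inv x#}"
  have S: "S = {#x, inv x#} + T" unfolding T_def using sub by (rule subset_mset.add_diff_inverse[symmetric])
  have "balanced T" using balanced_cancel balanced_pair[OF xc(1)] Suc.prems(1) unfolding S by blast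
  then have "fact_len G k T" using Suc.IH[of T] Suc.prems S by auto
  then show ?case using S pair_atom[OF xc] fact_len_Suc by blast
qed simp

text \<open>With the number of terms plus the number of identities as weight, every atom weighs
  between two and six. Lengths k and 3 k force both bounds to be attained throughout: k atoms with
  six terms, and 3 k inverse pairs.\<close>

lemma (in davenport_6) maximal_length:
  assumes "fact_len G k S" "fact_len G (3 * k) S"
  obtains As where "length As = k" "sum_list As = S"
    "\<And>A. A \<in> set As \<Longrightarrow> A \<in> product_one_atoms G \<and> size A = 6" "balanced S" "\<one> \<notin># S"
proof -
  obtain As where As: "length As = k" "set As \<subseteq> product_one_atoms G" "sum_list As = S"
    using assms(1) by (auto simp: fact_len_def)
  have each: "size A + count A \<one> \<le> 6" if "A \<in> set As" for A
  proof (cases "\<one> \<in># A")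
    case True
    then show ?thesis using atom_one[of A] that As(2) by auto
  next
    case False
    then show ?thesis using atom_size_le[of A] that As(2) by (auto simp: not_in_iff)
  qed
  have sz: "size (sum_list Bs) + count (sum_list Bs) \<one> = (\<Sum>A\<leftarrow>Bs. size A + count A \<one>)" for Bs :: "'a multiset list"
    by (induction Bs) auto
  then have "6 * length As \<le> (\<Sum>A\<leftarrow>As. size A + count A \<one>)"
    using fact_len_size_count_one[OF is_group assms(2)] As sz[of As] by simp
  then have eq: "\<forall>A\<in>set As. size A + count A \<one> = 6"
    using each
  proof (induction As)
    case (Cons A As)
    have "(\<Sum>A\<leftarrow>As. size A + count A \<one>) \<le> 6 * length As"
      using Cons.prems(2) by (induction As) fastforce+
    then show ?case using Cons by fastforce
  qed simp
  have s6: "A \<in> product_one_atoms G \<and> size A = 6 \<and> \<one> \<notin># A" if "A \<in> set As" for A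
  proof -
    have A: "A \<in> product_one_atoms G" "size A + count A \<one> = 6" using that eq As(2) by auto
    then have "\<one> \<notin># A" using atom_one[OF A(1)] by force
    then show ?thesis using A by (auto simp: not_in_iff)
  qed
  have o: "\<one> \<notin># sum_list Bs" if "\<forall>A\<in>set Bs. \<one> \<notin># A" for Bs :: "'a multiset list"
    using that by (induction Bs) auto
  have "size (sum_list Bs) = 6 * length Bs" if "\<forall>A\<in>set Bs. size A = 6" for Bs :: "'a multiset list"
    using that by (induction Bs) auto
  then have "size S = 2 * (3 * k)" using s6 As by fastforce
  then have "balanced S" using fact_len_balanced[OF assms(2)] o[of As] s6 As by blast
  then show ?thesis using that[OF As(1,3)] s6 o[of As] As by blast
qed

subsection \<open>Cyclic groups of order six and elementary abelian groups\<close>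

lemma (in group) commutative_complement:
  assumes comm: "\<And>x y. x \<in> carrier G \<Longrightarrow> y \<in> carrier G \<Longrightarrow> x \<otimes> y = y \<otimes> x"
    and "prod_one G (A + B)" "prod_one G A"
  shows "prod_one G B"
proof -
  interpret comm_group G using comm by (intro group_comm_groupI) auto
  obtain us xs ys where us: "mset us = A + B" "lprod us = \<one>" and xs: "mset xs = A" "lprod xs = \<one>" and ys: "mset ys = B"
    using assms(2,3) ex_mset[of B] by (auto simp: carrier_product_one_monoid_iff)
  have "set us \<subseteq> carrier G" "set xs \<subseteq> carrier G" "set ys \<subseteq> carrier G"
    using prod_one_carrier[OF assms(2)] us(1) xs(1) ys by (metis Un_subset_iff set_mset_mset set_mset_union)+
  then have c: "set us \<subseteq> carrier G" "set xs \<subseteq> carrier G" "set ys \<subseteq> carrier G" by auto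
  have "mset us = mset (xs @ ys)" using us xs ys by simp
  then have "lprod (xs @ ys) = \<one>" using multlist_perm_cong[of "xs @ ys" us] c us by simp
  then have "lprod ys = \<one>" using foldr_mult_append[of xs ys] c xs by simp
  then show ?thesis using c ys by (intro prod_oneI) auto
qed

lemma (in group) commutative_atom_eq:
  assumes comm: "\<And>x y. x \<in> carrier G \<Longrightarrow> y \<in> carrier G \<Longrightarrow> x \<otimes> y = y \<otimes> x"
    and "A \<in> product_one_atoms G" "X \<subseteq># A" "prod_one G X" "X \<noteq> {#}"
  shows "A = X"
proof -
  have A: "A = X + (A - X)" using assms(3) by simp
  then have "prod_one G (A - X)" using commutative_complement[OF comm, of X "A - X"] atom_prod_one[OF assms(2)] assms(4) by simp
  then have "A - X = {#}" using atom_split[of X "A - X" G] A assms by auto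
  then show ?thesis using A by simp
qed

context davenport_6
begin

text \<open>For an atom x y c d e f the five proper initial products are distinct and nontrivial, so
  they exhaust the nonidentity elements and y is one of them. Any coincidence other than y = x would
  give a short product-one subsequence; thus any two terms agree.\<close>

lemma order_6_atom:
  assumes comm: "\<And>x y. x \<in> carrier G \<Longrightarrow> y \<in> carrier G \<Longrightarrow> x \<otimes> y = y \<otimes> x"
    and card: "card (carrier G) = 6" and U: "U \<in> product_one_atoms G" "size U = 6"
  obtains x where "x \<in> carrier G" "U = replicate_mset 6 x"
proof -
  have Uc: "set_mset U \<subseteq> carrier G" using U(1) by (rule atom_carrier)
  have sub: "lprod xs \<noteq> \<one>" if "mset xs \<subseteq># U" "xs \<noteq> []" "length xs < 6" for xs
    using commutative_atom_sub[OF comm U(1) that(1)] that(2,3) U(2) by (metis size_mset nat_neq_iff)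
  have eq: "x = y" if xy: "{#x, y#} \<subseteq># U" for x y
  proof -
    obtain W where W: "U = {#x, y#} + W" using xy by (metis subset_mset.add_diff_inverse)
    obtain ws where ws: "mset ws = W" using ex_mset by blast
    have "length ws = 4" using arg_cong[OF W, of size] U(2) ws by auto
    then obtain c d e f where w: "ws = [c, d, e, f]" by (auto simp: length_Suc_conv eval_nat_numeral)
    have Ueq: "U = mset [x, y, c, d, e, f]" using W ws w by simp
    have cc: "x \<in> carrier G" "y \<in> carrier G" "c \<in> carrier G" "d \<in> carrier G" "e \<in> carrier G"
      using Uc Ueq by auto
    \<comment> \<open>These inequalities keep the initial products apart and nontrivial, and exclude
      that y equals one of them other than x.\<close>
    have ne: "lprod [x] \<noteq> \<one>" "lprod [y] \<noteq> \<one>" "lprod [c] \<noteq> \<one>" "lprod [d] \<noteq> \<one>" "lprod [e] \<noteq> \<one>"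
      "lprod [x, y] \<noteq> \<one>" "lprod [y, c] \<noteq> \<one>" "lprod [c, d] \<noteq> \<one>" "lprod [d, e] \<noteq> \<one>" "lprod [x, c] \<noteq> \<one>"
      "lprod [x, y, c] \<noteq> \<one>" "lprod [y, c, d] \<noteq> \<one>" "lprod [c, d, e] \<noteq> \<one>" "lprod [x, c, d] \<noteq> \<one>"
      "lprod [x, y, c, d] \<noteq> \<one>" "lprod [y, c, d, e] \<noteq> \<one>" "lprod [x, c, d, e] \<noteq> \<one>" "lprod [x, y, c, d, e] \<noteq> \<one>"
      by (rule sub; (simp add: Ueq; intro mset_subset_eqI; simp)?; simp)+
    define P where "P = {x, x \<otimes> y, x \<otimes> y \<otimes> c, x \<otimes> y \<otimes> c \<otimes> d, x \<otimes> y \<otimes> c \<otimes> d \<otimes> e}"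
    have "card P = 5" using cc ne by (simp add: P_def m_assoc)
    moreover have "P \<subseteq> carrier G - {\<one>}" using cc ne by (auto simp: P_def m_assoc)
    moreover have "card (carrier G - {\<one>}) = 5" using card finite_carrier by simp
    ultimately have "P = carrier G - {\<one>}" using finite_carrier by (metis card_subset_eq finite_Diff)
    then have "y \<in> P" using cc ne by auto
    moreover have "x \<otimes> y = y \<otimes> x" using comm cc by blast
    ultimately show "x = y"
      using cc ne unfolding P_def by (auto simp: m_assoc)
  qed
  obtain x where x: "x \<in># U" using U(2) by (metis multiset_nonemptyE size_empty zero_neq_numeral)
  have "y = x" if y: "y \<in># U" for y
  proof (rule ccontr)
    assume "y \<noteq> x"
    then have "{#x, y#} \<subseteq># U" using x y by (intro mset_subset_eqI) (auto simp: Suc_le_eq)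
    then show False using eq \<open>y \<noteq> x\<close> by blast
  qed
  then have "U = replicate_mset 6 x" using U(2) by (metis set_mset_subset_singletonD singletonI subsetI)
  then show ?thesis using that x Uc by blast
qed

lemma order_6_no_square:
  assumes "x \<in> carrier G" "replicate_mset 6 x \<in> product_one_atoms G"
  shows "inv x \<noteq> x"
proof
  assume "inv x = x"
  then have "prod_one G (replicate_mset 2 x)" using assms(1) prod_one_pair[of x x] r_inv[of x] by (simp add: numeral_2_eq_2)
  moreover have "replicate_mset 4 x = replicate_mset 2 x + replicate_mset 2 x" by (intro multiset_eqI) simp
  moreover have "prod_one G (replicate_mset 4 x)" using prod_one_add[OF calculation(1,1)] calculation(2) by simp
  moreover have "replicate_mset 6 x = replicate_mset 2 x + replicate_mset 4 x" by (intro multiset_eqI) simp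
  ultimately show False using atom_split[of "replicate_mset 2 x" "replicate_mset 4 x" G] assms(2) by auto
qed

text \<open>Lengths 2 and 6 force the sequence x^6 x^-6, whose dividing atoms are x x^-1 and the two
  sixth powers. Three sixth powers cannot be balanced, since their bases would have to be paired off
  with inverses.\<close>

lemma order_6_lengths:
  assumes comm: "\<And>x y. x \<in> carrier G \<Longrightarrow> y \<in> carrier G \<Longrightarrow> x \<otimes> y = y \<otimes> x"
    and card: "card (carrier G) = 6" and L: "L \<in> system_of_lengths G"
  shows "{2, 6} \<subseteq> L \<Longrightarrow> 3 \<notin> L \<and> 4 \<notin> L" and "\<not> {3, 9} \<subseteq> L"
proof -
  obtain S where S: "L = {k. fact_len G k S}" using L by (auto simp: mem_system_of_lengths)
  show "3 \<notin> L \<and> 4 \<notin> L" if "{2, 6} \<subseteq> L"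
  proof -
    have "fact_len G 2 S" "fact_len G (3 * 2) S" using that S by auto
    then obtain As where As: "length As = 2" "sum_list As = S"
      "\<And>A. A \<in> set As \<Longrightarrow> A \<in> product_one_atoms G \<and> size A = 6" "balanced S" "\<one> \<notin># S"
      using maximal_length by metis
    obtain A B where AB: "As = [A, B]" using As(1) by (auto simp: length_Suc_conv numeral_2_eq_2)
    obtain x where x: "x \<in> carrier G" "A = replicate_mset 6 x" using order_6_atom[OF comm card, of A] As(3) AB by auto
    obtain y where y: "y \<in> carrier G" "B = replicate_mset 6 y" using order_6_atom[OF comm card, of B] As(3) AB by auto
    have Sxy: "S = replicate_mset 6 x + replicate_mset 6 y" using As(2) AB x y by simp
    have ix: "inv x \<noteq> x" using order_6_no_square[OF x(1)] As(3)[of A] AB x by auto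
    have "count S (inv x) = count S x" using balancedD(2)[OF As(4) x(1) ix] .
    then have yx: "y = inv x" using Sxy ix by (auto split: if_splits)
    have A6: "replicate_mset 6 x \<in> product_one_atoms G" "replicate_mset 6 (inv x) \<in> product_one_atoms G"
      using As(3) AB x y yx by auto
    have cand: "C \<in> set [{#x, inv x#}, replicate_mset 6 x, replicate_mset 6 (inv x)]"
      if C: "C \<in> product_one_atoms G" "C \<subseteq># S" for C
    proof -
      have Cx: "set_mset C \<subseteq> {x, inv x}" using set_mset_mono[OF C(2)] Sxy yx by auto
      show ?thesis
      proof (cases "x \<in># C \<and> inv x \<in># C")
        case True
        then have "{#x, inv x#} \<subseteq># C" using ix by (intro mset_subset_eqI) (auto simp: Suc_le_eq)
        then show ?thesis using commutative_atom_eq[OF comm C(1)] x prod_one_pair by auto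
      next
        case False
        then obtain w where w: "w \<in> {x, inv x}" "set_mset C \<subseteq> {w}" using Cx by blast
        then obtain n where n: "C = replicate_mset n w" by (metis set_mset_subset_singletonD)
        have w6: "replicate_mset 6 w \<in> product_one_atoms G" using w A6 by auto
        have "n \<le> 6" using mset_subset_eq_count[OF C(2), of w] n w Sxy yx ix by (auto split: if_splits)
        then have "C \<subseteq># replicate_mset 6 w" using n by (intro mset_subset_eqI) auto
        then have "C = replicate_mset 6 w"
          using commutative_atom_eq[OF comm w6] atom_prod_one[OF C(1)] atom_nonempty[OF C(1)] by auto
        then show ?thesis using w by auto
      qed
    qed
    have no: False if fk: "fact_len G k S" and k34: "k = 3 \<or> k = 4" for k
    proof -
      have d: "distinct [{#x, inv x#}, replicate_mset 6 x, replicate_mset 6 (inv x)]"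
        using ix by (auto simp: multiset_eq_iff eval_nat_numeral split: if_splits)
      obtain n where n: "S = (\<Sum>C\<leftarrow>[{#x, inv x#}, replicate_mset 6 x, replicate_mset 6 (inv x)]. repeat_mset (n C) C)"
        "k = (\<Sum>C\<leftarrow>[{#x, inv x#}, replicate_mset 6 x, replicate_mset 6 (inv x)]. n C)"
        using fact_len_candidates[OF fk cand d] by blast
      have c6: "count S x = 6" "count S (inv x) = 6" using Sxy yx ix by auto
      define p q r where pqr: "p = n {#x, inv x#}" "q = n (replicate_mset 6 x)" "r = n (replicate_mset 6 (inv x))"
      have "count S x = p + q * 6" using arg_cong[OF n(1), of "\<lambda>M. count M x"] ix by (simp add: pqr)
      then have e1: "p + q * 6 = 6" using c6 by simp
      have "count S (inv x) = p + r * 6"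
        using arg_cong[OF n(1), of "\<lambda>M. count M (inv x)"] ix ix[symmetric] by (simp add: pqr)
      then have e2: "p + r * 6 = 6" using c6 by simp
      have e3: "k = p + q + r" using n(2) by (simp add: pqr)
      \<comment> \<open>The equations p + 6 q = 6 = p + 6 r leave only lengths two and six.\<close>
      have "q = r" "q = 0 \<or> q = 1" using e1 e2 by linarith+
      then show False using e1 e3 k34 by auto
    qed
    then show ?thesis using S by auto
  qed
  show "\<not> {3, 9} \<subseteq> L"
  proof
    assume "{3, 9} \<subseteq> L"
    then have "fact_len G 3 S" "fact_len G (3 * 3) S" using S by auto
    then obtain As where As: "length As = 3" "sum_list As = S"
      "\<And>A. A \<in> set As \<Longrightarrow> A \<in> product_one_atoms G \<and> size A = 6" "balanced S" "\<one> \<notin># S"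
      using maximal_length by metis
    obtain A B C where AB: "As = [A, B, C]" using As(1) by (auto simp: length_Suc_conv numeral_3_eq_3)
    obtain x where x: "x \<in> carrier G" "A = replicate_mset 6 x" using order_6_atom[OF comm card, of A] As(3) AB by auto
    obtain y where y: "y \<in> carrier G" "B = replicate_mset 6 y" using order_6_atom[OF comm card, of B] As(3) AB by auto
    obtain w where w: "w \<in> carrier G" "C = replicate_mset 6 w" using order_6_atom[OF comm card, of C] As(3) AB by auto
    have Sxy: "S = replicate_mset 6 x + replicate_mset 6 y + replicate_mset 6 w" using As(2) AB x y w by (simp add: add.assoc)
    have i: "inv x \<noteq> x" "inv y \<noteq> y" "inv w \<noteq> w" using order_6_no_square As(3) AB x y w by auto
    have "count S (inv x) = count S x" "count S (inv y) = count S y" "count S (inv w) = count S w"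
      using balancedD(2)[OF As(4)] x(1) y(1) w(1) i by blast+
    moreover have "count S t = (if x = t then 6 else 0) + (if y = t then 6 else 0) + (if w = t then 6 else 0)" for t
      unfolding Sxy by simp
    ultimately show False using i x(1) y(1) w(1) by (auto split: if_splits)
  qed
qed

end

section \<open>Elementary abelian groups\<close>

lemma (in group) atom_fact_len:
  assumes "A \<in> product_one_atoms G" "fact_len G k A" shows "k = 1"
proof (cases k)
  case 0
  then show ?thesis using assms atom_nonempty by auto
next
  case (Suc l)
  then obtain C T where CT: "C \<in> product_one_atoms G" "fact_len G l T" "A = C + T"
    using assms(2) by (auto simp: fact_len_Suc)
  have "C = {#} \<or> T = {#}"
    using atom_split[of C T G] assms(1) CT atom_prod_one[OF CT(1)] fact_len_prod_one[OF is_group CT(2)] by simp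
  then have "T = {#}" using atom_nonempty[OF CT(1)] by simp
  then have "l = 0" using CT(2) by (cases l) (auto simp: fact_len_Suc dest: atom_nonempty)
  then show ?thesis using Suc by simp
qed

text \<open>Atoms of length six have distinct terms, so a balanced product of two of them is A A. A
  factor without repeated terms divides A and equals it, and the cofactor is A; otherwise all
  factors are pairs.\<close>

lemma (in davenport_6) elementary_lengths:
  assumes e2: "\<And>x. x \<in> carrier G \<Longrightarrow> x \<otimes> x = \<one>"
    and comm: "\<And>x y. x \<in> carrier G \<Longrightarrow> y \<in> carrier G \<Longrightarrow> x \<otimes> y = y \<otimes> x"
    and L: "L \<in> system_of_lengths G" "{2, 6} \<subseteq> L"
  shows "L \<subseteq> {2, 6}"
proof
  fix k assume k: "k \<in> L"
  obtain S where S: "L = {k. fact_len G k S}" using L by (auto simp: mem_system_of_lengths)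
  have "fact_len G 2 S" "fact_len G (3 * 2) S" using L(2) S by auto
  then obtain As where As: "length As = 2" "sum_list As = S"
    "\<And>A. A \<in> set As \<Longrightarrow> A \<in> product_one_atoms G \<and> size A = 6" "balanced S" "\<one> \<notin># S"
    using maximal_length by metis
  obtain A B where AB: "As = [A, B]" using As(1) by (auto simp: length_Suc_conv numeral_2_eq_2)
  have at: "A \<in> product_one_atoms G" "B \<in> product_one_atoms G" "size A = 6" "size B = 6" using As(3) AB by auto
  have SAB: "S = A + B" using As(2) AB by simp
  have sq: "count C x \<le> 1" if C: "C \<in> product_one_atoms G" "size C = 6" for C x
  proof (rule ccontr)
    assume "\<not> count C x \<le> 1"
    then have "C = {#x, x#}" using elementary_balanced[OF e2 C(1), of x] by simp
    then show False using C(2) by simp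
  qed
  \<comment> \<open>Multiplicities in A and in B are zero or one, and their sum is even.\<close>
  have "A = B"
  proof (rule multiset_eqI)
    fix x
    show "count A x = count B x"
    proof (cases "x \<in> carrier G")
      case True
      then have "even (count S x)" using balancedD(1)[OF As(4) True] square_one_imp_inv[OF True e2] by blast
      then show ?thesis using sq[OF at(1,3), of x] sq[OF at(2,4), of x] SAB
        by (auto simp: le_Suc_eq)
    next
      case False
      then show ?thesis using atom_carrier[OF at(1)] atom_carrier[OF at(2)] by (metis count_inI subsetD)
    qed
  qed
  obtain Bs where Bs: "length Bs = k" "set Bs \<subseteq> product_one_atoms G" "sum_list Bs = S"
    using k S by (auto simp: fact_len_def)
  show "k \<in> {2, 6}"
  proof (cases "A \<in> set Bs")
    case True
    then obtain us vs where uv: "Bs = us @ A # vs" by (meson split_list)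
    then have "sum_list (us @ vs) = A" using Bs(3) SAB \<open>A = B\<close> by (simp add: ac_simps)
    then have "fact_len G (length (us @ vs)) A" unfolding fact_len_def using Bs(2) uv by (intro exI[of _ "us @ vs"]) auto
    then have "length (us @ vs) = 1" using atom_fact_len[OF at(1)] by blast
    then show ?thesis using Bs(1) uv by auto
  next
    case False
    have two: "size C = 2" if C: "C \<in> set Bs" for C
    proof -
      have Ca: "C \<in> product_one_atoms G" using C Bs(2) by blast
      have CS: "C \<subseteq># S" using C Bs(3) by (metis mset_subset_eq_add_left split_list sum_list.Cons sum_list.append union_lcomm)
      have "\<exists>x. 2 \<le> count C x"
      proof (rule ccontr)
        assume no: "\<nexists>x. 2 \<le> count C x"
        have "C \<subseteq># A"
        proof (rule mset_subset_eqI)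
          fix x
          have "count C x \<le> 1" using no by (metis not_less_eq_eq numeral_2_eq_2 One_nat_def)
          moreover have "count C x \<le> count A x + count A x" using mset_subset_eq_count[OF CS, of x] SAB \<open>A = B\<close> by simp
          ultimately show "count C x \<le> count A x" by linarith
        qed
        then have "A = C" using commutative_atom_eq[OF comm at(1)] atom_prod_one[OF Ca] atom_nonempty[OF Ca] by blast
        then show False using False C by simp
      qed
      then show ?thesis using elementary_balanced[OF e2 Ca] by fastforce
    qed
    have "size (sum_list Cs) = 2 * length Cs" if "\<forall>C\<in>set Cs. size C = 2" for Cs :: "'a multiset list"
      using that by (induction Cs) auto
    then have "size S = 2 * k" using two Bs by metis
    then show ?thesis using SAB at by simp
  qed
qed

text \<open>For distinct terms the possible factors correspond to sublists, so irreducibility of a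
  concrete sequence can be decided by evaluating \<open>subseqs\<close>.\<close>

lemma (in comm_group) distinct_atomI:
  assumes xs: "distinct xs" "set xs \<subseteq> carrier G" "lprod xs = \<one>" "xs \<noteq> []"
    and sub: "\<And>ys. ys \<in> set (subseqs xs) \<Longrightarrow> lprod ys = \<one> \<Longrightarrow> ys = [] \<or> length ys = length xs"
  shows "mset xs \<in> product_one_atoms G"
proof -
  have "T = {#} \<or> U = {#}" if TU: "prod_one G T" "prod_one G U" "mset xs = T + U" for T U
  proof -
    have "T \<subseteq># mset xs" using TU(3) by simp
    then have d: "count T x \<le> 1" for x
      using xs(1) by (metis distinct_count_atmost_1 le_trans le_numeral_extra(4) mset_subset_eq_count zero_le_one)
    have "set_mset T \<in> set ` set (subseqs xs)"
      unfolding subseqs_powset using set_mset_mono[OF \<open>T \<subseteq># mset xs\<close>] by simp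
    then obtain ys where ys: "ys \<in> set (subseqs xs)" "set ys = set_mset T" by auto
    have "distinct ys" using subseqs_distinctD[OF ys(1) xs(1)] .
    have "mset ys = T"
    proof (rule multiset_eqI)
      fix x
      show "count (mset ys) x = count T x"
        using \<open>distinct ys\<close> ys(2) d[of x] by (cases "x \<in># T") (auto simp: distinct_count_atmost_1 count_eq_zero_iff le_Suc_eq)
    qed
    obtain ts where ts: "mset ts = T" "lprod ts = \<one>" using TU(1) by (auto simp: carrier_product_one_monoid_iff)
    have "set ts \<subseteq> carrier G" "set ys \<subseteq> carrier G" using prod_one_carrier[OF TU(1)] ts ys by auto
    then have "lprod ys = \<one>" using multlist_perm_cong[of ys ts] ts \<open>mset ys = T\<close> by simp
    then have "ys = [] \<or> length ys = length xs" using sub ys by blast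
    then have "size T = 0 \<or> size T = size (mset xs)" using \<open>mset ys = T\<close> by auto
    then show ?thesis using TU(3) by auto
  qed
  moreover have "prod_one G (mset xs)" using xs by (intro prod_oneI) auto
  ultimately show ?thesis using xs(4) by (auto simp: product_one_atoms_iff)
qed

abbreviation C2_5_group :: "((((bool \<times> bool) \<times> bool) \<times> bool) \<times> bool) monoid" where
  "C2_5_group \<equiv> (((C2_group \<times>\<times> C2_group) \<times>\<times> C2_group) \<times>\<times> C2_group) \<times>\<times> C2_group"

lemma C2_5_group_props:
  "group C2_5_group" "x \<otimes>\<^bsub>C2_5_group\<^esub> x = \<one>\<^bsub>C2_5_group\<^esub>" "x \<otimes>\<^bsub>C2_5_group\<^esub> y = y \<otimes>\<^bsub>C2_5_group\<^esub> x"
proof -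
  show "group C2_5_group" by (intro DirProd_group group_C2)
  obtain a b c d e where x: "x = ((((a, b), c), d), e)" by (metis surj_pair)
  obtain a' b' c' d' e' where y: "y = ((((a', b'), c'), d'), e')" by (metis surj_pair)
  show "x \<otimes>\<^bsub>C2_5_group\<^esub> x = \<one>\<^bsub>C2_5_group\<^esub>" unfolding x by simp
  show "x \<otimes>\<^bsub>C2_5_group\<^esub> y = y \<otimes>\<^bsub>C2_5_group\<^esub> x" unfolding x y by auto
qed

text \<open>The witness is \<open>(ABC)\<^sup>2\<close> for three pairwise disjoint triples with equal sums such that the union
  of any two of them is an atom.\<close>

lemma C2_5_lengths: "\<exists>L \<in> system_of_lengths C2_5_group. {3, 9} \<subseteq> L"
proof -
  interpret comm_group C2_5_group
    using group.group_comm_groupI[OF C2_5_group_props(1)] C2_5_group_props(3) by blast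
  define A :: "((((bool \<times> bool) \<times> bool) \<times> bool) \<times> bool) list" where
    "A = [((((True, False), False), False), False), ((((False, True), False), False), False), ((((False, False), True), False), False)]"
  define B :: "((((bool \<times> bool) \<times> bool) \<times> bool) \<times> bool) list" where
    "B = [((((False, False), False), True), False), ((((False, False), False), False), True), ((((True, True), True), True), True)]"
  define C :: "((((bool \<times> bool) \<times> bool) \<times> bool) \<times> bool) list" where
    "C = [((((True, False), False), True), False), ((((False, True), False), False), True), ((((False, False), True), True), True)]"
  note defs = A_def B_def C_def
  have 1: "mset (A @ B) \<in> product_one_atoms C2_5_group"
    by (rule distinct_atomI) (auto simp: defs Let_def)
  have 2: "mset (B @ C) \<in> product_one_atoms C2_5_group"
    by (rule distinct_atomI) (auto simp: defs Let_def)
  have 3: "mset (A @ C) \<in> product_one_atoms C2_5_group"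
    by (rule distinct_atomI) (auto simp: defs Let_def)
  let ?S = "mset (A @ B) + (mset (B @ C) + mset (A @ C))"
  have "fact_len C2_5_group 3 ?S" unfolding fact_len_def
    using 1 2 3 by (intro exI[of _ "[mset (A @ B), mset (B @ C), mset (A @ C)]"]) simp
  \<comment> \<open>Each of the nine elements lies in two of the three atoms, so it occurs twice and
    is its own inverse.\<close>
  moreover have "fact_len C2_5_group 9 ?S" unfolding fact_len_def
  proof (intro exI conjI)
    let ?p = "\<lambda>x. {#x, x#}"
    show "length (map ?p (A @ B @ C)) = 9" by (simp add: defs)
    show "sum_list (map ?p (A @ B @ C)) = ?S" by (simp add: defs add_mset_commute)
    have "{#x, x#} \<in> product_one_atoms C2_5_group" if "x \<noteq> \<one>\<^bsub>C2_5_group\<^esub>" for x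
    proof -
      have "inv\<^bsub>C2_5_group\<^esub> x = x" using inv_equality[of x x] C2_5_group_props(2) by simp
      then show ?thesis using pair_atom[of x] that by simp
    qed
    then show "set (map ?p (A @ B @ C)) \<subseteq> product_one_atoms C2_5_group" by (auto simp: defs)
  qed
  moreover have "prod_one C2_5_group ?S" using fact_len_prod_one[OF is_group calculation(1)] .
  ultimately show ?thesis unfolding mem_system_of_lengths by (intro bexI[of _ "{k. fact_len C2_5_group k ?S}"]) (auto simp: mem_system_of_lengths)
qed

subsection \<open>The symmetric group\<close>

text \<open>The second component is the sign homomorphism.\<close>

lemma S3_parity:
  assumes "prod_one S3_group S"
  shows "even (size (filter_mset snd S))"
proof -
  obtain xs where xs: "mset xs = S" "foldr (\<otimes>\<^bsub>S3_group\<^esub>) xs \<one>\<^bsub>S3_group\<^esub> = \<one>\<^bsub>S3_group\<^esub>"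
    using assms by (auto simp: carrier_product_one_monoid_iff)
  have "snd (foldr (\<otimes>\<^bsub>S3_group\<^esub>) xs \<one>\<^bsub>S3_group\<^esub>) \<longleftrightarrow> odd (size (filter_mset snd (mset xs)))" for xs
  proof (induction xs)
    case (Cons x xs)
    obtain i e where x: "x = (i, e)" by (cases x)
    obtain j f where y: "foldr (\<otimes>\<^bsub>S3_group\<^esub>) xs \<one>\<^bsub>S3_group\<^esub> = (j, f)" by (meson surj_pair)
    then show ?case using Cons x by auto
  qed simp
  then show ?thesis using xs by (metis S3_group_simps(2) snd_conv)
qed

interpretation S3: group S3_group by (rule group_S3)

lemma S3_carrier_cases: "x \<in> carrier S3_group \<longleftrightarrow> x \<in> {(0, False), (1, False), (2, False), (0, True), (1, True), (2, True)}"
  by (cases x) auto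

lemma S3_inv: "inv\<^bsub>S3_group\<^esub> (1, False) = (2, False)" "inv\<^bsub>S3_group\<^esub> (2, False) = (1, False)"
  "i \<in> {0, 1, 2} \<Longrightarrow> inv\<^bsub>S3_group\<^esub> (i, True) = (i, True)"
  by (rule S3.inv_equality; auto)+

definition S3_reflections :: "(int \<times> bool) set" where
  "S3_reflections = {(0, True), (1, True), (2, True)}"

lemma S3_reflectionsD:
  assumes "r \<in> S3_reflections"
  shows "r \<in> carrier S3_group" "r \<otimes>\<^bsub>S3_group\<^esub> r = (0, False)" "snd r" "r \<noteq> (0, False)"
  using assms by (auto simp: S3_reflections_def)

lemma S3_pow_reflection:
  assumes "r \<in> S3_reflections"
  shows "r [^]\<^bsub>S3_group\<^esub> (n::nat) = (if even n then (0, False) else r)"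
proof (induction n)
  case (Suc n)
  then show ?case using S3_reflectionsD[OF assms] S3.l_one[of r] by auto
qed simp

lemma S3_two_reflections_even:
  assumes "r \<in> S3_reflections" "s \<in> S3_reflections" "even i" "even j"
  shows "prod_one S3_group (replicate_mset i r + replicate_mset j s)"
  using assms S3.prod_one_replicate[of r i] S3.prod_one_replicate[of s j] S3_pow_reflection S3_reflectionsD(1)
  by (intro S3.prod_one_add) auto

lemma S3_two_reflections_not:
  assumes "r \<in> S3_reflections" "s \<in> S3_reflections" "r \<noteq> s" "odd j"
  shows "\<not> prod_one S3_group (add_mset r (replicate_mset j s))"
proof
  assume p: "prod_one S3_group (add_mset r (replicate_mset j s))"
  obtain ys where ys: "mset ys = replicate_mset j s" "r \<otimes>\<^bsub>S3_group\<^esub> S3.lprod ys = \<one>\<^bsub>S3_group\<^esub>"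
    using S3.prod_one_rotate[OF p] by blast
  have "set ys \<subseteq> {s}" "length ys = j" using arg_cong[OF ys(1), of set_mset] arg_cong[OF ys(1), of size] by (auto split: if_splits)
  then have "S3.lprod ys = s [^]\<^bsub>S3_group\<^esub> j" using S3.lprod_const[OF S3_reflectionsD(1)[OF assms(2)]] by blast
  then have "r \<otimes>\<^bsub>S3_group\<^esub> s = (0, False)" using ys(2) S3_pow_reflection[OF assms(2)] assms(4) by simp
  then show False using assms by (auto simp: S3_reflections_def)
qed

lemma S3_alternating:
  assumes "r \<in> S3_reflections" "s \<in> S3_reflections"
  shows "prod_one S3_group (replicate_mset 3 r + replicate_mset 3 s)"
  using assms by (intro S3.prod_oneI[of "[r, s, r, s, r, s]"]) (auto simp: S3_reflections_def eval_nat_numeral)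

lemma size_filter_replicate: "size (filter_mset P (replicate_mset n x)) = (if P x then n else 0)"
  by (induction n) auto

text \<open>The exponents of a product-one sequence r^i s^j are both even, or both odd and at least
  three, because r s has order three. So the dividing atoms are r^2, s^2 and r^3 s^3, and the last
  is used an even number of times.\<close>

lemma S3_two_reflections_lengths:
  assumes r: "r \<in> S3_reflections" "s \<in> S3_reflections" "r \<noteq> s"
  shows "{k. fact_len S3_group k (replicate_mset 6 r + replicate_mset 6 s)} = {2, 6}"
proof -
  let ?S = "replicate_mset 6 r + replicate_mset 6 s" and ?A = "replicate_mset 3 r + replicate_mset 3 s"
  have sn: "snd r" "snd s" using S3_reflectionsD r by auto
  have shape: "i = 0 \<and> even j \<or> j = 0 \<and> even i \<or> even i \<and> even j \<or> odd i \<and> odd j \<and> 3 \<le> i \<and> 3 \<le> j"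
    if p: "prod_one S3_group (replicate_mset i r + replicate_mset j s)" for i j
  proof -
    have e: "even (i + j)" using S3_parity[OF p] sn by (simp add: size_filter_replicate)
    have "\<not> (i = 1 \<and> odd j)"
    proof
      assume "i = 1 \<and> odd j"
      then show False using S3_two_reflections_not[OF r, of j] p by simp
    qed
    moreover have "\<not> (j = 1 \<and> odd i)"
    proof
      assume "j = 1 \<and> odd i"
      then show False using S3_two_reflections_not[OF r(2,1) r(3)[symmetric], of i] p by (simp add: add.commute)
    qed
    ultimately show ?thesis using e by presburger
  qed
  have counts: "X = replicate_mset (count X r) r + replicate_mset (count X s) s" if X: "set_mset X \<subseteq> {r, s}" for X
    using X r(3) by (intro multiset_eqI) (auto simp: count_eq_zero_iff)
  have pairs: "{#t, t#} \<in> product_one_atoms S3_group" if t: "t \<in> S3_reflections" for t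
  proof -
    have "inv\<^bsub>S3_group\<^esub> t = t" using S3.inv_equality[of t t] S3_reflectionsD[OF t] by simp
    then show ?thesis using S3.pair_atom[of t] S3_reflectionsD[OF t] by simp
  qed
  have A: "?A \<in> product_one_atoms S3_group"
  proof -
    have "T = {#} \<or> U = {#}" if TU: "prod_one S3_group T" "prod_one S3_group U" "?A = T + U" for T U
    proof -
      have c: "count T r + count U r = 3" "count T s + count U s = 3"
        using arg_cong[OF TU(3), of "\<lambda>M. count M r"] arg_cong[OF TU(3), of "\<lambda>M. count M s"] r(3) by auto
      have st: "set_mset T \<subseteq> {r, s}" "set_mset U \<subseteq> {r, s}"
        using arg_cong[OF TU(3), of set_mset] by auto
      have gen: "i = 0 \<and> j = 0 \<or> i' = 0 \<and> j' = 0" if "i + i' = 3" "j + j' = 3"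
        "i = 0 \<and> even j \<or> j = 0 \<and> even i \<or> even i \<and> even j \<or> odd i \<and> odd j \<and> 3 \<le> i \<and> 3 \<le> j"
        "i' = 0 \<and> even j' \<or> j' = 0 \<and> even i' \<or> even i' \<and> even j' \<or> odd i' \<and> odd j' \<and> 3 \<le> i' \<and> 3 \<le> j'"
        for i j i' j' :: nat using that by presburger
      have "prod_one S3_group (replicate_mset (count T r) r + replicate_mset (count T s) s)"
        "prod_one S3_group (replicate_mset (count U r) r + replicate_mset (count U s) s)"
        using TU(1,2) counts[OF st(1)] counts[OF st(2)] by simp_all
      then have "count T r = 0 \<and> count T s = 0 \<or> count U r = 0 \<and> count U s = 0"
        using gen[OF c shape shape] by blast
      then show ?thesis using counts[OF st(1)] counts[OF st(2)] by auto
    qed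
    then show ?thesis using S3_alternating[OF r(1,2)] by (auto simp: product_one_atoms_iff)
  qed
  have cand: "C \<in> set [{#r, r#}, {#s, s#}, ?A]" if C: "C \<in> product_one_atoms S3_group" "C \<subseteq># ?S" for C
  proof -
    define i j where ij: "i = count C r" "j = count C s"
    have "set_mset C \<subseteq> {r, s}" using set_mset_mono[OF C(2)] by auto
    then have Ceq: "C = replicate_mset i r + replicate_mset j s" using counts ij by simp
    have ne: "i \<noteq> 0 \<or> j \<noteq> 0" using atom_nonempty[OF C(1)] Ceq by auto
    have split: "X = C" if "C = X + (replicate_mset i' r + replicate_mset j' s)" "X \<noteq> {#}" "prod_one S3_group X" "even i'" "even j'" for X i' j'
      using atom_split[of X "replicate_mset i' r + replicate_mset j' s" S3_group] C(1) that S3_two_reflections_even[OF r(1,2)] by auto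
    have rr: "replicate_mset 2 t = {#t, t#}" for t :: "int \<times> bool" by (simp add: numeral_2_eq_2)
    have sh: "i = 0 \<and> even j \<or> j = 0 \<and> even i \<or> even i \<and> even j \<or> odd i \<and> odd j \<and> 3 \<le> i \<and> 3 \<le> j"
      using shape[of i j] atom_prod_one[OF C(1)] Ceq by simp
    have "even i \<and> even j \<and> 2 \<le> i \<or> even i \<and> even j \<and> 2 \<le> j \<or> odd i \<and> odd j \<and> 3 \<le> i \<and> 3 \<le> j"
      using sh ne by presburger
    then consider "even i" "even j" "2 \<le> i" | "even i" "even j" "2 \<le> j" | "odd i" "odd j" "3 \<le> i" "3 \<le> j"
      by blast
    then show ?thesis
    proof cases
      case 1
      then have "C = {#r, r#} + (replicate_mset (i - 2) r + replicate_mset j s)"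
        unfolding Ceq rr[symmetric] by (intro multiset_eqI) auto
      then have "{#r, r#} = C" by (rule split) (use atom_prod_one[OF pairs[OF r(1)]] 1 in auto)
      then show ?thesis by simp
    next
      case 2
      then have "C = {#s, s#} + (replicate_mset i r + replicate_mset (j - 2) s)"
        unfolding Ceq rr[symmetric] by (intro multiset_eqI) auto
      then have "{#s, s#} = C" by (rule split) (use atom_prod_one[OF pairs[OF r(2)]] 2 in auto)
      then show ?thesis by simp
    next
      case 3
      then have "C = ?A + (replicate_mset (i - 3) r + replicate_mset (j - 3) s)"
        unfolding Ceq by (intro multiset_eqI) auto
      then have "?A = C" by (rule split) (use atom_prod_one[OF A] 3 in auto)
      then show ?thesis by simp
    qed
  qed
  have "{#r, r#} \<noteq> {#s, s#}"
  proof
    assume "{#r, r#} = {#s, s#}"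
    from arg_cong[OF this, of "\<lambda>M. count M r"] show False using r(3) by simp
  qed
  moreover have "{#r, r#} \<noteq> ?A"
  proof
    assume "{#r, r#} = ?A"
    from arg_cong[OF this, of size] show False by simp
  qed
  moreover have "{#s, s#} \<noteq> ?A"
  proof
    assume "{#s, s#} = ?A"
    from arg_cong[OF this, of size] show False by simp
  qed
  ultimately have d: "distinct [{#r, r#}, {#s, s#}, ?A]" by auto
  have "k \<in> {2, 6}" if fk: "fact_len S3_group k ?S" for k
  proof -
    obtain n where n: "?S = (\<Sum>C\<leftarrow>[{#r, r#}, {#s, s#}, ?A]. repeat_mset (n C) C)" "k = (\<Sum>C\<leftarrow>[{#r, r#}, {#s, s#}, ?A]. n C)"
      using fact_len_candidates[OF fk cand d] by blast
    define p q w where pqw: "p = n {#r, r#}" "q = n {#s, s#}" "w = n ?A"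
    have e: "6 = p * 2 + w * 3" using arg_cong[OF n(1), of "\<lambda>M. count M r"] r(3) by (simp add: pqw)
    have f: "6 = q * 2 + w * 3" using arg_cong[OF n(1), of "\<lambda>M. count M s"] r(3) by (simp add: pqw)
    have g: "k = p + q + w" using n(2) by (simp add: pqw)
    \<comment> \<open>Since 6 = 2 p + 3 w, the number w is even, so w = 0 or w = 2.\<close>
    have "w = 0 \<or> w = 1 \<or> w = 2" using e by linarith
    then have "k = 2 \<or> k = 6"
    proof (elim disjE)
      assume w: "w = 1"
      have "odd (p * 2 + w * 3)" unfolding w by simp
      then show ?thesis unfolding e[symmetric] by simp
    next
      assume w: "w = 0"
      have "p = 3" "q = 3" using e f unfolding w by linarith+
      then show ?thesis using g w by linarith
    next
      assume w: "w = 2"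
      have "p = 0" "q = 0" using e f unfolding w by linarith+
      then show ?thesis using g w by linarith
    qed
    then show ?thesis by simp
  qed
  moreover have "fact_len S3_group 2 ?S"
    unfolding fact_len_def using A by (intro exI[of _ "[?A, ?A]"]) (auto intro!: multiset_eqI)
  moreover have "fact_len S3_group 6 ?S"
    unfolding fact_len_def using pairs[OF r(1)] pairs[OF r(2)]
    by (intro exI[of _ "[{#r, r#}, {#r, r#}, {#r, r#}, {#s, s#}, {#s, s#}, {#s, s#}]"]) (auto simp: eval_nat_numeral)
  ultimately show ?thesis by blast
qed

lemma S3_2_6: "{2, 6} \<in> system_of_lengths S3_group"
proof -
  have r: "(0, True) \<in> S3_reflections" "(1, True) \<in> S3_reflections" "(0, True) \<noteq> (1 :: int, True)" by (auto simp: S3_reflections_def)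
  let ?S = "replicate_mset 6 (0, True) + replicate_mset 6 (1 :: int, True)"
  have e: "{k. fact_len S3_group k ?S} = {2, 6}" using S3_two_reflections_lengths[OF r] .
  then have "fact_len S3_group 2 ?S" by blast
  then have "prod_one S3_group ?S" using fact_len_prod_one[OF group_S3] by blast
  then show ?thesis unfolding mem_system_of_lengths using e by (intro exI[of _ ?S]) simp
qed

lemma S3_prod_one_small:
  assumes "x \<in> {(1, False), (2, False)}" "r \<in> S3_reflections" "s \<in> S3_reflections"
  shows "r \<noteq> s \<Longrightarrow> {#x, r, s#} \<in> product_one_atoms S3_group"
    and "{#x, x, x#} \<in> product_one_atoms S3_group"
    and "{#x, x, r, r#} \<in> product_one_atoms S3_group"
proof -
  note f = S3_reflections_def S3.prod_one_pair S3.prod_one_triple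
  show "{#x, r, s#} \<in> product_one_atoms S3_group" if "r \<noteq> s"
    using assms that by (intro S3.small_atomI) (auto simp: f S3.prod_one_single split: if_splits)
  have "prod_one S3_group {#x, x, x#}" using assms by (auto simp: f)
  then show "{#x, x, x#} \<in> product_one_atoms S3_group"
    using assms by (intro S3.small_atomI) (auto simp: f S3.prod_one_single split: if_splits)
  have "prod_one S3_group {#x, x, r, r#}" using assms by (intro S3.prod_oneI[of "[x, r, x, r]"]) (auto simp: f)
  then show "{#x, x, r, r#} \<in> product_one_atoms S3_group"
    using assms by (intro S3.small_atomI) (auto simp: f split: if_splits)
qed

text \<open>The ordering is s x x s x x. A factor without reflections can only be x^3, and its
  cofactor s s x is not product-one.\<close>

lemma S3_six_atom:
  assumes x: "x \<in> {(1, False), (2, False)}"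
  shows "replicate_mset 4 x + {#(0, True), (0, True)#} \<in> product_one_atoms S3_group"
proof -
  let ?s = "(0, True) :: int \<times> bool"
  have xc: "x \<in> carrier S3_group" "x \<noteq> ?s" using x by auto
  have "add_mset ?s (add_mset ?s (replicate_mset 4 x)) \<in> product_one_atoms S3_group"
  proof (rule product_one_atomI)
    show "prod_one S3_group (add_mset ?s (add_mset ?s (replicate_mset 4 x)))"
      using x by (intro S3.prod_oneI[of "[?s, x, x, ?s, x, x]"]) (auto simp: eval_nat_numeral)
    fix X assume X: "X \<subseteq># add_mset ?s (replicate_mset 4 x)" "prod_one S3_group X"
      "prod_one S3_group (add_mset ?s (add_mset ?s (replicate_mset 4 x) - X))"
    have "?s \<notin># X"
    proof
      assume "?s \<in># X"
      then obtain Y where Y: "X = add_mset ?s Y" using multi_member_split[of ?s X] by blast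
      then have "Y \<subseteq># replicate_mset 4 x" using X(1) by simp
      then have "set_mset Y \<subseteq> {x}" using set_mset_mono by fastforce
      then have F: "filter_mset snd Y = {#}" using x by (auto simp: filter_mset_eq_conv)
      have "size (filter_mset snd X) = 1"
        unfolding Y by (simp only: filter_mset_add_mset F snd_conv if_True size_single)
      then show False using S3_parity[OF X(2)] by simp
    qed
    with X(1) have "X \<subseteq># replicate_mset 4 x" by (rule S3.subset_add_mset_notin)
    then obtain n where n: "n \<le> 4" "X = replicate_mset n x" by (metis msubseteq_replicate_msetE)
    have "x [^]\<^bsub>S3_group\<^esub> n = (0, False)" using X(2) n S3.prod_one_replicate[OF xc(1)] by simp
    moreover have "n = 0 \<or> n = 1 \<or> n = 2 \<or> n = 3 \<or> n = 4" using n(1) by linarith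
    ultimately have "n = 0 \<or> n = 3" using x by (auto simp: eval_nat_numeral)
    moreover have False if "n = 3"
    proof -
      have "add_mset ?s (add_mset ?s (replicate_mset 4 x) - X) = {#?s, ?s, x#}"
        using n(2) xc(2) \<open>n = 3\<close> by (simp add: eval_nat_numeral)
      then have "prod_one S3_group {#?s, ?s, x#}" using X(3) by simp
      then show False using x by (auto simp: S3.prod_one_triple)
    qed
    ultimately show "X = {#}" using n by auto
  qed
  then show ?thesis by (simp add: add.commute)
qed

lemma S3_2_3_6: "\<exists>L \<in> system_of_lengths S3_group. {2, 3, 6} \<subseteq> L"
proof -
  let ?s = "(0, True) :: int \<times> bool" and ?a = "(1, False) :: int \<times> bool" and ?b = "(2, False) :: int \<times> bool"
  have s: "?s \<in> S3_reflections" by (simp add: S3_reflections_def)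
  \<comment> \<open>This is the atom a^4 s^2 times its inverse b^4 s^2.\<close>
  let ?S = "{#?a, ?a, ?a, ?a, ?b, ?b, ?b, ?b, ?s, ?s, ?s, ?s#}"
  have 1: "fact_len S3_group 2 ?S"
    unfolding fact_len_def using S3_six_atom[of ?a] S3_six_atom[of ?b]
    by (intro exI[of _ "[replicate_mset 4 ?a + {#?s, ?s#}, replicate_mset 4 ?b + {#?s, ?s#}]"]) (simp add: eval_nat_numeral)
  have "{#?a, ?a, ?b, ?s, ?s#} \<in> product_one_atoms S3_group"
  proof (rule S3.small_atomI)
    show "prod_one S3_group {#?a, ?a, ?b, ?s, ?s#}" by (intro S3.prod_oneI[of "[?a, ?a, ?s, ?b, ?s]"]) auto
    fix x y assume "x \<in># {#?a, ?a, ?b, ?s, ?s#}" "y \<in># {#?a, ?a, ?b, ?s, ?s#}"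
      "x \<otimes>\<^bsub>S3_group\<^esub> y = \<one>\<^bsub>S3_group\<^esub>" "prod_one S3_group ({#?a, ?a, ?b, ?s, ?s#} - {#x, y#})"
    then show "{#?a, ?a, ?b, ?s, ?s#} = {#x, y#}" by (auto simp: S3.prod_one_triple add_mset_commute)
  qed auto
  then have 2: "fact_len S3_group 3 ?S"
    unfolding fact_len_def using S3_prod_one_small(3)[of ?a, OF _ s s] S3_prod_one_small(2)[of ?b, OF _ s s]
    by (intro exI[of _ "[{#?a, ?a, ?s, ?s#}, {#?b, ?b, ?b#}, {#?a, ?a, ?b, ?s, ?s#}]"]) (simp add: add_mset_commute)
  have "{#?a, ?b#} \<in> product_one_atoms S3_group" "{#?s, ?s#} \<in> product_one_atoms S3_group"
    using S3.pair_atom[of ?a] S3.pair_atom[of ?s] S3_inv by simp_all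
  then have 3: "fact_len S3_group 6 ?S"
    unfolding fact_len_def
    by (intro exI[of _ "[{#?a, ?b#}, {#?a, ?b#}, {#?a, ?b#}, {#?a, ?b#}, {#?s, ?s#}, {#?s, ?s#}]"]) (simp add: add_mset_commute)
  have "prod_one S3_group ?S" using fact_len_prod_one[OF group_S3 1] .
  then show ?thesis using 1 2 3 by (intro bexI[of _ "{k. fact_len S3_group k ?S}"]) (auto simp: mem_system_of_lengths)
qed

text \<open>The conjugate x y x is the third reflection w.\<close>

lemma S3_reflections_po4:
  assumes "x \<in> S3_reflections" "y \<in> S3_reflections" "w \<in> S3_reflections" "x \<noteq> y" "x \<noteq> w" "y \<noteq> w"
  shows "prod_one S3_group {#x, x, y, w#}"
proof (rule S3.prod_oneI[of "[x, y, x, w]"])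
  show "foldr (\<otimes>\<^bsub>S3_group\<^esub>) [x, y, x, w] \<one>\<^bsub>S3_group\<^esub> = \<one>\<^bsub>S3_group\<^esub>"
    using assms unfolding S3_reflections_def by (elim insertE emptyE; simp)
qed (use assms S3_reflectionsD(1) in \<open>auto simp: add_mset_commute\<close>)

text \<open>For exponents with sum six other than 3, 3, 0, either a square splits off with
  product-one cofactor or, for 5, 1, 0, no ordering has trivial product.\<close>

lemma S3_reflection_atom:
  assumes U: "U \<in> product_one_atoms S3_group" "size U = 6" and refl: "set_mset U \<subseteq> S3_reflections"
  obtains r s where "r \<in> S3_reflections" "s \<in> S3_reflections" "r \<noteq> s" "U = replicate_mset 3 r + replicate_mset 3 s"
proof -
  have sq: "prod_one S3_group {#x, x#}" if "x \<in> S3_reflections" for x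
    using S3_two_reflections_even[of x x 2 0] that by (simp add: numeral_2_eq_2)
  have split: "\<not> prod_one S3_group W" if "U = {#x, x#} + W" "x \<in> S3_reflections" "W \<noteq> {#}" for x W
    using atom_split[of "{#x, x#}" W S3_group] U(1) sq[OF that(2)] that by auto
  have ne: "U \<noteq> replicate_mset 6 x" "U \<noteq> replicate_mset 4 x + replicate_mset 2 y" "U \<noteq> replicate_mset 5 x + {#y#}"
    "U \<noteq> replicate_mset 4 x + {#y, w#}" "U \<noteq> replicate_mset 3 x + replicate_mset 2 y + {#w#}"
    "U \<noteq> replicate_mset 2 x + replicate_mset 2 y + replicate_mset 2 w"
    if d: "x \<in> S3_reflections" "y \<in> S3_reflections" "w \<in> S3_reflections" "x \<noteq> y" "x \<noteq> w" "y \<noteq> w" for x y w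
  proof -
    note ev = S3_two_reflections_even
    have spl: "U \<noteq> M" if "M = {#x, x#} + W" "prod_one S3_group W" "W \<noteq> {#}" for M W
      using split[of x W] d(1) that by blast
    have "replicate_mset 6 x = {#x, x#} + (replicate_mset 4 x + replicate_mset 0 x)" by (simp add: eval_nat_numeral)
    then show "U \<noteq> replicate_mset 6 x" using split[OF _ d(1)] ev[OF d(1,1), of 4 0] by auto
    have "replicate_mset 4 x + replicate_mset 2 y = {#x, x#} + (replicate_mset 2 x + replicate_mset 2 y)" by (simp add: eval_nat_numeral)
    then show "U \<noteq> replicate_mset 4 x + replicate_mset 2 y" using split[OF _ d(1)] ev[OF d(1,2), of 2 2] by auto
    show "U \<noteq> replicate_mset 5 x + {#y#}"
      using S3_two_reflections_not[OF d(2,1), of 5] atom_prod_one[OF U(1)] d by auto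
    have "replicate_mset 4 x + {#y, w#} = {#x, x#} + {#x, x, y, w#}" by (simp add: eval_nat_numeral add_mset_commute)
    then show "U \<noteq> replicate_mset 4 x + {#y, w#}" using S3_reflections_po4[OF d] by (rule spl) simp
    have "replicate_mset 3 x + replicate_mset 2 y + {#w#} = {#x, x#} + {#y, y, x, w#}" by (simp add: eval_nat_numeral add_mset_commute)
    then show "U \<noteq> replicate_mset 3 x + replicate_mset 2 y + {#w#}"
      using S3_reflections_po4[OF d(2,1,3) d(4)[symmetric] d(6,5)] by (rule spl) simp
    have "replicate_mset 2 x + replicate_mset 2 y + replicate_mset 2 w = {#x, x#} + (replicate_mset 2 y + replicate_mset 2 w)"
      by (simp add: eval_nat_numeral add_mset_commute)
    then show "U \<noteq> replicate_mset 2 x + replicate_mset 2 y + replicate_mset 2 w"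
      using split[OF _ d(1)] ev[OF d(2,3), of 2 2] by auto
  qed
  define c where "c i = count U (i, True)" for i
  have Ueq: "U = replicate_mset (c 0) (0, True) + replicate_mset (c 1) (1, True) + replicate_mset (c 2) (2, True)"
  proof (rule multiset_eqI)
    fix t
    show "count U t = count (replicate_mset (c 0) (0, True) + replicate_mset (c 1) (1, True) + replicate_mset (c 2) (2, True)) t"
    proof (cases "t \<in> S3_reflections")
      case True
      then show ?thesis by (auto simp: S3_reflections_def c_def)
    next
      case False
      then have "t \<notin># U" using refl by blast
      then show ?thesis using False by (auto simp: S3_reflections_def count_eq_zero_iff)
    qed
  qed
  have sum: "c 0 + c 1 + c 2 = 6" using arg_cong[OF Ueq, of size] U(2) by simp
  let ?r = "(0 :: int, True)" and ?s = "(1 :: int, True)" and ?t = "(2 :: int, True)"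
  have m: "?r \<in> S3_reflections" "?s \<in> S3_reflections" "?t \<in> S3_reflections" by (auto simp: S3_reflections_def)
  have n: "?r \<noteq> ?s" "?r \<noteq> ?t" "?s \<noteq> ?t" "?s \<noteq> ?r" "?t \<noteq> ?r" "?t \<noteq> ?s" by auto
  note N = ne[OF m(1,2,3) n(1,2,3)] ne[OF m(1,3,2) n(2,1,6)] ne[OF m(2,1,3) n(4,3,2)]
    ne[OF m(2,3,1) n(3,4,5)] ne[OF m(3,1,2) n(5,6,1)] ne[OF m(3,2,1) n(6,5,4)]
  have "c 0 = 3 \<and> c 1 = 3 \<and> c 2 = 0 \<or> c 0 = 3 \<and> c 1 = 0 \<and> c 2 = 3 \<or> c 0 = 0 \<and> c 1 = 3 \<and> c 2 = 3"
  proof (rule ccontr)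
    assume no: "\<not> ?thesis"
    have e: "c 0 = 0 \<or> c 0 = 1 \<or> c 0 = 2 \<or> c 0 = 3 \<or> c 0 = 4 \<or> c 0 = 5 \<or> c 0 = 6"
      "c 1 = 0 \<or> c 1 = 1 \<or> c 1 = 2 \<or> c 1 = 3 \<or> c 1 = 4 \<or> c 1 = 5 \<or> c 1 = 6" using sum by linarith+
    \<comment> \<open>Fixing the order of the three reflections turns the 25 excluded exponent
      triples into instances of \<open>ne\<close> for the six permutations.\<close>
    define U' where "U' i j k = replicate_mset i ?r + replicate_mset j ?s + replicate_mset k ?t" for i j k
    have N': "U \<noteq> U' 6 0 0" "U \<noteq> U' 0 6 0" "U \<noteq> U' 0 0 6" "U \<noteq> U' 4 2 0" "U \<noteq> U' 4 0 2" "U \<noteq> U' 2 4 0"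
      "U \<noteq> U' 0 4 2" "U \<noteq> U' 2 0 4" "U \<noteq> U' 0 2 4" "U \<noteq> U' 5 1 0" "U \<noteq> U' 5 0 1" "U \<noteq> U' 1 5 0"
      "U \<noteq> U' 0 5 1" "U \<noteq> U' 1 0 5" "U \<noteq> U' 0 1 5" "U \<noteq> U' 4 1 1" "U \<noteq> U' 1 4 1" "U \<noteq> U' 1 1 4"
      "U \<noteq> U' 3 2 1" "U \<noteq> U' 3 1 2" "U \<noteq> U' 2 3 1" "U \<noteq> U' 1 3 2" "U \<noteq> U' 2 1 3" "U \<noteq> U' 1 2 3" "U \<noteq> U' 2 2 2"
      unfolding U'_def using N by (simp_all add: ac_simps add_mset_commute)
    have "U = U' (c 0) (c 1) (c 2)" using Ueq by (simp add: U'_def)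
    moreover have "c 2 = 6 - c 0 - c 1" using sum by linarith
    ultimately show False using e no sum N' by (elim disjE) simp_all
  qed
  then show ?thesis
  proof (elim disjE)
    assume "c 0 = 3 \<and> c 1 = 3 \<and> c 2 = 0"
    then show ?thesis using that[OF m(1,2) n(1)] Ueq by simp
  next
    assume "c 0 = 3 \<and> c 1 = 0 \<and> c 2 = 3"
    then show ?thesis using that[OF m(1,3) n(2)] Ueq by simp
  next
    assume "c 0 = 0 \<and> c 1 = 3 \<and> c 2 = 3"
    then show ?thesis using that[OF m(2,3) n(3)] Ueq by simp
  qed
qed

lemma eq_replicate_three:
  assumes "set_mset A \<subseteq> {x, y, w}" "x \<noteq> y" "x \<noteq> w" "y \<noteq> w"
  shows "A = replicate_mset (count A x) x + (replicate_mset (count A y) y + replicate_mset (count A w) w)"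
  using assms by (intro multiset_eqI) (auto simp: count_eq_zero_iff)

text \<open>By parity r occurs four or six times, and then r^2 splits off with a product-one
  cofactor.\<close>

lemma S3_mixed_atom:
  assumes A: "A \<in> product_one_atoms S3_group" "size A = 6" and r: "r \<in> S3_reflections"
    and eq: "A = replicate_mset n r + (replicate_mset x (1, False) + replicate_mset y (2, False))"
  shows "\<not> 4 \<le> n"
proof
  assume n: "4 \<le> n"
  let ?a = "(1, False) :: int \<times> bool" and ?b = "(2, False) :: int \<times> bool"
  have sn: "snd r" using S3_reflectionsD(3)[OF r] .
  have "size (filter_mset snd A) = n" unfolding eq by (simp add: size_filter_replicate sn)
  then have ev: "even n" using S3_parity[OF atom_prod_one[OF A(1)]] by simp
  have sum: "n + (x + y) = 6" using A(2) unfolding eq by simp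
  define m where m: "m = n - 2"
  have "n \<noteq> 5" using ev by auto
  then have "n = 4 \<or> n = 6" using n sum by linarith
  then have cases: "m = 4 \<and> x = 0 \<and> y = 0 \<or> m = 2 \<and> x = 2 \<and> y = 0 \<or> m = 2 \<and> x = 1 \<and> y = 1 \<or> m = 2 \<and> x = 0 \<and> y = 2"
    using sum unfolding m by (elim disjE) auto
  define X where "X m x y = replicate_mset m r + (replicate_mset x ?a + replicate_mset y ?b)" for m x y
  have "n = Suc (Suc m)" using n m by simp
  then have Aeq: "A = {#r, r#} + X m x y" unfolding eq X_def by simp
  have rr: "prod_one S3_group {#r, r#}" using S3_reflectionsD[OF r] by (simp add: S3.prod_one_pair)
  have 1: "prod_one S3_group (X 4 0 0)" unfolding X_def using S3_two_reflections_even[OF r r, of 4 0] by simp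
  have "prod_one S3_group {#?a, ?a, r, r#}" "prod_one S3_group {#?b, ?b, r, r#}"
    using atom_prod_one[OF S3_prod_one_small(3)[OF _ r r]] by auto
  moreover have "X 2 2 0 = {#?a, ?a, r, r#}" "X 2 0 2 = {#?b, ?b, r, r#}" "X 2 1 1 = {#?a, ?b#} + {#r, r#}"
    unfolding X_def by (simp_all add: numeral_2_eq_2 add_mset_commute)
  moreover have "prod_one S3_group ({#?a, ?b#} + {#r, r#})"
    using rr by (intro S3.prod_one_add) (auto simp: S3.prod_one_pair)
  ultimately have "prod_one S3_group (X m x y)" using 1 cases by (elim disjE conjE) simp_all
  moreover have "X m x y \<noteq> {#}" using cases unfolding X_def by auto
  ultimately show False using atom_split[OF A(1)[unfolded Aeq] rr] by simp
qed

text \<open>A sequence with lengths 2 and 6 also has length 5 unless it is r^6 s^6, whose lengths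
  are only 2 and 6. Absence of length 5 leaves few rotations and, if there are rotations, a single
  reflection, which then occurs too often in one of the two atoms.\<close>

lemma S3_not_2_4_6:
  assumes D: "davenport_6 S3_group"
  shows "{2, 4, 6} \<notin> system_of_lengths S3_group"
proof
  interpret davenport_6 S3_group by (rule D)
  assume "{2, 4, 6} \<in> system_of_lengths S3_group"
  then obtain S where S: "{2, 4, 6} = {k. fact_len S3_group k S}" by (auto simp: mem_system_of_lengths)
  then have fl: "fact_len S3_group k S \<longleftrightarrow> k = 2 \<or> k = 4 \<or> k = 6" for k by blast
  then have "fact_len S3_group 2 S" "fact_len S3_group (3 * 2) S" by simp_all
  then obtain As where As: "length As = 2" "sum_list As = S"
    "\<And>A. A \<in> set As \<Longrightarrow> A \<in> product_one_atoms S3_group \<and> size A = 6" "S3.balanced S" "\<one>\<^bsub>S3_group\<^esub> \<notin># S"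
    using maximal_length by metis
  obtain U V where UV: "As = [U, V]" using As(1) by (auto simp: length_Suc_conv numeral_2_eq_2)
  have at: "U \<in> product_one_atoms S3_group" "V \<in> product_one_atoms S3_group" "size U = 6" "size V = 6"
    and SUV: "S = U + V" using As(2,3) UV by auto
  have Sc: "set_mset S \<subseteq> carrier S3_group - {(0, False)}" using atom_carrier[OF at(1)] atom_carrier[OF at(2)] SUV As(5) by auto
  have S12: "size S = 12" using SUV at by simp
  have no5: "\<not> fact_len S3_group 5 S" using fl[of 5] by simp
  let ?a = "(1 :: int, False)" and ?b = "(2 :: int, False)"
  have pab: "count S ?b = count S ?a" using S3.balancedD(2)[OF As(4), of ?a] S3_inv by simp
  \<comment> \<open>Once A and B are removed, the remaining six terms are balanced and form three
    inverse pairs, which would give length five.\<close>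
  have five: False if W: "A \<in> product_one_atoms S3_group" "B \<in> product_one_atoms S3_group" "size A + size B = 6"
    "S3.balanced (A + B)" "A + B \<subseteq># S" for A B
  proof -
    have eq: "S = (A + B) + (S - (A + B))" using W(5) by (rule subset_mset.add_diff_inverse[symmetric])
    have "S3.balanced (S - (A + B))" using S3.balanced_cancel[of "A + B" "S - (A + B)"] eq As(4) W(4) by simp
    moreover have "set_mset (S - (A + B)) \<subseteq> carrier S3_group" "\<one>\<^bsub>S3_group\<^esub> \<notin># S - (A + B)"
      using Sc by (auto dest: in_diffD)
    moreover have "size (S - (A + B)) = 2 * 3" using size_Diff_submset[OF W(5)] S12 W(3) by simp
    ultimately have "fact_len S3_group 3 (S - (A + B))" by (rule S3.balanced_fact_len)
    then have "fact_len S3_group (Suc (Suc 3)) (A + (B + (S - (A + B))))"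
      using W(1,2) fact_len_Suc by blast
    then show False using no5 eq by (simp add: add.assoc eval_nat_numeral)
  qed
  have bal: "S3.balanced A" if "count A ?a = count A ?b" "\<forall>r\<in>S3_reflections. even (count A r)" "count A (0, False) = 0" for A
    unfolding S3.balanced_def
  proof
    fix t assume "t \<in> carrier S3_group"
    then have "t \<in> {(0, False), ?a, ?b, (0, True), (1, True), (2, True)}" by (simp only: S3_carrier_cases)
    then show "if inv\<^bsub>S3_group\<^esub> t = t then even (count A t) else count A t = count A (inv\<^bsub>S3_group\<^esub> t)"
      using that S3_inv S3.inv_one by (elim insertE) (simp_all add: S3_reflections_def)
  qed
  \<comment> \<open>Three copies of a come with three copies of its inverse b, so a^3 and b^3 would
    be such a pair of atoms.\<close>
  have p2: "count S ?a \<le> 2"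
  proof (rule ccontr)
    assume p: "\<not> count S ?a \<le> 2"
    show False
    proof (rule five[of "{#?a, ?a, ?a#}" "{#?b, ?b, ?b#}"])
      show "{#?a, ?a, ?a#} \<in> product_one_atoms S3_group" "{#?b, ?b, ?b#} \<in> product_one_atoms S3_group"
        by (rule S3_prod_one_small(2)[of _ "(0, True)" "(0, True)"]; simp add: S3_reflections_def)+
      show "{#?a, ?a, ?a#} + {#?b, ?b, ?b#} \<subseteq># S" using p pab by (intro mset_subset_eqI) auto
    qed (auto intro!: bal simp: S3_reflections_def)
  qed
  \<comment> \<open>Every reflection that occurs does so at least twice, by parity. So a r s and b r
    s would together divide S.\<close>
  have mixed: "r = s" if p: "1 \<le> count S ?a" and rs: "r \<in> S3_reflections" "s \<in> S3_reflections" "r \<in># S" "s \<in># S" for r s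
  proof (rule ccontr)
    assume "r \<noteq> s"
    have ev: "even (count S t)" if "t \<in> S3_reflections" for t
      using S3.balancedD(1)[OF As(4), of t] S3_reflectionsD(1)[OF that] S3_inv(3) that by (auto simp: S3_reflections_def)
    have two: "2 \<le> count S t" if "t \<in> S3_reflections" "t \<in># S" for t
      using ev[OF that(1)] that(2) by (metis count_greater_zero_iff dvd_imp_le)
    show False
    proof (rule five[of "{#?a, r, s#}" "{#?b, r, s#}"])
      show "{#?a, r, s#} \<in> product_one_atoms S3_group" "{#?b, r, s#} \<in> product_one_atoms S3_group"
        using S3_prod_one_small(1)[of ?a r s] S3_prod_one_small(1)[of ?b r s] rs \<open>r \<noteq> s\<close> by auto
      have "snd r" "snd s" using S3_reflectionsD(3) rs by auto
      then have d: "r \<noteq> ?a" "r \<noteq> ?b" "s \<noteq> ?a" "s \<noteq> ?b" "r \<noteq> (0, False)" "s \<noteq> (0, False)" by auto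
      show "{#?a, r, s#} + {#?b, r, s#} \<subseteq># S"
      proof (rule mset_subset_eqI)
        fix t
        have "1 \<le> count S ?b" using p pab by simp
        then show "count ({#?a, r, s#} + {#?b, r, s#}) t \<le> count S t"
          using p two[OF rs(1,3)] two[OF rs(2,4)] d \<open>r \<noteq> s\<close> by auto
      qed
      have "t \<noteq> ?a" "t \<noteq> ?b" if "t \<in> S3_reflections" for t using S3_reflectionsD(3)[OF that] by auto
      then show "S3.balanced ({#?a, r, s#} + {#?b, r, s#})" using d by (intro bal) auto
    qed simp
  qed
  show False
  proof (cases "count S ?a = 0")
    case True
    then have "count S ?b = 0" using pab by simp
    then have "?a \<notin># S" "?b \<notin># S" using True unfolding count_eq_zero_iff by simp_all
    then have refl: "set_mset S \<subseteq> S3_reflections"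
      using Sc S3_carrier_cases unfolding S3_reflections_def by blast
    have refls: "set_mset U \<subseteq> S3_reflections" "set_mset V \<subseteq> S3_reflections" using refl SUV by simp_all
    obtain r s where rs: "r \<in> S3_reflections" "s \<in> S3_reflections" "r \<noteq> s" "U = replicate_mset 3 r + replicate_mset 3 s"
      by (rule S3_reflection_atom[OF at(1,3) refls(1)])
    obtain r' s' where rs': "r' \<in> S3_reflections" "s' \<in> S3_reflections" "r' \<noteq> s'" "V = replicate_mset 3 r' + replicate_mset 3 s'"
      by (rule S3_reflection_atom[OF at(2,4) refls(2)])
    have ev: "even (count S t)" if "t \<in> S3_reflections" for t
      using S3.balancedD(1)[OF As(4), of t] S3_reflectionsD(1)[OF that] S3_inv(3) that by (auto simp: S3_reflections_def)
    have "even (count V r) \<longleftrightarrow> even (count U r)" "even (count V s) \<longleftrightarrow> even (count U s)"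
      using ev[OF rs(1)] ev[OF rs(2)] SUV by auto
    moreover have "odd (count U r)" "odd (count U s)" using rs by auto
    ultimately have "odd (count V r)" "odd (count V s)" by auto
    then have "V = replicate_mset 3 r + replicate_mset 3 s"
      using rs(3) rs'(3) unfolding rs'(4) by (auto split: if_splits)
    then have "S = replicate_mset 6 r + replicate_mset 6 s" using SUV rs(4) by (intro multiset_eqI) simp
    then have "{2, 4, 6} = {2, 6 :: nat}" using S3_two_reflections_lengths[OF rs(1-3)] S by simp
    then have "4 \<in> {2, 6 :: nat}" by blast
    then show False by simp
  next
    case False
    then have p1: "1 \<le> count S ?a" by simp
    have "\<exists>r \<in> S3_reflections. r \<in># S"
    proof (rule ccontr)
      assume "\<not> ?thesis"
      then have "set_mset S \<subseteq> {?a, ?b}" using Sc S3_carrier_cases unfolding S3_reflections_def by blast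
      then have "S = replicate_mset (count S ?a) ?a + replicate_mset (count S ?b) ?b"
        by (intro multiset_eqI) (auto simp: count_eq_zero_iff)
      then have "size S = count S ?a + count S ?b" by (metis size_replicate_mset size_union)
      then show False using p2 pab S12 by linarith
    qed
    then obtain r where r: "r \<in> S3_reflections" "r \<in># S" by blast
    have ne: "r \<noteq> ?a" "r \<noteq> ?b" "?a \<noteq> ?b" using S3_reflectionsD(3)[OF r(1)] by auto
    have sub: "set_mset S \<subseteq> {r, ?a, ?b}"
      using Sc mixed[OF p1 r(1) _ r(2)] S3_carrier_cases unfolding S3_reflections_def by blast
    have eq: "A = replicate_mset (count A r) r + (replicate_mset (count A ?a) ?a + replicate_mset (count A ?b) ?b)" if "A \<subseteq># S" for A
      using set_mset_mono[OF that] sub ne by (rule_tac eq_replicate_three) auto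
    have US: "U \<subseteq># S" "V \<subseteq># S" using SUV by auto
    have sz: "size A = count A r + (count A ?a + count A ?b)" if "A \<subseteq># S" for A
      by (subst eq[OF that]) simp
    have "count U ?a + count V ?a \<le> 2" "count U ?b + count V ?b \<le> 2" using p2 pab SUV by auto
    \<comment> \<open>At most four of the twelve terms are rotations, so r occurs at least eight
      times in total.\<close>
    then have "4 \<le> count U r \<or> 4 \<le> count V r" using sz[OF US(1), unfolded at(3)] sz[OF US(2), unfolded at(4)] by linarith
    then show False using S3_mixed_atom[OF at(1,3) r(1) eq[OF US(1)]] S3_mixed_atom[OF at(2,4) r(1) eq[OF US(2)]] by blast
  qed
qed

subsection \<open>The nonabelian groups of order eight\<close>

text \<open>The class modulo the centre, in the Klein four-group; its nonzero values correspond to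
  the three subgroups of order four.\<close>

definition axis :: "bool \<times> bool \<times> bool \<Rightarrow> bool \<times> bool" where
  "axis x = (fst x, fst (snd x))"

definition axis_count :: "(bool \<times> bool \<times> bool) multiset \<Rightarrow> bool \<times> bool \<Rightarrow> nat" where
  "axis_count S \<alpha> = size (filter_mset (\<lambda>x. axis x = \<alpha>) S)"

text \<open>These are the pairs that do not commute.\<close>

definition skew :: "bool \<times> bool \<times> bool \<Rightarrow> bool \<times> bool \<times> bool \<Rightarrow> bool" where
  "skew x y \<longleftrightarrow> axis x \<noteq> axis y \<and> axis x \<noteq> (False, False) \<and> axis y \<noteq> (False, False)"

text \<open>This says that the product, in any order, lies in the centre.\<close>

definition even_axes :: "(bool \<times> bool \<times> bool) multiset \<Rightarrow> bool" where
  "even_axes S \<longleftrightarrow> even (axis_count S (True, False) + axis_count S (True, True)) \<and>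
     even (axis_count S (False, True) + axis_count S (True, True))"

lemma axis_simp [simp]: "axis (u, v, w) = (u, v)"
  by (simp add: axis_def)

lemma axis_count_simps [simp]:
  "axis_count {#} \<alpha> = 0"
  "axis_count (add_mset x S) \<alpha> = (if axis x = \<alpha> then Suc (axis_count S \<alpha>) else axis_count S \<alpha>)"
  "axis_count (S + T) \<alpha> = axis_count S \<alpha> + axis_count T \<alpha>"
  "axis_count (replicate_mset n x) \<alpha> = (if axis x = \<alpha> then n else 0)"
proof -
  show "axis_count (replicate_mset n x) \<alpha> = (if axis x = \<alpha> then n else 0)"
    unfolding axis_count_def by (induction n) auto
qed (simp_all add: axis_count_def)

lemma axis_count_eq: "axis_count S (u, v) = count S (u, v, False) + count S (u, v, True)"
  by (induction S) (auto simp: axis_def)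

lemma size_axis_count:
  "size S = axis_count S (False, False) + axis_count S (True, False) + axis_count S (False, True) + axis_count S (True, True)"
proof (induction S)
  case (add x S)
  then show ?case by (cases x) auto
qed simp

lemma axis_count_pos: "axis_count S \<alpha> > 0 \<longleftrightarrow> (\<exists>x. x \<in># S \<and> axis x = \<alpha>)"
  unfolding axis_count_def nonempty_has_size[symmetric] filter_mset_eq_conv by force

lemma axis_count_size:
  assumes "axis_count S \<alpha> = size S" "x \<in># S" shows "axis x = \<alpha>"
proof -
  have "size S = axis_count S \<alpha> + size (filter_mset (\<lambda>x. axis x \<noteq> \<alpha>) S)"
    unfolding axis_count_def by (metis multiset_partition size_union)
  then show ?thesis using assms by (auto simp: filter_mset_eq_conv)
qed

lemma even_axes_cancel: "even_axes (S + T) \<Longrightarrow> even_axes S \<Longrightarrow> even_axes T"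
  by (auto simp: even_axes_def)

interpretation O8: group "order_8_group s" for s by (rule group_order_8)

lemma axis_lprod:
  "axis (foldr (\<otimes>\<^bsub>order_8_group s\<^esub>) xs (False, False, False))
    = (odd (axis_count (mset xs) (True, False) + axis_count (mset xs) (True, True)),
       odd (axis_count (mset xs) (False, True) + axis_count (mset xs) (True, True)))"
proof (induction xs)
  case (Cons x xs)
  obtain u v w where x: "x = (u, v, w)" by (cases x)
  obtain u' v' w' where y: "foldr (\<otimes>\<^bsub>order_8_group s\<^esub>) xs (False, False, False) = (u', v', w')"
    by (cases "foldr (\<otimes>\<^bsub>order_8_group s\<^esub>) xs (False, False, False)")
  then show ?case using Cons x by auto
qed simp

lemma prod_one_even_axes: "prod_one (order_8_group s) S \<Longrightarrow> even_axes S"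
proof -
  assume "prod_one (order_8_group s) S"
  then obtain xs where xs: "mset xs = S" "foldr (\<otimes>\<^bsub>order_8_group s\<^esub>) xs (False, False, False) = (False, False, False)"
    by (auto simp: carrier_product_one_monoid_iff)
  then show ?thesis using axis_lprod[of s xs] unfolding even_axes_def by simp
qed

text \<open>Interchanging two noncommuting factors multiplies a product by the central element of order two.\<close>

lemma even_axes_prod_one:
  assumes S: "even_axes S" and xy: "x \<in># S" "y \<in># S" "skew x y"
  shows "prod_one (order_8_group s) S"
proof -
  have "x \<noteq> y" using xy(3) by (auto simp: skew_def)
  then obtain W where W: "S = add_mset x (add_mset y W)"
    using xy(1,2) by (metis insert_noteq_member multi_member_split)
  obtain ws where ws: "mset ws = W" using ex_mset by blast
  define p where "p = foldr (\<otimes>\<^bsub>order_8_group s\<^esub>) ws (False, False, False)"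
  obtain u v w where p: "p = (u, v, w)" by (cases p)
  obtain a b c a' b' c' where ab: "x = (a, b, c)" "y = (a', b', c')" by (cases x, cases y)
  have "axis (foldr (\<otimes>\<^bsub>order_8_group s\<^esub>) (x # y # ws) (False, False, False)) = (False, False)"
    using axis_lprod[of s "x # y # ws"] S W ws by (simp add: even_axes_def)
  then have e: "axis (x \<otimes>\<^bsub>order_8_group s\<^esub> (y \<otimes>\<^bsub>order_8_group s\<^esub> p)) = (False, False)" by (simp add: p_def)
  have "x \<otimes>\<^bsub>order_8_group s\<^esub> (y \<otimes>\<^bsub>order_8_group s\<^esub> p) = (False, False, False)
      \<or> y \<otimes>\<^bsub>order_8_group s\<^esub> (x \<otimes>\<^bsub>order_8_group s\<^esub> p) = (False, False, False)"
    using e xy(3) unfolding ab p skew_def by (cases a; cases b; cases a'; cases b'; cases s; simp; blast)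
  then show ?thesis
  proof
    assume "x \<otimes>\<^bsub>order_8_group s\<^esub> (y \<otimes>\<^bsub>order_8_group s\<^esub> p) = (False, False, False)"
    then show ?thesis using W ws by (intro O8.prod_oneI[of "x # y # ws"]) (auto simp: p_def)
  next
    assume "y \<otimes>\<^bsub>order_8_group s\<^esub> (x \<otimes>\<^bsub>order_8_group s\<^esub> p) = (False, False, False)"
    then show ?thesis using W ws by (intro O8.prod_oneI[of "y # x # ws"]) (auto simp: p_def)
  qed
qed

text \<open>The cofactor of a product-one factor has central product, and a noncommuting pair in it
  allows this product to be corrected to the identity.\<close>

lemma order_8_atom_split:
  assumes U: "U \<in> product_one_atoms (order_8_group s)" "U = X + Y" and X: "prod_one (order_8_group s) X" "X \<noteq> {#}"
    and xy: "x \<in># Y" "y \<in># Y" "skew x y"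
  shows False
proof -
  have "even_axes Y"
    using even_axes_cancel[OF prod_one_even_axes[OF atom_prod_one[OF U(1)[unfolded U(2)]]] prod_one_even_axes[OF X(1)]] .
  then have "prod_one (order_8_group s) Y" using xy by (rule even_axes_prod_one)
  then show False using atom_split[OF U(1)[unfolded U(2)] X(1)] X(2) xy(1) by auto
qed

text \<open>Commuting terms lie in the centre together with one axis, a subgroup of order four, and
  its atoms have at most four terms.\<close>

lemma order_8_skew_pair:
  assumes U: "U \<in> product_one_atoms (order_8_group s)" "4 < size U"
  shows "\<exists>x y. x \<in># U \<and> y \<in># U \<and> skew x y"
proof (rule ccontr)
  assume no: "\<not> ?thesis"
  \<comment> \<open>The value (True, False) is an arbitrary default for the case that all terms are
    central.\<close>
  define \<alpha> where "\<alpha> = (if \<exists>x. x \<in># U \<and> axis x \<noteq> (False, False)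
    then axis (SOME x. x \<in># U \<and> axis x \<noteq> (False, False)) else (True, False))"
  obtain u v where uv: "\<alpha> = (u, v)" by (cases \<alpha>)
  define H where "H = {(False, False, False), (False, False, True), (u, v, False), (u, v, True)}"
  have UH: "set_mset U \<subseteq> H"
  proof
    fix x assume x: "x \<in># U"
    have "axis x = \<alpha>" if "axis x \<noteq> (False, False)"
    proof -
      have ex: "\<exists>x. x \<in># U \<and> axis x \<noteq> (False, False)" using x that by blast
      define y where "y = (SOME x. x \<in># U \<and> axis x \<noteq> (False, False))"
      have y: "y \<in># U" "axis y \<noteq> (False, False)" using someI_ex[OF ex] by (auto simp: y_def)
      have "\<alpha> = axis y" using ex by (simp add: \<alpha>_def y_def)
      moreover have "\<not> skew x y" using no x y by blast
      ultimately show ?thesis using y that by (auto simp: skew_def)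
    qed
    then show "x \<in> H" using uv by (cases x) (auto simp: H_def)
  qed
  have "subgroup H (order_8_group s)"
  proof (rule O8.subgroupI)
    fix x y assume "x \<in> H" "y \<in> H"
    then show "x \<otimes>\<^bsub>order_8_group s\<^esub> y \<in> H" unfolding H_def by (elim insertE emptyE; simp; cases u; cases v; cases s; simp)
  next
    fix x assume x: "x \<in> H"
    have "inv\<^bsub>order_8_group s\<^esub> x = x \<otimes>\<^bsub>order_8_group s\<^esub> (x \<otimes>\<^bsub>order_8_group s\<^esub> x)"
      by (rule O8.inv_equality) (cases x; simp; argo)+
    then show "inv\<^bsub>order_8_group s\<^esub> x \<in> H" using x unfolding H_def by (elim insertE emptyE; simp; cases u; cases v; cases s; simp)
  qed (auto simp: H_def)
  then have gH: "group (order_8_group s\<lparr>carrier := H\<rparr>)" by (rule O8.subgroup_imp_group)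
  have "U \<in> product_one_atoms (order_8_group s\<lparr>carrier := H\<rparr>)"
    using U(1) UH by (auto simp: product_one_atoms_iff carrier_product_one_monoid_iff)
  then have "size U \<le> card (carrier (order_8_group s\<lparr>carrier := H\<rparr>))"
    by (intro size_product_one_atom_le[OF gH]) (auto simp: H_def)
  also have "\<dots> \<le> 4" unfolding H_def by (simp add: card_insert_if)
  finally show False using U(2) by simp
qed

text \<open>Two copies of the central involution would split off and leave a noncommuting
  pair.\<close>

lemma order_8_central_count:
  assumes U: "U \<in> product_one_atoms (order_8_group s)" "4 < size U"
  shows "count U (False, False, True) \<le> 1"
proof (rule ccontr)
  let ?z = "(False, False, True)"
  obtain x y where xy: "x \<in># U" "y \<in># U" "skew x y" using order_8_skew_pair[OF U] by auto
  assume "\<not> ?thesis"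
  then have eq: "U = {#?z, ?z#} + (U - {#?z, ?z#})"
    by (intro subset_mset.add_diff_inverse[symmetric] mset_subset_eqI) auto
  have "x \<noteq> ?z" "y \<noteq> ?z" using xy(3) by (auto simp: skew_def)
  then have "x \<in># U - {#?z, ?z#}" "y \<in># U - {#?z, ?z#}" using xy by (auto simp: in_diff_count)
  moreover have "prod_one (order_8_group s) {#?z, ?z#}" by (simp add: O8.prod_one_pair)
  ultimately show False using order_8_atom_split[OF U(1) eq _ _ _ _ xy(3)] by simp
qed

lemma order_8_square: "axis x \<noteq> (False, False) \<Longrightarrow>
  x \<otimes>\<^bsub>order_8_group s\<^esub> x = (False, False, False) \<or> x \<otimes>\<^bsub>order_8_group s\<^esub> x = (False, False, True)"
  by (cases x) auto

text \<open>Two terms of axis \<alpha> with trivial product would split off and leave terms of both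
  axes. So the four terms of axis \<alpha> are equal and of order four; as g^4 is trivial, h k is
  not.\<close>

lemma order_8_four_two:
  assumes U: "U \<in> product_one_atoms (order_8_group s)" "size U = 6"
    and ab: "axis_count U \<alpha> = 4" "axis_count U \<beta> = 2" "\<alpha> \<noteq> \<beta>" "\<alpha> \<noteq> (False, False)" "\<beta> \<noteq> (False, False)"
  obtains g h k where "U = replicate_mset 4 g + {#h, k#}" "axis g = \<alpha>" "axis h = \<beta>" "axis k = \<beta>"
    "g \<otimes>\<^bsub>order_8_group s\<^esub> g = (False, False, True)" "h \<otimes>\<^bsub>order_8_group s\<^esub> k \<noteq> (False, False, False)"
proof -
  obtain u v where uv: "\<alpha> = (u, v)" by (cases \<alpha>)
  have no: False if "U = {#x, y#} + Y" "prod_one (order_8_group s) {#x, y#}" "axis x = \<alpha>" "axis y = \<alpha>" for x y Y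
  proof -
    have "axis_count Y \<alpha> > 0" "axis_count Y \<beta> > 0" using ab that by simp_all
    then obtain x' y' where "x' \<in># Y" "axis x' = \<alpha>" "y' \<in># Y" "axis y' = \<beta>" using axis_count_pos by metis
    then show False using order_8_atom_split[OF U(1) that(1,2), of x' y'] ab by (simp add: skew_def)
  qed
  have "\<exists>g. axis g = \<alpha> \<and> replicate_mset 4 g \<subseteq># U \<and> g \<otimes>\<^bsub>order_8_group s\<^esub> g = (False, False, True)"
  proof -
    have c: "count U (u, v, False) + count U (u, v, True) = 4" using ab(1) axis_count_eq uv by metis
    have sq: "x \<otimes>\<^bsub>order_8_group s\<^esub> x = (False, False, True)" if "axis x = \<alpha>" "2 \<le> count U x" for x
    proof (rule ccontr)
      assume "x \<otimes>\<^bsub>order_8_group s\<^esub> x \<noteq> (False, False, True)"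
      then have "prod_one (order_8_group s) {#x, x#}" using order_8_square[of x s] that ab by (simp add: O8.prod_one_pair)
      moreover have "U = {#x, x#} + (U - {#x, x#})"
        using that(2) by (intro subset_mset.add_diff_inverse[symmetric] mset_subset_eqI) auto
      ultimately show False using no that(1) by blast
    qed
    have sq2: "x \<otimes>\<^bsub>order_8_group s\<^esub> x = (False, False, True)" if "axis x = \<alpha>" for x
    proof -
      have "2 \<le> count U (u, v, False) \<or> 2 \<le> count U (u, v, True)" using c by linarith
      then obtain w where "(u, v, w) \<otimes>\<^bsub>order_8_group s\<^esub> (u, v, w) = (False, False, True)" using sq uv by (metis axis_simp)
      then show ?thesis using that uv by (cases x) auto
    qed
    \<comment> \<open>The two elements of an axis are inverse to each other when they have order
      four.\<close>
    have "count U (u, v, False) = 0 \<or> count U (u, v, True) = 0"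
    proof (rule ccontr)
      assume n: "\<not> ?thesis"
      have "(u, v, False) \<otimes>\<^bsub>order_8_group s\<^esub> (u, v, True) = (False, False, False)"
        using sq2[of "(u, v, False)"] uv by auto
      then have "prod_one (order_8_group s) {#(u, v, False), (u, v, True)#}" by (simp add: O8.prod_one_pair)
      moreover have "U = {#(u, v, False), (u, v, True)#} + (U - {#(u, v, False), (u, v, True)#})"
        using n by (intro subset_mset.add_diff_inverse[symmetric] mset_subset_eqI) auto
      ultimately show False using no uv by (metis axis_simp)
    qed
    then have "4 \<le> count U (u, v, False) \<or> 4 \<le> count U (u, v, True)" using c by linarith
    then show ?thesis using sq2 uv by (metis axis_simp count_le_replicate_mset_subset_eq)
  qed
  then obtain g where g: "axis g = \<alpha>" "replicate_mset 4 g \<subseteq># U" "g \<otimes>\<^bsub>order_8_group s\<^esub> g = (False, False, True)" by blast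
  define W where "W = U - replicate_mset 4 g"
  have UW: "U = replicate_mset 4 g + W" using g(2) by (simp add: W_def)
  then have "size W = 2" using U(2) by simp
  then obtain h k where hk: "W = {#h, k#}"
    by (metis One_nat_def Suc_1 size_1_singleton_mset size_eq_Suc_imp_eq_union size_Suc_Diff1 add_mset_add_single insert_DiffM size_add_mset nat.inject)
  have "axis_count W \<beta> = size W" using UW ab g \<open>size W = 2\<close> by simp
  then have ax: "axis h = \<beta>" "axis k = \<beta>" using axis_count_size[of W \<beta>] hk by (simp_all del: axis_count_simps)
  moreover have "h \<otimes>\<^bsub>order_8_group s\<^esub> k \<noteq> (False, False, False)"
  proof
    assume "h \<otimes>\<^bsub>order_8_group s\<^esub> k = (False, False, False)"
    then have "prod_one (order_8_group s) {#h, k#}" by (simp add: O8.prod_one_pair)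
    moreover have "prod_one (order_8_group s) (replicate_mset 4 g)"
      using g(3) by (intro O8.prod_oneI[of "[g, g, g, g]"]) (cases g; auto simp: eval_nat_numeral)+
    ultimately show False using atom_split[of "replicate_mset 4 g" W "order_8_group s"] U(1) UW hk by simp
  qed
  ultimately show ?thesis using that[of g h k] UW hk g by simp
qed

text \<open>By parity the three axis counts are congruent modulo two, and at most one term is
  central. This leaves 2, 2, 2; 3, 1, 1 with a central term; 6, 0, 0; and 4, 2, 0. The first two
  admit a factor whose removal keeps a noncommuting pair, and the third has no such pair.\<close>

lemma order_8_six_atom:
  assumes U: "U \<in> product_one_atoms (order_8_group s)" "size U = 6"
  obtains g h k where "U = replicate_mset 4 g + {#h, k#}" "axis g \<noteq> (False, False)"
    "axis h \<noteq> (False, False)" "axis h \<noteq> axis g" "axis k = axis h"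
    "g \<otimes>\<^bsub>order_8_group s\<^esub> g = (False, False, True)" "h \<otimes>\<^bsub>order_8_group s\<^esub> k \<noteq> (False, False, False)"
proof -
  let ?z = "(False, False, True)"
  let ?A = "axis_count U"
  obtain x y where xy: "x \<in># U" "y \<in># U" "skew x y" using order_8_skew_pair[OF U(1)] U(2) by auto
  note concl = that
  have one: "count U (False, False, False) = 0"
    using O8.atom_one[OF U(1)] U(2) by (auto simp: count_eq_zero_iff)
  have z1: "?A (False, False) \<le> 1"
    using order_8_central_count[OF U(1)] U(2) one by (simp add: axis_count_eq)
  \<comment> \<open>One term from each axis can be ordered to trivial product, and its removal
    leaves all three axes represented.\<close>
  have no222: False if c: "2 \<le> ?A (True, False)" "2 \<le> ?A (False, True)" "2 \<le> ?A (True, True)"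
  proof -
    have "?A (True, False) > 0" "?A (False, True) > 0" "?A (True, True) > 0" using c by auto
    then obtain x y w where e: "x \<in># U" "axis x = (True, False)" "y \<in># U" "axis y = (False, True)" "w \<in># U" "axis w = (True, True)"
      using axis_count_pos by metis
    let ?Y = "U - {#x, y, w#}"
    have d: "x \<noteq> y" "x \<noteq> w" "y \<noteq> w" using e by auto
    have eq: "U = {#x, y, w#} + ?Y"
      using e d by (intro subset_mset.add_diff_inverse[symmetric] mset_subset_eqI) (auto simp: Suc_le_eq)
    have "even_axes {#x, y, w#}" using e by (simp add: even_axes_def)
    then have po: "prod_one (order_8_group s) {#x, y, w#}"
      using e by (intro even_axes_prod_one[of _ x y]) (auto simp: skew_def)
    have "?A (True, False) = Suc (axis_count ?Y (True, False))" "?A (False, True) = Suc (axis_count ?Y (False, True))"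
      using e arg_cong[OF eq, of "\<lambda>M. axis_count M (True, False)"] arg_cong[OF eq, of "\<lambda>M. axis_count M (False, True)"] by simp_all
    then have "axis_count ?Y (True, False) > 0" "axis_count ?Y (False, True) > 0" using c by auto
    then obtain x' y' where "x' \<in># ?Y" "axis x' = (True, False)" "y' \<in># ?Y" "axis y' = (False, True)"
      using axis_count_pos by metis
    then show False using order_8_atom_split[OF U(1) eq po, of x' y'] by (simp add: skew_def)
  qed
  \<comment> \<open>A repeated x of the threefold axis allows x^2 or z x^2 to be split off,
    according to the order of x; y and w remain.\<close>
  have no311: False if c: "1 \<le> ?A (False, False)" "3 \<le> ?A \<alpha>" "1 \<le> ?A \<beta>" "1 \<le> ?A \<gamma>"
    and d: "\<alpha> \<noteq> \<beta>" "\<alpha> \<noteq> \<gamma>" "\<beta> \<noteq> \<gamma>" "\<alpha> \<noteq> (False, False)" "\<beta> \<noteq> (False, False)" "\<gamma> \<noteq> (False, False)" for \<alpha> \<beta> \<gamma>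
  proof -
    have z: "?z \<in># U" using c(1) one by (simp add: axis_count_eq Suc_le_eq)
    obtain u v where uv: "\<alpha> = (u, v)" by (cases \<alpha>)
    have "2 \<le> count U (u, v, False) \<or> 2 \<le> count U (u, v, True)" using c(2) unfolding uv axis_count_eq by linarith
    then obtain x where x: "2 \<le> count U x" "axis x = \<alpha>" using uv by (metis axis_simp)
    have "?A \<beta> > 0" "?A \<gamma> > 0" using c by auto
    then obtain y w where yw: "y \<in># U" "axis y = \<beta>" "w \<in># U" "axis w = \<gamma>" using axis_count_pos by metis
    have ne: "x \<noteq> ?z" "y \<noteq> ?z" "w \<noteq> ?z" "x \<noteq> y" "x \<noteq> w" "y \<noteq> w" using x yw d by auto
    have sk: "skew y w" using yw d by (simp add: skew_def)
    show False
    proof (cases "x \<otimes>\<^bsub>order_8_group s\<^esub> x = (False, False, False)")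
      case True
      have eq: "U = {#x, x#} + (U - {#x, x#})"
        using x by (intro subset_mset.add_diff_inverse[symmetric] mset_subset_eqI) auto
      have "y \<in># U - {#x, x#}" "w \<in># U - {#x, x#}" using yw ne by (auto simp: in_diff_count)
      moreover have "prod_one (order_8_group s) {#x, x#}" using True by (simp add: O8.prod_one_pair)
      ultimately show False using order_8_atom_split[OF U(1) eq _ _ _ _ sk] by simp
    next
      case False
      then have xx: "x \<otimes>\<^bsub>order_8_group s\<^esub> x = ?z" using order_8_square[of x s] x d by simp
      have eq: "U = {#?z, x, x#} + (U - {#?z, x, x#})"
        using x ne z by (intro subset_mset.add_diff_inverse[symmetric] mset_subset_eqI) (auto simp: Suc_le_eq)
      have "y \<in># U - {#?z, x, x#}" "w \<in># U - {#?z, x, x#}" using yw ne by (auto simp: in_diff_count)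
      moreover have "prod_one (order_8_group s) {#?z, x, x#}" using xx by (simp add: O8.prod_one_triple)
      ultimately show False using order_8_atom_split[OF U(1) eq _ _ _ _ sk] by simp
    qed
  qed
  have res: thesis if ab: "?A \<alpha> = 4" "?A \<beta> = 2" "\<alpha> \<noteq> \<beta>" "\<alpha> \<noteq> (False, False)" "\<beta> \<noteq> (False, False)" for \<alpha> \<beta>
  proof -
    obtain g h k where r: "U = replicate_mset 4 g + {#h, k#}" "axis g = \<alpha>" "axis h = \<beta>" "axis k = \<beta>"
      "g \<otimes>\<^bsub>order_8_group s\<^esub> g = (False, False, True)" "h \<otimes>\<^bsub>order_8_group s\<^esub> k \<noteq> (False, False, False)"
      by (rule order_8_four_two[OF U ab])
    then show thesis using concl[of g h k] ab by metis
  qed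
  define a b c n where abc: "a = ?A (True, False)" "b = ?A (False, True)" "c = ?A (True, True)" "n = ?A (False, False)"
  have ev: "even (a + c)" "even (b + c)" using prod_one_even_axes[OF atom_prod_one[OF U(1)]] by (simp_all add: even_axes_def abc)
  have sum: "n + a + b + c = 6" using size_axis_count[of U] U(2) by (simp add: abc)
  have n01: "n = 0 \<or> n = 1" using z1 abc by linarith
  have two: "a \<noteq> 6" "b \<noteq> 6" "c \<noteq> 6"
  proof -
    have "?A (axis x) > 0" "?A (axis y) > 0" using xy axis_count_pos by blast+
    moreover have "axis x \<in> {(True, False), (False, True), (True, True)}" "axis y \<in> {(True, False), (False, True), (True, True)}"
      using xy(3) by (cases x; cases y; auto simp: skew_def)+
    ultimately have "a > 0 \<and> b > 0 \<or> a > 0 \<and> c > 0 \<or> b > 0 \<and> c > 0"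
      using xy(3) unfolding skew_def abc by (elim insertE emptyE; simp)
    then show "a \<noteq> 6" "b \<noteq> 6" "c \<noteq> 6" using sum by linarith+
  qed
  have "(a = 2 \<and> b = 2 \<and> c = 2) \<or> n = 1 \<and> (a = 3 \<and> b = 1 \<and> c = 1 \<or> a = 1 \<and> b = 3 \<and> c = 1 \<or> a = 1 \<and> b = 1 \<and> c = 3)
    \<or> a = 4 \<and> b = 2 \<or> a = 4 \<and> c = 2 \<or> b = 4 \<and> a = 2 \<or> b = 4 \<and> c = 2 \<or> c = 4 \<and> a = 2 \<or> c = 4 \<and> b = 2"
  proof -
    have ra: "a = 0 \<or> a = 1 \<or> a = 2 \<or> a = 3 \<or> a = 4 \<or> a = 5 \<or> a = 6"
      and rb: "b = 0 \<or> b = 1 \<or> b = 2 \<or> b = 3 \<or> b = 4 \<or> b = 5 \<or> b = 6" using sum by linarith+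
    have c: "c = 6 - n - a - b" using sum by linarith
    show ?thesis using ra rb n01 ev sum two unfolding c by (elim disjE) simp_all
  qed
  then show thesis
    using no222 no311[of "(True, False)" "(False, True)" "(True, True)"] no311[of "(False, True)" "(True, False)" "(True, True)"]
      no311[of "(True, True)" "(True, False)" "(False, True)"]
      res[of "(True, False)" "(False, True)"] res[of "(True, False)" "(True, True)"] res[of "(False, True)" "(True, False)"]
      res[of "(False, True)" "(True, True)"] res[of "(True, True)" "(True, False)"] res[of "(True, True)" "(False, True)"]
    unfolding abc by (elim disjE conjE) simp_all
qed

lemma order_8_inv:
  assumes "axis g \<noteq> (False, False)" "g \<otimes>\<^bsub>order_8_group s\<^esub> g = (False, False, True)"
  shows "inv\<^bsub>order_8_group s\<^esub> g = (fst g, fst (snd g), \<not> snd (snd g))" "inv\<^bsub>order_8_group s\<^esub> g \<noteq> g"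
    "axis (inv\<^bsub>order_8_group s\<^esub> g) = axis g"
    "inv\<^bsub>order_8_group s\<^esub> g \<otimes>\<^bsub>order_8_group s\<^esub> inv\<^bsub>order_8_group s\<^esub> g = (False, False, True)"
proof -
  show 1: "inv\<^bsub>order_8_group s\<^esub> g = (fst g, fst (snd g), \<not> snd (snd g))"
    using assms by (intro O8.inv_equality) (cases g; auto)+
  show "inv\<^bsub>order_8_group s\<^esub> g \<noteq> g" "axis (inv\<^bsub>order_8_group s\<^esub> g) = axis g"
    "inv\<^bsub>order_8_group s\<^esub> g \<otimes>\<^bsub>order_8_group s\<^esub> inv\<^bsub>order_8_group s\<^esub> g = (False, False, True)"
    unfolding 1 using assms by (cases g; auto)+
qed

text \<open>A factor with two terms would be an inverse pair and lie in one axis, but neither g g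
  nor h k has trivial product.\<close>

lemma order_8_four_atom:
  assumes "axis g \<noteq> (False, False)" "axis h \<noteq> (False, False)" "axis g \<noteq> axis h" "axis k = axis h"
    "g \<otimes>\<^bsub>order_8_group s\<^esub> g \<noteq> (False, False, False)" "h \<otimes>\<^bsub>order_8_group s\<^esub> k \<noteq> (False, False, False)"
  shows "{#g, g, h, k#} \<in> product_one_atoms (order_8_group s)"
proof (rule O8.small_atomI)
  show "prod_one (order_8_group s) {#g, g, h, k#}"
    using assms by (intro even_axes_prod_one[of _ g h]) (auto simp: even_axes_def skew_def)
  have ax: "axis x = axis y" if "x \<otimes>\<^bsub>order_8_group s\<^esub> y = (False, False, False)" for x y
    using that by (cases x; cases y) auto
  have hk: "k \<otimes>\<^bsub>order_8_group s\<^esub> h \<noteq> (False, False, False)"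
    using assms(4,6) by (cases h; cases k) auto
  fix x y assume xy: "x \<in># {#g, g, h, k#}" "y \<in># {#g, g, h, k#}" "{#x, y#} \<subseteq># {#g, g, h, k#}"
    "x \<otimes>\<^bsub>order_8_group s\<^esub> y = \<one>\<^bsub>order_8_group s\<^esub>"
  have a: "axis x = axis y" using ax xy(4) by simp
  have "h \<noteq> g" "k \<noteq> g" using assms by auto
  then have "\<not> (x = y \<and> h \<noteq> k \<and> (x = h \<or> x = k))"
    using mset_subset_eq_count[OF xy(3), of x] by auto
  then show "{#g, g, h, k#} = {#x, y#}"
    using xy(1,2,4) a assms hk by auto
qed (use assms(1,2,4) in auto)

lemma order_8_power_atom:
  assumes "axis g \<noteq> (False, False)" "g \<otimes>\<^bsub>order_8_group s\<^esub> g = (False, False, True)"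
  shows "{#g, g, g, g#} \<in> product_one_atoms (order_8_group s)"
proof (rule O8.small_atomI)
  show "prod_one (order_8_group s) {#g, g, g, g#}"
    using assms by (intro O8.prod_oneI[of "[g, g, g, g]"]) (cases g; auto)+
qed (use assms in auto)

text \<open>For atoms g^4 h k and x^4 p q, balance forces x = g^-1. Regrouping gives three atoms:
  g^2 h k, g^2 p q and x^4.\<close>

lemma order_8_2_6:
  assumes D: "davenport_6 (order_8_group s)" and L: "L \<in> system_of_lengths (order_8_group s)" "{2, 6} \<subseteq> L"
  shows "3 \<in> L"
proof -
  interpret davenport_6 "order_8_group s" by (rule D)
  let ?M = "order_8_group s"
  obtain S where S: "L = {k. fact_len ?M k S}" using L(1) by (auto simp: mem_system_of_lengths)
  then have "fact_len ?M 2 S" "fact_len ?M (3 * 2) S" using L(2) by auto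
  then obtain As where As: "length As = 2" "sum_list As = S"
    "\<And>A. A \<in> set As \<Longrightarrow> A \<in> product_one_atoms ?M \<and> size A = 6" "O8.balanced s S"
    using maximal_length by metis
  obtain U V where UV: "As = [U, V]" using As(1) by (auto simp: length_Suc_conv numeral_2_eq_2)
  have at: "U \<in> product_one_atoms ?M" "V \<in> product_one_atoms ?M" "size U = 6" "size V = 6"
    and SUV: "S = U + V" using As(2,3) UV by auto
  obtain g h k where U: "U = replicate_mset 4 g + {#h, k#}" "axis g \<noteq> (False, False)"
    "axis h \<noteq> (False, False)" "axis h \<noteq> axis g" "axis k = axis h"
    "g \<otimes>\<^bsub>?M\<^esub> g = (False, False, True)" "h \<otimes>\<^bsub>?M\<^esub> k \<noteq> (False, False, False)"
    by (rule order_8_six_atom[OF at(1,3)])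
  obtain x p q where V: "V = replicate_mset 4 x + {#p, q#}" "axis x \<noteq> (False, False)"
    "axis p \<noteq> (False, False)" "axis p \<noteq> axis x" "axis q = axis p"
    "x \<otimes>\<^bsub>?M\<^esub> x = (False, False, True)" "p \<otimes>\<^bsub>?M\<^esub> q \<noteq> (False, False, False)"
    by (rule order_8_six_atom[OF at(2,4)])
  note g' = order_8_inv[OF U(2,6)]
  let ?g = "inv\<^bsub>?M\<^esub> g"
  have "count S ?g = count S g" using O8.balancedD(2)[OF As(4), of g] g'(2) by simp
  moreover have "?g \<noteq> h" "?g \<noteq> k" using g'(3) U(4,5) by auto
  ultimately have "4 \<le> count V ?g" using SUV U(1) g'(2) by (auto split: if_splits)
  then have "x = ?g" using V(1) by (auto split: if_splits)
  then have eq: "S = {#g, g, h, k#} + ({#g, g, p, q#} + {#?g, ?g, ?g, ?g#})"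
    using SUV U(1) V(1) by (simp add: eval_nat_numeral add_mset_commute)
  have "{#g, g, h, k#} \<in> product_one_atoms ?M" using U by (intro order_8_four_atom) auto
  moreover have "{#g, g, p, q#} \<in> product_one_atoms ?M"
    using U V \<open>x = ?g\<close> g'(3) by (intro order_8_four_atom) auto
  moreover have "{#?g, ?g, ?g, ?g#} \<in> product_one_atoms ?M"
    using order_8_power_atom[OF _ g'(4)] g'(3) U(2) by metis
  ultimately have "fact_len ?M 3 S"
    unfolding fact_len_def eq by (intro exI[of _ "[{#g, g, h, k#}, {#g, g, p, q#}, {#?g, ?g, ?g, ?g#}]"]) simp
  then show ?thesis using S by simp
qed

text \<open>The witness is z^2 b^4 c^4 with noncommuting reflections b and c. An odd number of z is
  compensated only by reordering b and c, so the dividing atoms are z^2, b^2, c^2 and z b^2 c^2; the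
  last is used twice or not at all.\<close>

lemma D8_2_5: "{2, 5} \<in> system_of_lengths (order_8_group False)"
proof -
  let ?M = "order_8_group False"
  let ?z = "(False, False, True)" and ?b = "(False, True, False)" and ?c = "(True, True, False)"
  let ?R = "\<lambda>i j k. replicate_mset i ?z + (replicate_mset j ?b + replicate_mset k ?c)"
  let ?S = "?R 2 4 4"
  have rep: "prod_one ?M (replicate_mset n x)" if xx: "x \<otimes>\<^bsub>?M\<^esub> x = (False, False, False)" and n: "even n" for n x
  proof -
    obtain m where n: "n = 2 * m" using n by blast
    have "x [^]\<^bsub>?M\<^esub> n = (x [^]\<^bsub>?M\<^esub> (2::nat)) [^]\<^bsub>?M\<^esub> m" unfolding n using O8.nat_pow_pow[of x False 2 m] by simp
    also have "x [^]\<^bsub>?M\<^esub> (2::nat) = \<one>\<^bsub>?M\<^esub>" using xx by (cases x) (auto simp: numeral_2_eq_2)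
    also have "\<one>\<^bsub>?M\<^esub> [^]\<^bsub>?M\<^esub> m = \<one>\<^bsub>?M\<^esub>" by (rule O8.nat_pow_one)
    finally show ?thesis using O8.prod_one_replicate[of x False n] by simp
  qed
  have even_po: "prod_one ?M (?R i j k)" if "even i" "even j" "even k" for i j k
    using that by (intro O8.prod_one_add rep) auto
  have odd_po: "prod_one ?M (?R i j k)" if "even j" "even k" "0 < j" "0 < k" for i j k
    using that by (intro even_axes_prod_one[of _ ?b ?c]) (auto simp: even_axes_def skew_def)
  \<comment> \<open>If b or c is missing, all terms commute, and an odd number of copies of z leaves
    a factor z.\<close>
  have shape: "even j \<and> even k \<and> (even i \<or> 0 < j \<and> 0 < k)" if p: "prod_one ?M (?R i j k)" for i j k
  proof -
    have ev: "even j" "even k" using prod_one_even_axes[OF p] by (auto simp: even_axes_def)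
    have one: False if i: "odd i" and pr: "prod_one ?M (replicate_mset i ?z + replicate_mset n x)" and x: "x \<in> {?b, ?c}" and n: "even n" for n x
    proof -
      obtain xs where xs: "mset xs = replicate_mset i ?z + replicate_mset n x"
        "foldr (\<otimes>\<^bsub>?M\<^esub>) xs (False, False, False) = (False, False, False)"
        using pr by (auto simp: carrier_product_one_monoid_iff)
      have "foldr (\<otimes>\<^bsub>?M\<^esub>) xs (False, False, False) =
          (if odd (count (mset xs) x) then x else (False, False, False)) \<otimes>\<^bsub>?M\<^esub>
          (if odd (count (mset xs) ?z) then ?z else (False, False, False))"
        if "set xs \<subseteq> {?z, x}" for xs
        using that
      proof (induction xs)
        case (Cons y ys)
        then show ?case using \<open>x \<in> {?b, ?c}\<close> by (elim insertE emptyE) auto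
      qed simp
      moreover have "set xs \<subseteq> {?z, x}" using arg_cong[OF xs(1), of set_mset] by (auto split: if_splits)
      moreover have "count (mset xs) x = n" "count (mset xs) ?z = i" using xs(1) x by auto
      ultimately show False using xs(2) i n by simp
    qed
    have "even i \<or> 0 < j \<and> 0 < k"
    proof (rule ccontr)
      assume n: "\<not> ?thesis"
      then consider "j = 0" | "k = 0" by auto
      then show False
        using one[of k ?c] one[of j ?b] n p ev by cases auto
    qed
    then show ?thesis using ev by simp
  qed
  have small: "C = X" if C: "C = ?R i j k" "C \<in> product_one_atoms ?M"
    and X: "C = X + ?R i' j' k'" "X \<noteq> {#}" "prod_one ?M X" "even j'" "even k'" "even i' \<or> 0 < j' \<and> 0 < k'" for C X i j k i' j' k'
  proof -
    have "prod_one ?M (?R i' j' k')" using even_po odd_po X by blast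
    then have "?R i' j' k' = {#}" using atom_split[of X "?R i' j' k'" ?M] C(2) X by blast
    then show ?thesis using X(1) by simp
  qed
  let ?Cs = "[{#?z, ?z#}, {#?b, ?b#}, {#?c, ?c#}, {#?z, ?b, ?b, ?c, ?c#}]"
  have cand: "C \<in> set ?Cs" if C: "C \<in> product_one_atoms ?M" "C \<subseteq># ?S" for C
  proof -
    define i j k where ijk: "i = count C ?z" "j = count C ?b" "k = count C ?c"
    have "set_mset C \<subseteq> {?z, ?b, ?c}" using set_mset_mono[OF C(2)] by auto
    then have Ceq: "C = ?R i j k" unfolding ijk by (intro multiset_eqI) (auto simp: count_eq_zero_iff)
    have s: "even j \<and> even k \<and> (even i \<or> 0 < j \<and> 0 < k)" using shape atom_prod_one[OF C(1)] Ceq by metis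
    have i2: "i \<le> 2" using mset_subset_eq_count[OF C(2), of ?z] ijk by simp
    have ne: "i \<noteq> 0 \<or> j \<noteq> 0 \<or> k \<noteq> 0" using atom_nonempty[OF C(1)] Ceq by auto
    have po: "prod_one ?M {#?z, ?z#}" "prod_one ?M {#?b, ?b#}" "prod_one ?M {#?c, ?c#}"
      by (simp_all add: O8.prod_one_pair)
    consider "i = 2" | "i = 1" | "i = 0" "2 \<le> j" | "i = 0" "j = 0" "2 \<le> k"
    proof -
      have "j \<noteq> 1" "k \<noteq> 1" using s by auto
      then have "i = 2 \<or> i = 1 \<or> i = 0 \<and> 2 \<le> j \<or> i = 0 \<and> j = 0 \<and> 2 \<le> k" using i2 ne by linarith
      then show thesis using that by blast
    qed
    then show ?thesis
    proof cases
      case 1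
      then have "C = {#?z, ?z#} + ?R 0 j k" unfolding Ceq by (simp add: numeral_2_eq_2)
      then have "C = {#?z, ?z#}" using small[OF Ceq C(1), of "{#?z, ?z#}" 0 j k] po s by simp
      then show ?thesis by simp
    next
      case 2
      then have p: "even j" "even k" "0 < j" "0 < k" using s by auto
      then have "2 \<le> j" "2 \<le> k" using dvd_imp_le by blast+
      then have "C = {#?z, ?b, ?b, ?c, ?c#} + ?R 0 (j - 2) (k - 2)" unfolding Ceq 2 by (intro multiset_eqI) auto
      moreover have "prod_one ?M {#?z, ?b, ?b, ?c, ?c#}" using odd_po[of 2 2 1] by (simp add: numeral_2_eq_2 add_mset_commute)
      ultimately have "C = {#?z, ?b, ?b, ?c, ?c#}"
        using small[OF Ceq C(1), of "{#?z, ?b, ?b, ?c, ?c#}" 0 "j - 2" "k - 2"] p by simp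
      then show ?thesis by simp
    next
      case 3
      then have "C = {#?b, ?b#} + ?R 0 (j - 2) k" unfolding Ceq by (intro multiset_eqI) auto
      then have "C = {#?b, ?b#}" using small[OF Ceq C(1), of "{#?b, ?b#}" 0 "j - 2" k] po s by simp
      then show ?thesis by simp
    next
      case 4
      then have "C = {#?c, ?c#} + ?R 0 0 (k - 2)" unfolding Ceq by (intro multiset_eqI) auto
      then have "C = {#?c, ?c#}" using small[OF Ceq C(1), of "{#?c, ?c#}" 0 0 "k - 2"] po s by simp
      then show ?thesis by simp
    qed
  qed
  have "distinct (map (\<lambda>C. (size C, set_mset C)) ?Cs)" by simp
  then have d: "distinct ?Cs" by (simp only: distinct_map)
  have at: "C \<in> product_one_atoms ?M" if "C \<in> set (butlast ?Cs)" for C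
  proof -
    have inv: "inv\<^bsub>?M\<^esub> x = x" if "x \<otimes>\<^bsub>?M\<^esub> x = (False, False, False)" for x
      using that by (intro O8.inv_equality) auto
    then show ?thesis using that O8.pair_atom[of ?z False] O8.pair_atom[of ?b False] O8.pair_atom[of ?c False] by auto
  qed
  have at5: "{#?z, ?b, ?b, ?c, ?c#} \<in> product_one_atoms ?M"
  proof (rule O8.small_atomI)
    show "prod_one ?M {#?z, ?b, ?b, ?c, ?c#}" using odd_po[of 2 2 1] by (simp add: numeral_2_eq_2 add_mset_commute)
    fix x y assume xy: "x \<in># {#?z, ?b, ?b, ?c, ?c#}" "y \<in># {#?z, ?b, ?b, ?c, ?c#}" "{#x, y#} \<subseteq># {#?z, ?b, ?b, ?c, ?c#}"
      "x \<otimes>\<^bsub>?M\<^esub> y = \<one>\<^bsub>?M\<^esub>" and po: "prod_one ?M ({#?z, ?b, ?b, ?c, ?c#} - {#x, y#})"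
    have "\<not> (x = ?z \<and> y = ?z)" using mset_subset_eq_count[OF xy(3), of ?z] by auto
    then consider "x = ?b" "y = ?b" | "x = ?c" "y = ?c" using xy(1,2,4) by auto
    then have "prod_one ?M {#?z, ?c, ?c#} \<or> prod_one ?M {#?z, ?b, ?b#}"
      using po by cases auto
    then show "{#?z, ?b, ?b, ?c, ?c#} = {#x, y#}" by (simp add: O8.prod_one_triple)
  qed auto
  have "k \<in> {2, 5}" if fk: "fact_len ?M k ?S" for k
  proof -
    obtain n where n: "?S = (\<Sum>C\<leftarrow>?Cs. repeat_mset (n C) C)" "k = (\<Sum>C\<leftarrow>?Cs. n C)"
      using fact_len_candidates[OF fk cand d] by blast
    define p q r w where pqw: "p = n {#?z, ?z#}" "q = n {#?b, ?b#}" "r = n {#?c, ?c#}" "w = n {#?z, ?b, ?b, ?c, ?c#}"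
    have e: "2 = p * 2 + w" using arg_cong[OF n(1), of "\<lambda>M. count M ?z"] by (simp add: pqw)
    have f: "4 = q * 2 + w * 2" using arg_cong[OF n(1), of "\<lambda>M. count M ?b"] by (simp add: pqw)
    have h: "4 = r * 2 + w * 2" using arg_cong[OF n(1), of "\<lambda>M. count M ?c"] by (simp add: pqw)
    have g: "k = p + q + r + w" using n(2) by (simp add: pqw)
    have "p = 0 \<or> p = 1" using e by linarith
    then have "k = 2 \<or> k = 5"
    proof
      assume p: "p = 0"
      have "w = 2" using e unfolding p by linarith
      then have "q = 0" "r = 0" using f h by linarith+
      then show ?thesis using g p \<open>w = 2\<close> by linarith
    next
      assume p: "p = 1"
      have "w = 0" using e unfolding p by linarith
      then have "q = 2" "r = 2" using f h by linarith+
      then show ?thesis using g p \<open>w = 0\<close> by linarith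
    qed
    then show ?thesis by simp
  qed
  moreover have 2: "fact_len ?M 2 ?S"
    unfolding fact_len_def using at5
    by (intro exI[of _ "[{#?z, ?b, ?b, ?c, ?c#}, {#?z, ?b, ?b, ?c, ?c#}]"]) (simp add: eval_nat_numeral add_mset_commute)
  moreover have "fact_len ?M 5 ?S"
    unfolding fact_len_def using at
    by (intro exI[of _ "[{#?z, ?z#}, {#?b, ?b#}, {#?b, ?b#}, {#?c, ?c#}, {#?c, ?c#}]"]) (simp add: eval_nat_numeral add_mset_commute)
  ultimately have "{k. fact_len ?M k ?S} = {2, 5}" by blast
  then show ?thesis
    unfolding mem_system_of_lengths using fact_len_prod_one[OF group_order_8 2] by (intro exI[of _ ?S]) simp
qed

section \<open>The quaternion group\<close>

lemma Q8_square: "axis x \<noteq> (False, False) \<Longrightarrow> x \<otimes>\<^bsub>order_8_group True\<^esub> x = (False, False, True)"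
  by (cases x) auto

text \<open>If U has more than four terms, removing g^4 from V = g^4 h k leaves h k U, which
  contains a noncommuting pair, is product-one, and is too long for an atom; its two or three
  factors give length three or four. If U has four terms, balance would require U = g^-4 and leave h
  without its inverse.\<close>

lemma Q8_six_complement:
  assumes D: "davenport_6 (order_8_group True)"
    and U: "U \<in> product_one_atoms (order_8_group True)" "4 \<le> size U"
    and V: "V \<in> product_one_atoms (order_8_group True)" "size V = 6"
    and one: "(False, False, False) \<notin># U + V" and five: "fact_len (order_8_group True) 5 (U + V)"
  shows "fact_len (order_8_group True) 3 (U + V) \<or> fact_len (order_8_group True) 4 (U + V)"
proof -
  let ?M = "order_8_group True"
  interpret davenport_6 ?M by (rule D)
  obtain g h k where g: "V = replicate_mset 4 g + {#h, k#}" "axis g \<noteq> (False, False)"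
    "axis h \<noteq> (False, False)" "axis h \<noteq> axis g" "axis k = axis h"
    "g \<otimes>\<^bsub>?M\<^esub> g = (False, False, True)" "h \<otimes>\<^bsub>?M\<^esub> k \<noteq> (False, False, False)"
    by (rule order_8_six_atom[OF V])
  note g' = order_8_inv[OF g(2,6)]
  have ax: "axis (inv\<^bsub>?M\<^esub> x) = axis x" "inv\<^bsub>?M\<^esub> x \<noteq> x" if "axis x \<noteq> (False, False)" for x
    using order_8_inv[OF that Q8_square[OF that]] by simp_all
  have u6: "size U \<le> 6" using atom_size_le[OF U(1)] .
  define N where "N = {#h, k#} + U"
  have S: "U + V = {#g, g, g, g#} + N" unfolding N_def g(1) by (simp add: eval_nat_numeral add_mset_commute)
  show ?thesis
  proof (cases "size U = 4")
    case True
    then have bal: "O8.balanced True (U + V)" using O8.fact_len_balanced[OF five] V(2) one by simp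
    have "count (U + V) (inv\<^bsub>?M\<^esub> g) = count (U + V) g" using O8.balancedD(2)[OF bal, of g] g'(2) by simp
    moreover have "inv\<^bsub>?M\<^esub> g \<noteq> h" "inv\<^bsub>?M\<^esub> g \<noteq> k" using g'(3) g(4,5) by auto
    ultimately have "4 \<le> count U (inv\<^bsub>?M\<^esub> g)" using g(1) g'(2) by (auto split: if_splits)
    then have "replicate_mset 4 (inv\<^bsub>?M\<^esub> g) \<subseteq># U" by (simp add: count_le_replicate_mset_subset_eq)
    then have "replicate_mset 4 (inv\<^bsub>?M\<^esub> g) = U"
      using True by (metis mset_subset_size nless_le size_replicate_mset subset_mset.less_le)
    moreover have "inv\<^bsub>?M\<^esub> h \<noteq> k"
    proof
      assume "inv\<^bsub>?M\<^esub> h = k"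
      then have "h \<otimes>\<^bsub>?M\<^esub> k = \<one>\<^bsub>?M\<^esub>" using O8.r_inv[of h True] by simp
      then show False using g(7) by simp
    qed
    moreover have "h \<noteq> inv\<^bsub>?M\<^esub> g" "h \<noteq> g" "inv\<^bsub>?M\<^esub> h \<noteq> g" "inv\<^bsub>?M\<^esub> h \<noteq> inv\<^bsub>?M\<^esub> g" "inv\<^bsub>?M\<^esub> h \<noteq> h"
      using ax[OF g(3)] g'(3) g(4) by auto
    ultimately have "count (U + V) (inv\<^bsub>?M\<^esub> h) = 0" "count (U + V) h \<noteq> 0" using g(1) by auto
    moreover have "count (U + V) (inv\<^bsub>?M\<^esub> h) = count (U + V) h"
      using O8.balancedD(2)[OF bal, of h] ax(2)[OF g(3)] by simp
    ultimately show ?thesis by metis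
  next
    case False
    then have u5: "4 < size U" using U(2) by simp
    obtain x y where xy: "x \<in># U" "y \<in># U" "skew x y" using order_8_skew_pair[OF U(1) u5] by blast
    have "even_axes N" using prod_one_even_axes[OF O8.prod_one_add[OF atom_prod_one[OF U(1)] atom_prod_one[OF V(1)]]]
      unfolding S by (auto simp: even_axes_def split: if_splits)
    then have "prod_one ?M N" using xy by (intro even_axes_prod_one[of _ x y]) (auto simp: N_def)
    then obtain m where m: "fact_len ?M m N" using O8.fact_len_exists by blast
    have one': "(False, False, False) \<notin># N" using one S by auto
    then have "2 * m \<le> size N" using fact_len_size_ge[OF group_order_8 _ m] one' by simp
    moreover have sN: "size N = size U + 2" by (simp add: N_def)
    moreover have "m \<noteq> 0"
    proof
      assume "m = 0"
      then show False using m sN by (simp add: fact_len_0)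
    qed
    moreover have "m \<noteq> 1"
    proof
      assume "m = 1"
      then have "N \<in> product_one_atoms ?M" using m fact_len_1 by metis
      then show False using atom_size_le sN u5 by fastforce
    qed
    ultimately have m4: "m = 2 \<or> m = 3 \<or> m = 4 \<and> size U = 6" using u6 by linarith
    have S': "fact_len ?M (Suc m) (U + V)"
      unfolding S using order_8_power_atom[OF g(2,6)] m fact_len_Suc by blast
    \<comment> \<open>Four pairs would make \<open>N\<close> balanced; but U contributes x^4, while
      copies of the inverse of x can only come from h and k.\<close>
    have "m \<noteq> 4"
    proof
      assume m: "m = 4"
      then have "size N = 2 * m" using m4 sN by simp
      then have bal: "O8.balanced True N" using O8.fact_len_balanced[of True m N] \<open>fact_len ?M m N\<close> one' by simp
      have "size U = 6" using m4 m by simp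
      then obtain x p q where V: "U = replicate_mset 4 x + {#p, q#}" "axis x \<noteq> (False, False)"
        "axis p \<noteq> (False, False)" "axis p \<noteq> axis x" "axis q = axis p"
        using order_8_six_atom[OF U(1)] by metis
      have "inv\<^bsub>?M\<^esub> x \<noteq> p" "inv\<^bsub>?M\<^esub> x \<noteq> q" "inv\<^bsub>?M\<^esub> x \<noteq> x" using ax[OF V(2)] V(4,5) by auto
      then have "count N (inv\<^bsub>?M\<^esub> x) \<le> 2" "4 \<le> count N x" unfolding N_def V(1) by auto
      then show False using O8.balancedD(2)[OF bal, of x] ax(2)[OF V(2)] by simp
    qed
    then show ?thesis using m4 S' by auto
  qed
qed

text \<open>Two atoms with six terms in total and balanced product leave four terms, that is two
  inverse pairs, which gives length four. Such atoms are a triple meeting all three axes with the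
  triple of inverses, or z x^2 with z x^-2. If neither choice is available, parity excludes the
  length five of U.\<close>

lemma Q8_five_five:
  assumes U: "U \<in> product_one_atoms (order_8_group True)" "size U = 5"
    and V: "V \<in> product_one_atoms (order_8_group True)" "size V = 5"
    and one: "(False, False, False) \<notin># U + V" and bal: "O8.balanced True (U + V)"
  shows "fact_len (order_8_group True) 4 (U + V)"
proof -
  let ?M = "order_8_group True" and ?z = "(False, False, True)"
  define S where "S = U + V"
  note bal = bal[folded S_def] and one = one[folded S_def]
  have s10: "size S = 10" using U V by (simp add: S_def)
  have four: "fact_len ?M 4 S" if W: "A \<in> product_one_atoms ?M" "B \<in> product_one_atoms ?M" "size A + size B = 6"
    "O8.balanced True (A + B)" "A + B \<subseteq># S" for A B
  proof -
    have eq: "S = (A + B) + (S - (A + B))" using W(5) by (rule subset_mset.add_diff_inverse[symmetric])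
    have "O8.balanced True (S - (A + B))" using O8.balanced_cancel[of True "A + B" "S - (A + B)"] eq bal W(4) by simp
    moreover have "(False, False, False) \<notin># S - (A + B)" using one by (auto dest: in_diffD)
    moreover have "size (S - (A + B)) = 2 * 2" using size_Diff_submset[OF W(5)] s10 W(3) by simp
    ultimately have "fact_len ?M 2 (S - (A + B))" using O8.balanced_fact_len[of True "S - (A + B)" 2] by simp
    then have "fact_len ?M (Suc (Suc 2)) (A + (B + (S - (A + B))))"
      using W(1,2) fact_len_Suc by blast
    then show ?thesis using eq by (simp add: add.assoc eval_nat_numeral)
  qed
  have inv: "inv\<^bsub>?M\<^esub> (u, v, w) = (u, v, \<not> w)" if "(u, v) \<noteq> (False, False)" for u v w
    using order_8_inv(1)[of "(u, v, w)" True] Q8_square[of "(u, v, w)"] that by simp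
  have invz: "inv\<^bsub>?M\<^esub> ?z = ?z" by (rule O8.inv_equality) auto
  have sym: "count S (u, v, True) = count S (u, v, False)" if "(u, v) \<noteq> (False, False)" for u v
    using O8.balancedD(2)[OF bal, of "(u, v, False)"] inv[OF that] by simp
  have pair: "O8.balanced True {#(u, v, False), (u, v, True)#}" if "(u, v) \<noteq> (False, False)" for u v
    using O8.balanced_pair[of "(u, v, False)" True] inv[OF that] by simp
  have pairz: "O8.balanced True {#?z, ?z#}" using O8.balanced_pair[of ?z True] invz by simp
  have "even (count S ?z)" using O8.balancedD(1)[OF bal, of ?z] invz by simp
  moreover have "count S ?z \<le> 2"
    using order_8_central_count[OF U(1)] order_8_central_count[OF V(1)] U(2) V(2) by (simp add: S_def)
  ultimately have zc: "count S ?z = 0 \<or> count S ?z = 2" by (auto simp: le_Suc_eq numeral_2_eq_2)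
  define a b c where abc: "a = count S (True, False, False)" "b = count S (False, True, False)" "c = count S (True, True, False)"
  have ax: "axis_count S (False, False) = count S ?z" "axis_count S (True, False) = 2 * a"
    "axis_count S (False, True) = 2 * b" "axis_count S (True, True) = 2 * c"
    using one sym by (simp_all add: axis_count_eq abc count_eq_zero_iff)
  have sum: "count S ?z + 2 * a + 2 * b + 2 * c = 10" using size_axis_count[of S] s10 ax by simp
  have z4: "fact_len ?M 4 S" if uv: "(u, v) \<noteq> (False, False)" and c2: "2 \<le> count S (u, v, False)" and z2: "count S ?z = 2" for u v
  proof (rule four)
    have n: "(u, v, w) \<noteq> ?z" "(u, v, w) \<noteq> (False, False, False)" for w using uv by auto
    have sq: "(u, v, w) \<otimes>\<^bsub>?M\<^esub> (u, v, w) = ?z" for w using Q8_square[of "(u, v, w)"] uv by simp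
    have at: "{#?z, (u, v, w), (u, v, w)#} \<in> product_one_atoms ?M" for w
    proof (rule O8.small_atomI)
      show "prod_one ?M {#?z, (u, v, w), (u, v, w)#}" using sq[of w] by (simp add: O8.prod_one_triple)
      fix x y assume xy: "x \<in># {#?z, (u, v, w), (u, v, w)#}" "y \<in># {#?z, (u, v, w), (u, v, w)#}"
        "{#x, y#} \<subseteq># {#?z, (u, v, w), (u, v, w)#}" "x \<otimes>\<^bsub>?M\<^esub> y = \<one>\<^bsub>?M\<^esub>"
      have "\<not> (x = ?z \<and> y = ?z)" using mset_subset_eq_count[OF xy(3), of ?z] uv by (auto split: if_splits)
      then show "{#?z, (u, v, w), (u, v, w)#} = {#x, y#}" using xy(1,2,4) sq[of w] uv by auto
    qed (use n in auto)
    show "{#?z, (u, v, False), (u, v, False)#} \<in> product_one_atoms ?M" "{#?z, (u, v, True), (u, v, True)#} \<in> product_one_atoms ?M"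
      by (rule at)+
    have "O8.balanced True ({#?z, ?z#} + ({#(u, v, False), (u, v, True)#} + {#(u, v, False), (u, v, True)#}))"
      by (intro O8.balanced_add pair pairz uv)
    then show "O8.balanced True ({#?z, (u, v, False), (u, v, False)#} + {#?z, (u, v, True), (u, v, True)#})"
      by (simp add: add_mset_commute)
    show "{#?z, (u, v, False), (u, v, False)#} + {#?z, (u, v, True), (u, v, True)#} \<subseteq># S"
      using c2 z2 sym[OF uv] uv by (intro mset_subset_eqI) auto
  qed simp
  have "fact_len ?M 4 S"
  proof (cases "a = 0 \<or> b = 0 \<or> c = 0")
    case False
    have at: "{#(True, False, w), (False, True, w), (True, True, w)#} \<in> product_one_atoms ?M" for w
    proof (rule O8.small_atomI)
      show "prod_one ?M {#(True, False, w), (False, True, w), (True, True, w)#}"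
        by (intro even_axes_prod_one[of _ "(True, False, w)" "(False, True, w)"]) (auto simp: even_axes_def skew_def)
    qed auto
    have "O8.balanced True ({#(True, False, False), (True, False, True)#} + ({#(False, True, False), (False, True, True)#} + {#(True, True, False), (True, True, True)#}))"
      by (intro O8.balanced_add pair) auto
    then have "O8.balanced True ({#(True, False, False), (False, True, False), (True, True, False)#} + {#(True, False, True), (False, True, True), (True, True, True)#})"
      by (simp add: add_mset_commute)
    moreover have "{#(True, False, False), (False, True, False), (True, True, False)#} + {#(True, False, True), (False, True, True), (True, True, True)#} \<subseteq># S"
    proof -
      have "1 \<le> count S (True, False, w)" "1 \<le> count S (False, True, w)" "1 \<le> count S (True, True, w)" for w
        using False sym[of True False] sym[of False True] sym[of True True] by (cases w; simp add: abc Suc_le_eq)+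
      then show ?thesis by (intro mset_subset_eqI) auto
    qed
    ultimately show ?thesis using four[OF at[of False] at[of True]] by simp
  next
    case True
    show ?thesis
    proof (cases "count S ?z = 2")
      case z: True
      \<comment> \<open>Here a + b + c = 4 and one summand vanishes.\<close>
      have "2 \<le> a \<or> 2 \<le> b \<or> 2 \<le> c" using sum z True by linarith
      then show ?thesis
        using z4[of True False] z4[of False True] z4[of True True] z by (auto simp: abc)
    next
      case False
      then have z: "count S ?z = 0" using zc by simp
      \<comment> \<open>Without central terms and with one axis missing, parity would make the
        length of U even.\<close>
      have ev: "even (axis_count U (True, False) + axis_count U (True, True))" "even (axis_count U (False, True) + axis_count U (True, True))"
        using prod_one_even_axes[OF atom_prod_one[OF U(1)]] by (simp_all add: even_axes_def)
      have "axis_count U (False, False) = 0" using ax(1) z by (simp add: S_def)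
      then have s: "axis_count U (True, False) + axis_count U (False, True) + axis_count U (True, True) = 5"
        using size_axis_count[of U] U(2) by simp
      have "axis_count U (True, False) = 0 \<or> axis_count U (False, True) = 0 \<or> axis_count U (True, True) = 0"
        using True ax by (auto simp: S_def)
      then have "even (axis_count U (True, False) + axis_count U (False, True) + axis_count U (True, True))"
        using ev by (elim disjE) simp_all
      then show ?thesis unfolding s by simp
    qed
  qed
  then show ?thesis by (simp add: S_def)
qed

text \<open>Length five requires at least ten terms, so one atom has six terms and the other at
  least four, or both have five.\<close>

lemma Q8_2_5:
  assumes D: "davenport_6 (order_8_group True)" and L: "L \<in> system_of_lengths (order_8_group True)" "{2, 5} \<subseteq> L"
  shows "3 \<in> L \<or> 4 \<in> L"
proof -
  let ?M = "order_8_group True"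
  interpret davenport_6 ?M by (rule D)
  obtain S where S: "L = {k. fact_len ?M k S}" using L(1) by (auto simp: mem_system_of_lengths)
  have 5: "fact_len ?M 5 S" and "fact_len ?M 2 S" using L(2) S by auto
  then obtain U V where UV: "U \<in> product_one_atoms ?M" "V \<in> product_one_atoms ?M" "S = U + V"
    by (auto simp: fact_len_2)
  have one: "(False, False, False) \<notin># U + V" using O8.two_atoms_no_one[OF UV(1,2)] 5 UV(3) by auto
  have "10 \<le> size U + size V" using fact_len_size_ge[OF group_order_8 _ 5] UV(3) one by simp
  moreover have "size U \<le> 6" "size V \<le> 6" using atom_size_le UV by auto
  ultimately consider "size V = 6" "4 \<le> size U" | "size U = 6" "4 \<le> size V" | "size U = 5" "size V = 5" by linarith
  then show ?thesis
  proof cases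
    case 1
    then show ?thesis using Q8_six_complement[OF D UV(1) _ UV(2)] one 5 UV(3) S by auto
  next
    case 2
    then show ?thesis using Q8_six_complement[OF D UV(2) _ UV(1)] one 5 UV(3) S by (auto simp: add.commute)
  next
    case 3
    then have "O8.balanced True (U + V)" using O8.fact_len_balanced[OF 5] UV(3) one by simp
    then show ?thesis using Q8_five_five[OF UV(1) 3(1) UV(2) 3(2) one] UV(3) S by simp
  qed
qed

subsection \<open>The remaining abelian group\<close>

abbreviation C4_2_2_group :: "((int \<times> bool) \<times> bool) monoid" where
  "C4_2_2_group \<equiv> (integer_mod_group 4 \<times>\<times> C2_group) \<times>\<times> C2_group"

lemma group_C4_2_2: "group C4_2_2_group"
  by (intro DirProd_group group_C2) simp

interpretation C422: group C4_2_2_group by (rule group_C4_2_2)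

lemma C4_2_2_simps:
  "\<one>\<^bsub>C4_2_2_group\<^esub> = ((0, False), False)"
  "((i, u), v) \<otimes>\<^bsub>C4_2_2_group\<^esub> ((j, u'), v') = (((i + j) mod 4, u \<noteq> u'), v \<noteq> v')"
  "((i, u), v) \<in> carrier C4_2_2_group \<longleftrightarrow> i \<in> {0..<4}"
  by (auto simp: DirProd_def integer_mod_group_def carrier_integer_mod_group)

lemma C4_2_2_lprod:
  "set xs \<subseteq> carrier C4_2_2_group \<Longrightarrow>
    foldr (\<otimes>\<^bsub>C4_2_2_group\<^esub>) xs ((0, False), False) =
      (((\<Sum>x\<leftarrow>xs. fst (fst x)) mod 4, odd (size (filter_mset (\<lambda>x. snd (fst x)) (mset xs)))), odd (size (filter_mset snd (mset xs))))"
proof (induction xs)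
  case (Cons x xs)
  obtain i u v where "x = ((i, u), v)" by (metis surj_pair)
  then show ?case using Cons by (auto simp: C4_2_2_simps(2) mod_simps)
qed simp

lemma C4_2_2_prod_one:
  assumes "set_mset S \<subseteq> carrier C4_2_2_group"
  shows "prod_one C4_2_2_group S \<longleftrightarrow> (\<Sum>x\<in>#S. fst (fst x)) mod 4 = 0 \<and>
    even (size (filter_mset (\<lambda>x. snd (fst x)) S)) \<and> even (size (filter_mset snd S))"
proof -
  obtain xs where xs: "mset xs = S" using ex_mset by blast
  have sum: "(\<Sum>x\<leftarrow>ys. fst (fst x)) = (\<Sum>x\<in>#S. fst (fst x))" if "mset ys = S" for ys
    using that by (metis mset_map sum_mset_sum_list)
  have iff: "foldr (\<otimes>\<^bsub>C4_2_2_group\<^esub>) ys ((0, False), False) = ((0, False), False) \<longleftrightarrow> (\<Sum>x\<in>#S. fst (fst x)) mod 4 = 0 \<and>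
    even (size (filter_mset (\<lambda>x. snd (fst x)) S)) \<and> even (size (filter_mset snd S))" if ys: "mset ys = S" for ys
  proof -
    have "set ys \<subseteq> carrier C4_2_2_group" using assms ys by auto
    then show ?thesis using C4_2_2_lprod[of ys] sum[OF ys] ys by simp
  qed
  show ?thesis
    unfolding carrier_product_one_monoid_iff using assms iff xs C4_2_2_simps(1) by metis
qed

text \<open>The witness is the atom e^3 f h m times its inverse, where e, f, h is a basis and m = e
  + f + h in additive notation. By \<open>sub\<close> every nonempty product-one subsequence
  contains one of eight candidates, so these are the dividing atoms.\<close>

lemma C4_2_2_2_4_6: "{2, 4, 6} \<in> system_of_lengths C4_2_2_group"
proof -
  let ?G = C4_2_2_group
  let ?e = "((1, False), False) :: (int \<times> bool) \<times> bool" and ?e' = "((3, False), False) :: (int \<times> bool) \<times> bool"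
    and ?f = "((0, True), False) :: (int \<times> bool) \<times> bool" and ?h = "((0, False), True) :: (int \<times> bool) \<times> bool"
    and ?m = "((1, True), True) :: (int \<times> bool) \<times> bool" and ?n = "((3, True), True) :: (int \<times> bool) \<times> bool"
  let ?R = "\<lambda>i i' j k l l'. replicate_mset i ?e + replicate_mset i' ?e' + replicate_mset j ?f + replicate_mset k ?h
    + replicate_mset l ?m + replicate_mset l' ?n"
  let ?S = "?R 3 3 2 2 1 1"
  have comm: "x \<otimes>\<^bsub>?G\<^esub> y = y \<otimes>\<^bsub>?G\<^esub> x" for x y
    by (cases x; cases y; cases "fst x"; cases "fst y") (auto simp: C4_2_2_simps(2) add.commute)
  have size_rep: "size (filter_mset P (replicate_mset n x)) = (if P x then n else 0)" for P n and x :: "(int \<times> bool) \<times> bool"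
    by (induction n) auto
  have sum_rep: "(\<Sum>x\<in>#replicate_mset n y. fst (fst x)) = int n * fst (fst y)" for n and y :: "(int \<times> bool) \<times> bool"
    by (induction n) (auto simp: algebra_simps)
  define R where "R i i' j k l l' = ?R i i' j k l l'" for i i' j k l l'
  have po: "prod_one ?G (R i i' j k l l') \<longleftrightarrow>
      (int i + int i' * 3 + int l + int l' * 3) mod 4 = 0 \<and> even (j + l + l') \<and> even (k + l + l')" for i i' j k l l'
  proof -
    have "set_mset (R i i' j k l l') \<subseteq> carrier ?G"
      by (auto simp: R_def carrier_integer_mod_group split: if_splits)
    then show ?thesis by (subst C4_2_2_prod_one) (simp_all add: R_def size_rep sum_rep)
  qed
  have Rcount [simp]: "count (R i i' j k l l') ?e = i" "count (R i i' j k l l') ?e' = i'" "count (R i i' j k l l') ?f = j"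
    "count (R i i' j k l l') ?h = k" "count (R i i' j k l l') ?m = l" "count (R i i' j k l l') ?n = l'" for i i' j k l l'
    by (simp_all add: R_def)
  have Rinj [simp]: "R i i' j k l l' = R a a' b c d d' \<longleftrightarrow> i = a \<and> i' = a' \<and> j = b \<and> k = c \<and> l = d \<and> l' = d'" for i i' j k l l' a a' b c d d'
    using Rcount by metis
  have Rsub [simp]: "R a a' b c d d' \<subseteq># R i i' j k l l' \<longleftrightarrow> a \<le> i \<and> a' \<le> i' \<and> b \<le> j \<and> c \<le> k \<and> d \<le> l \<and> d' \<le> l'" for i i' j k l l' a a' b c d d'
  proof
    assume "R a a' b c d d' \<subseteq># R i i' j k l l'"
    then show "a \<le> i \<and> a' \<le> i' \<and> b \<le> j \<and> c \<le> k \<and> d \<le> l \<and> d' \<le> l'"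
      using mset_subset_eq_count[of "R a a' b c d d'" "R i i' j k l l'"] Rcount by metis
  next
    assume "a \<le> i \<and> a' \<le> i' \<and> b \<le> j \<and> c \<le> k \<and> d \<le> l \<and> d' \<le> l'"
    then show "R a a' b c d d' \<subseteq># R i i' j k l l'" unfolding R_def by (intro mset_subset_eqI) auto
  qed
  have Radd: "R i i' j k l l' + R a a' b c d d' = R (i + a) (i' + a') (j + b) (k + c) (l + d) (l' + d')" for i i' j k l l' a a' b c d d'
    unfolding R_def by (intro multiset_eqI) simp
  have R0: "R 0 0 0 0 0 0 = {#}" by (simp add: R_def)
  define S where "S = R 3 3 2 2 1 1"
  \<comment> \<open>The four inverse pairs, the chosen atom and its inverse, and the two shorter
    mixed atoms e' f h m and e f h n.\<close>
  define Cs where "Cs = [R 1 1 0 0 0 0, R 0 0 2 0 0 0, R 0 0 0 2 0 0, R 0 0 0 0 1 1, R 3 0 1 1 1 0, R 0 3 1 1 0 1, R 0 1 1 1 1 0, R 1 0 1 1 0 1]"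
  have sub: "\<exists>X \<in> set Cs. X \<subseteq># C" if C: "prod_one ?G C" "C \<noteq> {#}" "C \<subseteq># S" for C
  proof (rule ccontr)
    assume no: "\<not> ?thesis"
    define i i' j k l l' where ijk: "i = count C ?e" "i' = count C ?e'" "j = count C ?f" "k = count C ?h" "l = count C ?m" "l' = count C ?n"
    have "set_mset C \<subseteq> {?e, ?e', ?f, ?h, ?m, ?n}" using set_mset_mono[OF C(3)] by (auto simp: S_def R_def split: if_splits)
    then have Ceq: "C = R i i' j k l l'" unfolding ijk R_def by (intro multiset_eqI) (auto simp: count_eq_zero_iff)
    have le: "i \<le> 3" "i' \<le> 3" "l \<le> 1" "l' \<le> 1" using C(3) unfolding Ceq S_def by simp_all
    note p = po[THEN iffD1, OF C(1)[unfolded Ceq]]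
    have "\<not> (1 \<le> i \<and> 1 \<le> i') \<and> \<not> 2 \<le> j \<and> \<not> 2 \<le> k \<and> \<not> (1 \<le> l \<and> 1 \<le> l') \<and>
      \<not> (3 \<le> i \<and> 1 \<le> j \<and> 1 \<le> k \<and> 1 \<le> l) \<and> \<not> (3 \<le> i' \<and> 1 \<le> j \<and> 1 \<le> k \<and> 1 \<le> l') \<and>
      \<not> (1 \<le> i' \<and> 1 \<le> j \<and> 1 \<le> k \<and> 1 \<le> l) \<and> \<not> (1 \<le> i \<and> 1 \<le> j \<and> 1 \<le> k \<and> 1 \<le> l')"
      using no unfolding Ceq Cs_def by simp
    then have no': "i = 0 \<or> i' = 0" "j < 2" "k < 2" "l = 0 \<or> l' = 0" "\<not> (3 \<le> i \<and> 1 \<le> j \<and> 1 \<le> k \<and> 1 \<le> l)"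
      "\<not> (3 \<le> i' \<and> 1 \<le> j \<and> 1 \<le> k \<and> 1 \<le> l')" "\<not> (1 \<le> i' \<and> 1 \<le> j \<and> 1 \<le> k \<and> 1 \<le> l)"
      "\<not> (1 \<le> i \<and> 1 \<le> j \<and> 1 \<le> k \<and> 1 \<le> l')"
      by (simp_all add: not_le Suc_le_eq)
    have jk: "j = 0 \<or> j = 1" "k = 0 \<or> k = 1" using no'(2,3) by linarith+
    have ii: "i = 0 \<or> i = 1 \<or> i = 2 \<or> i = 3" "i' = 0 \<or> i' = 1 \<or> i' = 2 \<or> i' = 3" using le by linarith+
    consider "l = 0" "l' = 0" | "l = 1" "l' = 0" | "l = 0" "l' = 1" using no'(4) le(3,4) by linarith
    then show False
    proof cases
      case 1
      then have "j = 0" "k = 0" using p jk by auto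
      moreover have "i = 0 \<and> i' = 0" using no'(1) ii p 1 by (elim disjE) simp_all
      ultimately show False using C(2) Ceq R0 1 by simp
    next
      case 2
      then have "j = 1" "k = 1" using p jk by auto
      then have "i' = 0" "i < 3" using no' 2 by auto
      then show False using ii(1) p 2 by (elim disjE) simp_all
    next
      case 3
      then have "j = 1" "k = 1" using p jk by auto
      then have "i = 0" "i' < 3" using no' 3 by auto
      then show False using ii(2) p 3 by (elim disjE) simp_all
    qed
  qed
  have Cpo: "prod_one ?G X \<and> X \<noteq> {#} \<and> X \<subseteq># S" if "X \<in> set Cs" for X
    using that unfolding Cs_def by (auto simp: po S_def R0[symmetric])
  \<comment> \<open>No candidate contains another one, so each candidate is minimal and hence an
    atom.\<close>
  have anti: "X = Y" if "X \<in> set Cs" "Y \<in> set Cs" "X \<subseteq># Y" for X Y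
    using that unfolding Cs_def by auto
  have at: "X \<in> product_one_atoms ?G" if X: "X \<in> set Cs" for X
  proof -
    have "U = {#}" if TU: "X = T + U" "prod_one ?G T" "T \<noteq> {#}" for T U
    proof -
      have TX: "T \<subseteq># X" using TU(1) by simp
      then obtain Y where Y: "Y \<in> set Cs" "Y \<subseteq># T" using sub[OF TU(2,3)] Cpo[OF X] subset_mset.order_trans by blast
      then have "Y = X" using anti[OF Y(1) X] TX subset_mset.order_trans by blast
      then have "T = X" using Y(2) TX by (rule_tac subset_mset.antisym) simp_all
      then show ?thesis using TU(1) by simp
    qed
    then show ?thesis using Cpo[OF X] unfolding product_one_atoms_iff by blast
  qed
  have cand: "C \<in> set Cs" if C: "C \<in> product_one_atoms ?G" "C \<subseteq># S" for C
  proof -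
    obtain X where X: "X \<in> set Cs" "X \<subseteq># C" using sub[OF atom_prod_one[OF C(1)] atom_nonempty[OF C(1)] C(2)] by blast
    then have "C = X" using C422.commutative_atom_eq[OF comm C(1) X(2)] Cpo[OF X(1)] by blast
    then show ?thesis using X by simp
  qed
  have d: "distinct Cs" by (simp add: Cs_def)
  have "k \<in> {2, 4, 6}" if fk: "fact_len ?G k S" for k
  proof -
    obtain n where n: "S = (\<Sum>C\<leftarrow>Cs. repeat_mset (n C) C)" "k = (\<Sum>C\<leftarrow>Cs. n C)"
      using fact_len_candidates[OF fk cand d] by blast
    define p1 p2 p3 p4 p5 p6 p7 p8 where p: "p1 = n (R 1 1 0 0 0 0)" "p2 = n (R 0 0 2 0 0 0)" "p3 = n (R 0 0 0 2 0 0)"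
      "p4 = n (R 0 0 0 0 1 1)" "p5 = n (R 3 0 1 1 1 0)" "p6 = n (R 0 3 1 1 0 1)" "p7 = n (R 0 1 1 1 1 0)" "p8 = n (R 1 0 1 1 0 1)"
    have e1: "3 = p1 + p5 * 3 + p8" using arg_cong[OF n(1), of "\<lambda>M. count M ?e"] by (simp add: p S_def Cs_def)
    have e2: "3 = p1 + p6 * 3 + p7" using arg_cong[OF n(1), of "\<lambda>M. count M ?e'"] by (simp add: p S_def Cs_def)
    have e3: "2 = p2 * 2 + p5 + p6 + p7 + p8" using arg_cong[OF n(1), of "\<lambda>M. count M ?f"] by (simp add: p S_def Cs_def)
    have e4: "2 = p3 * 2 + p5 + p6 + p7 + p8" using arg_cong[OF n(1), of "\<lambda>M. count M ?h"] by (simp add: p S_def Cs_def)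
    have e5: "1 = p4 + p5 + p7" using arg_cong[OF n(1), of "\<lambda>M. count M ?m"] by (simp add: p S_def Cs_def)
    have e6: "1 = p4 + p6 + p8" using arg_cong[OF n(1), of "\<lambda>M. count M ?n"] by (simp add: p S_def Cs_def)
    have e7: "k = p1 + p2 + p3 + p4 + p5 + p6 + p7 + p8" using n(2) by (simp add: p Cs_def)
    \<comment> \<open>If m and n form a pair, the length is six. Otherwise they lie in different
      mixed atoms: both long ones give length two, both short ones length four, and one of each
      violates the counts of e and e'.\<close>
    have "p4 = 0 \<or> p4 = 1" using e5 by linarith
    then have "k = 2 \<or> k = 4 \<or> k = 6"
    proof
      assume "p4 = 1"
      then have "p5 = 0" "p7 = 0" "p6 = 0" "p8 = 0" using e5 e6 by linarith+
      then show ?thesis using e1 e3 e4 e7 \<open>p4 = 1\<close> by simp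
    next
      assume p4: "p4 = 0"
      have "p5 = 0 \<and> p7 = 1 \<or> p5 = 1 \<and> p7 = 0" "p6 = 0 \<and> p8 = 1 \<or> p6 = 1 \<and> p8 = 0"
        using e5 e6 unfolding p4 by linarith+
      then show ?thesis using e1 e2 e3 e4 e7 p4 by (elim disjE conjE) simp_all
    qed
    then show ?thesis by simp
  qed
  moreover have 2: "fact_len ?G 2 S"
    unfolding fact_len_def using at
    by (intro exI[of _ "[R 3 0 1 1 1 0, R 0 3 1 1 0 1]"]) (simp add: Radd S_def Cs_def)
  moreover have "fact_len ?G 4 S"
    unfolding fact_len_def using at
    by (intro exI[of _ "[R 1 1 0 0 0 0, R 1 1 0 0 0 0, R 0 1 1 1 1 0, R 1 0 1 1 0 1]"]) (simp add: Radd S_def Cs_def)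
  moreover have "fact_len ?G 6 S"
    unfolding fact_len_def using at
    by (intro exI[of _ "[R 1 1 0 0 0 0, R 1 1 0 0 0 0, R 1 1 0 0 0 0, R 0 0 2 0 0 0, R 0 0 0 2 0 0, R 0 0 0 0 1 1]"])
      (simp add: Radd S_def Cs_def)
  ultimately have "{k. fact_len ?G k S} = {2, 4, 6}" by blast
  then show ?thesis
    unfolding mem_system_of_lengths using fact_len_prod_one[OF group_C4_2_2 2] by (intro exI[of _ S]) simp
qed

subsection \<open>Characterization by sets of lengths\<close>

context davenport_6
begin

lemma iso_C6:
  assumes x: "x \<in> carrier G" "ord x = 6"
  shows "integer_mod_group 6 \<cong> G"
proof (rule is_isoI)
  let ?f = "\<lambda>i::int. x [^] i"
  have x6: "x [^] (6::int) = \<one>" using pow_ord_eq_1[OF x(1)] x(2) int_pow_int[of G x 6] by simp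
  have mod: "x [^] (i mod 6) = x [^] i" for i :: int
  proof -
    have "x [^] i = x [^] (6 * (i div 6)) \<otimes> x [^] (i mod 6)"
      using int_pow_mult[OF x(1), of "6 * (i div 6)" "i mod 6"] by simp
    also have "x [^] (6 * (i div 6)) = (x [^] (6::int)) [^] (i div 6)" using x(1) by (simp only: int_pow_pow)
    also have "\<dots> = \<one>" unfolding x6 by simp
    finally show ?thesis using x(1) by simp
  qed
  have hom: "?f \<in> hom (integer_mod_group 6) G"
    using x(1) mod by (auto simp: hom_def int_pow_mult)
  have im: "?f ` {0..<6} = carrier G"
  proof
    show "carrier G \<subseteq> ?f ` {0..<6}"
    proof
      fix y assume "y \<in> carrier G"
      then obtain k :: nat where "y = x [^] k" using order_6_cyclic[OF x] by auto
      then have "y = x [^] (int k mod 6)" using mod[of "int k"] by (simp add: int_pow_int)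
      then show "y \<in> ?f ` {0..<6}" by auto
    qed
  qed (use x in auto)
  then have "card (?f ` {0..<6}) = card {0::int..<6}"
    using card_carrier_ge card_image_le[of "{0::int..<6}" ?f] by simp
  then have "inj_on ?f {0..<6}" by (intro eq_card_imp_inj_on) simp_all
  then show "?f \<in> iso (integer_mod_group 6) G"
    using hom im by (auto simp: iso_def bij_betw_def carrier_integer_mod_group)
qed

text \<open>Without order six, an element of order three comes with an involution by
  \<open>exponent_3_impossible\<close>, which gives the symmetric group. In the absence of order
  three the exponent divides four, and commutativity and the squares separate the other
  cases.\<close>

lemma davenport_6_cases:
  "(\<exists>x \<in> carrier G. ord x = 6) \<or> C2_5_group \<cong> G \<or> C4_2_2_group \<cong> G \<or> S3_group \<cong> G
    \<or> order_8_group False \<cong> G \<or> order_8_group True \<cong> G"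
proof (cases "\<exists>x \<in> carrier G. ord x = 6")
  case False
  then have no6: "ord x \<noteq> 6" if "x \<in> carrier G" for x using that by blast
  have ords: "ord x = 1 \<or> ord x = 2 \<or> ord x = 3 \<or> ord x = 4" if "x \<in> carrier G" for x
  proof -
    have "ord x \<noteq> 5" using no_order_5[OF that] by blast
    then show ?thesis using ord_pos[OF that] ord_le_6[OF that] no6[OF that] by linarith
  qed
  have pow: "x [^] (k::nat) = \<one>" if "x \<in> carrier G" "ord x dvd k" for x k
    using that pow_eq_id by blast
  show ?thesis
  proof (cases "\<exists>a \<in> carrier G. ord a = 3")
    case True
    then obtain a where a: "a \<in> carrier G" "ord a = 3" by blast
    have "\<exists>s \<in> carrier G. ord s = 2"
    proof (rule ccontr)
      assume no2: "\<not> ?thesis"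
      have no4: "ord x \<noteq> 4" if x: "x \<in> carrier G" for x
      proof
        assume o: "ord x = 4"
        have "x \<otimes> x \<noteq> \<one>"
        proof
          assume "x \<otimes> x = \<one>"
          then have "x [^] (2::nat) = \<one>" using x by (simp add: numeral_2_eq_2)
          then have "(4::nat) dvd 2" using ord_dvdI[OF x] o by metis
          then show False by simp
        qed
        moreover have "x \<otimes> x \<otimes> (x \<otimes> x) = \<one>" using pow[OF x, of 4] o x by (simp add: eval_nat_numeral m_assoc)
        ultimately have "ord (x \<otimes> x) = 2" using ord_eq_2[of "x \<otimes> x"] x by (simp add: numeral_2_eq_2)
        then show False using no2 x by blast
      qed
      have "x \<otimes> (x \<otimes> x) = \<one>" if x: "x \<in> carrier G" for x
      proof -
        have "ord x = 1 \<or> ord x = 3" using ords[OF x] no4[OF x] no2 x by blast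
        then have "x [^] (3::nat) = \<one>" using pow[OF x, of 3] by auto
        then show ?thesis using x by (simp add: numeral_3_eq_3 m_assoc)
      qed
      then show False by (rule exponent_3_impossible)
    qed
    then show ?thesis using iso_S3[OF no6 _ _ a] is_isoI by metis
  next
    case False
    have e4: "x [^] (4::nat) = \<one>" if x: "x \<in> carrier G" for x
    proof -
      have "ord x = 1 \<or> ord x = 2 \<or> ord x = 4" using ords[OF x] False x by blast
      then show ?thesis using pow[OF x, of 4] by auto
    qed
    show ?thesis
    proof (cases "\<exists>x \<in> carrier G. \<exists>y \<in> carrier G. x \<otimes> y \<noteq> y \<otimes> x")
      case True
      then obtain x y where xy: "x \<in> carrier G" "y \<in> carrier G" "x \<otimes> y \<noteq> y \<otimes> x" by blast
      obtain h s where "h \<in> iso (order_8_group s) G" using iso_order_8_group[OF e4 xy] by blast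
      then have "order_8_group s \<cong> G" by (rule is_isoI)
      then show ?thesis by (cases s) auto
    next
      case False
      then have comm: "x \<otimes> y = y \<otimes> x" if "x \<in> carrier G" "y \<in> carrier G" for x y using that by blast
      show ?thesis
      proof (cases "\<exists>a \<in> carrier G. a \<otimes> a \<noteq> \<one>")
        case True
        then show ?thesis using iso_C4_C2_C2[OF comm e4] is_isoI by metis
      next
        case False
        then show ?thesis using iso_elementary is_isoI by metis
      qed
    qed
  qed
qed simp

end

section \<open>Separation of the groups by their systems of sets of lengths\<close>

lemma is_iso_system_eq:
  assumes "group G" "group H" "G \<cong> H"
  shows "system_of_lengths G = system_of_lengths H"
  using assms iso_system_eq[OF assms(1,2)] by (auto simp: is_iso_def)

text \<open>The Davenport constant of a model is inherited from the given group instead of being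
  computed in the model.\<close>

lemma davenport_6_model:
  assumes G: "group G" "finite (carrier G)" "large_Davenport G = 6" and M: "group M" "M \<cong> G"
  shows "davenport_6 M"
proof -
  have "finite (carrier M)" using M(2) G(2) by (auto simp: is_iso_def iso_def bij_betw_finite)
  then show ?thesis
    using Davenport_6_transfer[OF G M(1)] davenport_6I[OF M(1)] is_iso_system_eq[OF M(1) G(1) M(2)] by blast
qed

text \<open>Each alternative records enough memberships and non-memberships to contradict every
  other one.\<close>

lemma system_classification:
  fixes G (structure)
  assumes G: "group G" "finite (carrier G)" "large_Davenport G = 6"
  defines "LL \<equiv> system_of_lengths G"
  shows "integer_mod_group 6 \<cong> G \<and> {2, 4, 6} \<notin> LL \<and> (\<forall>L \<in> LL. \<not> {2, 3, 6} \<subseteq> L) \<and> (\<forall>L \<in> LL. \<not> {3, 9} \<subseteq> L)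
    \<or> C2_5_group \<cong> G \<and> {2, 4, 6} \<notin> LL \<and> (\<forall>L \<in> LL. \<not> {2, 3, 6} \<subseteq> L) \<and> (\<exists>L \<in> LL. {3, 9} \<subseteq> L)
    \<or> C4_2_2_group \<cong> G \<and> {2, 4, 6} \<in> LL
    \<or> S3_group \<cong> G \<and> {2, 4, 6} \<notin> LL \<and> (\<exists>L \<in> LL. {2, 3, 6} \<subseteq> L) \<and> {2, 6} \<in> LL
    \<or> order_8_group False \<cong> G \<and> {2, 4, 6} \<notin> LL \<and> (\<exists>L \<in> LL. {2, 3, 6} \<subseteq> L) \<and> {2, 6} \<notin> LL \<and> {2, 5} \<in> LL
    \<or> order_8_group True \<cong> G \<and> {2, 4, 6} \<notin> LL \<and> (\<exists>L \<in> LL. {2, 3, 6} \<subseteq> L) \<and> {2, 6} \<notin> LL \<and> {2, 5} \<notin> LL"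
proof -
  interpret davenport_6 G by (rule davenport_6I[OF G])
  note transfer = is_iso_system_eq[OF _ is_group, folded LL_def]
  \<comment> \<open>Some set of lengths contains 2 and 6, and then it contains 3. This supplies a
    set above {2, 3, 6} and excludes both {2, 6} and {2, 4, 6}.\<close>
  have o8: "{2, 4, 6} \<notin> LL \<and> (\<exists>L \<in> LL. {2, 3, 6} \<subseteq> L) \<and> {2, 6} \<notin> LL" if iso: "order_8_group s \<cong> G" for s
  proof -
    have three: "3 \<in> L" if "L \<in> LL" "{2, 6} \<subseteq> L" for L
      using order_8_2_6[OF davenport_6_model[OF G group_order_8 iso]] that transfer[OF group_order_8 iso] by simp
    obtain L where "L \<in> LL" "2 \<in> L" "6 \<in> L" using system_large_Davenport G unfolding LL_def by auto
    then have "\<exists>L \<in> LL. {2, 3, 6} \<subseteq> L" using three by blast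
    then show ?thesis using three[of "{2, 4, 6}"] three[of "{2, 6}"] by auto
  qed
  consider x where "x \<in> carrier G" "ord x = 6" | "C2_5_group \<cong> G" | "C4_2_2_group \<cong> G" | "S3_group \<cong> G"
    | "order_8_group False \<cong> G" | "order_8_group True \<cong> G"
    using davenport_6_cases by blast
  then show ?thesis
  proof cases
    case 1
    have iso: "integer_mod_group 6 \<cong> G" using iso_C6[OF 1] .
    have card: "card (carrier G) = 6" using iso_same_card[OF iso] by (simp add: carrier_integer_mod_group)
    have comm: "y \<otimes> z = z \<otimes> y" if "y \<in> carrier G" "z \<in> carrier G" for y z
    proof -
      obtain k l :: nat where "y = x [^] k" "z = x [^] l" using \<open>y \<in> carrier G\<close> \<open>z \<in> carrier G\<close> order_6_cyclic[OF 1] by auto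
      then show ?thesis using 1(1) by (simp add: nat_pow_mult add.commute)
    qed
    have no: "\<not> {2, 3, 6} \<subseteq> L" "\<not> {2, 4, 6} \<subseteq> L" "\<not> {3, 9} \<subseteq> L" if "L \<in> LL" for L
    proof -
      have L: "L \<in> system_of_lengths G" using that unfolding LL_def .
      have "{2, 6} \<subseteq> L \<Longrightarrow> 3 \<notin> L \<and> 4 \<notin> L" using comm card L by (rule order_6_lengths(1))
      then show "\<not> {2, 3, 6} \<subseteq> L" "\<not> {2, 4, 6} \<subseteq> L" by blast+
      show "\<not> {3, 9} \<subseteq> L" using comm card L by (rule order_6_lengths(2))
    qed
    have "{2, 4, 6} \<notin> LL" using no(2)[of "{2, 4, 6}"] by blast
    moreover have "\<forall>L \<in> LL. \<not> {2, 3, 6} \<subseteq> L" "\<forall>L \<in> LL. \<not> {3, 9} \<subseteq> L" using no(1,3) by blast+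
    ultimately show ?thesis using iso by simp
  next
    case 2
    note tr = transfer[OF C2_5_group_props(1) 2]
    have e2: "L \<subseteq> {2, 6}" if "L \<in> LL" "{2, 6} \<subseteq> L" for L
      using davenport_6.elementary_lengths[OF davenport_6_model[OF G C2_5_group_props(1) 2] C2_5_group_props(2,3)] that tr by simp
    have no: "\<not> {2, 3, 6} \<subseteq> L" "\<not> {2, 4, 6} \<subseteq> L" if "L \<in> LL" for L
    proof -
      have "3 \<notin> L" "4 \<notin> L" if "{2, 6} \<subseteq> L"
      proof -
        have "L \<subseteq> {2, 6}" using e2[OF \<open>L \<in> LL\<close> that] .
        moreover have "3 \<notin> {2, 6 :: nat}" "4 \<notin> {2, 6 :: nat}" by simp_all
        ultimately show "3 \<notin> L" "4 \<notin> L" by blast+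
      qed
      then show "\<not> {2, 3, 6} \<subseteq> L" "\<not> {2, 4, 6} \<subseteq> L" by blast+
    qed
    then show ?thesis using 2 C2_5_lengths tr by auto
  next
    case 3
    then show ?thesis using C4_2_2_2_4_6 transfer[OF group_C4_2_2 3] by auto
  next
    case 4
    then show ?thesis
      using S3_2_6 S3_2_3_6 S3_not_2_4_6[OF davenport_6_model[OF G group_S3 4]] transfer[OF group_S3 4] by auto
  next
    case 5
    have "{2, 5} \<in> LL" using D8_2_5 transfer[OF group_order_8 5] by simp
    then show ?thesis using 5 o8[OF 5] by blast
  next
    case 6
    have "{2, 5} \<notin> LL"
      using Q8_2_5[OF davenport_6_model[OF G group_order_8 6], of "{2, 5}"] transfer[OF group_order_8 6] by auto
    then show ?thesis using 6 o8[OF 6] by blast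
  qed
qed

theorem theorem4p7:
  fixes G :: "('a, 'm) monoid_scheme" and G' :: "('b, 'n) monoid_scheme"
  assumes "group G" and "finite (carrier G)"
    and "large_Davenport G = 6"
    and "group G'" and "finite (carrier G')"
    and "system_of_lengths G' = system_of_lengths G"
  shows "G' \<cong> G"
proof -
  have D: "large_Davenport G' = 6" using Davenport_6_transfer[OF assms] .
  have via6: "integer_mod_group 6 \<cong> G \<Longrightarrow> integer_mod_group 6 \<cong> G' \<Longrightarrow> G' \<cong> G"
    and viaE: "C2_5_group \<cong> G \<Longrightarrow> C2_5_group \<cong> G' \<Longrightarrow> G' \<cong> G"
    and via4: "C4_2_2_group \<cong> G \<Longrightarrow> C4_2_2_group \<cong> G' \<Longrightarrow> G' \<cong> G"
    and viaS: "S3_group \<cong> G \<Longrightarrow> S3_group \<cong> G' \<Longrightarrow> G' \<cong> G"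
    and via8: "order_8_group s \<cong> G \<Longrightarrow> order_8_group s \<cong> G' \<Longrightarrow> G' \<cong> G" for s
    using iso_trans[OF group.iso_sym] group_integer_mod_group C2_5_group_props(1) group_C4_2_2 group_S3 group_order_8 by metis+
  \<comment> \<open>Equality of the systems contradicts all combinations of different alternatives;
    in the remaining ones both groups are isomorphic to the same model.\<close>
  show ?thesis
    using system_classification[OF assms(1-3)] system_classification[OF assms(4,5) D]
    unfolding assms(6) by (elim disjE conjE; use via6 viaE via4 viaS via8 in blast)
qed

end
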